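(* Let $R$ be a finite local principal ideal ring of length two whose residue field $k$ is finite of order $q$. For every positive integer $N$, the number of similarity classes in $M_n(R)$ whose centralizer in $\mathrm{GL}_n(R)$ has $N$ elements is $$\sum_\tau n_\tau\,\#\big\{\xi\in G_{A_\tau}\backslash \mathrm{Ext}^1_{k[t]}(M^{A_\tau},M^{A_\tau})\;:\;q^{z_\tau}|G_\xi|=N\big\},$$ where the sum is over all types $\tau$ of similarity classes in $M_n(k)$, and for each $\tau$, $n_\tau$ denotes the number of similarity classes in $M_n(k)$ of type $\tau$, $z_\tau=\sum_{(\lambda,d)}d\,m(\lambda)$ (sum over all the primary types in $\tau$), $A_\tau$ is any matrix of type $\tau$, and $G_\xi$ is the stabilizer of (a representative of the orbit) $\xi$ in $G_{A_\tau}$. Similarly, the number of conjugacy classes in the group $\mathrm{GL}_n(R)$ whose centralizer has $N$ elements is $$\sum_\tau n^*_\tau\,\#\big\{\xi\in G_{A_\tau}\backslash \mathrm{Ext}^1_{k[t]}(M^{A_\tau},M^{A_\tau})\;:\;q^{z_\tau}|G_\xi|=N\big\},$$ where $n^*_\tau$ denotes the number of invertible similarity classes in $M_n(k)$ of type $\tau$.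
   Context: For $A\in M_n(k)$, $M^A$ is the $k[t]$-module $k^n$ with $t$ acting by $A$; $G_A$ is the centralizer of $A$ in $\mathrm{GL}_n(k)$, i.e. $\mathrm{Aut}_{k[t]}(M^A)$, acting on $\mathrm{Ext}^1_{k[t]}(M^A,M^A)$ diagonally by functoriality in both arguments: for classes $\xi,\xi'$ of $0\to M^A\xrightarrow{i}E\xrightarrow{s}M^A\to0$ and $0\to M^A\xrightarrow{i'}E'\xrightarrow{s'}M^A\to0$, ${}^g\xi=\xi'$ iff there is a homomorphism $\phi:E\to E'$ with $\phi i=i'g$ and $s'\phi=gs$. Similarity classes in $M_n(k)$ correspond to functions $c$ from the set $\mathrm{Irr}(k[t])$ of monic irreducible polynomials to the set of partitions with $\sum_p(\deg p)|c(p)|=n$: $c$ corresponds to the module $\bigoplus_p\bigoplus_ik[t]/p^{c(p)_i}$. Two classes $c,c'$ are of the same type if $c'=c\circ\phi$ for some degree-preserving permutation $\phi$ of $\mathrm{Irr}(k[t])$. The type $\tau$ of $c$ is recorded as the multiset of primary types $(c(p),\deg p)$, $p$ ranging over those $p$ with $c(p)\ne\emptyset$. For a partition $\lambda=(\lambda_1\ge\lambda_2\ge\dots\ge\lambda_r)$, $m(\lambda)=\lambda_1+3\lambda_2+\dots+(2r-1)\lambda_r$; thus $z_\tau$ is the dimension over $k$ of the centralizer algebra in $M_n(k)$ of a matrix of type $\tau$. *)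

theory Defs
  imports "HOL-Algebra.Group_Action" "HOL-Algebra.QuotRing" "Jordan_Normal_Form.VS_Connect"
begin

section \<open>Local principal ideal rings of finite length\<close>

definition local_ring :: "('a, 'b) ring_scheme \<Rightarrow> bool" where
  "local_ring R \<longleftrightarrow> cring R \<and> (\<exists>!m. maximalideal m R)"

definition principal_ideal_ring :: "('a, 'b) ring_scheme \<Rightarrow> bool" where
  "principal_ideal_ring R \<longleftrightarrow> cring R \<and> (\<forall>I. ideal I R \<longrightarrow> principalideal I R)"

text \<open>Length of \<open>R\<close> as a module over itself, by means of a composition series; by the
  Jordan--Hoelder theorem the choice of the series does not matter.\<close>

definition ring_has_length :: "('a, 'b) ring_scheme \<Rightarrow> nat \<Rightarrow> bool" where
  "ring_has_length R l \<longleftrightarrow> (\<exists>I :: nat \<Rightarrow> 'a set.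
     (\<forall>i\<le>l. ideal (I i) R) \<and> I 0 = {\<zero>\<^bsub>R\<^esub>} \<and> I l = carrier R \<and>
     (\<forall>i<l. I i \<subset> I (Suc i) \<and> \<not> (\<exists>J. ideal J R \<and> I i \<subset> J \<and> J \<subset> I (Suc i))))"


section \<open>Matrices up to similarity\<close>

definition GL_mat :: "'a::comm_ring_1 itself \<Rightarrow> nat \<Rightarrow> 'a mat monoid" where
  "GL_mat ty n = units_of (ring_mat ty n ())"

definition centralizer_mat :: "nat \<Rightarrow> 'a::comm_ring_1 mat \<Rightarrow> 'a mat set" where
  "centralizer_mat n A = {g \<in> carrier (GL_mat TYPE('a) n). g * A = A * g}"

definition centralizer_group :: "nat \<Rightarrow> 'a::comm_ring_1 mat \<Rightarrow> 'a mat monoid" where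
  "centralizer_group n A = (GL_mat TYPE('a) n)\<lparr>carrier := centralizer_mat n A\<rparr>"

definition similarity_classes :: "'a::comm_ring_1 itself \<Rightarrow> nat \<Rightarrow> 'a mat set set" where
  "similarity_classes ty n =
     carrier_mat n n // {(A, B). A \<in> carrier_mat n n \<and> similar_mat A B}"

definition conjugacy_classes :: "('a, 'b) monoid_scheme \<Rightarrow> 'a set set" where
  "conjugacy_classes G =
     orbits G (carrier G) (\<lambda>g. \<lambda>h\<in>carrier G. g \<otimes>\<^bsub>G\<^esub> h \<otimes>\<^bsub>G\<^esub> m_inv G g)"


section \<open>Extensions of modules\<close>

text \<open>A module record also has fields \<open>mult\<close> and \<open>one\<close>; \<^locale>\<open>module\<close> does not
  refer to them, and they are left unspecified in the modules constructed below.\<close>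

definition module_iso :: "('a, 'c0) ring_scheme \<Rightarrow> ('a, 'b1, 'c1) module_scheme \<Rightarrow>
    ('a, 'b2, 'c2) module_scheme \<Rightarrow> bool" where
  "module_iso R M N \<longleftrightarrow>
     (\<exists>f \<in> LinearCombinations.module_hom R M N. bij_betw f (carrier M) (carrier N))"

text \<open>Short exact sequences \<open>0 \<rightarrow> M \<rightarrow> E \<rightarrow> N \<rightarrow> 0\<close>, given as \<open>(E, i, s)\<close>. The elements of
  \<open>E\<close> are taken from the type \<open>'m \<times> 'n\<close>. This is no restriction up to equivalence: as a set,
  the middle term of any extension is in bijection with \<open>carrier M \<times> carrier N\<close>.\<close>

type_synonym ('a, 'm, 'n) extension =
  "('a, 'm \<times> 'n) module \<times> ('m \<Rightarrow> 'm \<times> 'n) \<times> ('m \<times> 'n \<Rightarrow> 'n)"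

definition extensions :: "'a ring \<Rightarrow> ('a, 'n) module \<Rightarrow> ('a, 'm) module \<Rightarrow>
    ('a, 'm, 'n) extension set" where
  "extensions R N M = {(E, i, s). module R E \<and>
     i \<in> LinearCombinations.module_hom R M E \<and> s \<in> LinearCombinations.module_hom R E N \<and>
     inj_on i (carrier M) \<and>
     i ` carrier M = {e \<in> carrier E. s e = \<zero>\<^bsub>N\<^esub>} \<and>
     s ` carrier E = carrier N}"

text \<open>There is a homomorphism \<open>\<phi> : E \<rightarrow> E'\<close> with \<open>\<phi> i = i' f\<close> and \<open>s' \<phi> = h s\<close>.\<close>

fun extension_morphism :: "'a ring \<Rightarrow> ('a, 'm) module \<Rightarrow> ('m \<Rightarrow> 'm) \<Rightarrow> ('n \<Rightarrow> 'n) \<Rightarrow>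
    ('a, 'm, 'n) extension \<Rightarrow> ('a, 'm, 'n) extension \<Rightarrow> bool" where
  "extension_morphism R M f h (E, i, s) (E', i', s') \<longleftrightarrow>
     (\<exists>\<phi> \<in> LinearCombinations.module_hom R E E'.
        (\<forall>x \<in> carrier M. \<phi> (i x) = i' (f x)) \<and> (\<forall>e \<in> carrier E. s' (\<phi> e) = h (s e)))"

definition extension_equiv :: "'a ring \<Rightarrow> ('a, 'n) module \<Rightarrow> ('a, 'm) module \<Rightarrow>
    (('a, 'm, 'n) extension \<times> ('a, 'm, 'n) extension) set" where
  "extension_equiv R N M = {(x, y). x \<in> extensions R N M \<and> y \<in> extensions R N M \<and>
     extension_morphism R M (\<lambda>a. a) (\<lambda>a. a) x y}"

definition Ext1 :: "'a ring \<Rightarrow> ('a, 'n) module \<Rightarrow> ('a, 'm) module \<Rightarrow>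
    ('a, 'm, 'n) extension set set" where
  "Ext1 R N M = extensions R N M // extension_equiv R N M"

text \<open>The diagonal action of an automorphism \<open>g\<close> of \<open>M\<close> on \<open>Ext1 R M M\<close>: the class
  \<open>\<^sup>g\<xi>\<close> consists of the extensions that receive a morphism with outer components \<open>g\<close>, \<open>g\<close>
  from an extension in \<open>\<xi>\<close>.\<close>

definition Ext1_act :: "'a ring \<Rightarrow> ('a, 'm) module \<Rightarrow> ('m \<Rightarrow> 'm) \<Rightarrow>
    ('a, 'm, 'm) extension set \<Rightarrow> ('a, 'm, 'm) extension set" where
  "Ext1_act R M g = (\<lambda>\<xi>\<in>Ext1 R M M.
     {y \<in> extensions R M M. \<exists>x\<in>\<xi>. extension_morphism R M g g x y})"


section \<open>The module of a matrix over the polynomial ring\<close>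

definition mat_module :: "nat \<Rightarrow> 'k::field mat \<Rightarrow> ('k poly, 'k vec) module" where
  "mat_module n A = \<lparr>
     carrier = carrier_vec n, monoid.mult = undefined, one = undefined, zero = 0\<^sub>v n, add = (+),
     smult = (\<lambda>f v. finsum_vec TYPE('k) n
       (\<lambda>i. coeff f i \<cdot>\<^sub>v ((A ^\<^sub>m i) *\<^sub>v v)) {..degree f})\<rparr>"

definition mat_Ext1 :: "nat \<Rightarrow> 'k::field mat \<Rightarrow> ('k poly, 'k vec, 'k vec) extension set set" where
  "mat_Ext1 n A = Ext1 class_ring (mat_module n A) (mat_module n A)"

definition mat_Ext1_act :: "nat \<Rightarrow> 'k::field mat \<Rightarrow> 'k mat \<Rightarrow>
    ('k poly, 'k vec, 'k vec) extension set \<Rightarrow> ('k poly, 'k vec, 'k vec) extension set" where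
  "mat_Ext1_act n A g = Ext1_act class_ring (mat_module n A) (\<lambda>v. g *\<^sub>v v)"


section \<open>Types of similarity classes\<close>

definition Irr :: "'k::field poly set" where
  "Irr = {p. irreducible p \<and> lead_coeff p = 1}"

text \<open>Partitions are weakly decreasing lists of positive numbers.\<close>

definition is_partition :: "nat list \<Rightarrow> bool" where
  "is_partition l \<longleftrightarrow> sorted_wrt (\<ge>) l \<and> 0 \<notin> set l"

text \<open>Functions from \<^term>\<open>Irr\<close> to partitions are extended by the empty partition to all
  polynomials.\<close>

definition class_functions :: "nat \<Rightarrow> ('k::field poly \<Rightarrow> nat list) set" where
  "class_functions n = {c. (\<forall>p. is_partition (c p)) \<and> (\<forall>p. p \<notin> Irr \<longrightarrow> c p = []) \<and>
     finite {p. c p \<noteq> []} \<and> (\<Sum>p | c p \<noteq> []. degree p * sum_list (c p)) = n}"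

definition cyclic_ring :: "'k::field poly \<Rightarrow> 'k poly set ring" where
  "cyclic_ring f = class_ring Quot (PIdl\<^bsub>class_ring\<^esub> f)"

text \<open>The direct sum of the modules \<open>k[t]/p^(c p ! i)\<close>, indexed by the pairs \<open>(p, i)\<close>. The index
  set is finite for \<^term>\<open>c \<in> class_functions n\<close>. A polynomial \<open>f\<close> acts on each summand as
  multiplication by its coset.\<close>

definition class_module ::
    "('k::field poly \<Rightarrow> nat list) \<Rightarrow> ('k poly, 'k poly \<times> nat \<Rightarrow> 'k poly set) module" where
  "class_module c =
    (let J = {(p, i). i < length (c p)};
         e = (\<lambda>(p, i). p ^ (c p ! i));
         Q = (\<lambda>j. cyclic_ring (e j))
     in \<lparr>carrier = (\<Pi>\<^sub>E j\<in>J. carrier (Q j)), monoid.mult = undefined, one = undefined,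
         zero = (\<lambda>j\<in>J. \<zero>\<^bsub>Q j\<^esub>),
         add = (\<lambda>x y. \<lambda>j\<in>J. x j \<oplus>\<^bsub>Q j\<^esub> y j),
         smult = (\<lambda>f x. \<lambda>j\<in>J.
           ((PIdl\<^bsub>class_ring\<^esub> (e j)) +>\<^bsub>class_ring\<^esub> f) \<otimes>\<^bsub>Q j\<^esub> x j)\<rparr>)"

definition same_type :: "nat \<Rightarrow>
    (('k::field poly \<Rightarrow> nat list) \<times> ('k poly \<Rightarrow> nat list)) set" where
  "same_type n = {(c, c'). c \<in> class_functions n \<and> c' \<in> class_functions n \<and>
     (\<exists>\<phi>. bij_betw \<phi> Irr Irr \<and> (\<forall>p\<in>Irr. degree (\<phi> p) = degree p \<and> c' p = c (\<phi> p)))}"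

definition sim_types :: "nat \<Rightarrow> ('k::field poly \<Rightarrow> nat list) set set" where
  "sim_types n = class_functions n // same_type n"

definition has_sim_type :: "nat \<Rightarrow> 'k::field mat \<Rightarrow> ('k poly \<Rightarrow> nat list) set \<Rightarrow> bool" where
  "has_sim_type n A \<tau> \<longleftrightarrow> A \<in> carrier_mat n n \<and>
     (\<exists>c\<in>\<tau>. module_iso class_ring (mat_module n A) (class_module c))"

definition classes_of_type :: "nat \<Rightarrow> ('k::field poly \<Rightarrow> nat list) set \<Rightarrow> 'k mat set set" where
  "classes_of_type n \<tau> = {C \<in> similarity_classes TYPE('k) n. \<exists>A\<in>C. has_sim_type n A \<tau>}"

definition invertible_classes_of_type ::
    "nat \<Rightarrow> ('k::field poly \<Rightarrow> nat list) set \<Rightarrow> 'k mat set set" where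
  "invertible_classes_of_type n \<tau> =
     {C \<in> classes_of_type n \<tau>. \<forall>A\<in>C. invertible_mat A}"

text \<open>The multiset of primary types does not depend on the chosen member of \<open>\<tau>\<close>.\<close>

definition primary_types :: "('k::field poly \<Rightarrow> nat list) set \<Rightarrow> (nat list \<times> nat) multiset" where
  "primary_types \<tau> = (let c = (SOME c. c \<in> \<tau>) in
     image_mset (\<lambda>p. (c p, degree p)) (mset_set {p. c p \<noteq> []}))"

text \<open>\<open>\<lambda>\<^sub>1 + 3 \<lambda>\<^sub>2 + \<dots> + (2 r - 1) \<lambda>\<^sub>r\<close>, with list positions counted from \<open>0\<close>.\<close>

definition part_m :: "nat list \<Rightarrow> nat" where
  "part_m l = (\<Sum>i<length l. (2 * i + 1) * l ! i)"

definition type_z :: "('k::field poly \<Rightarrow> nat list) set \<Rightarrow> nat" where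
  "type_z \<tau> = (\<Sum>(l, d)\<in>#primary_types \<tau>. d * part_m l)"

end

theory Submission
  imports Defs "HOL-Library.Function_Algebras" "Jordan_Normal_Form.Char_Poly"
begin

text \<open>
  Let \<open>\<mm>\<close> be the maximal ideal of \<open>R\<close>. It is spanned by one element of square zero, so it is the
  image of an additive embedding \<open>\<theta> : k \<rightarrow> R\<close> with \<open>r \<theta>(x) = \<theta>(r x)\<close> (\<open>square_zero\<close>,
  \<open>square_zero_exists\<close>). With \<open>\<theta>\<close> applied to matrices entrywise, the matrices over \<open>R\<close> that reduce to a given \<open>A\<close> over \<open>k\<close>
  are \<open>A' + \<theta>(X)\<close>, for a fixed lift \<open>A'\<close> of \<open>A\<close> and arbitrary \<open>X\<close> over \<open>k\<close>.

  The lift \<open>A'\<close> can be chosen such that every matrix that commutes with \<open>A\<close> has a lift that commutes with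
  \<open>A'\<close> (\<open>centralizer_lifts\<close>). An invertible matrix that intertwines \<open>A' + \<theta>(X)\<close> and \<open>A' + \<theta>(X')\<close> then has
  the form \<open>g' + \<theta>(W)\<close>, where \<open>g'\<close> commutes with \<open>A'\<close> and reduces to some \<open>g\<close> in \<open>G_A\<close>. As products of two values of \<open>\<theta>\<close>
  vanish, it is an intertwiner if and only if \<open>g X - X' g = A W - W A\<close> (\<open>first_order_intertwiner_iff\<close>).
  Let \<open>M\<close> be the space of all square matrices over \<open>k\<close> of the size of \<open>A\<close>, let \<open>Z\<close> be the subspace of those that commute
  with \<open>A\<close>, and \<open>[A, M]\<close> the space of commutators with \<open>A\<close>.
  The similarity classes above the class of \<open>A\<close> are therefore the orbits of \<open>G_A\<close> on \<open>M/[A, M]\<close>, and the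
  centralizer of \<open>A' + \<theta>(X)\<close> has \<open>|Z|\<close> times as many elements as the stabilizer of \<open>X\<close>, because
  for each \<open>g\<close> in the stabilizer the solutions \<open>W\<close> form a coset of \<open>Z\<close>.

  An extension of \<open>M\<^sup>A\<close> by itself becomes, after the choice of a linear section, the space \<open>k\<^sup>n \<oplus> k\<^sup>n\<close> on which
  \<open>t\<close> acts by a block matrix with rows \<open>(A, 0)\<close> and \<open>(D, A)\<close>. A morphism of extensions with
  outer components \<open>g\<close> exists if and only if \<open>g D - D' g\<close> lies in \<open>[A, M]\<close> (\<open>extension_morphism_iff\<close>). Hence
  \<open>Ext\<^sup>1\<close> is \<open>M/[A, M]\<close> with the same action of \<open>G_A\<close>, and orbits and stabilizers agree with those above.

  What remains is to compare different classes of one type. All of the data depend only on \<open>Z\<close> and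
  \<open>[A, M]\<close>, and \<open>type_transport\<close> shows that every class of the type of \<open>A\<close> contains a matrix for which these two spaces
  are literally the same: a polynomial in \<open>A\<close>. Its construction uses that over a finite field
  irreducible polynomials of equal degree have roots in the same fields. The class function of a
  matrix exists by the structure theorem (\<open>finite_module_cyclic_sum\<close>) and is unique by counting torsion
  (\<open>class_function_unique\<close>), so the classes over \<open>k\<close> are partitioned by type, and \<open>|Z|\<close> is \<open>q\<close> to the power \<open>z\<^sub>\<tau>\<close>
  (\<open>centralizer_dim\<close>). Summation over a set of classes over \<open>k\<close> gives \<open>count_classes\<close>, which is used for all classes
  and for the invertible ones.
\<close>

section \<open>Irreducible polynomials over a field\<close>

text \<open>A nonzero combination of \<open>p\<close> and \<open>h\<close> of least degree divides both of them.\<close>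

lemma irreducible_bezout:
  fixes p h :: "'k::field poly"
  assumes p: "irreducible p" and h: "\<not> p dvd h"
  obtains a b where "a * p + b * h = 1"
proof -
  define S where "S = {x. x \<noteq> 0 \<and> (\<exists>a b. x = a * p + b * h)}"
  have "p \<noteq> 0" using p by (auto simp: irreducible_def)
  moreover have "p = 1 * p + 0 * h" by simp
  ultimately have "p \<in> S" unfolding S_def by blast
  then obtain d where d: "d \<in> S" and dmin: "\<And>y. y \<in> S \<Longrightarrow> degree d \<le> degree y"
    using ex_has_least_nat[of "\<lambda>x. x \<in> S" p degree] by blast
  from d obtain a b where ab: "d = a * p + b * h" and d0: "d \<noteq> 0" by (auto simp: S_def)
  have dvd: "d dvd x" if x: "\<exists>a b. x = a * p + b * h" for x
  proof (rule ccontr)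
    assume "\<not> d dvd x"
    then have m0: "x mod d \<noteq> 0" by (simp add: mod_eq_0_iff_dvd)
    from x obtain a' b' where "x = a' * p + b' * h" by blast
    then have "x mod d = (a' - x div d * a) * p + (b' - x div d * b) * h"
      using ab by (simp add: minus_div_mult_eq_mod[symmetric] algebra_simps)
    then have "x mod d \<in> S" using m0 unfolding S_def by blast
    from dmin[OF this] degree_mod_less[OF d0, of x] m0 show False by auto
  qed
  have "d dvd p" by (rule dvd) (rule exI[of _ 1], rule exI[of _ 0], simp)
  moreover have dh: "d dvd h" by (rule dvd) (rule exI[of _ 0], rule exI[of _ 1], simp)
  ultimately have "d dvd 1" using irreducibleD'[OF p, of d] h dvd_trans by blast
  then obtain c where "1 = d * c" by (rule dvdE)
  then have "(c * a) * p + (c * b) * h = 1" using ab by (simp add: algebra_simps)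
  then show ?thesis by (rule that)
qed

lemma irreducible_dvd_mult:
  fixes p :: "'k::field poly"
  assumes "irreducible p" "p dvd x * y"
  shows "p dvd x \<or> p dvd y"
proof (rule ccontr)
  assume *: "\<not> ?thesis"
  then obtain a b where "a * p + b * x = 1" using irreducible_bezout[OF assms(1)] by metis
  then have "y = (a * p + b * x) * y" by simp
  then have "y = a * y * p + b * (x * y)" by (simp only: algebra_simps)
  then have "p dvd y" using assms(2) by (metis dvd_add dvd_mult dvd_triv_right)
  with * show False by blast
qed

lemma irreducible_power_bezout:
  fixes p g :: "'k::field poly"
  assumes "irreducible p" "\<not> p dvd g"
  obtains a b where "a * p ^ n + b * g = 1"
proof -
  have "\<exists>a b. a * p ^ n + b * g = 1"
  proof (induction n)
    case 0 show ?case by (rule exI[of _ 1], rule exI[of _ 0]) simp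
  next
    case (Suc n)
    then obtain a b where ab: "a * p ^ n + b * g = 1" by blast
    obtain c d where cd: "c * p + d * g = 1" using irreducible_bezout[OF assms] .
    have "(a * p ^ n + b * g) * (c * p + d * g) = 1" using ab cd by simp
    then have "(a * c) * p ^ Suc n + (a * p ^ n * d + b * c * p + b * d * g) * g = 1"
      by (simp add: algebra_simps)
    then show ?case by blast
  qed
  then show ?thesis using that by blast
qed

lemma irreducible_power_split:
  fixes p f :: "'k::field poly"
  assumes p: "irreducible p" and f: "f \<noteq> 0"
  obtains b g where "f = p ^ b * g" "\<not> p dvd g"
  using f
proof (induction "degree f" arbitrary: f thesis rule: less_induct)
  case less
  show ?case
  proof (cases "p dvd f")
    case False
    then show ?thesis using less.prems(1)[of 0 f] by simp
  next
    case True
    then obtain f' where f': "f = p * f'" by (rule dvdE)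
    with less.prems(2) have "f' \<noteq> 0" "p \<noteq> 0" by auto
    moreover have "degree p > 0" using p \<open>p \<noteq> 0\<close>
      by (metis irreducible_def is_unit_iff_degree neq0_conv)
    ultimately have "degree f' < degree f" by (simp add: f' degree_mult_eq)
    from less.hyps[OF this _ \<open>f' \<noteq> 0\<close>] obtain b g where "f' = p ^ b * g" "\<not> p dvd g" by blast
    then show ?thesis using less.prems(1)[of "Suc b" g] f' by (simp add: algebra_simps)
  qed
qed

lemma Irr_irreducible: "p \<in> Irr \<Longrightarrow> irreducible p" by (simp add: Irr_def)

lemma Irr_degree_pos: "p \<in> Irr \<Longrightarrow> 0 < degree p"
  unfolding Irr_def by (metis (mono_tags, lifting) irreducible_def is_unit_iff_degree mem_Collect_eq neq0_conv)

lemma Irr_dvd_eq: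
  assumes "p \<in> Irr" "r \<in> Irr" "p dvd r"
  shows "p = r"
proof -
  have "r dvd p" using irreducibleD'[OF Irr_irreducible[OF assms(2)] assms(3)] assms(1)
    by (auto simp: Irr_def irreducible_def)
  then obtain x where x: "p = r * x" by (rule dvdE)
  from assms(3) obtain y where y: "r = p * y" by (rule dvdE)
  have "p \<noteq> 0" using assms(1) by (auto simp: Irr_def)
  have "r \<noteq> 0" using assms(2) by (auto simp: Irr_def)
  have "p * (y * x) = p * 1" using x y by (simp flip: mult.assoc)
  then have "x * y = 1" using \<open>p \<noteq> 0\<close> by (simp add: mult.commute)
  then have "degree x = 0" by (metis dvd_triv_left is_unit_iff_degree one_neq_zero mult_zero_left)
  then obtain c where c: "x = [:c:]" by (metis degree_eq_zeroE)
  have "lead_coeff p = lead_coeff r * c" using x c by (simp add: lead_coeff_mult)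
  then have "c = 1" using assms by (simp add: Irr_def)
  then show ?thesis using x c by simp
qed

lemma Irr_not_dvd_power:
  assumes "p \<in> Irr" "r \<in> Irr" "p \<noteq> r"
  shows "\<not> p dvd r ^ n"
proof (induction n)
  case 0
  then show ?case using assms(1) by (auto simp: Irr_def irreducible_def)
next
  case (Suc n)
  then show ?case using irreducible_dvd_mult[OF Irr_irreducible[OF assms(1)]] Irr_dvd_eq[OF assms(1,2)] assms(3) by auto
qed

lemma exists_Irr_factor:
  fixes f :: "'k::field poly"
  assumes "degree f > 0"
  obtains p where "p \<in> Irr" "p dvd f"
proof -
  define S where "S = {g. g dvd f \<and> degree g > 0}"
  have "f \<in> S" using assms by (simp add: S_def)
  then obtain d where d: "d \<in> S" and dmin: "\<And>y. y \<in> S \<Longrightarrow> degree d \<le> degree y"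
    using ex_has_least_nat[of "\<lambda>x. x \<in> S" f degree] by blast
  have d0: "d \<noteq> 0" using d by (auto simp: S_def)
  have "irreducible d"
  proof (rule irreducibleI)
    show "d \<noteq> 0" by fact
    show "\<not> d dvd 1" using d d0 by (simp add: S_def is_unit_iff_degree)
    fix a b assume ab: "d = a * b"
    show "a dvd 1 \<or> b dvd 1"
    proof (rule ccontr)
      assume *: "\<not> (a dvd 1 \<or> b dvd 1)"
      have "a \<noteq> 0" "b \<noteq> 0" using ab d0 by auto
      then have "degree a > 0" "degree b > 0" using * by (auto simp: is_unit_iff_degree)
      then have "a \<in> S" using d ab unfolding S_def by (auto intro: dvd_trans)
      from dmin[OF this] have "degree b = 0" using ab \<open>a \<noteq> 0\<close> \<open>b \<noteq> 0\<close> by (simp add: degree_mult_eq)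
      with \<open>degree b > 0\<close> show False by simp
    qed
  qed
  define p where "p = Polynomial.smult (inverse (lead_coeff d)) d"
  have c: "inverse (lead_coeff d) \<noteq> 0" using d0 by simp
  have "irreducible p"
  proof (rule irreducibleI)
    show "p \<noteq> 0" using d0 by (simp add: p_def)
    show "\<not> p dvd 1" using irreducible_not_unit[OF \<open>irreducible d\<close>] c by (simp add: p_def smult_dvd_iff)
    fix a b assume "p = a * b"
    then have "Polynomial.smult (lead_coeff d) p = Polynomial.smult (lead_coeff d) a * b" by simp
    then have "d = Polynomial.smult (lead_coeff d) a * b" using d0 by (simp add: p_def)
    then have "Polynomial.smult (lead_coeff d) a dvd 1 \<or> b dvd 1" using irreducibleD[OF \<open>irreducible d\<close>] by blast
    then show "a dvd 1 \<or> b dvd 1" using d0 by (simp add: smult_dvd_iff)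
  qed
  then have "p \<in> Irr" using d0 by (simp add: Irr_def p_def)
  moreover have "p dvd f" using d c by (simp add: p_def smult_dvd_iff S_def)
  ultimately show ?thesis by (rule that)
qed

section \<open>Finite modules over the polynomial ring\<close>

text \<open>\<open>V\<close> is the direct sum of the cyclic submodules generated by the \<open>v j\<close>, and the annihilator of \<open>v j\<close> is
  generated by \<open>e j\<close>. The second conjunct expresses both the independence of the summands and their annihilators.\<close>

definition cyclic_sum :: "('s::comm_ring_1 \<Rightarrow> 'b::ab_group_add \<Rightarrow> 'b) \<Rightarrow> 'b set \<Rightarrow> 'j set
    \<Rightarrow> ('j \<Rightarrow> 's) \<Rightarrow> ('j \<Rightarrow> 'b) \<Rightarrow> bool" where
  "cyclic_sum scale V J e v \<longleftrightarrow>
     V = range (\<lambda>f. \<Sum>j\<in>J. scale (f j) (v j)) \<and>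
     (\<forall>f. (\<Sum>j\<in>J. scale (f j) (v j)) = 0 \<longleftrightarrow> (\<forall>j\<in>J. e j dvd f j))"

locale poly_module = Modules.module scale
  for scale :: "'k::field poly \<Rightarrow> 'b::ab_group_add \<Rightarrow> 'b" (infixr \<open>*s\<close> 75)
begin

text \<open>As \<open>V\<close> is finite, two powers of \<open>t\<close> agree on \<open>x\<close>.\<close>

lemma exists_annihilator:
  assumes "finite V" "subspace V" "x \<in> V"
  obtains f where "f \<noteq> 0" "f *s x = 0"
proof -
  have "range (\<lambda>i. monom 1 i *s x) \<subseteq> V" using assms by (auto intro: subspace_scale)
  then have "finite (range (\<lambda>i. monom 1 i *s x))" using assms(1) finite_subset by blast
  then have "\<not> inj (\<lambda>i::nat. monom (1::'k) i *s x)" using finite_imageD infinite_UNIV_nat by blast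
  then obtain i j :: nat where ij: "i \<noteq> j" "monom 1 i *s x = monom 1 j *s x"
    by (auto simp: inj_on_def)
  have "(monom 1 i - monom 1 j) *s x = 0" using ij by (simp add: scale_left_diff_distrib)
  moreover have "monom (1::'k) i - monom 1 j \<noteq> 0" using ij by (metis degree_monom_eq eq_iff_diff_eq_0 one_neq_zero)
  ultimately show ?thesis by (rule that[rotated])
qed

text \<open>Choose \<open>x\<close> outside \<open>U\<close> and a nonzero polynomial \<open>g\<close> with \<open>g x\<close> in \<open>U\<close> such that the degree of \<open>g\<close> is as small as possible. If \<open>p\<close>
  is a prime factor of \<open>g\<close>, then \<open>(g/p) x\<close> is still outside \<open>U\<close>, and \<open>p\<close> moves it into \<open>U\<close>.\<close>

lemma exists_step_outside:
  assumes V: "finite V" "subspace V" and U: "subspace U" and x: "x \<in> V" "x \<notin> U"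
  obtains y p where "y \<in> V" "y \<notin> U" "p \<in> Irr" "p *s y \<in> U"
proof -
  define S where "S = {(x, f). x \<in> V \<and> x \<notin> U \<and> f \<noteq> 0 \<and> f *s x \<in> U}"
  obtain f where "f \<noteq> 0" "f *s x = 0" using exists_annihilator[OF V x(1)] .
  then have "(x, f) \<in> S" using x U by (simp add: S_def subspace_0)
  then obtain z where z: "z \<in> S" and zmin: "\<And>y. y \<in> S \<Longrightarrow> degree (snd z) \<le> degree (snd y)"
    using ex_has_least_nat[of "\<lambda>x. x \<in> S" "(x, f)" "\<lambda>z. degree (snd z)"] by blast
  obtain y g where yg: "z = (y, g)" by force
  have y: "y \<in> V" "y \<notin> U" "g \<noteq> 0" "g *s y \<in> U" using z by (auto simp: S_def yg)
  have "degree g > 0"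
  proof (rule ccontr)
    assume "\<not> degree g > 0"
    then obtain h where "1 = g * h" using y(3) by (metis dvdE is_unit_iff_degree neq0_conv)
    then have "y = h *s (g *s y)" by (metis mult.commute scale_one scale_scale)
    then show False using y U by (metis subspace_scale)
  qed
  then obtain p where p: "p \<in> Irr" "p dvd g" by (rule exists_Irr_factor)
  from p(2) obtain h where h: "g = p * h" by (rule dvdE)
  have "p \<noteq> 0" "h \<noteq> 0" using h y(3) by auto
  have "degree h < degree g" using Irr_degree_pos[OF p(1)] \<open>p \<noteq> 0\<close> \<open>h \<noteq> 0\<close> by (simp add: h degree_mult_eq)
  then have "(y, h) \<notin> S" using zmin[of "(y, h)"] by (auto simp: yg)
  then have "h *s y \<notin> U" using y \<open>h \<noteq> 0\<close> by (simp add: S_def)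
  moreover have "h *s y \<in> V" using y(1) V by (simp add: subspace_scale)
  moreover have "p *s (h *s y) \<in> U" using y(4) by (simp add: h)
  ultimately show ?thesis using p(1) that by blast
qed

lemma prime_power_order:
  assumes p: "irreducible p" and v: "p ^ a *s v = 0" "p ^ (a - 1) *s v \<noteq> 0"
  shows "f *s v = 0 \<longleftrightarrow> p ^ a dvd f"
proof
  assume "p ^ a dvd f"
  then obtain g where "f = g * p ^ a" by (metis dvdE mult.commute)
  then show "f *s v = 0" using v(1) by (simp flip: scale_scale)
next
  assume fv: "f *s v = 0"
  show "p ^ a dvd f"
  proof (cases "f = 0")
    case False
    obtain b g where f: "f = p ^ b * g" "\<not> p dvd g" using irreducible_power_split[OF p False] .
    show ?thesis
    proof (rule ccontr)
      assume *: "\<not> p ^ a dvd f"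
      then have "\<not> a \<le> b" using f(1) by (metis dvd_mult2 le_imp_power_dvd)
      then have ba: "a - 1 = (a - 1 - b) + b" by linarith
      obtain \<alpha> \<beta> where "\<alpha> * p ^ a + \<beta> * g = 1" using irreducible_power_bezout[OF p f(2)] .
      then have "p ^ (a - 1) = p ^ (a - 1) * (\<alpha> * p ^ a + \<beta> * g)" by simp
      also have "\<dots> = p ^ (a - 1) * \<alpha> * p ^ a + \<beta> * (p ^ (a - 1 - b + b) * g)"
        using ba by (simp add: algebra_simps)
      also have "\<dots> = p ^ (a - 1) * \<alpha> * p ^ a + (p ^ (a - 1 - b) * \<beta>) * f"
        unfolding power_add f(1) by (simp only: ac_simps)
      finally have "p ^ (a - 1) = p ^ (a - 1) * \<alpha> * p ^ a + (p ^ (a - 1 - b) * \<beta>) * f" .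
      then have "p ^ (a - 1) *s v = (p ^ (a - 1) * \<alpha>) *s (p ^ a *s v) + (p ^ (a - 1 - b) * \<beta>) *s (f *s v)"
        by (metis scale_left_distrib scale_scale)
      then show False using v fv by simp
    qed
  qed simp
qed

text \<open>The elements \<open>v, p v, \<dots>, p\<^sup>a\<^sup>-\<^sup>1 v\<close> are distinct. The bound makes a largest exponent available.\<close>

lemma prime_exponent_bounded:
  assumes V: "finite V" "subspace V" and v: "v \<in> V" "p ^ a *s v = 0" "p ^ (a - 1) *s v \<noteq> 0"
  shows "a \<le> card V"
proof -
  have "inj_on (\<lambda>i. p ^ i *s v) {..<a}"
  proof (rule linorder_inj_onI)
    fix i j assume ij: "i < j" "i \<in> {..<a}" "j \<in> {..<a}"
    show "p ^ i *s v \<noteq> p ^ j *s v"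
    proof
      assume eq: "p ^ i *s v = p ^ j *s v"
      have "p ^ (a - 1) *s v = p ^ (a - 1 - i) *s (p ^ i *s v)"
        using ij by (simp flip: power_add)
      also have "\<dots> = p ^ (j - 1 - i) *s (p ^ a *s v)"
        using ij by (simp add: eq add.commute flip: power_add)
      finally show False using v by simp
    qed
  qed auto
  moreover have "(\<lambda>i. p ^ i *s v) ` {..<a} \<subseteq> V" using v V by (auto intro: subspace_scale)
  ultimately have "card {..<a} \<le> card V" using V(1) by (metis card_inj_on_le)
  then show ?thesis by simp
qed

lemma subspace_adjoin:
  assumes W: "subspace W"
  shows "subspace {f *s v + w | f w. w \<in> W}" "W \<subseteq> {f *s v + w | f w. w \<in> W}" "f *s v \<in> {f *s v + w | f w. w \<in> W}"
proof -
  let ?U = "{f *s v + w | f w. w \<in> W}"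
  show sub: "W \<subseteq> ?U"
  proof
    fix w assume "w \<in> W"
    moreover have "w = 0 *s v + w" by simp
    ultimately show "w \<in> ?U" by blast
  qed
  have "f *s v = f *s v + 0" by simp
  then show "f *s v \<in> ?U" using subspace_0[OF W] by blast
  show "subspace ?U"
  proof (rule subspaceI)
    show "0 \<in> ?U" using sub subspace_0[OF W] by blast
    fix x y assume "x \<in> ?U" "y \<in> ?U"
    then obtain f w f' w' where *: "x = f *s v + w" "y = f' *s v + w'" "w \<in> W" "w' \<in> W" by auto
    then have "x + y = (f + f') *s v + (w + w')" "w + w' \<in> W"
      using W by (auto simp: scale_left_distrib subspace_add)
    then show "x + y \<in> ?U" by blast
  next
    fix c x assume "x \<in> ?U"
    then obtain f w where *: "x = f *s v + w" "w \<in> W" by auto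
    then have "c *s x = (c * f) *s v + c *s w" "c *s w \<in> W" using W by (auto simp: scale_right_distrib subspace_scale)
    then show "c *s x \<in> ?U" by blast
  qed
qed

text \<open>An element \<open>v\<close> whose order \<open>p\<^sup>a\<close> is largest among the orders that are powers of \<open>p\<close> spans a direct summand. The
  complement \<open>W\<close> is a maximal submodule that meets the span of \<open>v\<close> only in \<open>0\<close>. If the sum \<open>U\<close> of the two were not
  all of \<open>V\<close>, there would be \<open>x\<close> outside \<open>U\<close> and a prime \<open>r\<close> with \<open>r x\<close> in \<open>U\<close>. One can change \<open>x\<close> by a multiple of \<open>v\<close> such
  that \<open>r x\<close> lies in \<open>W\<close>: for \<open>r \<noteq> p\<close> because \<open>r\<close> is invertible modulo \<open>p\<^sup>a\<close>, and for \<open>r = p\<close> because maximality of \<open>a\<close>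
  forces the coefficient of \<open>v\<close> in \<open>p x\<close> to be a multiple of \<open>p\<close>. Then \<open>W\<close> can be enlarged by \<open>x\<close>, a contradiction.\<close>

lemma split_cyclic_summand:
  assumes V: "finite V" "subspace V" and nz: "V \<noteq> {0}"
  obtains p a v W where "p \<in> Irr" "a > 0" "v \<in> V" "v \<noteq> 0" "subspace W" "W \<subseteq> V"
    "\<And>f. f *s v = 0 \<longleftrightarrow> p ^ a dvd f"
    "\<And>u. u \<in> V \<Longrightarrow> \<exists>f w. w \<in> W \<and> u = f *s v + w"
    "\<And>f. f *s v \<in> W \<Longrightarrow> f *s v = 0"
proof -
  obtain x0 where "x0 \<in> V" "x0 \<notin> {0}" using nz V(2) subspace_0 by blast
  then obtain y0 p where y0: "y0 \<in> V" "y0 \<noteq> 0" and p: "p \<in> Irr" and "p *s y0 = 0"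
    using exists_step_outside[OF V, of "{0}" x0] by (metis singletonD singletonI subspace_single_0)
  have irr: "irreducible p" using p by (rule Irr_irreducible)
  define P where "P a \<longleftrightarrow> a > 0 \<and> (\<exists>v\<in>V. p ^ a *s v = 0 \<and> p ^ (a - 1) *s v \<noteq> 0)" for a
  have "P 1" using y0 \<open>p *s y0 = 0\<close> by (auto simp: P_def)
  have bnd: "a \<le> card V" if "P a" for a using that prime_exponent_bounded[OF V] by (auto simp: P_def)
  define a where "a = (GREATEST a. P a)"
  have Pa: "P a" unfolding a_def using GreatestI_nat[of P 1 "card V"] \<open>P 1\<close> bnd by blast
  have amax: "b \<le> a" if "P b" for b unfolding a_def using Greatest_le_nat[of P b "card V"] that bnd by blast
  from Pa obtain v where v: "v \<in> V" "p ^ a *s v = 0" "p ^ (a - 1) *s v \<noteq> 0" "a > 0" by (auto simp: P_def)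
  have order: "f *s v = 0 \<longleftrightarrow> p ^ a dvd f" for f using prime_power_order[OF irr v(2,3)] .
  \<comment> \<open>By maximality of \<open>a\<close>, every element killed by a power of \<open>p\<close> is killed by \<open>p ^ a\<close>.\<close>
  have kill: "p ^ a *s x = 0" if x: "x \<in> V" "p ^ b *s x = 0" for x b
  proof (rule ccontr)
    assume n: "p ^ a *s x \<noteq> 0"
    define c where "c = (LEAST c. p ^ c *s x = 0)"
    have c: "p ^ c *s x = 0" unfolding c_def by (rule LeastI) (rule x(2))
    have "c > 0" using c n by (metis gr0I power_0 scale_one scale_zero_right)
    then have "p ^ (c - 1) *s x \<noteq> 0" using not_less_Least[of "c - 1" "\<lambda>c. p ^ c *s x = 0"] by (simp add: c_def[symmetric])
    then have "P c" using c x \<open>c > 0\<close> by (auto simp: P_def)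
    then have "c \<le> a" by (rule amax)
    then have "p ^ a *s x = p ^ (a - c) *s (p ^ c *s x)" by (simp flip: power_add)
    then show False using c n by simp
  qed
  define \<W> where "\<W> = {W. subspace W \<and> W \<subseteq> V \<and> (\<forall>f. f *s v \<in> W \<longrightarrow> f *s v = 0)}"
  have "finite \<W>" using V(1) by (auto simp: \<W>_def intro: finite_subset[of _ "Pow V"])
  moreover have "{0} \<in> \<W>" using V subspace_0 by (auto simp: \<W>_def subspace_single_0)
  ultimately obtain W where W: "W \<in> \<W>" and Wmax: "\<And>W'. W' \<in> \<W> \<Longrightarrow> W \<subseteq> W' \<Longrightarrow> W = W'"
    using finite_has_maximal[of \<W>] by blast
  have Ws: "subspace W" "W \<subseteq> V" and Wv: "\<And>f. f *s v \<in> W \<Longrightarrow> f *s v = 0" using W by (auto simp: \<W>_def)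
  define U where "U = {f *s v + w | f w. w \<in> W}"
  have U: "subspace U" and WU: "\<And>w. w \<in> W \<Longrightarrow> w \<in> U" and vU: "\<And>f. f *s v \<in> U"
    using subspace_adjoin[OF Ws(1)] unfolding U_def by blast+
  have "V \<subseteq> U"
  proof (rule ccontr)
    assume "\<not> V \<subseteq> U"
    then obtain x1 where "x1 \<in> V" "x1 \<notin> U" by blast
    then obtain x r where x: "x \<in> V" "x \<notin> U" "r \<in> Irr" "r *s x \<in> U"
      using exists_step_outside[OF V U] by metis
    \<comment> \<open>Change \<open>x\<close> by a multiple of \<open>v\<close> such that \<open>r *s x\<close> lies in \<open>W\<close>.\<close>
    have "\<exists>y\<in>V. y \<notin> U \<and> r *s y \<in> W"
    proof -
      have "\<exists>y g. y \<in> V \<and> y \<notin> U \<and> r *s y - r *s (g *s v) \<in> W"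
      proof (cases "r = p")
        case False
        obtain f w where fw: "r *s x = f *s v + w" "w \<in> W" using x(4) by (auto simp: U_def)
        have "\<not> r dvd p ^ a" using Irr_not_dvd_power[OF x(3) p False] .
        then obtain \<alpha> \<beta> where "\<alpha> * r + \<beta> * p ^ a = 1" using irreducible_bezout[OF Irr_irreducible[OF x(3)]] by metis
        then have "f = f * (\<alpha> * r + \<beta> * p ^ a)" by simp
        then have "f = r * (f * \<alpha>) + (f * \<beta>) * p ^ a" by (simp only: algebra_simps)
        then have "f *s v = r *s ((f * \<alpha>) *s v) + (f * \<beta>) *s (p ^ a *s v)" by (metis scale_left_distrib scale_scale)
        then have "r *s x - r *s ((f * \<alpha>) *s v) = w" using v(2) fw(1) by simp
        then show ?thesis using x fw(2) by blast
      next
        case True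
        obtain h where h: "h \<noteq> 0" "h *s x = 0" using exists_annihilator[OF V x(1)] .
        obtain b m where bm: "h = p ^ b * m" "\<not> p dvd m" using irreducible_power_split[OF irr h(1)] .
        define y where "y = m *s x"
        have yV: "y \<in> V" using x(1) V by (simp add: y_def subspace_scale)
        have "p ^ b *s y = 0" using h bm by (simp add: y_def)
        then have ya: "p ^ a *s y = 0" by (rule kill[OF yV])
        have yU: "y \<notin> U"
        proof
          assume "y \<in> U"
          obtain \<alpha> \<beta> where "\<alpha> * p + \<beta> * m = 1" using irreducible_bezout[OF irr bm(2)] .
          then have "x = \<alpha> *s (p *s x) + \<beta> *s y" by (metis scale_left_distrib scale_scale scale_one y_def)
          moreover have "\<alpha> *s (p *s x) \<in> U" "\<beta> *s y \<in> U" using x(4) True \<open>y \<in> U\<close> U by (metis subspace_scale)+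
          ultimately have "x \<in> U" using U subspace_add by metis
          then show False using x by simp
        qed
        have "p *s y = m *s (p *s x)" by (simp add: y_def mult.commute)
        then have "p *s y \<in> U" using x(4) True U by (simp only: subspace_scale)
        then obtain f w where fw: "p *s y = f *s v + w" "w \<in> W" by (auto simp: U_def)
        have "p ^ (a - 1) *s (p *s y) = 0" using ya v(4) by (metis power_minus_mult scale_scale)
        then have "(p ^ (a - 1) * f) *s v = p ^ (a - 1) *s (- w)"
          by (simp add: fw(1) scale_right_distrib eq_neg_iff_add_eq_0)
        also have "\<dots> \<in> W" using fw(2) Ws by (simp only: subspace_scale subspace_neg)
        finally have "(p ^ (a - 1) * f) *s v = 0" by (rule Wv)
        then have "p ^ a dvd p ^ (a - 1) * f" by (simp only: order)
        then have "p ^ (a - 1) * p dvd p ^ (a - 1) * f" using v(4) by (metis power_minus_mult)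
        moreover have "p ^ (a - 1) \<noteq> 0" using irr by (simp add: irreducible_def)
        ultimately have "p dvd f" using dvd_mult_cancel_left by blast
        then obtain g where g: "f = p * g" by (rule dvdE)
        then have "p *s y - p *s (g *s v) = w" by (simp add: fw(1))
        then show ?thesis using yV yU fw(2) True by blast
      qed
      then obtain y g where y: "y \<in> V" "y \<notin> U" "r *s y - r *s (g *s v) \<in> W" by blast
      have "y - g *s v \<in> V" using y(1) v(1) V by (simp add: subspace_diff subspace_scale)
      moreover have "y - g *s v \<notin> U" using y(2) vU[of g] U subspace_add[of U "y - g *s v" "g *s v"] by auto
      moreover have "r *s (y - g *s v) \<in> W" using y(3) by (simp only: scale_right_diff_distrib)
      ultimately show ?thesis by blast
    qed
    then obtain y where y: "y \<in> V" "y \<notin> U" "r *s y \<in> W" by blast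
    define W' where "W' = {h *s y + w | h w. w \<in> W}"
    have W': "subspace W'" and WW': "W \<subseteq> W'" and "1 *s y \<in> W'"
      unfolding W'_def by (rule subspace_adjoin[OF Ws(1)])+
    then have yW': "y \<in> W'" by simp
    have "W \<noteq> W'" using yW' y(2) WU by blast
    then have "W' \<notin> \<W>" using Wmax WW' by blast
    moreover have "W' \<subseteq> V" unfolding W'_def using y(1) Ws(2) V(2) by (auto simp: subspace_add subspace_scale subsetD)
    ultimately obtain f where f: "f *s v \<in> W'" "f *s v \<noteq> 0" using W' by (auto simp: \<W>_def)
    then obtain h w where hw: "f *s v = h *s y + w" "w \<in> W" by (auto simp: W'_def)
    show False
    proof (cases "r dvd h")
      case True
      then obtain k where "h = k * r" by (metis dvdE mult.commute)
      then have "h *s y \<in> W" using y(3) Ws(1) by (metis scale_scale subspace_scale)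
      then have "f *s v \<in> W" using hw Ws(1) by (simp add: subspace_add)
      then show False using Wv f(2) by blast
    next
      case False
      obtain \<alpha> \<beta> where "\<alpha> * r + \<beta> * h = 1" using irreducible_bezout[OF Irr_irreducible[OF x(3)] False] .
      then have eq: "y = \<alpha> *s (r *s y) + \<beta> *s (h *s y)" by (metis scale_left_distrib scale_scale scale_one)
      have "h *s y = f *s v - w" using hw by simp
      then have "h *s y \<in> U" using vU WU[OF hw(2)] U by (simp add: subspace_diff)
      then have "y \<in> U" using eq WU[OF y(3)] U by (metis subspace_add subspace_scale)
      then show False using y by simp
    qed
  qed
  then have sur: "\<exists>f w. w \<in> W \<and> u = f *s v + w" if "u \<in> V" for u
    using that \<open>V \<subseteq> U\<close> unfolding U_def by blast
  have "v \<noteq> 0" using v(3) by auto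
  show ?thesis by (rule that[OF p v(4,1) \<open>v \<noteq> 0\<close> Ws order sur Wv])
qed

theorem finite_module_cyclic_sum:
  assumes "finite V" "subspace V"
  shows "\<exists>m e v. cyclic_sum scale V {..<m::nat} e v \<and> (\<forall>j<m. \<exists>p\<in>Irr. \<exists>a>0. e j = p ^ a)"
  using assms
proof (induction "card V" arbitrary: V rule: less_induct)
  case less
  show ?case
  proof (cases "V = {0}")
    case True
    then show ?thesis by (intro exI[of _ 0]) (auto simp: cyclic_sum_def)
  next
    case False
    obtain p a v W where *: "p \<in> Irr" "a > 0" "v \<in> V" "v \<noteq> 0" "subspace W" "W \<subseteq> V"
      "\<And>f. f *s v = 0 \<longleftrightarrow> p ^ a dvd f"
      "\<And>u. u \<in> V \<Longrightarrow> \<exists>f w. w \<in> W \<and> u = f *s v + w"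
      "\<And>f. f *s v \<in> W \<Longrightarrow> f *s v = 0"
      by (rule split_cyclic_summand[OF less.prems False]) (rule that)
    have "v \<notin> W" using *(9)[of 1] *(4) by auto
    then have "W \<subset> V" using *(3,6) by blast
    then have "card W < card V" using less.prems(1) psubset_card_mono by blast
    moreover have "finite W" using *(6) less.prems(1) finite_subset by blast
    ultimately obtain m e w where IH: "cyclic_sum scale W {..<m::nat} e w" "\<And>j. j < m \<Longrightarrow> \<exists>p\<in>Irr. \<exists>a>0. e j = p ^ a"
      using less.hyps[OF _ _ *(5)] by blast
    have rng: "(\<Sum>j<m. f j *s w j) \<in> W" for f using IH(1) by (auto simp: cyclic_sum_def)
    define e' where "e' = e(m := p ^ a)"
    define w' where "w' = w(m := v)"
    have sum: "(\<Sum>j<Suc m. f j *s w' j) = (\<Sum>j<m. f j *s w j) + f m *s v" for f by (simp add: w'_def)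
    have "cyclic_sum scale V {..<Suc m} e' w'"
      unfolding cyclic_sum_def
    proof (rule conjI[OF subset_antisym[OF subsetI subsetI]]; (intro allI iffI)?)
      fix u assume "u \<in> V"
      then obtain f x where fx: "x \<in> W" "u = f *s v + x" using *(8) by blast
      then obtain g where g: "x = (\<Sum>j<m. g j *s w j)" using IH(1) by (auto simp: cyclic_sum_def)
      have "u = (\<Sum>j<Suc m. (g(m := f)) j *s w' j)" unfolding sum using fx g by simp
      then show "u \<in> range (\<lambda>f. \<Sum>j<Suc m. f j *s w' j)" by blast
    next
      fix u assume "u \<in> range (\<lambda>f. \<Sum>j<Suc m. f j *s w' j)"
      then obtain f where "u = (\<Sum>j<m. f j *s w j) + f m *s v" unfolding sum by blast
      then show "u \<in> V" using rng[of f] * less.prems by (auto intro!: subspace_add subspace_scale)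
    next
      fix f assume z: "(\<Sum>j<Suc m. f j *s w' j) = 0"
      then have "f m *s v = - (\<Sum>j<m. f j *s w j)" unfolding sum by (simp add: eq_neg_iff_add_eq_0 add.commute)
      then have "f m *s v \<in> W" using rng[of f] *(5) by (simp add: subspace_neg)
      then have fm: "f m *s v = 0" by (rule *(9))
      then have "(\<Sum>j<m. f j *s w j) = 0" using z unfolding sum by simp
      then have "\<forall>j<m. e j dvd f j" using IH(1) by (auto simp: cyclic_sum_def)
      then show "\<forall>j\<in>{..<Suc m}. e' j dvd f j" using fm *(7) by (auto simp: e'_def less_Suc_eq)
    next
      fix f assume d: "\<forall>j\<in>{..<Suc m}. e' j dvd f j"
      then have "\<forall>j<m. e j dvd f j" unfolding e'_def by (metis fun_upd_apply lessThan_iff less_SucI nat_neq_iff)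
      then have "(\<Sum>j<m. f j *s w j) = 0" using IH(1) by (auto simp: cyclic_sum_def)
      moreover have "f m *s v = 0" using bspec[OF d, of m] *(7)[of "f m"] by (simp add: e'_def)
      ultimately show "(\<Sum>j<Suc m. f j *s w' j) = 0" unfolding sum by simp
    qed
    moreover have "\<exists>p\<in>Irr. \<exists>a>0. e' j = p ^ a" if "j < Suc m" for j
      using that IH(2) *(1,2) by (auto simp: e'_def less_Suc_eq)
    ultimately show ?thesis by blast
  qed
qed

end

section \<open>Square matrices as operators\<close>

text \<open>Vectors of length \<open>n\<close> are encoded as functions that vanish from \<open>n\<close> on. In this way they live in one additive
  group for all \<open>n\<close>, and the type-class theory of sums and modules applies to them.\<close>

definition Vn :: "nat \<Rightarrow> (nat \<Rightarrow> 'a::zero) set" where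
  "Vn n = {v. \<forall>i\<ge>n. v i = 0}"

definition mop :: "nat \<Rightarrow> 'a::comm_ring_1 mat \<Rightarrow> (nat \<Rightarrow> 'a) \<Rightarrow> nat \<Rightarrow> 'a" where
  "mop n A v = (\<lambda>i. if i < n then \<Sum>j<n. A $$ (i, j) * v j else 0)"

definition linop :: "((nat \<Rightarrow> 'a::comm_ring_1) \<Rightarrow> nat \<Rightarrow> 'a) \<Rightarrow> bool" where
  "linop T \<longleftrightarrow> (\<forall>v w. T (v + w) = T v + T w) \<and> (\<forall>a v. T (\<lambda>i. a * v i) = (\<lambda>i. a * T v i))"

text \<open>The polynomial \<open>f(T)\<close> applied to \<open>v\<close>, by Horner's scheme; the coefficients may come from any commutative ring, because
  it is needed over \<open>R\<close> as well as over \<open>k\<close>.\<close>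

definition act :: "((nat \<Rightarrow> 'a::comm_ring_1) \<Rightarrow> nat \<Rightarrow> 'a) \<Rightarrow> 'a poly \<Rightarrow> (nat \<Rightarrow> 'a) \<Rightarrow> nat \<Rightarrow> 'a" where
  "act T f v = fold_coeffs (\<lambda>a w. (\<lambda>i. a * v i) + T w) f 0"

lemma linop_add: "linop T \<Longrightarrow> T (v + w) = T v + T w" by (simp add: linop_def)
lemma linop_scale: "linop T \<Longrightarrow> T (\<lambda>i. a * v i) = (\<lambda>i. a * T v i)" by (simp add: linop_def)
lemma linop_0: "linop T \<Longrightarrow> T 0 = 0" using linop_add[of T 0 0] by simp

lemma act_0 [simp]: "act T 0 v = 0" by (simp add: act_def)

lemma act_pCons:
  assumes "linop T"
  shows "act T (pCons a f) v = (\<lambda>i. a * v i) + T (act T f v)"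
proof (cases "a = 0 \<and> f = 0")
  case True
  then show ?thesis using linop_0[OF assms] by (auto simp: fun_eq_iff)
next
  case False
  then show ?thesis by (cases "f = 0") (simp_all add: act_def)
qed

lemma act_add:
  assumes "linop T"
  shows "act T (f + g) v = act T f v + act T g v"
proof (induction f g rule: poly_induct2)
  case 0 show ?case by simp
next
  case (pCons a f b g)
  have "(\<lambda>i. (a + b) * v i) = (\<lambda>i. a * v i) + (\<lambda>i. b * v i)" by (simp add: fun_eq_iff algebra_simps)
  then show ?case unfolding add_pCons act_pCons[OF assms] pCons.IH linop_add[OF assms] by (simp only: add_ac)
qed

lemma act_smult:
  assumes "linop T"
  shows "act T (Polynomial.smult c f) v = (\<lambda>i. c * act T f v i)"
proof (induction f)
  case 0 then show ?case by (simp add: fun_eq_iff)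
next
  case (pCons a f)
  have "T (act T (Polynomial.smult c f) v) = (\<lambda>i. c * T (act T f v) i)"
    unfolding pCons.IH linop_scale[OF assms] ..
  then show ?case by (simp add: act_pCons[OF assms] fun_eq_iff algebra_simps)
qed

lemma act_vec_add:
  assumes "linop T"
  shows "act T f (v + w) = act T f v + act T f w"
proof (induction f)
  case 0 show ?case by simp
next
  case (pCons a f)
  have "(\<lambda>i. a * (v + w) i) = (\<lambda>i. a * v i) + (\<lambda>i. a * w i)" by (simp add: fun_eq_iff algebra_simps)
  then show ?case unfolding act_pCons[OF assms] pCons.IH linop_add[OF assms] by (simp only: add_ac)
qed

lemma act_mult:
  assumes "linop T"
  shows "act T (f * g) v = act T f (act T g v)"
proof (induction f)
  case 0 then show ?case by simp
next
  case (pCons a f)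
  have "(\<lambda>i. 0 * v i) = 0" by (simp add: fun_eq_iff)
  then show ?case
    unfolding mult_pCons_left act_add[OF assms] act_smult[OF assms] act_pCons[OF assms] pCons.IH by simp
qed

lemma act_1: "linop T \<Longrightarrow> act T 1 v = v"
  unfolding one_pCons by (subst act_pCons) (simp_all add: linop_0 fun_eq_iff)

lemma act_const: "linop T \<Longrightarrow> act T [:a:] v = (\<lambda>i. a * v i)"
  by (subst act_pCons) (simp_all add: linop_0 fun_eq_iff)

lemma act_X: "linop T \<Longrightarrow> act T [:0, 1:] v = T v"
  by (subst act_pCons) (simp_all add: act_const fun_eq_iff)

lemma act_module: "linop T \<Longrightarrow> Modules.module (act T)"
  by unfold_locales (simp_all add: act_add act_vec_add act_mult[symmetric] act_1)

lemma act_poly_module: "linop T \<Longrightarrow> poly_module (act T)"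
  unfolding poly_module_def by (rule act_module)

text \<open>A map that intertwines \<open>T\<close> and \<open>S\<close> intertwines every polynomial in them. It need only be linear on a
  subspace \<open>U\<close>.\<close>

lemma act_intertwine:
  assumes "linop T" "linop S"
    and add: "\<And>v w. v \<in> U \<Longrightarrow> w \<in> U \<Longrightarrow> P (v + w) = P v + P w"
    and scale: "\<And>a v. v \<in> U \<Longrightarrow> P (\<lambda>i. a * v i) = (\<lambda>i. a * P v i)"
    and comm: "\<And>v. v \<in> U \<Longrightarrow> P (T v) = S (P v)"
    and U: "\<And>v. v \<in> U \<Longrightarrow> T v \<in> U" "\<And>v w. v \<in> U \<Longrightarrow> w \<in> U \<Longrightarrow> v + w \<in> U"
      "\<And>a v. v \<in> U \<Longrightarrow> (\<lambda>i. a * v i) \<in> U"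
    and v: "v \<in> U"
  shows "P (act T f v) = act S f (P v) \<and> act T f v \<in> U"
proof (induction f)
  case 0
  have z: "(\<lambda>i. 0 * v i) = 0" by (simp add: fun_eq_iff)
  have "P 0 = (\<lambda>i. 0 * P v i)" using scale[OF v, of 0] by (simp only: z)
  also have "\<dots> = 0" by (simp add: fun_eq_iff)
  finally show ?case using U(3)[OF v, of 0] unfolding z act_0 by (rule conjI)
next
  case (pCons a f)
  then have IH: "P (act T f v) = act S f (P v)" "act T f v \<in> U" by auto
  then show ?case unfolding act_pCons[OF assms(1)] act_pCons[OF assms(2)]
    by (simp only: add scale comm U v IH)
qed

lemma Vn_add: "(v::nat \<Rightarrow> 'a::comm_ring_1) \<in> Vn n \<Longrightarrow> w \<in> Vn n \<Longrightarrow> v + w \<in> Vn n" by (simp add: Vn_def)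
lemma Vn_scale: "(v::nat \<Rightarrow> 'a::comm_ring_1) \<in> Vn n \<Longrightarrow> (\<lambda>i. a * v i) \<in> Vn n" by (simp add: Vn_def)
lemma Vn_0: "(0::nat \<Rightarrow> 'a::comm_ring_1) \<in> Vn n" by (simp add: Vn_def)

lemma act_Vn:
  assumes "linop T" "\<And>v. v \<in> Vn n \<Longrightarrow> T v \<in> Vn n" "v \<in> Vn n"
  shows "act T f v \<in> Vn n"
  using act_intertwine[OF assms(1,1), of "Vn n" "\<lambda>v. v" v f] assms by (auto simp: Vn_add Vn_scale)

lemma mop_linop: "linop (mop n A)"
  by (auto simp: linop_def mop_def fun_eq_iff algebra_simps sum.distrib sum_distrib_left)

lemma mop_Vn: "mop n A v \<in> Vn n" by (simp add: mop_def Vn_def)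

lemma act_mop_Vn: "v \<in> Vn n \<Longrightarrow> act (mop n A) f v \<in> Vn n"
  by (rule act_Vn[OF mop_linop mop_Vn])

lemma mop_mult:
  assumes "A \<in> carrier_mat n n" "B \<in> carrier_mat n n"
  shows "mop n (A * B) v = mop n A (mop n B v)"
proof
  fix i
  show "mop n (A * B) v i = mop n A (mop n B v) i"
  proof (cases "i < n")
    case True
    have "mop n (A * B) v i = (\<Sum>j<n. (\<Sum>k<n. A $$ (i, k) * B $$ (k, j)) * v j)"
      using assms True by (auto simp: mop_def scalar_prod_def atLeast0LessThan intro!: sum.cong)
    also have "\<dots> = (\<Sum>k<n. A $$ (i, k) * (\<Sum>j<n. B $$ (k, j) * v j))"
      unfolding sum_distrib_left sum_distrib_right by (subst sum.swap) (simp add: mult.assoc)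
    also have "\<dots> = mop n A (mop n B v) i" using True by (simp add: mop_def)
    finally show ?thesis .
  qed (simp add: mop_def)
qed

lemma mop_one: "v \<in> Vn n \<Longrightarrow> mop n (1\<^sub>m n) v = v"
proof
  fix i assume v: "v \<in> Vn n"
  have "(\<Sum>j<n. (1\<^sub>m n :: 'a mat) $$ (i, j) * v j) = v i" if "i < n"
  proof -
    have "(\<Sum>j<n. (1\<^sub>m n :: 'a mat) $$ (i, j) * v j) = (\<Sum>j<n. if i = j then v j else 0)"
      using that by (intro sum.cong) auto
    then show ?thesis using that by simp
  qed
  then show "mop n (1\<^sub>m n) v i = v i" using v by (auto simp: mop_def Vn_def if_distribR cong: if_cong)
qed

lemma mop_add: "A \<in> carrier_mat n n \<Longrightarrow> B \<in> carrier_mat n n \<Longrightarrow> mop n (A + B) v = mop n A v + mop n B v"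
  by (auto simp: mop_def fun_eq_iff algebra_simps sum.distrib intro!: sum.cong)

definition unitf :: "nat \<Rightarrow> nat \<Rightarrow> 'a::comm_ring_1" where
  "unitf j = (\<lambda>i. if i = j then 1 else 0)"

lemma unitf_Vn: "j < n \<Longrightarrow> unitf j \<in> Vn n" by (simp add: unitf_def Vn_def)

lemma mop_unitf: "i < n \<Longrightarrow> j < n \<Longrightarrow> mop n A (unitf j) i = A $$ (i, j)"
  by (simp add: mop_def unitf_def if_distrib cong: if_cong)

lemma mop_eqI:
  assumes "A \<in> carrier_mat n n" "B \<in> carrier_mat n n" "\<And>v. v \<in> Vn n \<Longrightarrow> mop n A v = mop n B v"
  shows "A = B"
proof (rule eq_matI)
  fix i j assume "i < dim_row B" "j < dim_col B"
  then have "i < n" "j < n" using assms by auto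
  then show "A $$ (i, j) = B $$ (i, j)" using mop_unitf[of i n j A] mop_unitf[of i n j B] assms(3)[OF unitf_Vn] by simp
qed (use assms in auto)

lemma linear_map_mop:
  assumes add: "\<And>v w. v \<in> Vn n \<Longrightarrow> w \<in> Vn n \<Longrightarrow> g (v + w) = g v + g w"
    and scale: "\<And>a v. v \<in> Vn n \<Longrightarrow> g (\<lambda>i. a * v i) = (\<lambda>i. a * g v i)"
    and maps: "\<And>v. v \<in> Vn n \<Longrightarrow> g v \<in> Vn n"
  obtains X :: "'a::comm_ring_1 mat" where "X \<in> carrier_mat n n" "\<And>v. v \<in> Vn n \<Longrightarrow> mop n X v = g v"
proof -
  define X where "X = mat n n (\<lambda>(i, j). g (unitf j) i)"
  have X: "X \<in> carrier_mat n n" by (simp add: X_def)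
  have g0: "g 0 = 0"
    using add[OF Vn_0 Vn_0] by simp
  have part: "g (\<Sum>j<m. (\<lambda>i. v j * unitf j i)) = (\<Sum>j<m. (\<lambda>i. v j * g (unitf j) i)) \<and> (\<Sum>j<m. (\<lambda>i. v j * unitf j i)) \<in> Vn n"
    if "m \<le> n" for m v using that
  proof (induction m)
    case 0 show ?case by (simp only: lessThan_0 sum.empty g0 Vn_0)
  next
    case (Suc m)
    then have u: "unitf m \<in> Vn n" by (simp add: unitf_Vn)
    from Suc have IH: "g (\<Sum>j<m. (\<lambda>i. v j * unitf j i)) = (\<Sum>j<m. (\<lambda>i. v j * g (unitf j) i))"
      "(\<Sum>j<m. (\<lambda>i. v j * unitf j i)) \<in> Vn n" by simp_all
    show ?case by (simp only: sum.lessThan_Suc add[OF IH(2) Vn_scale[OF u]] IH scale[OF u] Vn_add[OF IH(2) Vn_scale[OF u]])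
  qed
  have sumf: "(\<Sum>j<m. F j) i = (\<Sum>j<m. F j i)" for F :: "nat \<Rightarrow> nat \<Rightarrow> 'a" and m i
    by (induction m) auto
  have "mop n X v = g v" if v: "v \<in> Vn n" for v
  proof -
    have "v = (\<Sum>j<n. (\<lambda>i. v j * unitf j i))"
      using v by (auto simp: fun_eq_iff sumf unitf_def Vn_def if_distrib cong: if_cong)
    then have "g v = (\<Sum>j<n. (\<lambda>i. v j * g (unitf j) i))" using part[of n v] by simp
    moreover have "mop n X v = (\<Sum>j<n. (\<lambda>i. v j * g (unitf j) i))"
    proof
      fix i
      show "mop n X v i = (\<Sum>j<n. (\<lambda>i. v j * g (unitf j) i)) i"
        using maps[OF unitf_Vn] by (auto simp: mop_def sumf X_def mult.commute Vn_def)
    qed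
    ultimately show ?thesis by simp
  qed
  with X show ?thesis by (rule that)
qed

section \<open>Cyclic decompositions and intertwiners\<close>

text \<open>The module with \<open>t\<close> acting by \<open>A\<close> is the direct sum of the cyclic modules with generators \<open>v j\<close> and annihilators
  \<open>(e j)\<close>. Isomorphism types of modules are expressed by this predicate throughout.\<close>

definition gens :: "nat \<Rightarrow> 'a::comm_ring_1 mat \<Rightarrow> 'j set \<Rightarrow> ('j \<Rightarrow> 'a poly) \<Rightarrow> ('j \<Rightarrow> nat \<Rightarrow> 'a) \<Rightarrow> bool" where
  "gens n A J e v \<longleftrightarrow> finite J \<and> cyclic_sum (act (mop n A)) (Vn n) J e v"

abbreviation comb :: "nat \<Rightarrow> 'a::comm_ring_1 mat \<Rightarrow> 'j set \<Rightarrow> ('j \<Rightarrow> nat \<Rightarrow> 'a) \<Rightarrow> ('j \<Rightarrow> 'a poly) \<Rightarrow> nat \<Rightarrow> 'a" where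
  "comb n A J v f \<equiv> \<Sum>j\<in>J. act (mop n A) (f j) (v j)"

lemma comb_add: "comb n A J v (\<lambda>j. f j + g j) = comb n A J v f + comb n A J v g"
  by (simp add: act_add[OF mop_linop] sum.distrib)

lemma comb_act: "comb n A J v (\<lambda>j. h * f j) = act (mop n A) h (comb n A J v f)"
proof -
  interpret Modules.module "act (mop n A)" by (rule act_module[OF mop_linop])
  show ?thesis by (simp add: scale_sum_right)
qed

lemma comb_diff: "comb n A J v (\<lambda>j. f j - g j) = comb n A J v f - comb n A J v g"
proof -
  interpret Modules.module "act (mop n A)" by (rule act_module[OF mop_linop])
  show ?thesis by (simp add: scale_left_diff_distrib sum_subtractf)
qed

lemma comb_single:
  assumes "finite J" "j \<in> J"
  shows "comb n A J v (\<lambda>k. if k = j then f else 0) = act (mop n A) f (v j)"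
proof -
  have "comb n A J v (\<lambda>k. if k = j then f else 0) = (\<Sum>k\<in>J. if k = j then act (mop n A) f (v j) else 0)"
    by (rule sum.cong) auto
  then show ?thesis using assms by simp
qed

lemma comb_Vn: "(\<And>j. j \<in> J \<Longrightarrow> v j \<in> Vn n) \<Longrightarrow> comb n A J v f \<in> Vn n"
  by (induction J rule: infinite_finite_induct) (auto intro: Vn_add Vn_0 act_mop_Vn)

lemma gens_finite: "gens n A J e v \<Longrightarrow> finite J" by (simp add: gens_def)

lemma gens_zero: "gens n A J e v \<Longrightarrow> comb n A J v f = 0 \<longleftrightarrow> (\<forall>j\<in>J. e j dvd f j)"
  by (simp add: gens_def cyclic_sum_def)

lemma gens_eq_iff: "gens n A J e v \<Longrightarrow> comb n A J v f = comb n A J v g \<longleftrightarrow> (\<forall>j\<in>J. e j dvd f j - g j)"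
  using gens_zero[where f = "\<lambda>j. f j - g j"] unfolding comb_diff by simp

lemma gens_obtain:
  assumes "gens n A J e v" "w \<in> Vn n"
  obtains f where "w = comb n A J v f"
  using assms by (auto simp: gens_def cyclic_sum_def)

lemma gens_Vn:
  assumes "gens n A J e v" "j \<in> J"
  shows "v j \<in> Vn n"
proof -
  have "comb n A J v (\<lambda>k. if k = j then 1 else 0) \<in> Vn n" using assms by (auto simp: gens_def cyclic_sum_def)
  then show ?thesis using comb_single[OF gens_finite[OF assms(1)] assms(2), where n = n and A = A and v = v and f = 1] by (simp add: act_1[OF mop_linop])
qed

lemma gens_killed:
  assumes "gens n A J e v" "j \<in> J"
  shows "act (mop n A) (e j) (v j) = 0"
proof -
  have "comb n A J v (\<lambda>k. if k = j then e j else 0) = 0"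
    unfolding gens_zero[OF assms(1)] by simp
  then show ?thesis using comb_single[OF gens_finite[OF assms(1)] assms(2), of n A "e j" v] by simp
qed

lemma mop_sum:
  "mop n X (\<Sum>j\<in>J. F j) = (\<Sum>j\<in>J. mop n X (F j))"
proof (induction J rule: infinite_finite_induct)
  case (infinite J) show ?case unfolding sum.infinite[OF infinite] by (rule linop_0[OF mop_linop])
next
  case empty show ?case unfolding sum.empty by (rule linop_0[OF mop_linop])
next
  case (insert x J)
  show ?case unfolding sum.insert[OF insert(1,2)] linop_add[OF mop_linop] insert(3) ..
qed

lemma mop_intertwine:
  assumes "A \<in> carrier_mat n n" "B \<in> carrier_mat n n" "X \<in> carrier_mat n n" "B * X = X * A"
  shows "mop n X (act (mop n A) f v) = act (mop n B) f (mop n X v)"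
proof -
  have "mop n X (mop n A u) = mop n B (mop n X u)" for u using assms by (simp flip: mop_mult)
  then show ?thesis
    using act_intertwine[OF mop_linop mop_linop, of UNIV "mop n X" n A n B v f]
    by (simp add: linop_add[OF mop_linop] linop_scale[OF mop_linop])
qed

lemma mop_comb:
  assumes "A \<in> carrier_mat n n" "B \<in> carrier_mat n n" "X \<in> carrier_mat n n" "B * X = X * A"
  shows "mop n X (comb n A J v f) = comb n B J (\<lambda>j. mop n X (v j)) f"
  by (simp add: mop_sum mop_intertwine[OF assms])

lemma intertwiner_unique:
  assumes "A \<in> carrier_mat n n" "B \<in> carrier_mat n n" and g: "gens n A J e v"
    and X: "X \<in> carrier_mat n n" "B * X = X * A" and Y: "Y \<in> carrier_mat n n" "B * Y = Y * A"
    and eq: "\<And>j. j \<in> J \<Longrightarrow> mop n X (v j) = mop n Y (v j)"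
  shows "X = Y"
proof (rule mop_eqI[OF X(1) Y(1)])
  fix w :: "nat \<Rightarrow> 'a" assume "w \<in> Vn n"
  then obtain f where "w = comb n A J v f" using gens_obtain[OF g] by blast
  then show "mop n X w = mop n Y w"
    using mop_comb[OF assms(1,2) X, of f v J] mop_comb[OF assms(1,2) Y, of f v J] eq by simp
qed

text \<open>The universal property of a direct sum of cyclic modules: the generators can be sent to arbitrary vectors
  \<open>w j\<close> that are killed by the polynomials \<open>e j\<close>.\<close>

lemma intertwiner_exists:
  fixes A B :: "'a::comm_ring_1 mat"
  assumes A: "A \<in> carrier_mat n n" and B: "B \<in> carrier_mat n n" and g: "gens n A J e v"
    and w: "\<And>j. j \<in> J \<Longrightarrow> w j \<in> Vn n" "\<And>j. j \<in> J \<Longrightarrow> act (mop n B) (e j) (w j) = 0"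
  obtains X where "X \<in> carrier_mat n n" "B * X = X * A" "\<And>j. j \<in> J \<Longrightarrow> mop n X (v j) = w j"
proof -
  \<comment> \<open>The choice of coordinates does not matter, since \<open>e j\<close> kills \<open>w j\<close>.\<close>
  define h where "h u = comb n B J w (SOME f. u = comb n A J v f)" for u
  have h: "h (comb n A J v f) = comb n B J w f" for f
  proof -
    define f' where "f' = (SOME f'. comb n A J v f = comb n A J v f')"
    have "comb n A J v f = comb n A J v f'" unfolding f'_def by (rule someI[of _ f]) (rule refl)
    then have d: "\<forall>j\<in>J. e j dvd f' j - f j" using gens_eq_iff[OF g] by metis
    have "comb n B J w f' - comb n B J w f = comb n B J w (\<lambda>j. f' j - f j)" by (simp add: comb_diff)
    also have "\<dots> = 0"
    proof (rule sum.neutral, rule ballI)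
      fix j assume j: "j \<in> J"
      then obtain k where "f' j - f j = k * e j" using d by (metis dvdE mult.commute)
      then show "act (mop n B) (f' j - f j) (w j) = 0"
        using w(2)[OF j] module.scale_zero_right[OF act_module[OF mop_linop[of n B]]]
        by (simp add: act_mult[OF mop_linop])
    qed
    finally show ?thesis unfolding h_def f'_def[symmetric] by simp
  qed
  have h_act: "h (act (mop n A) k u) = act (mop n B) k (h u)" if "u \<in> Vn n" for k u
    using that h[of "\<lambda>j. k * _ j"] by (auto simp: h elim!: gens_obtain[OF g] simp flip: comb_act)
  have h_add: "h (u + u') = h u + h u'" if "u \<in> Vn n" "u' \<in> Vn n" for u u'
    using that by (auto simp: h elim!: gens_obtain[OF g] simp flip: comb_add)
  have h_Vn: "h u \<in> Vn n" for u unfolding h_def by (rule comb_Vn[OF w(1)])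
  have h_scale: "h (\<lambda>i. a * u i) = (\<lambda>i. a * h u i)" if "u \<in> Vn n" for a u
    using h_act[OF that, of "[:a:]"] by (simp add: act_const[OF mop_linop])
  obtain X where X: "X \<in> carrier_mat n n" "\<And>u. u \<in> Vn n \<Longrightarrow> mop n X u = h u"
    by (rule linear_map_mop[of n h]) (use h_add h_scale h_Vn in auto)
  have "B * X = X * A"
  proof (rule mop_eqI)
    fix u :: "nat \<Rightarrow> 'a" assume u: "u \<in> Vn n"
    show "mop n (B * X) u = mop n (X * A) u"
      using h_act[OF u, of "[:0, 1:]"] u by (simp add: mop_mult A B X act_X[OF mop_linop] mop_Vn)
  qed (use A B X in auto)
  moreover have "mop n X (v j) = w j" if j: "j \<in> J" for j
  proof -
    have "v j = comb n A J v (\<lambda>k. if k = j then 1 else 0)" "w j = comb n B J w (\<lambda>k. if k = j then 1 else 0)"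
      using comb_single[OF gens_finite[OF g] j, of n A 1 v] comb_single[OF gens_finite[OF g] j, of n B 1 w]
      by (simp_all only: act_1[OF mop_linop])
    then show ?thesis using h X(2)[OF gens_Vn[OF g j]] by metis
  qed
  ultimately show ?thesis using X(1) that by blast
qed

text \<open>The maps that match the generators in the two directions are inverse to each other by uniqueness.\<close>

lemma gens_similar:
  fixes A B :: "'a::comm_ring_1 mat"
  assumes A: "A \<in> carrier_mat n n" and B: "B \<in> carrier_mat n n"
    and g: "gens n A J e v" and g': "gens n B J e w"
  shows "similar_mat A B"
proof -
  obtain X where X: "X \<in> carrier_mat n n" "B * X = X * A" "\<And>j. j \<in> J \<Longrightarrow> mop n X (v j) = w j"
    using intertwiner_exists[OF A B g, of w] gens_Vn[OF g'] gens_killed[OF g'] by blast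
  obtain Y where Y: "Y \<in> carrier_mat n n" "A * Y = Y * B" "\<And>j. j \<in> J \<Longrightarrow> mop n Y (w j) = v j"
    using intertwiner_exists[OF B A g', of v] gens_Vn[OF g] gens_killed[OF g] by blast
  have "Y * X = 1\<^sub>m n"
  proof (rule intertwiner_unique[OF A A g])
    have "A * (Y * X) = (A * Y) * X" using assoc_mult_mat[OF A Y(1) X(1)] by simp
    also have "\<dots> = Y * (B * X)" using assoc_mult_mat[OF Y(1) B X(1)] Y(2) by simp
    also have "\<dots> = Y * X * A" using assoc_mult_mat[OF Y(1) X(1) A] X(2) by simp
    finally show "A * (Y * X) = Y * X * A" .
  qed (use A X Y gens_Vn[OF g] in \<open>auto simp: mop_mult mop_one\<close>)
  moreover have "X * Y = 1\<^sub>m n"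
  proof (rule intertwiner_unique[OF B B g'])
    have "B * (X * Y) = (B * X) * Y" using assoc_mult_mat[OF B X(1) Y(1)] by simp
    also have "\<dots> = X * (A * Y)" using assoc_mult_mat[OF X(1) A Y(1)] X(2) by simp
    also have "\<dots> = X * Y * B" using assoc_mult_mat[OF X(1) Y(1) B] Y(2) by simp
    finally show "B * (X * Y) = X * Y * B" .
  qed (use B X Y gens_Vn[OF g'] in \<open>auto simp: mop_mult mop_one\<close>)
  moreover have "A = Y * B * X"
    using assoc_mult_mat[OF A Y(1) X(1)] Y(2) \<open>Y * X = 1\<^sub>m n\<close> A by simp
  ultimately show ?thesis by (intro similar_matI[of A B Y X n]) (use A B X Y in auto)
qed

lemma gens_transport:
  fixes A B :: "'a::comm_ring_1 mat"
  assumes A: "A \<in> carrier_mat n n" and B: "B \<in> carrier_mat n n" and P: "P \<in> carrier_mat n n"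
    and Q: "Q \<in> carrier_mat n n" and PQ: "P * Q = 1\<^sub>m n" "Q * P = 1\<^sub>m n" and com: "B * P = P * A"
    and g: "gens n A J e v"
  shows "gens n B J e (\<lambda>j. mop n P (v j))"
proof -
  have c: "comb n B J (\<lambda>j. mop n P (v j)) f = mop n P (comb n A J v f)" for f
    by (rule mop_comb[OF A B P com, symmetric])
  have inj: "mop n P u = 0 \<longleftrightarrow> u = 0" if "u \<in> Vn n" for u
  proof
    assume "mop n P u = 0"
    then have "mop n Q (mop n P u) = 0" by (simp add: linop_0[OF mop_linop])
    then show "u = 0" using that P Q PQ by (simp add: mop_one flip: mop_mult)
  qed (simp add: linop_0[OF mop_linop])
  have sur: "u = mop n P (mop n Q u)" if "u \<in> Vn n" for u
    using that P Q PQ by (simp add: mop_one flip: mop_mult)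
  have V: "comb n A J v f \<in> Vn n" for f using g by (auto simp: gens_def cyclic_sum_def)
  show ?thesis unfolding gens_def cyclic_sum_def c
  proof (intro conjI allI subset_antisym subsetI)
    show "finite J" using g by (rule gens_finite)
    fix f show "mop n P (comb n A J v f) = 0 \<longleftrightarrow> (\<forall>j\<in>J. e j dvd f j)"
      using inj[OF V] gens_zero[OF g] by simp
  next
    fix u :: "nat \<Rightarrow> 'a" assume "u \<in> Vn n"
    then have u: "u = mop n P (mop n Q u)" by (rule sur)
    obtain f where f: "mop n Q u = comb n A J v f" using gens_obtain[OF g mop_Vn] .
    have "u = mop n P (comb n A J v f)" by (rule trans[OF u]) (simp only: f)
    then show "u \<in> range (\<lambda>f. mop n P (comb n A J v f))" by (rule range_eqI[where x = f])
  qed (auto simp: mop_Vn)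
qed

section \<open>Polynomials of bounded degree and division by monic polynomials\<close>

text \<open>Polynomials of degree less than \<open>d\<close>, in terms of coefficients so that \<open>0\<close> is included also for \<open>d = 0\<close>.\<close>

definition Pd :: "nat \<Rightarrow> 'a::zero poly set" where
  "Pd d = {f. \<forall>i\<ge>d. coeff f i = 0}"

definition polyof :: "nat \<Rightarrow> (nat \<Rightarrow> 'a::comm_ring_1) \<Rightarrow> 'a poly" where
  "polyof d v = (\<Sum>i<d. monom (v i) i)"

lemma coeff_polyof: "coeff (polyof d v) i = (if i < d then v i else 0)"
proof -
  have "coeff (polyof d v) i = (\<Sum>j<d. if j = i then v j else 0)"
    by (simp add: polyof_def coeff_sum)
  then show ?thesis by simp
qed

lemma polyof_Pd: "polyof d v \<in> Pd d" by (simp add: Pd_def coeff_polyof)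

lemma Pd_add: "f \<in> Pd d \<Longrightarrow> g \<in> Pd d \<Longrightarrow> f + g \<in> Pd d" for f :: "'a::comm_ring_1 poly" by (simp add: Pd_def)
lemma Pd_diff: "f \<in> Pd d \<Longrightarrow> g \<in> Pd d \<Longrightarrow> f - g \<in> Pd d" for f :: "'a::comm_ring_1 poly" by (simp add: Pd_def)
lemma Pd_smult: "f \<in> Pd d \<Longrightarrow> Polynomial.smult c f \<in> Pd d" for f :: "'a::comm_ring_1 poly" by (simp add: Pd_def)
lemma Pd_0: "0 \<in> Pd d" by (simp add: Pd_def)

lemma Pd_degree: "f \<in> Pd d \<longleftrightarrow> f = 0 \<or> degree f < d"
proof
  assume "f \<in> Pd d"
  then have "\<not> degree f < d \<Longrightarrow> lead_coeff f = 0" by (simp add: Pd_def)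
  then show "f = 0 \<or> degree f < d" by auto
qed (auto simp: Pd_def coeff_eq_0)

lemma card_Vn: "card (Vn n :: (nat \<Rightarrow> 'a::{finite,zero}) set) = card (UNIV :: 'a set) ^ n"
proof -
  have "bij_betw (\<lambda>v. restrict v {..<n}) (Vn n :: (nat \<Rightarrow> 'a) set) ({..<n} \<rightarrow>\<^sub>E UNIV)"
  proof (rule bij_betwI[where g = "\<lambda>v i. if i < n then v i else 0"])
    fix v :: "nat \<Rightarrow> 'a" assume "v \<in> Vn n"
    then show "(\<lambda>i. if i < n then restrict v {..<n} i else 0) = v" by (auto simp: fun_eq_iff Vn_def)
  next
    fix v :: "nat \<Rightarrow> 'a" assume "v \<in> {..<n} \<rightarrow>\<^sub>E UNIV"
    then show "restrict (\<lambda>i. if i < n then v i else 0) {..<n} = v"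
      by (intro ext) (simp add: restrict_def PiE_def extensional_def)
  qed (auto simp: Vn_def)
  then have "card (Vn n :: (nat \<Rightarrow> 'a) set) = card (({..<n} :: nat set) \<rightarrow>\<^sub>E (UNIV :: 'a set))" by (rule bij_betw_same_card)
  then show ?thesis by (simp add: card_PiE)
qed

lemma finite_Vn: "finite (Vn n :: (nat \<Rightarrow> 'a::{finite,zero}) set)"
  by (rule card_ge_0_finite) (simp add: card_Vn finite_UNIV_card_ge_0)

lemma card_Pd: "card (Pd d :: 'a::{finite,comm_ring_1} poly set) = card (UNIV :: 'a set) ^ d"
proof -
  have "bij_betw coeff (Pd d :: 'a poly set) (Vn d)"
    by (rule bij_betwI[where g = "polyof d"])
      (auto simp: Pd_def Vn_def coeff_polyof poly_eq_iff fun_eq_iff not_less)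
  then show ?thesis by (simp add: bij_betw_same_card card_Vn)
qed

lemma monic_dvd_small:
  fixes E :: "'a::comm_ring_1 poly"
  assumes "lead_coeff E = 1" "E dvd r" "r \<in> Pd (degree E)"
  shows "r = 0"
proof (rule ccontr)
  assume "r \<noteq> 0"
  obtain s where s: "r = E * s" using assms(2) by (rule dvdE)
  with \<open>r \<noteq> 0\<close> have "s \<noteq> 0" by auto
  have "coeff r (degree E + degree s) = lead_coeff s"
    using assms(1) by (simp add: s coeff_mult_degree_sum)
  moreover have "coeff r (degree E + degree s) = 0" using assms(3) by (simp add: Pd_def)
  ultimately show False using \<open>s \<noteq> 0\<close> by simp
qed

lemma monic_rem_exists:
  fixes E :: "'a::comm_ring_1 poly"
  assumes "lead_coeff E = 1"
  shows "\<exists>r\<in>Pd (degree E). E dvd f - r"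
proof (induction f)
  case 0 show ?case by (rule bexI[of _ 0]) (simp_all add: Pd_0)
next
  case (pCons a f)
  then obtain r where r: "r \<in> Pd (degree E)" "E dvd f - r" by blast
  define c where "c = coeff (pCons a r) (degree E)"
  define r' where "r' = pCons a r - Polynomial.smult c E"
  have "r' \<in> Pd (degree E)"
    unfolding Pd_def
  proof (intro CollectI allI impI)
    fix i assume i: "degree E \<le> i"
    show "coeff r' i = 0"
    proof (cases "i = degree E")
      case True then show ?thesis using assms by (simp add: r'_def c_def)
    next
      case False
      then obtain k where "i = Suc k" "degree E \<le> k" using i by (cases i) auto
      moreover from this have "coeff E i = 0" by (simp add: coeff_eq_0)
      ultimately show ?thesis using r(1) by (simp add: r'_def Pd_def)
    qed
  qed
  moreover have "pCons a f - r' = [:0, 1:] * (f - r) + E * [:c:]" by (simp add: r'_def)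
  then have "E dvd pCons a f - r'" using r(2) by (metis dvd_add dvd_mult dvd_triv_left)
  ultimately show ?case by blast
qed

text \<open>The remainder of division by a monic polynomial over an arbitrary commutative ring, where the
  operation \<open>mod\<close> of a Euclidean ring is not defined.\<close>

definition mrem :: "'a::comm_ring_1 poly \<Rightarrow> 'a poly \<Rightarrow> 'a poly" where
  "mrem E f = (SOME r. r \<in> Pd (degree E) \<and> E dvd f - r)"

lemma mrem:
  assumes "lead_coeff E = 1"
  shows mrem_Pd: "mrem E f \<in> Pd (degree E)" and mrem_dvd: "E dvd f - mrem E f"
  using someI_ex[of "\<lambda>r. r \<in> Pd (degree E) \<and> E dvd f - r"] monic_rem_exists[OF assms, of f]
  by (auto simp: mrem_def)

lemma mrem_unique:
  assumes "lead_coeff E = 1" "r \<in> Pd (degree E)" "E dvd f - r"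
  shows "mrem E f = r"
proof -
  have "E dvd (f - r) - (f - mrem E f)" using assms(3) mrem_dvd[OF assms(1)] by (rule dvd_diff)
  then have "mrem E f - r = 0"
    by (intro monic_dvd_small[OF assms(1)] Pd_diff mrem_Pd[OF assms(1)] assms(2)) simp
  then show ?thesis by simp
qed

lemma mrem_small: "lead_coeff E = 1 \<Longrightarrow> r \<in> Pd (degree E) \<Longrightarrow> mrem E r = r"
  by (rule mrem_unique) auto

lemma mrem_cong: "lead_coeff E = 1 \<Longrightarrow> E dvd f - g \<Longrightarrow> mrem E f = mrem E g"
  using mrem_dvd[of E g] dvd_add[of E "f - g" "g - mrem E g"] by (intro mrem_unique mrem_Pd) auto

lemma mrem_add: "lead_coeff E = 1 \<Longrightarrow> mrem E (f + g) = mrem E f + mrem E g"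
  using dvd_add[OF mrem_dvd mrem_dvd, of E f g] by (intro mrem_unique Pd_add mrem_Pd) (auto simp: algebra_simps)

lemma mrem_smult: "lead_coeff E = 1 \<Longrightarrow> mrem E (Polynomial.smult c f) = Polynomial.smult c (mrem E f)"
  using dvd_smult[OF mrem_dvd, of E c f] by (intro mrem_unique Pd_smult mrem_Pd) (auto simp: smult_diff_right)

lemma mrem_mult: "lead_coeff E = 1 \<Longrightarrow> mrem E (f * mrem E g) = mrem E (f * g)"
  using dvd_mult[OF mrem_dvd, of E f g] dvd_minus_iff[of E "f * (g - mrem E g)"]
  by (intro mrem_cong) (auto simp: algebra_simps)

lemma mrem_0_iff: "lead_coeff E = 1 \<Longrightarrow> mrem E f = 0 \<longleftrightarrow> E dvd f"
  using mrem_dvd[of E f] mrem_unique[of E 0 f] by (auto simp: Pd_0)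

section \<open>Counting with a cyclic decomposition\<close>

lemma comb_cong: "(\<And>j. j \<in> J \<Longrightarrow> f j = g j) \<Longrightarrow> comb n A J v f = comb n A J v g"
  by (rule sum.cong) auto

text \<open>Coefficients reduced modulo the \<open>e j\<close> are unique coordinates for the elements of the module.\<close>

lemma torsion_bij:
  assumes g: "gens n A J e v" and monic: "\<And>j. j \<in> J \<Longrightarrow> lead_coeff (e j) = 1"
  shows "bij_betw (comb n A J v) (\<Pi>\<^sub>E j\<in>J. {f \<in> Pd (degree (e j)). e j dvd h * f})
    {w \<in> Vn n. act (mop n A) h w = 0}"
proof -
  have zero: "act (mop n A) h (comb n A J v f) = 0 \<longleftrightarrow> (\<forall>j\<in>J. e j dvd h * f j)" for f
    using gens_zero[OF g, of "\<lambda>j. h * f j"] unfolding comb_act .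
  have inV: "comb n A J v f \<in> Vn n" for f using g by (auto simp: gens_def cyclic_sum_def)
  show ?thesis
    unfolding bij_betw_def
  proof (intro conjI inj_onI subset_antisym subsetI)
    fix f f' assume f: "f \<in> (\<Pi>\<^sub>E j\<in>J. {f \<in> Pd (degree (e j)). e j dvd h * f})"
      and f': "f' \<in> (\<Pi>\<^sub>E j\<in>J. {f \<in> Pd (degree (e j)). e j dvd h * f})"
      and eq: "comb n A J v f = comb n A J v f'"
    show "f = f'"
    proof (rule PiE_ext[OF f f'])
      fix j assume j: "j \<in> J"
      have "e j dvd f j - f' j" using eq j gens_eq_iff[OF g] by blast
      moreover have "f j - f' j \<in> Pd (degree (e j))" using f f' j by (intro Pd_diff) auto
      ultimately show "f j = f' j" using monic_dvd_small[OF monic[OF j]] by (metis eq_iff_diff_eq_0)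
    qed
  next
    fix w assume "w \<in> comb n A J v ` (\<Pi>\<^sub>E j\<in>J. {f \<in> Pd (degree (e j)). e j dvd h * f})"
    then obtain f where "w = comb n A J v f" "\<forall>j\<in>J. e j dvd h * f j" by auto
    then show "w \<in> {w \<in> Vn n. act (mop n A) h w = 0}" using zero inV by blast
  next
    fix w assume w: "w \<in> {w \<in> Vn n. act (mop n A) h w = 0}"
    then obtain f where f: "w = comb n A J v f" using gens_obtain[OF g] by blast
    define f' where "f' = (\<lambda>j\<in>J. mrem (e j) (f j))"
    have "comb n A J v f = comb n A J v f'"
      unfolding gens_eq_iff[OF g] f'_def using mrem_dvd[OF monic] by simp
    then have wf': "w = comb n A J v f'" using f by simp
    moreover have "\<forall>j\<in>J. e j dvd h * f' j" using w zero wf' by blast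
    then have "f' \<in> (\<Pi>\<^sub>E j\<in>J. {f \<in> Pd (degree (e j)). e j dvd h * f})"
      using mrem_Pd[OF monic] by (auto simp: f'_def)
    ultimately show "w \<in> comb n A J v ` (\<Pi>\<^sub>E j\<in>J. {f \<in> Pd (degree (e j)). e j dvd h * f})"
      by (rule image_eqI)
  qed
qed

lemma torsion_card:
  assumes g: "gens n A J e v" and monic: "\<And>j. j \<in> J \<Longrightarrow> lead_coeff (e j) = 1"
  shows "card {w \<in> Vn n. act (mop n A) h w = 0} = (\<Prod>j\<in>J. card {f \<in> Pd (degree (e j)). e j dvd h * f})"
  using bij_betw_same_card[OF torsion_bij[OF assms, of h]] by (simp add: card_PiE gens_finite[OF g])

text \<open>Comparison of the cardinalities of the module and of the set of its coordinate families.\<close>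

lemma gens_dim:
  fixes A :: "'a::{finite,comm_ring_1} mat"
  assumes g: "gens n A J e v" and monic: "\<And>j. j \<in> J \<Longrightarrow> lead_coeff (e j) = 1"
  shows "n = (\<Sum>j\<in>J. degree (e j))"
proof -
  have "{w \<in> Vn n. act (mop n A) 0 w = 0} = Vn n" by simp
  then have "card (UNIV :: 'a set) ^ n = (\<Prod>j\<in>J. card (UNIV :: 'a set) ^ degree (e j))"
    using torsion_card[OF assms, of 0] by (simp add: card_Vn card_Pd)
  also have "\<dots> = card (UNIV :: 'a set) ^ (\<Sum>j\<in>J. degree (e j))" by (simp add: power_sum)
  finally have eq: "card (UNIV :: 'a set) ^ n = card (UNIV :: 'a set) ^ (\<Sum>j\<in>J. degree (e j))" .
  have "card {0, 1 :: 'a} \<le> card (UNIV :: 'a set)" by (rule card_mono) auto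
  then have "1 < card (UNIV :: 'a set)" by simp
  then show ?thesis using eq power_inject_exp by blast
qed

text \<open>An endomorphism is determined by the images of the generators, and the image of \<open>v j\<close> can be any vector that
  is killed by \<open>e j\<close>.\<close>

lemma centralizer_card:
  fixes A :: "'a::{finite,comm_ring_1} mat"
  assumes A: "A \<in> carrier_mat n n" and g: "gens n A J e v"
  shows "card {X \<in> carrier_mat n n. A * X = X * A} = (\<Prod>j\<in>J. card {w \<in> Vn n. act (mop n A) (e j) w = 0})"
proof -
  have "bij_betw (\<lambda>X. \<lambda>j\<in>J. mop n X (v j)) {X \<in> carrier_mat n n. A * X = X * A}
    (\<Pi>\<^sub>E j\<in>J. {w \<in> Vn n. act (mop n A) (e j) w = 0})"
    unfolding bij_betw_def
  proof (intro conjI inj_onI subset_antisym subsetI)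
    fix X Y assume X: "X \<in> {X \<in> carrier_mat n n. A * X = X * A}" and Y: "Y \<in> {X \<in> carrier_mat n n. A * X = X * A}"
      and eq: "(\<lambda>j\<in>J. mop n X (v j)) = (\<lambda>j\<in>J. mop n Y (v j))"
    show "X = Y"
    proof (rule intertwiner_unique[OF A A g])
      fix j assume "j \<in> J"
      then show "mop n X (v j) = mop n Y (v j)" using fun_cong[OF eq, of j] by simp
    qed (use X Y in auto)
  next
    fix w assume "w \<in> (\<lambda>X. \<lambda>j\<in>J. mop n X (v j)) ` {X \<in> carrier_mat n n. A * X = X * A}"
    then obtain X where X: "X \<in> carrier_mat n n" "A * X = X * A" and w: "w = (\<lambda>j\<in>J. mop n X (v j))" by auto
    have "act (mop n A) (e j) (mop n X (v j)) = 0" if j: "j \<in> J" for j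
      using mop_intertwine[OF A A X, of "e j" "v j"] gens_killed[OF g j] linop_0[OF mop_linop] by metis
    then show "w \<in> (\<Pi>\<^sub>E j\<in>J. {w \<in> Vn n. act (mop n A) (e j) w = 0})" by (auto simp: w mop_Vn)
  next
    fix w assume w: "w \<in> (\<Pi>\<^sub>E j\<in>J. {w \<in> Vn n. act (mop n A) (e j) w = 0})"
    obtain X where X: "X \<in> carrier_mat n n" "A * X = X * A" "\<And>j. j \<in> J \<Longrightarrow> mop n X (v j) = w j"
      using intertwiner_exists[OF A A g, of w] w by blast
    have "w = (\<lambda>j\<in>J. mop n X (v j))" using w X(3)
      by (intro ext) (simp add: restrict_def PiE_def extensional_def)
    then show "w \<in> (\<lambda>X. \<lambda>j\<in>J. mop n X (v j)) ` {X \<in> carrier_mat n n. A * X = X * A}" using X by blast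
  qed
  then show ?thesis using bij_betw_same_card by (fastforce simp: card_PiE gens_finite[OF g])
qed

section \<open>Block companion matrices\<close>

text \<open>The bijection \<open>b\<close> numbers the coefficients of families of polynomials \<open>g j\<close> of degree less than \<open>d j\<close>, so that such a family
  becomes a vector of length \<open>n\<close> (\<open>enc\<close>, with inverse \<open>dec\<close>). For monic \<open>E j\<close> of degree \<open>d j\<close>, the families are
  representatives of the elements of the direct sum of the \<open>R[t]/(E j)\<close>, and \<open>comp_op E\<close> is multiplication by \<open>t\<close>.\<close>

locale block_data =
  fixes n :: nat and J :: "'j set" and d :: "'j \<Rightarrow> nat" and b :: "nat \<Rightarrow> 'j \<times> nat"
  assumes fin: "finite J" and bij: "bij_betw b {..<n} (SIGMA j:J. {..<d j})"
begin

definition enc :: "('j \<Rightarrow> 'a::comm_ring_1 poly) \<Rightarrow> nat \<Rightarrow> 'a" where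
  "enc g = (\<lambda>s. if s < n then coeff (g (fst (b s))) (snd (b s)) else 0)"

definition dec :: "(nat \<Rightarrow> 'a::comm_ring_1) \<Rightarrow> 'j \<Rightarrow> 'a poly" where
  "dec v j = polyof (d j) (\<lambda>i. v (the_inv_into {..<n} b (j, i)))"

definition comp_op :: "('j \<Rightarrow> 'a::comm_ring_1 poly) \<Rightarrow> (nat \<Rightarrow> 'a) \<Rightarrow> nat \<Rightarrow> 'a" where
  "comp_op E v = enc (\<lambda>j. mrem (E j) (pCons 0 (dec v j)))"

lemma enc_Vn: "enc g \<in> Vn n" by (simp add: enc_def Vn_def)

lemma comp_op_Vn: "comp_op E v \<in> Vn n" by (simp add: comp_op_def enc_Vn)

lemma b_range: "s < n \<Longrightarrow> fst (b s) \<in> J \<and> snd (b s) < d (fst (b s))"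
  using bij_betwE[OF bij] by (metis lessThan_iff mem_Sigma_iff prod.collapse)

lemma enc_cong: "(\<And>j. j \<in> J \<Longrightarrow> g j = h j) \<Longrightarrow> enc g = enc h"
  using b_range by (auto simp: enc_def fun_eq_iff)

lemma inv_b:
  assumes "j \<in> J" "i < d j"
  shows "the_inv_into {..<n} b (j, i) < n" "b (the_inv_into {..<n} b (j, i)) = (j, i)"
  using the_inv_into_into[of b "{..<n}" "(j, i)" "{..<n}"] f_the_inv_into_f_bij_betw[OF bij, of "(j, i)"] bij assms
  by (auto simp: bij_betw_def)

lemma dec_enc:
  assumes "j \<in> J" "g j \<in> Pd (d j)"
  shows "dec (enc g) j = g j"
  using assms inv_b by (auto simp: poly_eq_iff dec_def coeff_polyof enc_def Pd_def)

lemma enc_dec: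
  assumes "v \<in> Vn n"
  shows "enc (dec v) = v"
proof
  fix s show "enc (dec v) s = v s"
  proof (cases "s < n")
    case True
    then have "the_inv_into {..<n} b (b s) = s"
      using bij by (intro the_inv_into_f_f) (auto simp: bij_betw_def)
    then show ?thesis using True b_range[OF True] by (simp add: enc_def dec_def coeff_polyof)
  qed (use assms in \<open>auto simp: enc_def Vn_def\<close>)
qed

lemma dec_Pd: "dec v j \<in> Pd (d j)" by (simp add: dec_def polyof_Pd)

lemma enc_add: "enc (\<lambda>j. g j + h j) = enc g + enc h" by (simp add: enc_def fun_eq_iff)
lemma enc_smult: "enc (\<lambda>j. Polynomial.smult c (g j)) = (\<lambda>s. c * enc g s)" by (simp add: enc_def fun_eq_iff)

lemma dec_add: "dec (v + w) j = dec v j + dec w j" by (simp add: dec_def poly_eq_iff coeff_polyof)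
lemma dec_smult: "dec (\<lambda>i. c * v i) j = Polynomial.smult c (dec v j)" by (simp add: dec_def poly_eq_iff coeff_polyof)

lemma enc_eq_0:
  assumes "\<And>j. j \<in> J \<Longrightarrow> g j \<in> Pd (d j)"
  shows "enc g = 0 \<longleftrightarrow> (\<forall>j\<in>J. g j = 0)"
proof
  assume z: "enc g = 0"
  show "\<forall>j\<in>J. g j = 0"
  proof
    fix j assume j: "j \<in> J"
    have "g j = dec (enc g) j" using dec_enc[of j g] assms j by simp
    also have "\<dots> = 0" by (simp add: z dec_def poly_eq_iff coeff_polyof)
    finally show "g j = 0" .
  qed
next
  assume "\<forall>j\<in>J. g j = 0"
  then show "enc g = 0" using b_range by (simp add: enc_def fun_eq_iff)
qed

lemma comp_op_linop:
  assumes monic: "\<And>j. j \<in> J \<Longrightarrow> lead_coeff (E j) = 1"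
  shows "linop (comp_op E)"
  unfolding linop_def comp_op_def
proof (intro conjI allI)
  fix v w :: "nat \<Rightarrow> 'a"
  show "enc (\<lambda>j. mrem (E j) (pCons 0 (dec (v + w) j))) =
    enc (\<lambda>j. mrem (E j) (pCons 0 (dec v j))) + enc (\<lambda>j. mrem (E j) (pCons 0 (dec w j)))"
    unfolding enc_add[symmetric]
  proof (rule enc_cong)
    fix j assume "j \<in> J"
    have *: "pCons 0 (dec (v + w) j) = pCons 0 (dec v j) + pCons 0 (dec w j)" by (simp add: dec_add)
    show "mrem (E j) (pCons 0 (dec (v + w) j)) = mrem (E j) (pCons 0 (dec v j)) + mrem (E j) (pCons 0 (dec w j))"
      unfolding * by (rule mrem_add[OF monic[OF \<open>j \<in> J\<close>]])
  qed
next
  fix a :: 'a and v :: "nat \<Rightarrow> 'a"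
  show "enc (\<lambda>j. mrem (E j) (pCons 0 (dec (\<lambda>i. a * v i) j))) = (\<lambda>i. a * enc (\<lambda>j. mrem (E j) (pCons 0 (dec v j))) i)"
    unfolding enc_smult[symmetric]
  proof (rule enc_cong)
    fix j assume "j \<in> J"
    have *: "pCons 0 (dec (\<lambda>i. a * v i) j) = Polynomial.smult a (pCons 0 (dec v j))" by (simp add: dec_smult)
    show "mrem (E j) (pCons 0 (dec (\<lambda>i. a * v i) j)) = Polynomial.smult a (mrem (E j) (pCons 0 (dec v j)))"
      unfolding * by (rule mrem_smult[OF monic[OF \<open>j \<in> J\<close>]])
  qed
qed

lemma comp_op_act:
  assumes monic: "\<And>j. j \<in> J \<Longrightarrow> lead_coeff (E j) = 1" and deg: "\<And>j. j \<in> J \<Longrightarrow> degree (E j) = d j"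
    and g: "\<And>j. j \<in> J \<Longrightarrow> g j \<in> Pd (d j)"
  shows "act (comp_op E) f (enc g) = enc (\<lambda>j. mrem (E j) (f * g j))"
proof -
  have lin: "linop (comp_op E)" by (rule comp_op_linop) (rule monic)
  show ?thesis
  proof (induction f)
    case 0
    have "enc (\<lambda>j. mrem (E j) (0 * g j)) = enc (\<lambda>j. 0)"
      by (rule enc_cong) (simp add: mrem_small monic Pd_0)
    then show ?case by (simp add: enc_def fun_eq_iff)
  next
    case (pCons a f)
    have "comp_op E (enc (\<lambda>j. mrem (E j) (f * g j))) = enc (\<lambda>j. mrem (E j) ([:0, 1:] * (f * g j)))"
      unfolding comp_op_def
    proof (rule enc_cong)
      fix j assume j: "j \<in> J"
      have "dec (enc (\<lambda>j. mrem (E j) (f * g j))) j = mrem (E j) (f * g j)"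
        using j mrem_Pd[OF monic[OF j]] deg[OF j] by (intro dec_enc) auto
      then have "pCons 0 (dec (enc (\<lambda>j. mrem (E j) (f * g j))) j) = [:0, 1:] * mrem (E j) (f * g j)" by simp
      then show "mrem (E j) (pCons 0 (dec (enc (\<lambda>j. mrem (E j) (f * g j))) j)) = mrem (E j) ([:0, 1:] * (f * g j))"
        using mrem_mult[OF monic[OF j]] by metis
    qed
    moreover have "enc (\<lambda>j. mrem (E j) (pCons a f * g j)) =
      enc (\<lambda>j. Polynomial.smult a (g j) + mrem (E j) ([:0, 1:] * (f * g j)))"
    proof (rule enc_cong)
      fix j assume j: "j \<in> J"
      have "pCons a f * g j = Polynomial.smult a (g j) + [:0, 1:] * (f * g j)" by simp
      moreover have "mrem (E j) (Polynomial.smult a (g j)) = Polynomial.smult a (g j)"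
        using g[OF j] deg[OF j] monic[OF j] by (intro mrem_small Pd_smult) auto
      ultimately show "mrem (E j) (pCons a f * g j) = Polynomial.smult a (g j) + mrem (E j) ([:0, 1:] * (f * g j))"
        using mrem_add[OF monic[OF j]] by metis
    qed
    ultimately show ?case
      unfolding act_pCons[OF lin] pCons.IH by (simp only: enc_add enc_smult)
  qed
qed

lemma sum_fun_apply: "(\<Sum>j\<in>K. F j) x = (\<Sum>j\<in>K. F j x)" for F :: "'i \<Rightarrow> 'x \<Rightarrow> 'y::comm_monoid_add"
  by (induction K rule: infinite_finite_induct) auto

text \<open>The remainder of \<open>1\<close> rather than \<open>1\<close> itself, since \<open>E j\<close> may have degree \<open>0\<close>.\<close>

definition cgen :: "('j \<Rightarrow> 'a::comm_ring_1 poly) \<Rightarrow> 'j \<Rightarrow> nat \<Rightarrow> 'a" where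
  "cgen E j = enc (\<lambda>k. if k = j then mrem (E j) 1 else 0)"

text \<open>Under the identification of vectors with families of remainders, a combination of the generators with
  coefficients \<open>f j\<close> is the family of the remainders of the \<open>f j\<close>.\<close>

theorem companion_gens:
  fixes E :: "'j \<Rightarrow> 'a::comm_ring_1 poly"
  assumes monic: "\<And>j. j \<in> J \<Longrightarrow> lead_coeff (E j) = 1" and deg: "\<And>j. j \<in> J \<Longrightarrow> degree (E j) = d j"
    and C: "\<And>v. v \<in> Vn n \<Longrightarrow> mop n C v = comp_op E v"
  shows "gens n C J E (cgen E)"
proof -
  have lin: "linop (comp_op E)" by (rule comp_op_linop) (rule monic)
  have act: "act (mop n C) f v = act (comp_op E) f v" if "v \<in> Vn n" for f v
    by (rule conjunct1[OF act_intertwine[OF mop_linop lin, where U = "Vn n" and P = "\<lambda>v. v"]])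
      (use C that in \<open>auto simp: mop_Vn comp_op_Vn Vn_add Vn_scale\<close>)
  have single: "act (mop n C) (f j) (cgen E j) = enc (\<lambda>k. if k = j then mrem (E j) (f j) else 0)" if j: "j \<in> J" for f j
  proof -
    have "act (mop n C) (f j) (cgen E j) = enc (\<lambda>k. mrem (E k) (f j * (if k = j then mrem (E j) 1 else 0)))"
      unfolding cgen_def act[OF enc_Vn]
      using mrem_Pd[OF monic[OF j]] deg by (intro comp_op_act monic deg) (auto simp: Pd_0 j)
    also have "\<dots> = enc (\<lambda>k. if k = j then mrem (E j) (f j) else 0)"
      using mrem_mult[OF monic, of j "f j" 1] by (intro enc_cong) (auto simp: mrem_small monic Pd_0)
    finally show ?thesis .
  qed
  have comb: "comb n C J (cgen E) f = enc (\<lambda>j. mrem (E j) (f j))" for f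
  proof
    fix s
    have "comb n C J (cgen E) f s = (\<Sum>j\<in>J. enc (\<lambda>k. if k = j then mrem (E j) (f j) else 0) s)"
      unfolding sum_fun_apply using single by (intro sum.cong) auto
    also have "\<dots> = enc (\<lambda>j. mrem (E j) (f j)) s"
    proof (cases "s < n")
      case True
      have "(\<Sum>j\<in>J. enc (\<lambda>k. if k = j then mrem (E j) (f j) else 0) s) =
        (\<Sum>j\<in>J. if fst (b s) = j then coeff (mrem (E j) (f j)) (snd (b s)) else 0)"
        using True by (intro sum.cong) (auto simp: enc_def)
      then show ?thesis using True b_range[OF True] fin by (simp add: enc_def)
    qed (simp add: enc_def)
    finally show "comb n C J (cgen E) f s = enc (\<lambda>j. mrem (E j) (f j)) s" .
  qed
  show ?thesis
    unfolding gens_def cyclic_sum_def comb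
  proof (intro conjI allI subset_antisym subsetI)
    show "finite J" by (rule fin)
    fix f
    have "enc (\<lambda>j. mrem (E j) (f j)) = 0 \<longleftrightarrow> (\<forall>j\<in>J. mrem (E j) (f j) = 0)"
      using mrem_Pd[OF monic] deg by (intro enc_eq_0) auto
    then show "enc (\<lambda>j. mrem (E j) (f j)) = 0 \<longleftrightarrow> (\<forall>j\<in>J. E j dvd f j)" by (simp add: mrem_0_iff monic)
  next
    fix w :: "nat \<Rightarrow> 'a" assume "w \<in> Vn n"
    then have "w = enc (dec w)" by (simp add: enc_dec)
    also have "\<dots> = enc (\<lambda>j. mrem (E j) (dec w j))"
    proof (rule enc_cong)
      fix j assume j: "j \<in> J"
      have "dec w j \<in> Pd (degree (E j))" unfolding deg[OF j] by (rule dec_Pd)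
      then show "dec w j = mrem (E j) (dec w j)" by (rule mrem_small[OF monic[OF j], symmetric])
    qed
    finally show "w \<in> range (\<lambda>f. enc (\<lambda>j. mrem (E j) (f j)))" by (rule range_eqI[where x = "dec w"])
  qed (auto simp: enc_Vn)
qed

theorem companion_exists:
  assumes monic: "\<And>j. j \<in> J \<Longrightarrow> lead_coeff (E j) = 1" and deg: "\<And>j. j \<in> J \<Longrightarrow> degree (E j) = d j"
  obtains C where "C \<in> carrier_mat n n" "\<And>v. v \<in> Vn n \<Longrightarrow> mop n C v = comp_op E v"
proof (rule linear_map_mop[of n "comp_op E"])
  have lin: "linop (comp_op E)" by (rule comp_op_linop) (rule monic)
  show "comp_op E (v + w) = comp_op E v + comp_op E w" for v w by (rule linop_add[OF lin])
  show "comp_op E (\<lambda>i. a * v i) = (\<lambda>i. a * comp_op E v i)" for a v by (rule linop_scale[OF lin])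
  show "comp_op E v \<in> Vn n" for v by (simp add: comp_op_def enc_Vn)
qed (rule that)

end

lemma block_data_exists:
  assumes "finite J" "n = (\<Sum>j\<in>J. d j)"
  shows "\<exists>b. block_data n J d b"
proof -
  have "finite (SIGMA j:J. {..<d j})" "card (SIGMA j:J. {..<d j}) = n" using assms by auto
  then obtain b where "bij_betw b {..<n} (SIGMA j:J. {..<d j})"
    using ex_bij_betw_nat_finite[of "SIGMA j:J. {..<d j}"] by (auto simp: atLeast0LessThan)
  then show ?thesis using assms by (auto simp: block_data_def)
qed

section \<open>Powers of monic and of irreducible polynomials\<close>

lemma monic_mult:
  fixes f g :: "'a::comm_ring_1 poly"
  assumes "lead_coeff f = 1" "lead_coeff g = 1"
  shows "lead_coeff (f * g) = 1 \<and> degree (f * g) = degree f + degree g"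
proof -
  have c: "coeff (f * g) (degree f + degree g) = 1" using assms by (simp add: coeff_mult_degree_sum)
  then have "degree f + degree g \<le> degree (f * g)" by (metis le_degree zero_neq_one)
  then have "degree (f * g) = degree f + degree g" using degree_mult_le[of f g] by simp
  then show ?thesis using c by simp
qed

lemma monic_power:
  fixes f :: "'a::comm_ring_1 poly"
  assumes "lead_coeff f = 1"
  shows "lead_coeff (f ^ a) = 1 \<and> degree (f ^ a) = a * degree f"
proof (induction a)
  case 0 show ?case by simp
next
  case (Suc a)
  have m: "lead_coeff (f * f ^ a) = 1" "degree (f * f ^ a) = degree f + degree (f ^ a)"
    using monic_mult[OF assms conjunct1[OF Suc]] by blast+
  have "degree (f * f ^ a) = Suc a * degree f" unfolding m(2) conjunct2[OF Suc] by simp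
  with m(1) show ?case unfolding power_Suc by (rule conjI)
qed

lemma Irr_monic: "p \<in> Irr \<Longrightarrow> lead_coeff p = 1" by (simp add: Irr_def)

lemma Irr_power_monic: "p \<in> Irr \<Longrightarrow> lead_coeff (p ^ a) = 1"
  using monic_power[OF Irr_monic] by blast

lemma Irr_power_degree: "p \<in> Irr \<Longrightarrow> degree (p ^ a) = a * degree p"
  using monic_power[OF Irr_monic] by blast

lemma Irr_power_dvd_mult_cancel:
  assumes "p \<in> Irr" "r \<in> Irr" "p \<noteq> r" "p ^ a dvd r ^ b * f"
  shows "p ^ a dvd f"
proof -
  have "\<not> p dvd r ^ b" by (rule Irr_not_dvd_power[OF assms(1-3)])
  then obtain x y where "x * p ^ a + y * r ^ b = 1" using irreducible_power_bezout[OF Irr_irreducible[OF assms(1)]] by metis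
  then have "f = (x * p ^ a + y * r ^ b) * f" by simp
  then have f: "f = (x * f) * p ^ a + y * (r ^ b * f)" by (simp only: algebra_simps)
  have "p ^ a dvd (x * f) * p ^ a + y * (r ^ b * f)" by (intro dvd_add dvd_mult[OF assms(4)]) simp
  then show ?thesis by (subst f)
qed

lemma Irr_power_dvd_same:
  assumes "p \<in> Irr"
  shows "p ^ a dvd p ^ b * f \<longleftrightarrow> p ^ (a - b) dvd f"
proof (cases "a \<le> b")
  case True
  then show ?thesis by (simp add: dvd_mult2 le_imp_power_dvd)
next
  case False
  then have "p ^ a = p ^ b * p ^ (a - b)" by (simp flip: power_add)
  moreover have "p \<noteq> 0" using assms by (auto simp: Irr_def)
  ultimately show ?thesis by simp
qed

section \<open>Matrices over a square-zero extension\<close>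

text \<open>The kernel of the residue map is the image of \<open>k\<close> under an additive embedding \<open>\<theta>\<close>, on which \<open>R\<close> acts through
  the residue map. In particular products of two elements of the kernel vanish.\<close>

locale square_zero =
  fixes red :: "'r::{finite,comm_ring_1} \<Rightarrow> 'k::{finite,field}" and th :: "'k \<Rightarrow> 'r"
  assumes red_hom: "comm_ring_hom red" and red_surj: "surj red"
    and th_add: "th (x + y) = th x + th y" and th_inj: "inj th"
    and th_range: "range th = {x. red x = 0}"
    and th_mult: "r * th x = th (red r * x)"
begin

sublocale red: comm_ring_hom red by (rule red_hom)
sublocale redp: map_poly_comm_ring_hom red ..

abbreviation redm :: "'r mat \<Rightarrow> 'k mat" where "redm \<equiv> map_mat red"
abbreviation thmat :: "'k mat \<Rightarrow> 'r mat" where "thmat \<equiv> map_mat th"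

lemma th_0: "th 0 = 0" using th_add[of 0 0] by simp
lemma th_uminus: "th (- x) = - th x" using th_add[of x "- x"] th_0 by (simp add: add_eq_0_iff)
lemma th_sum: "th (\<Sum>i\<in>I. f i) = (\<Sum>i\<in>I. th (f i))"
  by (induction I rule: infinite_finite_induct) (simp_all add: th_0 th_add)
lemma th_mult_right: "th x * r = th (x * red r)" using th_mult[of r x] by (simp add: mult.commute)
lemma red_th: "red (th x) = 0" using th_range by blast
lemma red_0_th: "red r = 0 \<Longrightarrow> \<exists>x. r = th x" using th_range by blast

lemma redm_thmat: "X \<in> carrier_mat n n \<Longrightarrow> redm (thmat X) = 0\<^sub>m n n"
  by (rule eq_matI) (auto simp: red_th)

lemma thmat_mult_left:
  assumes "B \<in> carrier_mat n n" "X \<in> carrier_mat n n"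
  shows "B * thmat X = thmat (redm B * X)"
  using assms by (intro eq_matI) (auto simp: scalar_prod_def th_mult th_sum)

lemma thmat_mult_right:
  assumes "B \<in> carrier_mat n n" "X \<in> carrier_mat n n"
  shows "thmat X * B = thmat (X * redm B)"
  using assms by (intro eq_matI) (auto simp: scalar_prod_def th_mult_right th_sum)

lemma thmat_add: "X \<in> carrier_mat n n \<Longrightarrow> Y \<in> carrier_mat n n \<Longrightarrow> thmat (X + Y) = thmat X + thmat Y"
  by (intro eq_matI) (auto simp: th_add)

lemma thmat_uminus: "X \<in> carrier_mat n n \<Longrightarrow> thmat (- X) = - thmat X"
  by (intro eq_matI) (auto simp: th_uminus)

lemma thmat_inj: "X \<in> carrier_mat n n \<Longrightarrow> Y \<in> carrier_mat n n \<Longrightarrow> thmat X = thmat Y \<Longrightarrow> X = Y"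
proof (rule eq_matI)
  fix i j assume *: "X \<in> carrier_mat n n" "Y \<in> carrier_mat n n" "thmat X = thmat Y" "i < dim_row Y" "j < dim_col Y"
  have "thmat X $$ (i, j) = th (X $$ (i, j))" "thmat Y $$ (i, j) = th (Y $$ (i, j))"
    using *(1,2,4,5) by auto
  moreover have "thmat X $$ (i, j) = thmat Y $$ (i, j)" unfolding *(3) ..
  ultimately have "th (X $$ (i, j)) = th (Y $$ (i, j))" by simp
  then show "X $$ (i, j) = Y $$ (i, j)" using th_inj by (simp add: inj_eq)
qed auto

lemma thmat_mult_thmat:
  assumes "X \<in> carrier_mat n n" "Y \<in> carrier_mat n n"
  shows "thmat X * thmat Y = 0\<^sub>m n n"
proof -
  have "thmat X * thmat Y = thmat (redm (thmat X) * Y)" using assms by (intro thmat_mult_left) auto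
  also have "redm (thmat X) * Y = 0\<^sub>m n n" using assms by (simp add: redm_thmat)
  also have "thmat (0\<^sub>m n n) = 0\<^sub>m n n" by (intro eq_matI) (auto simp: th_0)
  finally show ?thesis .
qed

lemma redm_eqE:
  assumes "B \<in> carrier_mat n n" "B' \<in> carrier_mat n n" "redm B = redm B'"
  obtains X where "X \<in> carrier_mat n n" "B = B' + thmat X"
proof -
  have "\<exists>x. B $$ (i, j) = B' $$ (i, j) + th x" if "i < n" "j < n" for i j
  proof -
    have "redm B $$ (i, j) = red (B $$ (i, j))" "redm B' $$ (i, j) = red (B' $$ (i, j))"
      using assms(1,2) that by auto
    then have "red (B $$ (i, j) - B' $$ (i, j)) = 0" using assms(3) by (simp add: red.hom_minus)
    then show ?thesis using red_0_th by (metis add.commute diff_add_cancel)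
  qed
  then obtain x where x: "\<And>i j. i < n \<Longrightarrow> j < n \<Longrightarrow> B $$ (i, j) = B' $$ (i, j) + th (x i j)" by metis
  show ?thesis
    by (rule that[of "mat n n (\<lambda>(i, j). x i j)"]) (use assms x in \<open>auto intro!: eq_matI\<close>)
qed

lemma redm_surj:
  assumes "X \<in> carrier_mat n n"
  obtains B where "B \<in> carrier_mat n n" "redm B = X"
proof -
  have "\<exists>y. red y = x" for x using red_surj by (metis surjD)
  then obtain l where l: "\<And>x. red (l x) = x" by metis
  show ?thesis by (rule that[of "map_mat l X"]) (use assms l in \<open>auto intro!: eq_matI\<close>)
qed

lemma redm_mult: "B \<in> carrier_mat n n \<Longrightarrow> C \<in> carrier_mat n n \<Longrightarrow> redm (B * C) = redm B * redm C"
  by (rule red.mat_hom_mult)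
lemma redm_add: "B \<in> carrier_mat n n \<Longrightarrow> C \<in> carrier_mat n n \<Longrightarrow> redm (B + C) = redm B + redm C"
  by (intro eq_matI) (auto simp: red.hom_add)
lemma redm_one: "redm (1\<^sub>m n) = 1\<^sub>m n" by (rule red.mat_hom_one)

text \<open>A product that reduces to the identity has the form \<open>1 + \<theta>(X)\<close>, and \<open>1 - \<theta>(X)\<close> is its inverse.\<close>

lemma right_inverse_lift:
  assumes P: "P \<in> carrier_mat n n" and Q: "Q \<in> carrier_mat n n" and inv: "redm P * redm Q = 1\<^sub>m n"
  obtains R where "R \<in> carrier_mat n n" "P * (Q * R) = 1\<^sub>m n"
proof -
  have "redm (P * Q) = redm (1\<^sub>m n)" using inv P Q by (simp add: redm_mult redm_one)
  then obtain X where X: "X \<in> carrier_mat n n" "P * Q = 1\<^sub>m n + thmat X" using redm_eqE[of "P * Q" n "1\<^sub>m n"] P Q by auto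
  define R where "R = 1\<^sub>m n + thmat (- X)"
  have R: "R \<in> carrier_mat n n" using X by (auto simp: R_def)
  have T: "thmat X \<in> carrier_mat n n" "thmat (- X) \<in> carrier_mat n n" using X by auto
  have "P * (Q * R) = (1\<^sub>m n + thmat X) * R" using P Q R X by (simp flip: assoc_mult_mat)
  also have "\<dots> = R + thmat X * R"
    unfolding add_mult_distrib_mat[OF one_carrier_mat T(1) R] left_mult_one_mat[OF R] ..
  also have "thmat X * R = thmat X + thmat X * thmat (- X)"
    unfolding R_def mult_add_distrib_mat[OF T(1) one_carrier_mat T(2)] right_mult_one_mat[OF T(1)] ..
  also have "thmat X * thmat (- X) = 0\<^sub>m n n" using X by (intro thmat_mult_thmat) auto
  also have "R + (thmat X + 0\<^sub>m n n) = 1\<^sub>m n"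
    unfolding R_def thmat_uminus[OF X(1)] using T by (intro eq_matI) auto
  finally show ?thesis using R that by blast
qed

lemma left_right_inverse:
  fixes P :: "'a::comm_ring_1 mat"
  assumes "P \<in> carrier_mat n n" "Q \<in> carrier_mat n n" "Q' \<in> carrier_mat n n" "P * Q = 1\<^sub>m n" "Q' * P = 1\<^sub>m n"
  shows "Q = Q'"
proof -
  have "Q = (Q' * P) * Q" unfolding assms(5) left_mult_one_mat[OF assms(2)] ..
  also have "\<dots> = Q' * (P * Q)" by (rule assoc_mult_mat[OF assms(3,1,2)])
  finally show ?thesis unfolding assms(4) right_mult_one_mat[OF assms(3)] .
qed

lemma left_inverse_lift:
  assumes P: "P \<in> carrier_mat n n" and Q: "Q \<in> carrier_mat n n" and inv: "redm Q * redm P = 1\<^sub>m n"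
  obtains R where "R \<in> carrier_mat n n" "(R * Q) * P = 1\<^sub>m n"
proof -
  have "redm (Q * P) = redm (1\<^sub>m n)" using inv P Q by (simp add: redm_mult redm_one)
  then obtain X where X: "X \<in> carrier_mat n n" "Q * P = 1\<^sub>m n + thmat X" using redm_eqE[of "Q * P" n "1\<^sub>m n"] P Q by auto
  define R where "R = 1\<^sub>m n + thmat (- X)"
  have R: "R \<in> carrier_mat n n" using X by (auto simp: R_def)
  have T: "thmat X \<in> carrier_mat n n" "thmat (- X) \<in> carrier_mat n n" using X by auto
  have "(R * Q) * P = R * (1\<^sub>m n + thmat X)" using P Q R X by simp
  also have "\<dots> = R + R * thmat X"
    unfolding mult_add_distrib_mat[OF R one_carrier_mat T(1)] right_mult_one_mat[OF R] ..
  also have "R * thmat X = thmat X + thmat (- X) * thmat X"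
    unfolding R_def add_mult_distrib_mat[OF one_carrier_mat T(2) T(1)] left_mult_one_mat[OF T(1)] ..
  also have "thmat (- X) * thmat X = 0\<^sub>m n n" using X by (intro thmat_mult_thmat) auto
  also have "R + (thmat X + 0\<^sub>m n n) = 1\<^sub>m n"
    unfolding R_def thmat_uminus[OF X(1)] using T by (intro eq_matI) auto
  finally show ?thesis using R that by blast
qed

lemma inverse_lift:
  assumes P: "P \<in> carrier_mat n n" and q: "q \<in> carrier_mat n n" "redm P * q = 1\<^sub>m n" "q * redm P = 1\<^sub>m n"
  obtains Q where "Q \<in> carrier_mat n n" "P * Q = 1\<^sub>m n" "Q * P = 1\<^sub>m n" "redm Q = q"
proof -
  obtain Q where Q: "Q \<in> carrier_mat n n" "redm Q = q" using redm_surj[OF q(1)] .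
  obtain R where R: "R \<in> carrier_mat n n" "P * (Q * R) = 1\<^sub>m n" using right_inverse_lift[OF P Q(1)] q Q(2) by metis
  obtain R' where R': "R' \<in> carrier_mat n n" "(R' * Q) * P = 1\<^sub>m n" using left_inverse_lift[OF P Q(1)] q Q(2) by metis
  have eq: "Q * R = R' * Q" by (rule left_right_inverse[of P n]) (use P Q R R' in auto)
  define S where "S = Q * R"
  have S: "S \<in> carrier_mat n n" "P * S = 1\<^sub>m n" "S * P = 1\<^sub>m n"
    unfolding S_def by (rule mult_carrier_mat[OF Q(1) R(1)], rule R(2), unfold eq, rule R'(2))
  have "redm P * redm S = 1\<^sub>m n" using redm_mult[OF P S(1)] S(2) redm_one by simp
  from left_right_inverse[OF _ _ q(1) this q(3)] have "redm S = q" using P S(1) by simp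
  then show ?thesis using S that by blast
qed

section \<open>Lifts of a matrix that keep its centralizer\<close>

definition redv :: "(nat \<Rightarrow> 'r) \<Rightarrow> nat \<Rightarrow> 'k" where "redv v = (\<lambda>i. red (v i))"

lemma redv_add: "redv (v + w) = redv v + redv w" by (simp add: redv_def fun_eq_iff red.hom_add)
lemma redv_scale: "redv (\<lambda>i. a * v i) = (\<lambda>i. red a * redv v i)" by (simp add: redv_def fun_eq_iff red.hom_mult)
lemma redv_0: "redv 0 = 0" by (simp add: redv_def fun_eq_iff)

lemma redv_mop:
  assumes "B \<in> carrier_mat n n"
  shows "redv (mop n B v) = mop n (redm B) (redv v)"
proof
  fix i
  have "red (\<Sum>j<n. B $$ (i, j) * v j) = (\<Sum>j<n. redm B $$ (i, j) * red (v j))" if "i < n"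
    unfolding red.hom_sum using that assms by (intro sum.cong) (auto simp: red.hom_mult)
  then show "redv (mop n B v) i = mop n (redm B) (redv v) i" by (simp add: redv_def mop_def)
qed

lemma redv_act:
  assumes "B \<in> carrier_mat n n"
  shows "redv (act (mop n B) f v) = act (mop n (redm B)) (map_poly red f) (redv v)"
proof (induction f)
  case 0
  have "map_poly red 0 = 0" by simp
  then show ?case unfolding act_0 by (simp only: act_0 redv_0)
next
  case (pCons a f)
  have "map_poly red (pCons a f) = pCons (red a) (map_poly red f)" by (simp add: red.map_poly_pCons_hom)
  then show ?case unfolding act_pCons[OF mop_linop] redv_add redv_scale redv_mop[OF assms] pCons.IH
    by (simp only: act_pCons[OF mop_linop])
qed

lemma redv_comb:
  assumes "B \<in> carrier_mat n n"
  shows "redv (comb n B J v f) = comb n (redm B) J (\<lambda>j. redv (v j)) (\<lambda>j. map_poly red (f j))"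
proof (induction J rule: infinite_finite_induct)
  case (infinite J) show ?case unfolding sum.infinite[OF infinite] by (rule redv_0)
next
  case empty show ?case unfolding sum.empty by (rule redv_0)
next
  case (insert x J)
  show ?case unfolding sum.insert[OF insert(1,2)] redv_add insert(3) redv_act[OF assms] ..
qed

lemma poly_lift:
  obtains F where "map_poly red F = f" "F \<in> Pd (Suc (degree f))"
proof -
  have "\<exists>y. red y = x" for x using red_surj by (metis surjD)
  then obtain l where l: "\<And>x. red (l x) = x" by metis
  show ?thesis
    by (rule that[of "polyof (Suc (degree f)) (\<lambda>i. l (coeff f i))"])
      (auto simp: poly_eq_iff coeff_map_poly coeff_polyof l polyof_Pd coeff_eq_0)
qed

lemma monic_lift:
  assumes "lead_coeff f = 1"
  obtains F where "map_poly red F = f" "lead_coeff F = 1" "degree F = degree f"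
proof -
  obtain F0 where F0: "map_poly red F0 = f" "F0 \<in> Pd (Suc (degree f))" using poly_lift .
  define F where "F = F0 + monom (1 - coeff F0 (degree f)) (degree f)"
  have "red (coeff F0 (degree f)) = 1" using F0(1) assms by (metis coeff_map_poly red.hom_zero)
  then have r: "map_poly red F = f"
    using F0(1) by (auto simp: F_def poly_eq_iff coeff_map_poly red.hom_add red.hom_minus)
  have c: "coeff F (degree f) = 1" by (simp add: F_def)
  have z: "coeff F i = 0" if "degree f < i" for i using that F0(2) by (auto simp: F_def Pd_def)
  have "degree F = degree f"
    by (rule antisym[OF degree_le le_degree]) (use c z in auto)
  then show ?thesis using r c that by simp
qed

lemma redv_enc:
  assumes "block_data n J d b"
  shows "redv (block_data.enc n b g) = block_data.enc n b (\<lambda>j. map_poly red (g j))"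
proof -
  interpret block_data n J d b by fact
  show ?thesis by (simp add: redv_def enc_def fun_eq_iff coeff_map_poly)
qed

lemma mrem_red:
  assumes "lead_coeff E = 1" "lead_coeff (map_poly red E) = 1" "degree (map_poly red E) = degree E"
  shows "map_poly red (mrem E f) = mrem (map_poly red E) (map_poly red f)"
proof (rule mrem_unique[symmetric])
  show "map_poly red (mrem E f) \<in> Pd (degree (map_poly red E))"
    using mrem_Pd[OF assms(1), of f] assms(3) by (simp add: Pd_def coeff_map_poly)
  obtain s where "f - mrem E f = E * s" using mrem_dvd[OF assms(1), of f] by (rule dvdE)
  then have "map_poly red (f - mrem E f) = map_poly red (E * s)" by simp
  then have "map_poly red f - map_poly red (mrem E f) = map_poly red E * map_poly red s"
    by (simp only: redp.hom_minus redp.hom_mult)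
  then show "map_poly red E dvd map_poly red f - map_poly red (mrem E f)" by (metis dvd_triv_left)
qed (use assms in auto)

lemma companion_red:
  assumes bd: "block_data n J d b"
    and E: "\<And>j. j \<in> J \<Longrightarrow> lead_coeff (E j) = 1" "\<And>j. j \<in> J \<Longrightarrow> degree (E j) = d j"
    and e: "\<And>j. j \<in> J \<Longrightarrow> map_poly red (E j) = e j"
      "\<And>j. j \<in> J \<Longrightarrow> lead_coeff (e j) = 1" "\<And>j. j \<in> J \<Longrightarrow> degree (e j) = d j"
    and C: "C \<in> carrier_mat n n" "\<And>v. v \<in> Vn n \<Longrightarrow> mop n C v = block_data.comp_op n d b E v"
  shows "\<And>v. v \<in> Vn n \<Longrightarrow> mop n (redm C) v = block_data.comp_op n d b e v"
    and "\<And>j. j \<in> J \<Longrightarrow> redv (block_data.cgen n b E j) = block_data.cgen n b e j"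
proof -
  interpret block_data n J d b by fact
  have mr: "map_poly red (mrem (E j) f) = mrem (e j) (map_poly red f)" if "j \<in> J" for j f
    using mrem_red[OF E(1)[OF that], of f] e[OF that] E(2)[OF that] by simp
  fix v :: "nat \<Rightarrow> 'k" assume v: "v \<in> Vn n"
  have "\<exists>y. red y = x" for x using red_surj by (metis surjD)
  then obtain l where l: "\<And>x. red (l x) = x" by metis
  define w where "w = (\<lambda>i. if i < n then l (v i) else 0)"
  have w: "w \<in> Vn n" "redv w = v" using v by (auto simp: w_def redv_def Vn_def l fun_eq_iff)
  have dec: "map_poly red (dec w j) = dec v j" for j
    using w(2) by (auto simp: dec_def poly_eq_iff coeff_map_poly coeff_polyof redv_def)
  have "mop n (redm C) v = redv (mop n C w)" using redv_mop[OF C(1)] w(2) by simp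
  also have "\<dots> = enc (\<lambda>j. map_poly red (mrem (E j) (pCons 0 (dec w j))))"
    unfolding C(2)[OF w(1)] comp_op_def redv_enc[OF bd] ..
  also have "\<dots> = comp_op e v"
    unfolding comp_op_def by (rule enc_cong) (simp add: mr dec red.map_poly_pCons_hom)
  finally show "mop n (redm C) v = comp_op e v" .
next
  interpret block_data n J d b by fact
  fix j assume j: "j \<in> J"
  have "map_poly red (mrem (E j) 1) = mrem (e j) 1"
    using mrem_red[OF E(1)[OF j], of 1] e[OF j] E(2)[OF j] by simp
  then show "redv (cgen E j) = cgen e j"
    unfolding cgen_def redv_enc[OF bd] by (intro enc_cong) auto
qed

text \<open>A homomorphism \<open>k[t]/p\<^sup>b \<rightarrow> k[t]/r\<^sup>a\<close> is multiplication by some \<open>f\<close> with \<open>r\<^sup>a dvd p\<^sup>b f\<close>. This divisibility lifts to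
  the chosen monic lifts \<open>P p\<close> and \<open>P r\<close>, because the form of \<open>f\<close> is explicit: it is a multiple of \<open>r\<^sup>a\<close> if \<open>p \<noteq> r\<close>, and of
  the power of \<open>r\<close> with exponent \<open>a - b\<close> (truncated at \<open>0\<close>) if \<open>p = r\<close>.\<close>

lemma hom_coeff_lift:
  assumes p: "p \<in> Irr" "r \<in> Irr" and P: "map_poly red (P p) = p" "map_poly red (P r) = r"
    and dvd: "r ^ a dvd p ^ b * f"
  obtains F where "map_poly red F = f" "P r ^ a dvd P p ^ b * F"
proof (cases "p = r")
  case False
  then have "r ^ a dvd f" using Irr_power_dvd_mult_cancel[OF p(2,1) _ dvd] by simp
  then obtain g where g: "f = r ^ a * g" by (rule dvdE)
  obtain G where G: "map_poly red G = g" using poly_lift .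
  show ?thesis by (rule that[of "P r ^ a * G"]) (simp_all add: g G P redp.hom_mult redp.hom_power)
next
  case True
  then have "r ^ (a - b) dvd f" using dvd Irr_power_dvd_same[OF p(2)] by simp
  then obtain g where g: "f = r ^ (a - b) * g" by (rule dvdE)
  obtain G where G: "map_poly red G = g" using poly_lift .
  have "P r ^ a dvd P r ^ b * P r ^ (a - b)" by (simp add: le_imp_power_dvd flip: power_add)
  then have "P r ^ a dvd P r ^ b * (P r ^ (a - b) * G)" by (metis dvd_mult2 mult.assoc)
  then show ?thesis by (intro that[of "P r ^ (a - b) * G"]) (simp_all add: True g G P redp.hom_mult redp.hom_power)
qed

text \<open>Each irreducible \<open>p\<close> is lifted to one monic \<open>P\<close>, and each summand \<open>k[t]/p\<^sup>a\<close> to \<open>R[t]/P\<^sup>a\<close>; the matrix of this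
  \<open>R[t]\<close>-module reduces to a conjugate of \<open>A\<close>. Endomorphisms lift by \<open>hom_coeff_lift\<close>. It matters that all powers
  of \<open>p\<close> lift to powers of the same \<open>P\<close>. An arbitrary lift of \<open>A\<close> would not do: a matrix that commutes with the lift
  \<open>\<theta>(X)\<close> of \<open>A = 0\<close> reduces to one that commutes with \<open>X\<close>.\<close>

theorem centralizer_lifts:
  assumes A: "A \<in> carrier_mat n n"
  obtains At where "At \<in> carrier_mat n n" "redm At = A"
    "\<And>X. X \<in> carrier_mat n n \<Longrightarrow> A * X = X * A \<Longrightarrow>
      \<exists>Xt. Xt \<in> carrier_mat n n \<and> redm Xt = X \<and> At * Xt = Xt * At"
proof -
  interpret k: poly_module "act (mop n A)" by (rule act_poly_module[OF mop_linop])
  have "k.subspace (Vn n)"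
    by (rule k.subspaceI) (auto simp: Vn_0 Vn_add act_mop_Vn)
  then obtain m and e :: "nat \<Rightarrow> 'k poly" and v where cs: "cyclic_sum (act (mop n A)) (Vn n) {..<m} e v"
    and "\<forall>j<m. \<exists>p\<in>Irr. \<exists>a>0. e j = p ^ a" using k.finite_module_cyclic_sum[OF finite_Vn] by metis
  then obtain p a where pa: "\<And>j. j < m \<Longrightarrow> p j \<in> Irr" "\<And>j. j < m \<Longrightarrow> e j = p j ^ a j" by metis
  define J where "J = {..<m}"
  have g: "gens n A J e v" using cs by (simp add: gens_def J_def)
  have em: "lead_coeff (e j) = 1" if "j \<in> J" for j using that pa by (simp add: J_def Irr_power_monic)
  define d where "d j = degree (e j)" for j
  have dim: "n = (\<Sum>j\<in>J. d j)" unfolding d_def by (rule gens_dim[OF g em])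
  obtain b where bd: "block_data n J d b" using block_data_exists[OF gens_finite[OF g] dim] by blast
  interpret block_data n J d b by fact
  have "\<exists>F. map_poly red F = x \<and> lead_coeff F = 1 \<and> degree F = degree x" if "x \<in> Irr" for x
    using monic_lift[OF Irr_monic[OF that]] by metis
  then obtain P where P: "\<And>x. x \<in> Irr \<Longrightarrow> map_poly red (P x) = x" "\<And>x. x \<in> Irr \<Longrightarrow> lead_coeff (P x) = 1"
    "\<And>x. x \<in> Irr \<Longrightarrow> degree (P x) = degree x" by metis
  define E where "E j = P (p j) ^ a j" for j
  have E: "lead_coeff (E j) = 1" "degree (E j) = d j" "map_poly red (E j) = e j" if "j \<in> J" for j
  proof -
    have pj: "p j \<in> Irr" "e j = p j ^ a j" using that pa by (auto simp: J_def)
    show "lead_coeff (E j) = 1" unfolding E_def using monic_power[OF P(2)[OF pj(1)]] by blast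
    show "degree (E j) = d j" unfolding E_def d_def pj(2) Irr_power_degree[OF pj(1)]
      using monic_power[OF P(2)[OF pj(1)]] P(3)[OF pj(1)] by simp
    show "map_poly red (E j) = e j" unfolding E_def pj(2) redp.hom_power P(1)[OF pj(1)] ..
  qed
  obtain C where C: "C \<in> carrier_mat n n" "\<And>v. v \<in> Vn n \<Longrightarrow> mop n C v = comp_op E v"
    using companion_exists[of E] E by metis
  have gC: "gens n C J E (cgen E)" by (rule companion_gens) (use E C in auto)
  note cr = companion_red[OF bd, of E e C, OF E(1,2,3) em _ C]
  have "gens n (redm C) J e (cgen e)" by (rule companion_gens) (use em cr(1) d_def in auto)
  then have "similar_mat A (redm C)" using C by (intro gens_similar[OF A _ g]) auto
  then obtain R Q where RQ: "R \<in> carrier_mat n n" "Q \<in> carrier_mat n n" "R * Q = 1\<^sub>m n" "Q * R = 1\<^sub>m n"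
    and AR: "A = R * redm C * Q"
    using similar_matD[of A "redm C"] A by fastforce
  obtain Rt where Rt: "Rt \<in> carrier_mat n n" "redm Rt = R" using redm_surj[OF RQ(1)] .
  obtain Qt where Qt: "Qt \<in> carrier_mat n n" "Rt * Qt = 1\<^sub>m n" "Qt * Rt = 1\<^sub>m n" "redm Qt = Q"
    using inverse_lift[OF Rt(1) RQ(2)] RQ Rt by metis
  define At where "At = Rt * C * Qt"
  have At: "At \<in> carrier_mat n n" using Rt C Qt by (simp add: At_def)
  have redAt: "redm At = A"
    unfolding At_def AR redm_mult[OF mult_carrier_mat[OF Rt(1) C(1)] Qt(1)] redm_mult[OF Rt(1) C(1)] Rt(2) Qt(4) ..
  define vt where "vt j = mop n Rt (cgen E j)" for j
  have gAt: "gens n At J E vt"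
    unfolding vt_def
  proof (rule gens_transport[OF C(1) At Rt(1) Qt(1,2,3) _ gC])
    have "At * Rt = Rt * C * (Qt * Rt)" unfolding At_def by (rule assoc_mult_mat) (use Rt C Qt in auto)
    then show "At * Rt = Rt * C" using Rt C Qt by simp
  qed
  define u where "u j = redv (vt j)" for j
  have gA: "gens n A J e u"
  proof -
    have "gens n A J e (\<lambda>j. mop n R (cgen e j))"
    proof (rule gens_transport[OF _ A RQ])
      have "A * R = R * redm C * (Q * R)" unfolding AR by (rule assoc_mult_mat) (use RQ C in auto)
      then show "A * R = R * redm C" using RQ C by simp
    qed (use C \<open>gens n (redm C) J e (cgen e)\<close> in auto)
    moreover have "mop n R (cgen e j) = u j" if "j \<in> J" for j
      using that cr(2) d_def Rt by (simp add: u_def vt_def redv_mop)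
    ultimately show ?thesis unfolding gens_def cyclic_sum_def
      by (simp cong: sum.cong)
  qed
  have key: "\<exists>Xt. Xt \<in> carrier_mat n n \<and> redm Xt = X \<and> At * Xt = Xt * At"
    if X: "X \<in> carrier_mat n n" "A * X = X * A" for X
  proof -
    have "\<exists>f. mop n X (u j) = comb n A J u f" for j
      using gens_obtain[OF gA mop_Vn[of n X "u j"]] by blast
    then obtain f where f: "\<And>j. j \<in> J \<Longrightarrow> mop n X (u j) = comb n A J u (f j)" by metis
    have dv: "e l dvd e j * f j l" if j: "j \<in> J" and l: "l \<in> J" for j l
    proof -
      have "comb n A J u (\<lambda>l. e j * f j l) = mop n X (act (mop n A) (e j) (u j))"
        unfolding comb_act f[OF j, symmetric] mop_intertwine[OF A A X] ..
      also have "\<dots> = 0" unfolding gens_killed[OF gA j] by (rule linop_0[OF mop_linop])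
      finally show ?thesis using gens_zero[OF gA, of "\<lambda>l. e j * f j l"] l by simp
    qed
    have "\<exists>F. map_poly red F = f j l \<and> E l dvd E j * F" if j: "j \<in> J" and l: "l \<in> J" for j l
      using hom_coeff_lift[of "p j" "p l" P "a l" "a j" "f j l"] dv[OF j l] pa j l P(1) unfolding E_def J_def
      by (metis lessThan_iff)
    then obtain F where F: "\<And>j l. j \<in> J \<Longrightarrow> l \<in> J \<Longrightarrow> map_poly red (F j l) = f j l"
      "\<And>j l. j \<in> J \<Longrightarrow> l \<in> J \<Longrightarrow> E l dvd E j * F j l" by metis
    define w where "w j = comb n At J vt (F j)" for j
    have wV: "w j \<in> Vn n" for j unfolding w_def using gAt by (auto simp: gens_def cyclic_sum_def)
    have wk: "act (mop n At) (E j) (w j) = 0" if "j \<in> J" for j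
      unfolding w_def comb_act[symmetric] gens_zero[OF gAt] using F(2)[OF that] by blast
    obtain Xt where Xt: "Xt \<in> carrier_mat n n" "At * Xt = Xt * At" "\<And>j. j \<in> J \<Longrightarrow> mop n Xt (vt j) = w j"
      using intertwiner_exists[OF At At gAt, of w] wV wk by blast
    have "redm Xt = X"
    proof (rule intertwiner_unique[OF A A gA _ _ X])
      show "redm Xt \<in> carrier_mat n n" using Xt by simp
      show "A * redm Xt = redm Xt * A" using Xt At redAt by (metis redm_mult)
      fix j assume j: "j \<in> J"
      have "mop n (redm Xt) (u j) = redv (w j)" using Xt j by (simp add: u_def flip: redv_mop)
      also have "\<dots> = comb n A J u (\<lambda>l. map_poly red (F j l))"
        unfolding w_def redv_comb[OF At] redAt u_def ..
      also have "\<dots> = comb n A J u (f j)" by (rule comb_cong) (simp add: F(1) j)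
      finally show "mop n (redm Xt) (u j) = mop n X (u j)" using f[OF j] by simp
    qed
    then show ?thesis using Xt by blast
  qed
  show ?thesis by (rule that[OF At redAt key])
qed

end

section \<open>The class function of a matrix\<close>

lemma card_multiples:
  fixes u :: "'k::{finite,field} poly"
  assumes "u \<noteq> 0"
  shows "card {f \<in> Pd (degree u + k). u dvd f} = card (UNIV :: 'k set) ^ k"
proof -
  have "bij_betw ((*) u) (Pd k) {f \<in> Pd (degree u + k). u dvd f}"
    unfolding bij_betw_def
  proof (intro conjI inj_onI subset_antisym subsetI)
    fix x assume "x \<in> (*) u ` Pd k"
    then obtain g where g: "x = u * g" "g \<in> Pd k" by auto
    then show "x \<in> {f \<in> Pd (degree u + k). u dvd f}"
      using assms by (cases "g = 0") (auto simp: Pd_degree degree_mult_eq)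
  next
    fix x assume x: "x \<in> {f \<in> Pd (degree u + k). u dvd f}"
    then have "u dvd x" by simp
    then obtain g where g: "x = u * g" by (rule dvdE)
    then have "g \<in> Pd k"
      using assms x by (cases "g = 0") (auto simp: Pd_degree degree_mult_eq)
    then show "x \<in> (*) u ` Pd k" using g by auto
  qed (use assms in auto)
  then show ?thesis by (simp add: bij_betw_same_card[symmetric] card_Pd)
qed

lemma card_prime_torsion:
  fixes p r :: "'k::{finite,field} poly"
  assumes p: "p \<in> Irr" and r: "r \<in> Irr"
  shows "card {f \<in> Pd (degree (p ^ a)). p ^ a dvd r ^ b * f} =
    card (UNIV :: 'k set) ^ (if p = r then degree p * min a b else 0)"
proof (cases "p = r")
  case True
  have "p \<noteq> 0" using p by (auto simp: Irr_def)
  have "a * degree p = (a - b) * degree p + degree p * min a b"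
    by (cases "a \<le> b") (simp_all add: algebra_simps flip: add_mult_distrib2)
  then have deg: "degree (p ^ a) = degree (p ^ (a - b)) + degree p * min a b"
    by (simp only: Irr_power_degree[OF p])
  have "{f \<in> Pd (degree (p ^ a)). p ^ a dvd r ^ b * f} =
      {f \<in> Pd (degree (p ^ (a - b)) + degree p * min a b). p ^ (a - b) dvd f}"
    unfolding deg True[symmetric] Irr_power_dvd_same[OF p] ..
  then show ?thesis using True \<open>p \<noteq> 0\<close> card_multiples[of "p ^ (a - b)" "degree p * min a b"] by simp
next
  case False
  have "{f \<in> Pd (degree (p ^ a)). p ^ a dvd r ^ b * f} = {0}"
  proof (intro subset_antisym subsetI)
    fix f assume f: "f \<in> {f \<in> Pd (degree (p ^ a)). p ^ a dvd r ^ b * f}"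
    then have "p ^ a dvd f" using Irr_power_dvd_mult_cancel[OF p r False] by blast
    then show "f \<in> {0}" using monic_dvd_small[OF Irr_power_monic[OF p]] f by blast
  qed (auto simp: Pd_0)
  then show ?thesis using False by simp
qed

text \<open>The index set of the summands in \<open>class_module c\<close>; the prime powers belonging to them are given by \<open>ec\<close>.\<close>

definition Jc :: "('k::field poly \<Rightarrow> nat list) \<Rightarrow> ('k poly \<times> nat) set" where
  "Jc c = {(p, i). i < length (c p)}"

definition ec :: "('k::field poly \<Rightarrow> nat list) \<Rightarrow> 'k poly \<times> nat \<Rightarrow> 'k poly" where
  "ec c = (\<lambda>(p, i). p ^ (c p ! i))"

lemma Jc_Sigma: "Jc c = (SIGMA p:{p. c p \<noteq> []}. {..<length (c p)})"
  by (auto simp: Jc_def)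

lemma class_functions_Irr: "c \<in> class_functions n \<Longrightarrow> c p \<noteq> [] \<Longrightarrow> p \<in> Irr"
  by (auto simp: class_functions_def)

lemma class_functions_finite: "c \<in> class_functions n \<Longrightarrow> finite {p. c p \<noteq> []}"
  by (auto simp: class_functions_def)

lemma Jc_finite: "c \<in> class_functions n \<Longrightarrow> finite (Jc c)"
  unfolding Jc_Sigma using class_functions_finite by (intro finite_SigmaI) auto

lemma Jc_Irr: "c \<in> class_functions n \<Longrightarrow> (p, i) \<in> Jc c \<Longrightarrow> p \<in> Irr"
  by (rule class_functions_Irr[of c n p]) (auto simp: Jc_def)

lemma ec_monic: "c \<in> class_functions n \<Longrightarrow> j \<in> Jc c \<Longrightarrow> lead_coeff (ec c j) = 1"
  using Jc_Irr[of c n "fst j" "snd j"] by (cases j) (simp add: ec_def Irr_power_monic)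

lemma sum_Jc:
  assumes "c \<in> class_functions n"
  shows "(\<Sum>j\<in>Jc c. g (fst j) (snd j)) = (\<Sum>p | c p \<noteq> []. \<Sum>i<length (c p). (g p i :: nat))"
  unfolding Jc_Sigma using class_functions_finite[OF assms]
  by (subst sum.Sigma) (auto simp: case_prod_unfold)

lemma class_functions_degree:
  assumes c: "c \<in> class_functions n"
  shows "(\<Sum>j\<in>Jc c. degree (ec c j)) = (\<Sum>p | c p \<noteq> []. degree p * sum_list (c p))"
proof -
  have "(\<Sum>j\<in>Jc c. degree (ec c j)) = (\<Sum>j\<in>Jc c. c (fst j) ! snd j * degree (fst j))"
    using Jc_Irr[OF c] by (intro sum.cong) (auto simp: ec_def Irr_power_degree)
  also have "\<dots> = (\<Sum>p | c p \<noteq> []. \<Sum>i<length (c p). c p ! i * degree p)" by (rule sum_Jc[OF c])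
  also have "\<dots> = (\<Sum>p | c p \<noteq> []. degree p * sum_list (c p))"
    by (intro sum.cong) (simp_all add: sum_list_sum_nth atLeast0LessThan sum_distrib_left mult.commute)
  finally show ?thesis .
qed

lemma class_functions_dim: "c \<in> class_functions n \<Longrightarrow> (\<Sum>j\<in>Jc c. degree (ec c j)) = n"
  unfolding class_functions_degree by (simp add: class_functions_def)

lemma prime_torsion_card:
  fixes A :: "'k::{finite,field} mat"
  assumes c: "c \<in> class_functions n" and g: "gens n A (Jc c) (ec c) v" and p: "p \<in> Irr"
  shows "card {w \<in> Vn n. act (mop n A) (p ^ b) w = 0} =
    card (UNIV :: 'k set) ^ (degree p * (\<Sum>i<length (c p). min (c p ! i) b))"
proof -
  let ?q = "card (UNIV :: 'k set)"
  have "card {w \<in> Vn n. act (mop n A) (p ^ b) w = 0} =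
      (\<Prod>j\<in>Jc c. card {f \<in> Pd (degree (ec c j)). ec c j dvd p ^ b * f})"
    by (rule torsion_card[OF g ec_monic[OF c]])
  also have "\<dots> = (\<Prod>j\<in>Jc c. ?q ^ (if fst j = p then degree p * min (c p ! snd j) b else 0))"
    using Jc_Irr[OF c] by (intro prod.cong) (auto simp: ec_def card_prime_torsion p)
  also have "\<dots> = ?q ^ (\<Sum>j\<in>Jc c. if fst j = p then degree p * min (c p ! snd j) b else 0)"
    by (simp add: power_sum)
  also have "(\<Sum>j\<in>Jc c. if fst j = p then degree p * min (c p ! snd j) b else 0) =
      (\<Sum>r | c r \<noteq> []. \<Sum>i<length (c r). if r = p then degree p * min (c p ! i) b else 0)"
    by (rule sum_Jc[OF c])
  also have "\<dots> = (\<Sum>r | c r \<noteq> []. if r = p then \<Sum>i<length (c p). degree p * min (c p ! i) b else 0)"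
    by (rule sum.cong) auto
  also have "\<dots> = degree p * (\<Sum>i<length (c p). min (c p ! i) b)"
    using class_functions_finite[OF c] by (auto simp: sum_distrib_left)
  finally show ?thesis .
qed

lemma sum_min_step:
  "sum_list (map (\<lambda>x. min x (Suc b)) l) = sum_list (map (\<lambda>x. min x b) l) + length (filter (\<lambda>x. b < x) l)"
  for l :: "nat list"
  by (induction l) (auto simp: min_def)

lemma length_filter_step:
  "length (filter (\<lambda>x. b < x) l) = count (mset l) (Suc b) + length (filter (\<lambda>x. Suc b < x) l)" for l :: "nat list"
  by (induction l) auto

text \<open>Successive differences of the sums count the parts that are greater than \<open>b\<close>, and second differences
  count the parts equal to a given number.\<close>

lemma partition_eqI:
  assumes l: "is_partition l" "is_partition l'"
    and eq: "\<And>b. (\<Sum>i<length l. min (l ! i) b) = (\<Sum>i<length l'. min (l' ! i) b)"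
  shows "l = l'"
proof -
  have s: "(\<Sum>i<length k. min (k ! i) b) = sum_list (map (\<lambda>x. min x b) k)" for k :: "nat list" and b
    by (simp add: sum_list_sum_nth atLeast0LessThan)
  have f: "length (filter (\<lambda>x. b < x) l) = length (filter (\<lambda>x. b < x) l')" for b
    using eq[of b] eq[of "Suc b"] unfolding s sum_min_step by simp
  have "mset l = mset l'"
  proof (rule multiset_eqI)
    fix x show "count (mset l) x = count (mset l') x"
    proof (cases x)
      case 0
      have "count (mset l) 0 = 0" "count (mset l') 0 = 0"
        using l by (simp_all add: is_partition_def count_eq_zero_iff)
      then show ?thesis unfolding 0 by (simp only:)
    next
      case (Suc b)
      then show ?thesis using f[of b] f[of "Suc b"] unfolding length_filter_step[of b] by simp
    qed
  qed
  then have "sort (rev l) = sort (rev l')"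
    by (intro properties_for_sort) auto
  moreover have "sorted (rev l)" "sorted (rev l')"
    using l by (simp_all add: is_partition_def sorted_wrt_rev)
  ultimately show ?thesis by (simp add: sorted_sort_id)
qed

text \<open>The number of vectors killed by \<open>p\<^sup>b\<close> depends on \<open>A\<close> alone. It determines the sums of the \<open>min (c p ! i) b\<close>, and
  hence the partition \<open>c p\<close>.\<close>

theorem class_function_unique:
  fixes A :: "'k::{finite,field} mat"
  assumes c: "c \<in> class_functions n" "gens n A (Jc c) (ec c) v"
    and c': "c' \<in> class_functions n" "gens n A (Jc c') (ec c') v'"
  shows "c = c'"
proof
  fix p show "c p = c' p"
  proof (cases "p \<in> Irr")
    case True
    have q: "1 < card (UNIV :: 'k set)"
      using card_mono[of UNIV "{0, 1 :: 'k}"] by simp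
    show ?thesis
    proof (rule partition_eqI)
      fix b
      have "degree p * (\<Sum>i<length (c p). min (c p ! i) b) = degree p * (\<Sum>i<length (c' p). min (c' p ! i) b)"
        using prime_torsion_card[OF c True, of b] prime_torsion_card[OF c' True, of b] q power_inject_exp by metis
      then show "(\<Sum>i<length (c p). min (c p ! i) b) = (\<Sum>i<length (c' p). min (c' p ! i) b)"
        using Irr_degree_pos[OF True] by simp
    qed (use c c' in \<open>auto simp: class_functions_def\<close>)
  next
    case False
    then show ?thesis using c c' by (auto simp: class_functions_def)
  qed
qed

text \<open>The last part of a decreasing list of length \<open>r\<close> is the minimum of each of the \<open>2 r - 1\<close> pairs of positions that
  involve it.\<close>

lemma sum_min_part_m:
  assumes "sorted_wrt (\<ge>) l"
  shows "(\<Sum>i<length l. \<Sum>k<length l. min (l ! k) (l ! i)) = part_m l"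
  using assms
proof (induction l rule: rev_induct)
  case Nil then show ?case by (simp add: part_m_def)
next
  case (snoc x l)
  have le: "x \<le> l ! i" if "i < length l" for i using snoc.prems that by (auto simp: sorted_wrt_append)
  let ?n = "length l"
  have "(\<Sum>i<Suc ?n. \<Sum>k<Suc ?n. min ((l @ [x]) ! k) ((l @ [x]) ! i)) =
    (\<Sum>i<?n. (\<Sum>k<?n. min (l ! k) (l ! i)) + x) + (?n * x + x)"
    using le by (simp add: nth_append min_absorb1 min_absorb2 sum.distrib)
  also have "\<dots> = part_m l + (2 * ?n + 1) * x"
    using snoc by (simp add: sum.distrib sorted_wrt_append algebra_simps)
  also have "\<dots> = part_m (l @ [x])" by (simp add: part_m_def nth_append)
  finally show ?case by simp
qed

text \<open>The generator of a summand \<open>k[t]/p\<^sup>a\<close> can be sent to any vector killed by \<open>p\<^sup>a\<close>, and these form a space of dimension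
  \<open>deg p\<close> times the sum over the parts \<open>b\<close> of \<open>c p\<close> of \<open>min b a\<close>.\<close>

theorem centralizer_dim:
  fixes A :: "'k::{finite,field} mat"
  assumes A: "A \<in> carrier_mat n n" and c: "c \<in> class_functions n" and g: "gens n A (Jc c) (ec c) v"
  shows "card {X \<in> carrier_mat n n. A * X = X * A} =
    card (UNIV :: 'k set) ^ (\<Sum>p | c p \<noteq> []. degree p * part_m (c p))"
proof -
  let ?q = "card (UNIV :: 'k set)"
  have "card {X \<in> carrier_mat n n. A * X = X * A} =
      (\<Prod>j\<in>Jc c. card {w \<in> Vn n. act (mop n A) (ec c j) w = 0})" by (rule centralizer_card[OF A g])
  also have "\<dots> = (\<Prod>j\<in>Jc c. ?q ^ (degree (fst j) * (\<Sum>k<length (c (fst j)). min (c (fst j) ! k) (c (fst j) ! snd j))))"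
    using Jc_Irr[OF c] by (intro prod.cong) (auto simp: ec_def prime_torsion_card[OF c g])
  also have "\<dots> = ?q ^ (\<Sum>j\<in>Jc c. degree (fst j) * (\<Sum>k<length (c (fst j)). min (c (fst j) ! k) (c (fst j) ! snd j)))"
    by (simp add: power_sum)
  also have "(\<Sum>j\<in>Jc c. degree (fst j) * (\<Sum>k<length (c (fst j)). min (c (fst j) ! k) (c (fst j) ! snd j))) =
      (\<Sum>p | c p \<noteq> []. \<Sum>i<length (c p). degree p * (\<Sum>k<length (c p). min (c p ! k) (c p ! i)))"
    by (rule sum_Jc[OF c])
  also have "\<dots> = (\<Sum>p | c p \<noteq> []. degree p * part_m (c p))"
  proof (rule sum.cong)
    fix p
    have "sorted_wrt (\<ge>) (c p)" using c by (auto simp: class_functions_def is_partition_def)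
    then show "(\<Sum>i<length (c p). degree p * (\<Sum>k<length (c p). min (c p ! k) (c p ! i))) = degree p * part_m (c p)"
      by (simp add: sum_min_part_m flip: sum_distrib_left)
  qed simp
  finally show ?thesis .
qed

lemma gens_reindex:
  assumes g: "gens n A J e v" and h: "bij_betw h J' J"
  shows "gens n A J' (\<lambda>j. e (h j)) (\<lambda>j. v (h j))"
proof -
  let ?k = "the_inv_into J' h"
  have c: "comb n A J' (\<lambda>j. v (h j)) f = comb n A J v (\<lambda>j. f (?k j))" for f
  proof -
    have "comb n A J v (\<lambda>j. f (?k j)) = (\<Sum>j\<in>J'. act (mop n A) (f (?k (h j))) (v (h j)))"
      by (rule sum.reindex_bij_betw[OF h, symmetric])
    also have "\<dots> = comb n A J' (\<lambda>j. v (h j)) f"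
      using h by (intro sum.cong) (auto simp: the_inv_into_f_f bij_betw_def)
    finally show ?thesis by simp
  qed
  have c': "comb n A J v f = comb n A J' (\<lambda>j. v (h j)) (\<lambda>j. f (h j))" for f
    by (rule sum.reindex_bij_betw[OF h, symmetric])
  show ?thesis
    unfolding gens_def cyclic_sum_def
  proof (intro conjI allI subset_antisym subsetI)
    show "finite J'" using gens_finite[OF g] h by (simp add: bij_betw_finite)
    fix f
    have "(\<forall>j\<in>J. e j dvd f (?k j)) \<longleftrightarrow> (\<forall>j\<in>J'. e (h j) dvd f j)"
      using h by (auto simp: bij_betw_def the_inv_into_f_f)
    then show "comb n A J' (\<lambda>j. v (h j)) f = 0 \<longleftrightarrow> (\<forall>j\<in>J'. e (h j) dvd f j)"
      unfolding c gens_zero[OF g] .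
  next
    fix w :: "nat \<Rightarrow> 'a" assume "w \<in> Vn n"
    then obtain f where "w = comb n A J v f" using gens_obtain[OF g] by blast
    then have "w = comb n A J' (\<lambda>j. v (h j)) (\<lambda>j. f (h j))" using c' by simp
    then show "w \<in> range (comb n A J' (\<lambda>j. v (h j)))" by (rule range_eqI[where x = "\<lambda>j. f (h j)"])
  next
    fix w assume "w \<in> range (comb n A J' (\<lambda>j. v (h j)))"
    then obtain f where "w = comb n A J' (\<lambda>j. v (h j)) f" by blast
    then have "w = comb n A J v (\<lambda>j. f (?k j))" using c by simp
    then show "w \<in> Vn n" using g by (auto simp: gens_def cyclic_sum_def)
  qed
qed

text \<open>The summands of a primary decomposition are grouped by their primes, and the exponents sorted.\<close>

theorem class_function_exists:
  fixes A :: "'k::{finite,field} mat"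
  obtains c v where "c \<in> class_functions n" "gens n A (Jc c) (ec c) v"
proof -
  interpret k: poly_module "act (mop n A)" by (rule act_poly_module[OF mop_linop])
  have "k.subspace (Vn n)"
    by (rule k.subspaceI) (auto simp: Vn_0 Vn_add act_mop_Vn)
  then obtain m and e :: "nat \<Rightarrow> 'k poly" and v where cs: "cyclic_sum (act (mop n A)) (Vn n) {..<m} e v"
    and "\<forall>j<m. \<exists>p\<in>Irr. \<exists>a>0. e j = p ^ a" using k.finite_module_cyclic_sum[OF finite_Vn] by metis
  then obtain p a where pa: "\<And>j. j < m \<Longrightarrow> p j \<in> Irr" "\<And>j. j < m \<Longrightarrow> a j > 0" "\<And>j. j < m \<Longrightarrow> e j = p j ^ a j" by metis
  have g: "gens n A {..<m} e v" using cs by (simp add: gens_def)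
  define L where "L x = rev (sort_key a (filter (\<lambda>j. p j = x) [0..<m]))" for x
  define c where "c x = map a (L x)" for x
  define h where "h = (\<lambda>(x, i). L x ! i)"
  have L: "set (L x) = {j. j < m \<and> p j = x}" "distinct (L x)" for x by (auto simp: L_def)
  have Ln: "L x ! i < m \<and> p (L x ! i) = x" if "i < length (L x)" for x i using nth_mem[OF that] L(1) by auto
  have Jc: "Jc c = {(x, i). i < length (L x)}" by (simp add: Jc_def c_def)
  have h: "bij_betw h (Jc c) {..<m}"
    unfolding bij_betw_def
  proof (intro conjI inj_onI subset_antisym subsetI)
    fix y z assume "y \<in> Jc c" "z \<in> Jc c" "h y = h z"
    moreover obtain x i x' i' where "y = (x, i)" "z = (x', i')" by (cases y, cases z)
    ultimately have *: "i < length (L x)" "i' < length (L x')" "L x ! i = L x' ! i'" by (auto simp: Jc h_def)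
    then have "x = x'" using Ln by metis
    then show "y = z" using * L(2)[of x] \<open>y = _\<close> \<open>z = _\<close> by (simp add: nth_eq_iff_index_eq)
  next
    fix j assume j: "j \<in> {..<m}"
    then have "j \<in> set (L (p j))" using L(1) by simp
    then obtain i where "i < length (L (p j))" "L (p j) ! i = j" by (auto simp: in_set_conv_nth)
    then show "j \<in> h ` Jc c" by (auto simp: Jc h_def intro!: image_eqI[where x = "(p j, i)"])
  qed (use Ln in \<open>auto simp: Jc h_def\<close>)
  have e_h: "e (h j) = ec c j" if "j \<in> Jc c" for j
    using that Ln pa(3) by (auto simp: Jc h_def ec_def c_def)
  have "gens n A (Jc c) (\<lambda>j. e (h j)) (\<lambda>j. v (h j))" by (rule gens_reindex[OF g h])
  then have gc: "gens n A (Jc c) (ec c) (\<lambda>j. v (h j))"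
    using e_h by (simp add: gens_def cyclic_sum_def)
  have Lx: "L x \<noteq> [] \<Longrightarrow> x \<in> p ` {..<m}" for x using L(1)[of x] by (metis (mono_tags, lifting) image_eqI lessThan_iff list.set_intros(1) mem_Collect_eq neq_Nil_conv)
  have fin: "finite {x. c x \<noteq> []}"
    by (rule finite_subset[of _ "p ` {..<m}"]) (use Lx in \<open>auto simp: c_def\<close>)
  have part: "is_partition (c x)" for x
  proof -
    have "sorted_wrt (\<ge>) (c x)" by (simp add: c_def L_def sorted_wrt_rev flip: rev_map)
    moreover have "0 \<notin> set (c x)"
    proof
      assume "0 \<in> set (c x)"
      then obtain j where "j \<in> set (L x)" "a j = 0" by (auto simp: c_def)
      then show False using L(1)[of x] pa(2)[of j] by simp
    qed
    ultimately show ?thesis by (simp add: is_partition_def)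
  qed
  have irr: "x \<notin> Irr \<Longrightarrow> c x = []" for x using Lx[of x] pa(1) by (auto simp: c_def)
  define n' where "n' = (\<Sum>p | c p \<noteq> []. degree p * sum_list (c p))"
  have cf': "c \<in> class_functions n'" using fin part irr by (simp add: class_functions_def n'_def)
  have "n = n'" using gens_dim[OF gc ec_monic[OF cf']] class_functions_dim[OF cf'] by simp
  then show ?thesis using cf' gc that by blast
qed

section \<open>Types\<close>

lemma same_type_equiv: "equiv (class_functions n) (same_type n :: (('k::field poly \<Rightarrow> nat list) \<times> _) set)"
proof -
  let ?r = "same_type n :: (('k poly \<Rightarrow> nat list) \<times> _) set"
  have "?r \<subseteq> class_functions n \<times> class_functions n" by (auto simp: same_type_def)
  moreover have "refl_on (class_functions n) ?r"
    by (rule refl_onI) (auto simp: same_type_def intro!: exI[of _ id])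
  moreover have "sym ?r"
  proof (rule symI)
    fix c c' :: "'k poly \<Rightarrow> nat list" assume "(c, c') \<in> same_type n"
    then obtain \<phi> where \<phi>: "bij_betw \<phi> Irr Irr" "\<And>p. p \<in> Irr \<Longrightarrow> degree (\<phi> p) = degree p \<and> c' p = c (\<phi> p)"
      and cc: "c \<in> class_functions n" "c' \<in> class_functions n" by (auto simp: same_type_def)
    let ?\<psi> = "the_inv_into Irr \<phi>"
    have b: "bij_betw ?\<psi> Irr Irr" by (rule bij_betw_the_inv_into[OF \<phi>(1)])
    have "degree (?\<psi> p) = degree p \<and> c p = c' (?\<psi> p)" if "p \<in> Irr" for p
      using \<phi>(2)[of "?\<psi> p"] b that f_the_inv_into_f_bij_betw[OF \<phi>(1), of p] by (metis bij_betwE)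
    then show "(c', c) \<in> same_type n" using cc b by (auto simp: same_type_def)
  qed
  moreover have "trans ?r"
  proof (rule transI)
    fix c c' c'' :: "'k poly \<Rightarrow> nat list" assume "(c, c') \<in> same_type n" "(c', c'') \<in> same_type n"
    then obtain \<phi> \<psi> where \<phi>: "bij_betw \<phi> Irr Irr" "\<And>p. p \<in> Irr \<Longrightarrow> degree (\<phi> p) = degree p \<and> c' p = c (\<phi> p)"
      and \<psi>: "bij_betw \<psi> Irr Irr" "\<And>p. p \<in> Irr \<Longrightarrow> degree (\<psi> p) = degree p \<and> c'' p = c' (\<psi> p)"
      and cc: "c \<in> class_functions n" "c'' \<in> class_functions n" by (auto simp: same_type_def)
    have "degree ((\<phi> \<circ> \<psi>) p) = degree p \<and> c'' p = c ((\<phi> \<circ> \<psi>) p)" if "p \<in> Irr" for p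
      using \<phi>(2)[of "\<psi> p"] \<psi>(2)[OF that] bij_betwE[OF \<psi>(1)] that by auto
    then show "(c, c'') \<in> same_type n" using cc bij_betw_trans[OF \<psi>(1) \<phi>(1)]
      by (auto simp: same_type_def intro!: exI[of _ "\<phi> \<circ> \<psi>"])
  qed
  ultimately show ?thesis by (rule equivI)
qed

lemma same_type_support:
  assumes "(c, c') \<in> same_type n"
  obtains \<phi> where "bij_betw \<phi> {p. c' p \<noteq> []} {p. c p \<noteq> []}"
    "\<And>p. c' p \<noteq> [] \<Longrightarrow> degree (\<phi> p) = degree p \<and> c' p = c (\<phi> p)"
proof -
  obtain \<phi> where \<phi>: "bij_betw \<phi> Irr Irr" "\<And>p. p \<in> Irr \<Longrightarrow> degree (\<phi> p) = degree p \<and> c' p = c (\<phi> p)"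
    and cc: "c \<in> class_functions n" "c' \<in> class_functions n" using assms by (auto simp: same_type_def)
  have s: "{p. c' p \<noteq> []} \<subseteq> Irr" "{p. c p \<noteq> []} \<subseteq> Irr"
    using class_functions_Irr[OF cc(1)] class_functions_Irr[OF cc(2)] by auto
  have "\<phi> ` {p. c' p \<noteq> []} = {p. c p \<noteq> []}"
  proof (intro subset_antisym subsetI)
    fix r assume r: "r \<in> {p. c p \<noteq> []}"
    then have "r \<in> \<phi> ` Irr" using s \<phi>(1) by (auto simp: bij_betw_def)
    then obtain p where "p \<in> Irr" "r = \<phi> p" by blast
    then show "r \<in> \<phi> ` {p. c' p \<noteq> []}" using r \<phi>(2) by auto
  qed (use s \<phi>(2) in auto)
  moreover have "inj_on \<phi> {p. c' p \<noteq> []}" using \<phi>(1) s inj_on_subset by (auto simp: bij_betw_def)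
  ultimately have bb: "bij_betw \<phi> {p. c' p \<noteq> []} {p. c p \<noteq> []}" by (simp add: bij_betw_def)
  show ?thesis by (rule that[OF bb]) (use s \<phi>(2) in blast)
qed

lemma same_type_dim:
  assumes "(c, c') \<in> same_type n"
  shows "(\<Sum>p | c p \<noteq> []. degree p * part_m (c p)) = (\<Sum>p | c' p \<noteq> []. degree p * part_m (c' p))"
proof -
  obtain \<phi> where \<phi>: "bij_betw \<phi> {p. c' p \<noteq> []} {p. c p \<noteq> []}"
    "\<And>p. c' p \<noteq> [] \<Longrightarrow> degree (\<phi> p) = degree p \<and> c' p = c (\<phi> p)" by (rule same_type_support[OF assms]) (rule that)
  have "(\<Sum>p | c p \<noteq> []. degree p * part_m (c p)) = (\<Sum>p | c' p \<noteq> []. degree (\<phi> p) * part_m (c (\<phi> p)))"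
    by (rule sum.reindex_bij_betw[OF \<phi>(1), symmetric])
  also have "\<dots> = (\<Sum>p | c' p \<noteq> []. degree p * part_m (c' p))" using \<phi>(2) by (intro sum.cong) auto
  finally show ?thesis .
qed

lemma sim_types_class:
  assumes "\<tau> \<in> sim_types n" "c \<in> \<tau>"
  shows "c \<in> class_functions n" "\<And>c'. c' \<in> \<tau> \<longleftrightarrow> (c, c') \<in> same_type n"
proof -
  have t: "\<tau> \<in> class_functions n // same_type n" using assms by (simp add: sim_types_def)
  show "c \<in> class_functions n" using in_quotient_imp_subset[OF same_type_equiv t] assms(2) by blast
  show "c' \<in> \<tau> \<longleftrightarrow> (c, c') \<in> same_type n" for c'
    using quotient_eq_iff[OF same_type_equiv t t assms(2), of c'] in_quotient_imp_closed[OF same_type_equiv t assms(2), of c'] by blast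
qed

lemma type_z:
  assumes "\<tau> \<in> sim_types n" "c \<in> \<tau>"
  shows "type_z \<tau> = (\<Sum>p | c p \<noteq> []. degree p * part_m (c p))"
proof -
  define c0 where "c0 = (SOME c. c \<in> \<tau>)"
  have c0: "c0 \<in> \<tau>" unfolding c0_def by (rule someI[of "\<lambda>c. c \<in> \<tau>", OF assms(2)])
  have "type_z \<tau> = (\<Sum>p | c0 p \<noteq> []. degree p * part_m (c0 p))"
    by (simp add: type_z_def primary_types_def Let_def c0_def[symmetric] sum_unfold_sum_mset image_mset.compositionality comp_def)
  also have "\<dots> = (\<Sum>p | c p \<noteq> []. degree p * part_m (c p))"
    using same_type_dim sim_types_class(2)[OF assms(1) c0, of c] assms(2) by blast
  finally show ?thesis .
qed

section \<open>Irreducible polynomials of equal degree over a finite field\<close>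

lemma dvd_prod_diff:
  fixes r :: "'a::comm_ring_1"
  assumes "\<And>x. x \<in> S \<Longrightarrow> r dvd f x - g x"
  shows "r dvd prod f S - prod g S"
  using assms
proof (induction S rule: infinite_finite_induct)
  case (insert x S)
  have "f x * prod f S - g x * prod g S = f x * (prod f S - prod g S) + (f x - g x) * prod g S"
    by (simp add: algebra_simps)
  moreover have "r dvd prod f S - prod g S" "r dvd f x - g x" using insert by auto
  ultimately show ?case using insert(1,2) by (simp add: dvd_add dvd_mult dvd_mult2)
qed auto

lemma Irr_dvd_small: "r \<in> Irr \<Longrightarrow> r dvd x \<Longrightarrow> x \<in> Pd (degree r) \<Longrightarrow> x = 0"
  by (rule monic_dvd_small[OF Irr_monic])

text \<open>Multiplication by \<open>h\<close> permutes the nonzero residues modulo \<open>r\<close>, whose product is prime to \<open>r\<close>.\<close>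

lemma Irr_fermat:
  fixes r h :: "'k::{finite,field} poly"
  assumes r: "r \<in> Irr" and h: "\<not> r dvd h"
  shows "r dvd h ^ (card (UNIV :: 'k set) ^ degree r - 1) - 1"
proof -
  let ?S = "Pd (degree r) - {0} :: 'k poly set"
  note irr = Irr_irreducible[OF r]
  have card: "card (Pd (degree r) :: 'k poly set) = card (UNIV :: 'k set) ^ degree r" by (rule card_Pd)
  have fin: "finite (Pd (degree r) :: 'k poly set)"
    by (rule card_ge_0_finite) (simp add: card finite_UNIV_card_ge_0)
  have inj: "inj_on (\<lambda>x. mrem r (h * x)) ?S"
  proof (rule inj_onI)
    fix x y assume xy: "x \<in> ?S" "y \<in> ?S" "mrem r (h * x) = mrem r (h * y)"
    have "r dvd (h * x - mrem r (h * x)) - (h * y - mrem r (h * y))"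
      by (intro dvd_diff mrem_dvd Irr_monic[OF r])
    then have "r dvd h * (x - y)" using xy(3) by (simp add: algebra_simps)
    then have "r dvd x - y" using irreducible_dvd_mult[OF irr] h by blast
    then have "x - y = 0" using xy by (intro Irr_dvd_small[OF r]) (auto intro: Pd_diff)
    then show "x = y" by simp
  qed
  have maps: "(\<lambda>x. mrem r (h * x)) ` ?S \<subseteq> ?S"
  proof
    fix y assume "y \<in> (\<lambda>x. mrem r (h * x)) ` ?S"
    then obtain x where x: "x \<in> ?S" "y = mrem r (h * x)" by blast
    have "\<not> r dvd h * x" using irreducible_dvd_mult[OF irr] h Irr_dvd_small[OF r] x(1) by blast
    then show "y \<in> ?S" using x(2) mrem_Pd[OF Irr_monic[OF r]] mrem_0_iff[OF Irr_monic[OF r]] by auto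
  qed
  have "(\<lambda>x. mrem r (h * x)) ` ?S = ?S" by (rule endo_inj_surj[OF _ maps inj]) (use fin in simp)
  then have bij: "bij_betw (\<lambda>x. mrem r (h * x)) ?S ?S" using inj by (simp add: bij_betw_def)
  have "r dvd (\<Prod>x\<in>?S. h * x) - (\<Prod>x\<in>?S. mrem r (h * x))"
    by (rule dvd_prod_diff) (rule mrem_dvd[OF Irr_monic[OF r]])
  also have "(\<Prod>x\<in>?S. mrem r (h * x)) = \<Prod>?S" using prod.reindex_bij_betw[OF bij, of "\<lambda>x. x"] by simp
  also have "(\<Prod>x\<in>?S. h * x) = h ^ card ?S * \<Prod>?S" by (simp add: prod.distrib)
  also have "h ^ card ?S * \<Prod>?S - \<Prod>?S = (h ^ card ?S - 1) * \<Prod>?S" by (simp add: algebra_simps)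
  finally have d: "r dvd (h ^ card ?S - 1) * \<Prod>?S" .
  have "\<not> r dvd \<Prod>X" if "X \<subseteq> ?S" "finite X" for X
    using that(2,1)
  proof (induction X)
    case empty show ?case using Irr_degree_pos[OF r] by simp
  next
    case (insert x X)
    then have "\<not> r dvd x" using Irr_dvd_small[OF r] by blast
    moreover have "\<not> r dvd \<Prod>X" using insert by blast
    ultimately show ?case using irreducible_dvd_mult[OF irr] insert(1,2) by auto
  qed
  then have "\<not> r dvd \<Prod>?S" using fin by blast
  then have "r dvd h ^ card ?S - 1" using irreducible_dvd_mult[OF irr d] by blast
  moreover have "card ?S = card (UNIV :: 'k set) ^ degree r - 1" using fin by (simp add: card Pd_0)
  ultimately show ?thesis by simp
qed

lemma Irr_frobenius:
  fixes r h :: "'k::{finite,field} poly"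
  assumes r: "r \<in> Irr"
  shows "r dvd h ^ (card (UNIV :: 'k set) ^ degree r) - h"
proof -
  let ?m = "card (UNIV :: 'k set) ^ degree r"
  have m: "?m = Suc (?m - 1)" by (simp add: finite_UNIV_card_ge_0)
  have e: "h ^ ?m - h = h * (h ^ (?m - 1) - 1)" by (subst m) (simp add: algebra_simps)
  show ?thesis
  proof (cases "r dvd h")
    case True then show ?thesis unfolding e by (rule dvd_mult2)
  next
    case False then show ?thesis unfolding e by (intro dvd_mult Irr_fermat[OF r])
  qed
qed

text \<open>This is the bound for the number of roots in the field \<open>k[t]/r\<close>, whose elements are represented by polynomials. As over any
  field, roots are split off by synthetic division.\<close>

lemma root_bound:
  fixes r :: "'k::{finite,field} poly"
  assumes r: "r \<in> Irr" and F: "\<not> r dvd lead_coeff F"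
  shows "card {h \<in> Pd (degree r). r dvd poly F h} \<le> degree F"
  using F
proof (induction "degree F" arbitrary: F)
  case 0
  then obtain a where "F = [:a:]" by (metis degree_eq_zeroE)
  then show ?case using 0 by simp
next
  case (Suc k)
  have fin: "finite (Pd (degree r) :: 'k poly set)"
    by (rule card_ge_0_finite) (simp add: card_Pd finite_UNIV_card_ge_0)
  show ?case
  proof (cases "\<exists>h0\<in>Pd (degree r). r dvd poly F h0")
    case False
    then have e: "{h \<in> Pd (degree r). r dvd poly F h} = {}" by blast
    show ?thesis unfolding e by simp
  next
    case True
    then obtain h0 where h0: "h0 \<in> Pd (degree r)" "r dvd poly F h0" by blast
    define G where "G = synthetic_div F h0"
    have FG: "F = [:- h0, 1:] * G + [:poly F h0:]" unfolding G_def by (rule synthetic_div_correct'[symmetric])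
    have dG: "degree G = k" using Suc(2) by (simp add: G_def degree_synthetic_div)
    have "lead_coeff F = coeff ([:- h0, 1:] * G + [:poly F h0:]) (Suc k)" using Suc(2) FG by metis
    also have "\<dots> = lead_coeff G" by (simp add: dG coeff_eq_0)
    finally have "\<not> r dvd lead_coeff G" using Suc(3) by simp
    then have IH: "card {h \<in> Pd (degree r). r dvd poly G h} \<le> k" using Suc(1)[of G] dG by simp
    have "{h \<in> Pd (degree r). r dvd poly F h} \<subseteq> insert h0 {h \<in> Pd (degree r). r dvd poly G h}"
    proof
      fix h assume h: "h \<in> {h \<in> Pd (degree r). r dvd poly F h}"
      have "poly F h = poly ([:- h0, 1:] * G + [:poly F h0:]) h" using FG by metis
      then have "(h - h0) * poly G h = poly F h - poly F h0" by (simp add: algebra_simps)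
      then have "r dvd (h - h0) * poly G h" using h h0 by (simp add: dvd_diff)
      then have "r dvd h - h0 \<or> r dvd poly G h" by (rule irreducible_dvd_mult[OF Irr_irreducible[OF r]])
      moreover have "h = h0" if "r dvd h - h0"
        using Irr_dvd_small[OF r that] h h0 by (auto intro: Pd_diff)
      ultimately show "h \<in> insert h0 {h \<in> Pd (degree r). r dvd poly G h}" using h by blast
    qed
    then have "card {h \<in> Pd (degree r). r dvd poly F h} \<le> card (insert h0 {h \<in> Pd (degree r). r dvd poly G h})"
      using fin by (intro card_mono) auto
    also have "\<dots> \<le> Suc (card {h \<in> Pd (degree r). r dvd poly G h})" by (rule card_insert_le_m1) auto
    finally show ?thesis using IH Suc(2) by simp
  qed
qed

lemma pcompose_as_poly: "poly (map_poly (\<lambda>c. [:c:]) u) h = pcompose u h" for u :: "'k::field poly"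
  by (induction u) (simp_all add: map_poly_pCons pcompose_pCons)

text \<open>With \<open>m = q\<^sup>d\<close> for the common degree \<open>d\<close>, the polynomial \<open>p\<close> divides \<open>t\<^sup>m - t\<close>, which has all \<open>m\<close> residues modulo \<open>r\<close> as
  roots. If \<open>p\<close> had none of them, its cofactor would have \<open>m\<close> roots, which is more than its degree.\<close>

lemma exists_root:
  fixes p r :: "'k::{finite,field} poly"
  assumes p: "p \<in> Irr" and r: "r \<in> Irr" and deg: "degree p = degree r"
  obtains h where "r dvd pcompose p h"
proof -
  let ?q = "card (UNIV :: 'k set)"
  define m where "m = ?q ^ degree r"
  have q: "1 < ?q" using card_mono[of UNIV "{0, 1 :: 'k}"] by simp
  have m: "1 < m" unfolding m_def using q Irr_degree_pos[OF r] by (metis one_less_power)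
  define Q :: "'k poly" where "Q = [:0, 1:] ^ m - [:0, 1:]"
  have "p dvd Q" using Irr_frobenius[OF p, of "[:0, 1:]"] by (simp add: Q_def m_def deg)
  then obtain u where u: "Q = p * u" by (rule dvdE)
  have X: "degree ([:0, 1:] ^ m :: 'k poly) = m" by (simp add: degree_power_eq)
  have dQ: "degree Q = m"
    unfolding Q_def diff_conv_add_uminus[of _ "[:0, 1:]"] using m by (subst degree_add_eq_left) (simp_all add: X)
  then have Q0: "Q \<noteq> 0" using m by auto
  then have u0: "u \<noteq> 0" "p \<noteq> 0" using u by auto
  have du: "degree u < m" using dQ u u0 Irr_degree_pos[OF p] by (simp add: degree_mult_eq)
  have "\<exists>h. r dvd pcompose p h"
  proof (rule ccontr)
    assume no: "\<nexists>h. r dvd pcompose p h"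
    have "r dvd pcompose u h" for h
    proof -
      have "pcompose Q h = h ^ m - h" by (simp add: Q_def pcompose_diff pcompose_pCons pcompose_hom.hom_power)
      then have "r dvd pcompose p h * pcompose u h" using Irr_frobenius[OF r, of h] u by (simp add: m_def pcompose_mult)
      then show ?thesis using irreducible_dvd_mult[OF Irr_irreducible[OF r]] no by blast
    qed
    then have "{h \<in> Pd (degree r). r dvd poly (map_poly (\<lambda>c. [:c:]) u) h} = Pd (degree r)"
      by (simp add: pcompose_as_poly)
    moreover have dU: "degree (map_poly (\<lambda>c. [:c:]) u) = degree u" by (rule degree_map_poly) simp
    moreover have "\<not> r dvd lead_coeff (map_poly (\<lambda>c. [:c:]) u)"
    proof
      assume "r dvd lead_coeff (map_poly (\<lambda>c. [:c:]) u)"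
      then have "r dvd [:lead_coeff u:]" by (simp add: dU coeff_map_poly)
      then have "[:lead_coeff u:] = 0" using Irr_degree_pos[OF r]
        by (intro Irr_dvd_small[OF r]) (auto simp: Pd_degree)
      then show False using u0 by simp
    qed
    ultimately have "card (Pd (degree r) :: 'k poly set) \<le> degree u" using root_bound[OF r] by metis
    then show False using du by (simp add: card_Pd m_def)
  qed
  then show ?thesis using that by blast
qed

lemma pcompose_taylor:
  fixes p h x :: "'k::field poly"
  shows "\<exists>s. pcompose p (h + x) = pcompose p h + x * pcompose (pderiv p) h + x ^ 2 * s"
proof (induction p)
  case 0 then show ?case by simp
next
  case (pCons a p)
  then obtain s where s: "pcompose p (h + x) = pcompose p h + x * pcompose (pderiv p) h + x ^ 2 * s" by blast
  have "pcompose (pCons a p) (h + x) = pcompose (pCons a p) h + x * pcompose (pderiv (pCons a p)) h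
    + x ^ 2 * (pcompose (pderiv p) h + (h + x) * s)"
    by (simp add: pcompose_pCons s pderiv_pCons pcompose_add algebra_simps power2_eq_square)
  then show ?case by blast
qed

lemma of_nat_card_field: "of_nat (card (UNIV :: 'k::{finite,field} set)) = (0 :: 'k)"
proof -
  have "bij ((+) (1 :: 'k))" by (rule bij_plus)
  then have "(\<Sum>x\<in>UNIV. 1 + x) = (\<Sum>x\<in>UNIV. x :: 'k)"
    using sum.reindex_bij_betw[of "(+) (1 :: 'k)" UNIV UNIV "\<lambda>x. x"] by simp
  then show ?thesis by (simp add: sum.distrib)
qed

text \<open>If \<open>p(h)\<close> is divisible by \<open>r\<^sup>2\<close>, then \<open>p(h + r)\<close> is not, because \<open>p\<close> is separable: the derivative
  of its multiple \<open>t\<^sup>m - t\<close> is \<open>-1\<close>.\<close>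

lemma exists_simple_root:
  fixes p r :: "'k::{finite,field} poly"
  assumes p: "p \<in> Irr" and r: "r \<in> Irr" and deg: "degree p = degree r"
  obtains h where "r dvd pcompose p h" "\<not> r ^ 2 dvd pcompose p h"
proof -
  obtain h0 where h0: "r dvd pcompose p h0" using exists_root[OF assms] .
  show ?thesis
  proof (cases "r ^ 2 dvd pcompose p h0")
    case False then show ?thesis using h0 that by blast
  next
    case True
    have nd: "\<not> r dvd pcompose (pderiv p) h0"
    proof
      assume d: "r dvd pcompose (pderiv p) h0"
      let ?m = "card (UNIV :: 'k set) ^ degree r"
      have "p dvd [:0, 1:] ^ ?m - [:0, 1:]" using Irr_frobenius[OF p, of "[:0, 1:]"] by (simp add: deg)
      then obtain u where "[:0, 1:] ^ ?m - [:0, 1:] = p * u" by (rule dvdE)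
      then have "pderiv ([:0, 1:] ^ ?m - [:0, 1:]) = pderiv (p * u)" by simp
      moreover have "of_nat ?m = (0 :: 'k)" using of_nat_card_field Irr_degree_pos[OF r] by (simp add: of_nat_power)
      then have "pderiv ([:0, 1:] ^ ?m - [:0, 1:] :: 'k poly) = - 1"
        using Irr_degree_pos[OF r] by (simp add: pderiv_diff pderiv_power pderiv_pCons one_pCons zero_power)
      ultimately have "- 1 = p * pderiv u + u * pderiv p" by (simp add: pderiv_mult)
      then have "pcompose (- 1) h0 = pcompose (p * pderiv u + u * pderiv p) h0" by simp
      then have "- 1 = pcompose p h0 * pcompose (pderiv u) h0 + pcompose u h0 * pcompose (pderiv p) h0"
        by (simp add: pcompose_add pcompose_mult pcompose_uminus)
      then have "r dvd - 1" using h0 d by (metis dvd_add dvd_mult dvd_mult2)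
      then show False using Irr_irreducible[OF r] by (simp add: irreducible_def)
    qed
    obtain s where s: "pcompose p (h0 + r) = pcompose p h0 + r * pcompose (pderiv p) h0 + r ^ 2 * s"
      using pcompose_taylor by blast
    have "r dvd pcompose p (h0 + r)" unfolding s by (intro dvd_add h0) (simp_all add: power2_eq_square)
    moreover have "\<not> r ^ 2 dvd pcompose p (h0 + r)"
    proof
      assume "r ^ 2 dvd pcompose p (h0 + r)"
      moreover have "r ^ 2 dvd pcompose p h0 + r ^ 2 * s" using True by (intro dvd_add) simp_all
      ultimately have "r ^ 2 dvd pcompose p (h0 + r) - (pcompose p h0 + r ^ 2 * s)" by (rule dvd_diff)
      then have "r * r dvd r * pcompose (pderiv p) h0" by (simp add: s power2_eq_square)
      moreover have "r \<noteq> 0" using r by (auto simp: Irr_def)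
      ultimately show False using nd by simp
    qed
    ultimately show ?thesis using that by blast
  qed
qed

text \<open>Substitution of a root \<open>h\<close> that is simple modulo \<open>r\<^sup>2\<close> pulls the valuation of \<open>r\<close> back to the valuation of \<open>p\<close>. The exponent of
  \<open>r\<close> in \<open>s(h)\<close> is the exponent of \<open>p\<close> in \<open>s\<close> times the multiplicity of the root, which is \<open>1\<close>.\<close>

lemma simple_root_valuation:
  fixes p r h s :: "'k::field poly"
  assumes p: "p \<in> Irr" and r: "r \<in> Irr" and h: "r dvd pcompose p h" "\<not> r ^ 2 dvd pcompose p h"
  shows "r ^ a dvd pcompose s h \<longleftrightarrow> p ^ a dvd s"
proof (cases "s = 0")
  case False
  note irr = Irr_irreducible[OF r]
  obtain b g where s: "s = p ^ b * g" "\<not> p dvd g" using irreducible_power_split[OF Irr_irreducible[OF p] False] .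
  obtain x y where "x * p + y * g = 1" using irreducible_bezout[OF Irr_irreducible[OF p] s(2)] .
  then have "pcompose (x * p + y * g) h = 1" by (simp add: pcompose_1)
  then have xy: "pcompose x h * pcompose p h + pcompose y h * pcompose g h = 1" by (simp add: pcompose_add pcompose_mult)
  have g: "\<not> r dvd pcompose g h"
  proof
    assume "r dvd pcompose g h"
    then have "r dvd 1" using h(1) xy by (metis dvd_add dvd_mult)
    then show False using irr by (simp add: irreducible_def)
  qed
  obtain w where w: "pcompose p h = r * w" using h(1) by (rule dvdE)
  have "\<not> r dvd w" using h(2) by (simp add: w power2_eq_square mult_dvd_mono)
  then have nw: "\<not> r dvd w ^ b"
    by (induction b) (use irr irreducible_dvd_mult[OF irr] in \<open>auto simp: irreducible_def\<close>)
  have eq: "pcompose s h = r ^ b * (w ^ b * pcompose g h)"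
    by (simp add: s(1) pcompose_mult pcompose_hom.hom_power w power_mult_distrib mult.assoc)
  have "r ^ a dvd pcompose s h \<longleftrightarrow> r ^ (a - b) dvd w ^ b * pcompose g h"
    unfolding eq by (rule Irr_power_dvd_same[OF r])
  also have "\<dots> \<longleftrightarrow> a \<le> b"
  proof
    assume d: "r ^ (a - b) dvd w ^ b * pcompose g h"
    show "a \<le> b"
    proof (rule ccontr)
      assume "\<not> a \<le> b"
      then have "r dvd r ^ (a - b)" by simp
      then have "r dvd w ^ b * pcompose g h" using d by (rule dvd_trans)
      then show False using irreducible_dvd_mult[OF irr] nw g by blast
    qed
  qed simp
  also have "\<dots> \<longleftrightarrow> p ^ (a - b) dvd g"
  proof
    assume d: "p ^ (a - b) dvd g"
    show "a \<le> b"
    proof (rule ccontr)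
      assume "\<not> a \<le> b"
      then have "p dvd p ^ (a - b)" by simp
      then show False using d s(2) dvd_trans by blast
    qed
  qed simp
  also have "\<dots> \<longleftrightarrow> p ^ a dvd s" unfolding s(1) by (rule Irr_power_dvd_same[OF p, symmetric])
  finally show ?thesis .
qed simp

lemma pcompose_diff_dvd: "x - y dvd pcompose s x - pcompose s y" for s :: "'k::field poly"
proof (induction s)
  case (pCons a s)
  have "pcompose (pCons a s) x - pcompose (pCons a s) y = x * (pcompose s x - pcompose s y) + (x - y) * pcompose s y"
    by (simp add: pcompose_pCons algebra_simps)
  then show ?case using pCons by (simp add: dvd_add dvd_mult)
qed simp

lemma Irr_crt:
  fixes \<phi> :: "'i \<Rightarrow> 'k::field poly"
  assumes "finite I" "inj_on \<phi> I" "\<phi> ` I \<subseteq> Irr"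
  shows "\<exists>f. \<forall>i\<in>I. \<phi> i ^ M dvd f - h i"
  using assms
proof (induction I)
  case (insert i I)
  then obtain f0 where f0: "\<And>j. j \<in> I \<Longrightarrow> \<phi> j ^ M dvd f0 - h j" by auto
  define P where "P = (\<Prod>j\<in>I. \<phi> j ^ M)"
  have irr: "\<phi> i \<in> Irr" using insert by auto
  have "\<not> \<phi> i dvd (\<Prod>j\<in>K. \<phi> j ^ M)" if "finite K" "K \<subseteq> I" for K
    using that
  proof (induction K)
    case empty then show ?case using Irr_degree_pos[OF irr] by simp
  next
    case (insert j K)
    have "\<phi> i \<noteq> \<phi> j" using insert.prems inj_onD[OF \<open>inj_on \<phi> (insert i I)\<close>, of i j] \<open>i \<notin> I\<close> by auto
    then have "\<not> \<phi> i dvd \<phi> j ^ M" using \<open>\<phi> ` insert i I \<subseteq> Irr\<close> insert.prems by (intro Irr_not_dvd_power irr) auto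
    then show ?case using insert irreducible_dvd_mult[OF Irr_irreducible[OF irr]] by auto
  qed
  then have "\<not> \<phi> i dvd P" using insert(1) by (simp add: P_def)
  then obtain x y where xy: "x * \<phi> i ^ M + y * P = 1" using irreducible_power_bezout[OF Irr_irreducible[OF irr]] by metis
  define f where "f = f0 + P * (y * (h i - f0))"
  have "\<phi> i ^ M dvd f - h i"
  proof -
    have "f - h i = (y * P) * (h i - f0) - (h i - f0)" by (simp add: f_def algebra_simps)
    also have "y * P = 1 - x * \<phi> i ^ M" using xy by (simp add: algebra_simps)
    also have "(1 - x * \<phi> i ^ M) * (h i - f0) - (h i - f0) = \<phi> i ^ M * (- x * (h i - f0))"
      by (simp add: algebra_simps)
    finally show ?thesis by (metis dvd_triv_left)
  qed
  moreover have "\<phi> j ^ M dvd f - h j" if "j \<in> I" for j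
  proof -
    have "\<phi> j ^ M dvd P" unfolding P_def using insert(1) that by (rule dvd_prodI)
    moreover have "f - h j = (f0 - h j) + P * (y * (h i - f0))" by (simp add: f_def)
    ultimately show ?thesis using dvd_add[OF f0[OF that] dvd_mult2] by metis
  qed
  ultimately show ?case by blast
qed simp

section \<open>Matrices of the same type\<close>

text \<open>Horner's scheme for \<open>f(A)\<close>.\<close>

definition mpoly :: "nat \<Rightarrow> 'a::comm_ring_1 mat \<Rightarrow> 'a poly \<Rightarrow> 'a mat" where
  "mpoly n A f = fold_coeffs (\<lambda>a M. a \<cdot>\<^sub>m 1\<^sub>m n + A * M) f (0\<^sub>m n n)"

lemma mpoly_0 [simp]: "mpoly n A 0 = 0\<^sub>m n n" by (simp add: mpoly_def)

lemma mpoly_pCons: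
  assumes "A \<in> carrier_mat n n"
  shows "mpoly n A (pCons a f) = a \<cdot>\<^sub>m 1\<^sub>m n + A * mpoly n A f"
proof (cases "a = 0 \<and> f = 0")
  case True
  then show ?thesis using assms by (auto intro!: eq_matI)
next
  case False
  then show ?thesis by (cases "f = 0") (simp_all add: mpoly_def)
qed

lemma mpoly_carrier [simp]: "A \<in> carrier_mat n n \<Longrightarrow> mpoly n A f \<in> carrier_mat n n"
  by (induction f) (auto simp: mpoly_pCons)

lemma mop_smult_one: "v \<in> Vn n \<Longrightarrow> mop n (a \<cdot>\<^sub>m 1\<^sub>m n) v = (\<lambda>i. a * v i)"
proof
  fix i assume v: "v \<in> Vn n"
  have "mop n (a \<cdot>\<^sub>m 1\<^sub>m n) v i = a * mop n (1\<^sub>m n) v i"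
    by (auto simp: mop_def sum_distrib_left mult.assoc intro!: sum.cong)
  then show "mop n (a \<cdot>\<^sub>m 1\<^sub>m n) v i = a * v i" by (simp add: mop_one[OF v])
qed

lemma mop_mpoly:
  assumes A: "A \<in> carrier_mat n n" and v: "v \<in> Vn n"
  shows "mop n (mpoly n A f) v = act (mop n A) f v"
proof (induction f)
  case 0
  show ?case by (auto simp: mop_def fun_eq_iff)
next
  case (pCons a f)
  have "mop n (mpoly n A (pCons a f)) v = mop n (a \<cdot>\<^sub>m 1\<^sub>m n) v + mop n (A * mpoly n A f) v"
    unfolding mpoly_pCons[OF A] by (rule mop_add) (use A in auto)
  also have "mop n (A * mpoly n A f) v = mop n A (mop n (mpoly n A f) v)"
    by (rule mop_mult[OF A]) (use A in simp)
  finally show ?case unfolding mop_smult_one[OF v] pCons.IH act_pCons[OF mop_linop] .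
qed

lemma act_mpoly:
  assumes A: "A \<in> carrier_mat n n" and v: "v \<in> Vn n"
  shows "act (mop n (mpoly n A f)) s v = act (mop n A) (pcompose s f) v"
proof (induction s)
  case 0 show ?case by simp
next
  case (pCons a s)
  have "mop n (mpoly n A f) (act (mop n A) (pcompose s f) v) = act (mop n A) (f * pcompose s f) v"
    unfolding act_mult[OF mop_linop] by (rule mop_mpoly[OF A act_mop_Vn[OF v]])
  then show ?case
    unfolding pcompose_pCons act_add[OF mop_linop] act_const[OF mop_linop]
    unfolding act_pCons[OF mop_linop] pCons.IH by (simp only:)
qed

lemma mop_diff: "A \<in> carrier_mat n n \<Longrightarrow> B \<in> carrier_mat n n \<Longrightarrow> mop n (A - B) v = mop n A v - mop n B v"
  by (auto simp: mop_def fun_eq_iff algebra_simps sum_subtractf intro!: sum.cong)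

definition cent :: "nat \<Rightarrow> 'a::comm_ring_1 mat \<Rightarrow> 'a mat set" where
  "cent n A = {X \<in> carrier_mat n n. A * X = X * A}"

text \<open>The image of \<open>Y \<mapsto> A Y - Y A\<close>, whose kernel is \<open>cent n A\<close>.\<close>

definition adrange :: "nat \<Rightarrow> 'a::comm_ring_1 mat \<Rightarrow> 'a mat set" where
  "adrange n A = (\<lambda>Y. A * Y - Y * A) ` carrier_mat n n"

lemma cent_mpoly:
  assumes A: "A \<in> carrier_mat n n" and X: "X \<in> cent n A"
  shows "X \<in> cent n (mpoly n A f)"
proof -
  have X': "X \<in> carrier_mat n n" "A * X = X * A" using X by (auto simp: cent_def)
  have "mpoly n A f * X = X * mpoly n A f"
  proof (rule mop_eqI)
    fix v :: "nat \<Rightarrow> 'a" assume v: "v \<in> Vn n"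
    show "mop n (mpoly n A f * X) v = mop n (X * mpoly n A f) v"
      using mop_intertwine[OF A A X', of f v] mop_mpoly[OF A v] mop_mpoly[OF A mop_Vn, of f X v]
      by (simp add: mop_mult A X')
  qed (use A X' in \<open>auto intro: mult_carrier_mat[of _ n n]\<close>)
  then show ?thesis using X' by (simp add: cent_def)
qed

lemma diff_rearrange:
  fixes g x b c a :: "'a::ab_group_add"
  assumes "g - x = b - c"
  shows "a - x = a + b - (g + c)"
proof -
  have "a + b - (g + c) = a + (b - c) - g" by (simp add: algebra_simps)
  then show ?thesis by (simp add: assms[symmetric])
qed

text \<open>By induction along Horner's scheme: for \<open>f = a + t g\<close> the commutator \<open>[f(A), X]\<close> is
  \<open>[A, g(A) X] + [g(A), X A]\<close>.\<close>

lemma mpoly_commutator: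
  assumes A: "A \<in> carrier_mat n n" and X: "X \<in> carrier_mat n n"
  shows "\<exists>Y\<in>carrier_mat n n. mpoly n A f * X - X * mpoly n A f = A * Y - Y * A"
  using X
proof (induction f arbitrary: X)
  case 0
  then show ?case using A by (intro bexI[of _ "0\<^sub>m n n"]) (auto intro!: eq_matI)
next
  case (pCons a f X)
  let ?G = "mpoly n A f"
  have G: "?G \<in> carrier_mat n n" using A by simp
  obtain Y where Y: "Y \<in> carrier_mat n n" "?G * (X * A) - (X * A) * ?G = A * Y - Y * A"
    using pCons.IH[of "X * A"] pCons.prems A by auto
  have "mpoly n A (pCons a f) * X - X * mpoly n A (pCons a f) = A * (?G * X + Y) - (?G * X + Y) * A"
  proof (rule mop_eqI)
    fix v :: "nat \<Rightarrow> 'a" assume v: "v \<in> Vn n"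
    have "mop n (?G * (X * A) - (X * A) * ?G) v = mop n (A * Y - Y * A) v" using Y by simp
    then have eq: "mop n ?G (mop n X (mop n A v)) - mop n X (mop n A (mop n ?G v)) = mop n A (mop n Y v) - mop n Y (mop n A v)"
      using A G Y(1) pCons.prems by (simp add: mop_diff mop_mult)
    have X: "X \<in> carrier_mat n n" by fact
    have P: "mpoly n A (pCons a f) \<in> carrier_mat n n" using A by simp
    have mP: "mop n (mpoly n A (pCons a f)) w = (\<lambda>i. a * w i) + mop n A (mop n ?G w)" if w: "w \<in> Vn n" for w
      unfolding mop_mpoly[OF A w] by (rule act_pCons[OF mop_linop])
    have "mop n (mpoly n A (pCons a f) * X - X * mpoly n A (pCons a f)) v =
      mop n (mpoly n A (pCons a f)) (mop n X v) - mop n X (mop n (mpoly n A (pCons a f)) v)"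
      unfolding mop_diff[OF mult_carrier_mat[OF P X] mult_carrier_mat[OF X P]] mop_mult[OF P X] mop_mult[OF X P] ..
    also have "\<dots> = mop n A (mop n ?G (mop n X v)) - mop n X (mop n A (mop n ?G v))"
      unfolding mP[OF v] mP[OF mop_Vn] linop_add[OF mop_linop] linop_scale[OF mop_linop] by (rule add_diff_cancel_left)
    also have "\<dots> = mop n A (mop n ?G (mop n X v)) + mop n A (mop n Y v) - (mop n ?G (mop n X (mop n A v)) + mop n Y (mop n A v))"
      using eq by (rule diff_rearrange)
    also have "\<dots> = mop n (A * (?G * X + Y) - (?G * X + Y) * A) v"
    proof -
      have GX: "?G * X \<in> carrier_mat n n" using G X by (rule mult_carrier_mat)
      have W: "?G * X + Y \<in> carrier_mat n n" using Y(1) by (rule add_carrier_mat)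
      show ?thesis
        unfolding mop_diff[OF mult_carrier_mat[OF A W] mult_carrier_mat[OF W A]] mop_mult[OF A W] mop_mult[OF W A]
          mop_add[OF GX Y(1)] mop_mult[OF G X] linop_add[OF mop_linop] ..
    qed
    finally show "mop n (mpoly n A (pCons a f) * X - X * mpoly n A (pCons a f)) v = mop n (A * (?G * X + Y) - (?G * X + Y) * A) v" .
  qed (use A G Y pCons.prems in \<open>auto intro!: mult_carrier_mat[of _ n n] minus_carrier_mat\<close>)
  then show ?case using G Y(1) pCons.prems by (intro bexI[of _ "?G * X + Y"]) auto
qed

lemma adrange_mpoly: "A \<in> carrier_mat n n \<Longrightarrow> adrange n (mpoly n A f) \<subseteq> adrange n A"
  using mpoly_commutator[of A n _ f] by (auto simp: adrange_def)

lemma finite_carrier_mat: "finite (carrier_mat n n :: 'a::finite mat set)"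
proof -
  have "carrier_mat n n \<subseteq> (\<lambda>f. mat n n f) ` (({..<n} \<times> {..<n}) \<rightarrow>\<^sub>E (UNIV :: 'a set))"
  proof
    fix A :: "'a mat" assume "A \<in> carrier_mat n n"
    then have "A = mat n n (\<lambda>ij\<in>{..<n} \<times> {..<n}. A $$ ij)" by (intro eq_matI) auto
    then show "A \<in> (\<lambda>f. mat n n f) ` (({..<n} \<times> {..<n}) \<rightarrow>\<^sub>E UNIV)"
      by (rule image_eqI[where x = "\<lambda>ij\<in>{..<n} \<times> {..<n}. A $$ ij"]) auto
  qed
  then show ?thesis by (rule finite_subset) (intro finite_imageI finite_PiE, auto)
qed

text \<open>The fibres of \<open>X \<mapsto> A X - X A\<close> are cosets of its kernel.\<close>

lemma ad_fibre:
  fixes A :: "'a::{finite,comm_ring_1} mat"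
  assumes A: "A \<in> carrier_mat n n" and y: "y \<in> adrange n A"
  shows "card {X \<in> carrier_mat n n. A * X - X * A = y} = card (cent n A)"
proof -
  obtain Y where Y: "Y \<in> carrier_mat n n" "y = A * Y - Y * A" using y by (auto simp: adrange_def)
  have key: "A * (X + Y) - (X + Y) * A = y \<longleftrightarrow> A * X = X * A" if X: "X \<in> carrier_mat n n" for X
  proof -
    have "A * (X + Y) - (X + Y) * A = (A * X - X * A) + y"
      unfolding Y(2) mult_add_distrib_mat[OF A X Y(1)] add_mult_distrib_mat[OF X Y(1) A]
      using A X Y(1) by (intro eq_matI) auto
    moreover have "(A * X - X * A) + y = y \<longleftrightarrow> A * X = X * A"
    proof
      assume e: "(A * X - X * A) + y = y"
      show "A * X = X * A"
      proof (rule eq_matI)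
        fix i j assume ij: "i < dim_row (X * A)" "j < dim_col (X * A)"
        have "((A * X - X * A) + y) $$ (i, j) = y $$ (i, j)" using e by simp
        moreover have "((A * X - X * A) + y) $$ (i, j) = (A * X) $$ (i, j) - (X * A) $$ (i, j) + y $$ (i, j)"
          using ij A X Y by (simp add: Y(2))
        ultimately show "(A * X) $$ (i, j) = (X * A) $$ (i, j)" by simp
      qed (use A X in auto)
    next
      assume "A * X = X * A"
      then show "(A * X - X * A) + y = y" using A X Y by (intro eq_matI) auto
    qed
    ultimately show ?thesis by simp
  qed
  have "bij_betw (\<lambda>X. X + Y) (cent n A) {X \<in> carrier_mat n n. A * X - X * A = y}"
  proof (rule bij_betwI[where g = "\<lambda>X. X - Y"])
    show "(\<lambda>X. X + Y) \<in> cent n A \<rightarrow> {X \<in> carrier_mat n n. A * X - X * A = y}"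
      using key Y(1) by (auto simp: cent_def)
    have bck: "X - Y + Y = X" if "X \<in> carrier_mat n n" for X using that Y(1) by (intro eq_matI) auto
    show "(\<lambda>X. X - Y) \<in> {X \<in> carrier_mat n n. A * X - X * A = y} \<rightarrow> cent n A"
    proof (rule funcsetI)
      fix X assume X: "X \<in> {X \<in> carrier_mat n n. A * X - X * A = y}"
      then have X': "X - Y \<in> carrier_mat n n" using Y(1) by auto
      then show "X - Y \<in> cent n A" using key[OF X'] bck[of X] X by (simp add: cent_def)
    qed
    show "X - Y + Y = X" if "X \<in> {X \<in> carrier_mat n n. A * X - X * A = y}" for X using that bck by auto
    show "X + Y - Y = X" if "X \<in> cent n A" for X
      using that Y(1) by (intro eq_matI) (auto simp: cent_def)
  qed
  then show ?thesis by (simp add: bij_betw_same_card)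
qed

lemma card_adrange:
  fixes A :: "'a::{finite,comm_ring_1} mat"
  assumes A: "A \<in> carrier_mat n n"
  shows "card (adrange n A) * card (cent n A) = card (carrier_mat n n :: 'a mat set)"
proof -
  have "card (carrier_mat n n :: 'a mat set) = (\<Sum>y\<in>adrange n A. \<Sum>X\<in>{X \<in> carrier_mat n n. A * X - X * A = y}. 1)"
    unfolding adrange_def using sum.image_gen[OF finite_carrier_mat, of "\<lambda>_. 1 :: nat" n "\<lambda>X. A * X - X * A"] by simp
  also have "\<dots> = (\<Sum>y\<in>adrange n A. card (cent n A))"
    using ad_fibre[OF A] by (intro sum.cong) auto
  finally show ?thesis by simp
qed

lemma cent_finite: "finite (cent n A :: 'a::{finite,comm_ring_1} mat set)"
  unfolding cent_def by (rule finite_subset[OF _ finite_carrier_mat[of n]]) auto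

lemma cent_card_pos: "A \<in> carrier_mat n n \<Longrightarrow> 0 < card (cent n A :: 'a::{finite,comm_ring_1} mat set)"
  using cent_finite[of n A] by (auto simp: card_gt_0_iff cent_def intro!: exI[of _ "1\<^sub>m n"])

text \<open>Let \<open>\<phi>\<close> be the permutation that relates \<open>c\<close> and \<open>c'\<close>, and let \<open>B = f(A)\<close>, where modulo a high power of each \<open>\<phi> p\<close> the
  polynomial \<open>f\<close> is a simple root of \<open>p\<close> in the sense of \<open>exists_simple_root\<close>. By \<open>simple_root_valuation\<close> a generator whose order
  with respect to \<open>A\<close> is \<open>(\<phi> p)\<^sup>a\<close> has order \<open>p\<^sup>a\<close> with respect to \<open>B\<close>, so \<open>B\<close> has the class function \<open>c'\<close>. Whatever
  commutes with \<open>A\<close> commutes with \<open>B\<close>, and a commutator with \<open>B\<close> is a commutator with \<open>A\<close>. Both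
  inclusions are equalities by counting, since the dimension of the centralizer depends only on the type.\<close>

theorem type_transport:
  fixes A :: "'k::{finite,field} mat"
  assumes A: "A \<in> carrier_mat n n" and cc: "(c, c') \<in> same_type n" and g: "gens n A (Jc c) (ec c) v"
  obtains B v' where "B \<in> carrier_mat n n" "gens n B (Jc c') (ec c') v'"
    "cent n B = cent n A" "adrange n B = adrange n A"
proof -
  have c: "c \<in> class_functions n" "c' \<in> class_functions n" using cc by (auto simp: same_type_def)
  obtain \<phi> where \<phi>: "bij_betw \<phi> {p. c' p \<noteq> []} {p. c p \<noteq> []}"
    "\<And>p. c' p \<noteq> [] \<Longrightarrow> degree (\<phi> p) = degree p \<and> c' p = c (\<phi> p)"
    by (rule same_type_support[OF cc]) (rule that)
  let ?I = "{p. c' p \<noteq> []}"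
  have irr: "p \<in> Irr" "\<phi> p \<in> Irr" if "c' p \<noteq> []" for p
    using class_functions_Irr[OF c(2) that] class_functions_Irr[OF c(1), of "\<phi> p"] \<phi>(2)[OF that] that by auto
  have "\<exists>h. \<phi> p dvd pcompose p h \<and> \<not> \<phi> p ^ 2 dvd pcompose p h" if "c' p \<noteq> []" for p
    using exists_simple_root[OF irr[OF that]] \<phi>(2)[OF that] by metis
  then obtain h where h: "\<And>p. c' p \<noteq> [] \<Longrightarrow> \<phi> p dvd pcompose p (h p)"
    "\<And>p. c' p \<noteq> [] \<Longrightarrow> \<not> \<phi> p ^ 2 dvd pcompose p (h p)" by metis
  \<comment> \<open>All exponents are at most \<open>M\<close>, so congruences modulo \<open>(\<phi> p) ^ M\<close> suffice.\<close>
  define M where "M = (\<Sum>j\<in>Jc c'. c' (fst j) ! snd j)"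
  have M: "c' p ! i \<le> M" if "(p, i) \<in> Jc c'" for p i
    unfolding M_def using member_le_sum[OF that, of "\<lambda>j. c' (fst j) ! snd j"] Jc_finite[OF c(2)] by simp
  obtain f where f: "\<And>p. c' p \<noteq> [] \<Longrightarrow> \<phi> p ^ M dvd f - h p"
  proof -
    have "\<phi> ` ?I \<subseteq> Irr" using irr(2) by blast
    then show ?thesis
      using Irr_crt[OF class_functions_finite[OF c(2)] bij_betw_imp_inj_on[OF \<phi>(1)], of M h] that by blast
  qed
  define B where "B = mpoly n A f"
  have B: "B \<in> carrier_mat n n" using A by (simp add: B_def)
  have val: "\<phi> p ^ a dvd pcompose s f \<longleftrightarrow> p ^ a dvd s" if p: "c' p \<noteq> []" and a: "a \<le> M" for p a s
  proof -
    have "\<phi> p ^ a dvd f - h p" using f[OF p] a le_imp_power_dvd dvd_trans by blast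
    then have d: "\<phi> p ^ a dvd pcompose s f - pcompose s (h p)" using pcompose_diff_dvd dvd_trans by blast
    have "\<phi> p ^ a dvd pcompose s f \<longleftrightarrow> \<phi> p ^ a dvd pcompose s (h p)"
      using dvd_add[OF d, of "pcompose s (h p)"] dvd_diff[of _ "pcompose s f", OF _ d] by auto
    then show ?thesis using simple_root_valuation[OF irr[OF p] h(1)[OF p] h(2)[OF p], of a s] by simp
  qed
  define \<Phi> where "\<Phi> = (\<lambda>(p, i :: nat). (\<phi> p, i))"
  have \<Phi>: "bij_betw \<Phi> (Jc c') (Jc c)"
    unfolding bij_betw_def
  proof (intro conjI inj_onI subset_antisym subsetI)
    fix x y assume "x \<in> Jc c'" "y \<in> Jc c'" "\<Phi> x = \<Phi> y"
    moreover obtain p i p' i' where "x = (p, i)" "y = (p', i')" by (cases x, cases y)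
    ultimately have "c' p \<noteq> []" "c' p' \<noteq> []" "\<phi> p = \<phi> p'" "i = i'" by (auto simp: Jc_def \<Phi>_def)
    then show "x = y" using \<phi>(1) \<open>x = _\<close> \<open>y = _\<close> by (auto simp: bij_betw_def inj_on_def)
  next
    fix x assume "x \<in> Jc c"
    moreover obtain r i where x: "x = (r, i)" by (cases x)
    ultimately have r: "i < length (c r)" "c r \<noteq> []" by (auto simp: Jc_def)
    then have "r \<in> \<phi> ` ?I" using \<phi>(1) by (simp add: bij_betw_def)
    then obtain p where "c' p \<noteq> []" "r = \<phi> p" by blast
    then show "x \<in> \<Phi> ` Jc c'" using \<phi>(2) r x by (auto simp: Jc_def \<Phi>_def intro!: image_eqI[where x = "(p, i)"])
  next
    fix x assume "x \<in> \<Phi> ` Jc c'"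
    then obtain p i where x: "x = (\<phi> p, i)" "i < length (c' p)" by (auto simp: Jc_def \<Phi>_def)
    then have "c' p \<noteq> []" by auto
    then show "x \<in> Jc c" using \<phi>(2)[of p] x by (simp add: Jc_def)
  qed
  define v' where "v' j = v (\<Phi> j)" for j
  have gA: "gens n A (Jc c') (\<lambda>j. ec c (\<Phi> j)) v'" unfolding v'_def by (rule gens_reindex[OF g \<Phi>])
  have comb: "comb n B (Jc c') v' s = comb n A (Jc c') v' (\<lambda>j. pcompose (s j) f)" for s
    unfolding B_def using gens_Vn[OF gA] by (intro sum.cong) (auto simp: act_mpoly[OF A])
  have zero: "comb n B (Jc c') v' s = 0 \<longleftrightarrow> (\<forall>j\<in>Jc c'. ec c' j dvd s j)" for s
  proof -
    have "ec c (\<Phi> j) dvd pcompose (s j) f \<longleftrightarrow> ec c' j dvd s j" if "j \<in> Jc c'" for j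
    proof -
      obtain p i where j: "j = (p, i)" by (cases j)
      have p: "c' p \<noteq> []" "i < length (c' p)" using that j by (auto simp: Jc_def)
      show ?thesis using val[OF p(1), of "c' p ! i" "s j"] M[of p i] that \<phi>(2)[OF p(1)] by (simp add: j \<Phi>_def ec_def)
    qed
    then show ?thesis unfolding comb gens_zero[OF gA] by blast
  qed
  have VB: "comb n B (Jc c') v' s \<in> Vn n" for s by (rule comb_Vn) (rule gens_Vn[OF gA])
  define T where "T = (\<Pi>\<^sub>E j\<in>Jc c'. Pd (degree (ec c' j)) :: 'k poly set)"
  have "inj_on (comb n B (Jc c') v') T"
  proof (rule inj_onI)
    fix s s' assume s: "s \<in> T" "s' \<in> T" and eq: "comb n B (Jc c') v' s = comb n B (Jc c') v' s'"
    have "comb n B (Jc c') v' (\<lambda>j. s j - s' j) = 0" unfolding comb_diff using eq by simp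
    then have d: "\<forall>j\<in>Jc c'. ec c' j dvd s j - s' j" unfolding zero .
    show "s = s'"
    proof (rule PiE_ext[OF s[unfolded T_def]])
      fix j assume j: "j \<in> Jc c'"
      have "s j - s' j = 0"
        by (rule monic_dvd_small[OF ec_monic[OF c(2) j]]) (use d j s in \<open>auto simp: T_def intro: Pd_diff\<close>)
      then show "s j = s' j" by simp
    qed
  qed
  then have "card (comb n B (Jc c') v' ` T) = card T" by (rule card_image)
  also have "card T = card (UNIV :: 'k set) ^ n"
    unfolding T_def using class_functions_dim[OF c(2)] by (simp add: card_PiE Jc_finite[OF c(2)] card_Pd flip: power_sum)
  finally have "card (comb n B (Jc c') v' ` T) = card (Vn n :: (nat \<Rightarrow> 'k) set)" by (simp add: card_Vn)
  then have "comb n B (Jc c') v' ` T = Vn n" using VB by (intro card_subset_eq finite_Vn) auto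
  then have rng: "Vn n = range (comb n B (Jc c') v')" using VB by blast
  have gB: "gens n B (Jc c') (ec c') v'"
    unfolding gens_def cyclic_sum_def using Jc_finite[OF c(2)] rng zero by blast
  have sub: "cent n A \<subseteq> cent n B" using cent_mpoly[OF A] by (auto simp: B_def)
  have cards: "card (cent n A) = card (cent n B)"
    unfolding cent_def centralizer_dim[OF A c(1) g] centralizer_dim[OF B c(2) gB] same_type_dim[OF cc] ..
  have cent: "cent n A = cent n B" by (rule card_subset_eq[OF cent_finite sub cards])
  have fin: "finite (adrange n A)" by (simp add: adrange_def finite_carrier_mat)
  have "card (adrange n B) = card (adrange n A)"
    using card_adrange[OF A] card_adrange[OF B] cards cent_card_pos[OF A] by (metis mult_cancel2 neq0_conv)
  then have "adrange n B = adrange n A"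
    by (intro card_subset_eq fin) (use adrange_mpoly[OF A] in \<open>auto simp: B_def\<close>)
  then show ?thesis using that[OF B gB] cent by simp
qed

section \<open>The module of a matrix\<close>

text \<open>Passage from the type of vectors to the functions in \<open>Vn n\<close>.\<close>

definition fv :: "nat \<Rightarrow> 'a::comm_ring_1 vec \<Rightarrow> nat \<Rightarrow> 'a" where
  "fv n w = (\<lambda>i. if i < n then w $ i else 0)"

lemma fv_Vn: "fv n w \<in> Vn n" by (simp add: fv_def Vn_def)
lemma vec_fv: "w \<in> carrier_vec n \<Longrightarrow> vec n (fv n w) = w" by (intro eq_vecI) (auto simp: fv_def)
lemma fv_vec: "v \<in> Vn n \<Longrightarrow> fv n (vec n v) = v" by (auto simp: fv_def Vn_def fun_eq_iff)
lemma fv_inj: "w \<in> carrier_vec n \<Longrightarrow> w' \<in> carrier_vec n \<Longrightarrow> fv n w = fv n w' \<Longrightarrow> w = w'"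
  using vec_fv by metis
lemma fv_add: "w \<in> carrier_vec n \<Longrightarrow> w' \<in> carrier_vec n \<Longrightarrow> fv n (w + w') = fv n w + fv n w'"
  by (simp add: fv_def fun_eq_iff)
lemma fv_smult: "w \<in> carrier_vec n \<Longrightarrow> fv n (a \<cdot>\<^sub>v w) = (\<lambda>i. a * fv n w i)"
  by (simp add: fv_def fun_eq_iff)
lemma fv_mult: "X \<in> carrier_mat n n \<Longrightarrow> w \<in> carrier_vec n \<Longrightarrow> fv n (X *\<^sub>v w) = mop n X (fv n w)"
  by (auto simp: fv_def mop_def fun_eq_iff scalar_prod_def atLeast0LessThan intro!: sum.cong)

lemma mat_vec_eqI:
  fixes X Y :: "'a::comm_ring_1 mat"
  assumes "X \<in> carrier_mat n n" "Y \<in> carrier_mat n n" "\<And>v. v \<in> carrier_vec n \<Longrightarrow> X *\<^sub>v v = Y *\<^sub>v v"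
  shows "X = Y"
proof (rule mop_eqI[OF assms(1,2)])
  fix v :: "nat \<Rightarrow> 'a" assume v: "v \<in> Vn n"
  have "mop n X (fv n (vec n v)) = mop n Y (fv n (vec n v))"
    using assms(3)[of "vec n v"] fv_mult[OF assms(1), of "vec n v"] fv_mult[OF assms(2), of "vec n v"] by simp
  then show "mop n X v = mop n Y v" by (simp add: fv_vec v)
qed

lemma linear_vec_mat:
  fixes g :: "'a::comm_ring_1 vec \<Rightarrow> 'a vec"
  assumes maps: "\<And>v. v \<in> carrier_vec n \<Longrightarrow> g v \<in> carrier_vec n"
    and add: "\<And>v w. v \<in> carrier_vec n \<Longrightarrow> w \<in> carrier_vec n \<Longrightarrow> g (v + w) = g v + g w"
    and scale: "\<And>a v. v \<in> carrier_vec n \<Longrightarrow> g (a \<cdot>\<^sub>v v) = a \<cdot>\<^sub>v g v"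
  obtains X where "X \<in> carrier_mat n n" "\<And>v. v \<in> carrier_vec n \<Longrightarrow> X *\<^sub>v v = g v"
proof (rule linear_map_mop[of n "\<lambda>v. fv n (g (vec n v))"])
  fix v w :: "nat \<Rightarrow> 'a"
  have "vec n (v + w) = vec n v + vec n w" by (intro eq_vecI) auto
  then show "fv n (g (vec n (v + w))) = fv n (g (vec n v)) + fv n (g (vec n w))"
    by (simp add: add fv_add maps)
next
  fix a and v :: "nat \<Rightarrow> 'a"
  have "vec n (\<lambda>i. a * v i) = a \<cdot>\<^sub>v vec n v" by (intro eq_vecI) auto
  then show "fv n (g (vec n (\<lambda>i. a * v i))) = (\<lambda>i. a * fv n (g (vec n v)) i)"
    by (simp add: scale fv_smult maps)
next
  fix X :: "'a mat" assume X: "X \<in> carrier_mat n n" "\<And>v. v \<in> Vn n \<Longrightarrow> mop n X v = fv n (g (vec n v))"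
  have "X *\<^sub>v v = g v" if v: "v \<in> carrier_vec n" for v
  proof (rule fv_inj[of _ n])
    show "fv n (X *\<^sub>v v) = fv n (g v)" using X(2)[OF fv_Vn] by (simp add: fv_mult[OF X(1) v] vec_fv v)
  qed (use X v maps in auto)
  then show thesis using X(1) that by blast
qed (rule fv_Vn)

lemma pow_mat_commute: "A \<in> carrier_mat n n \<Longrightarrow> A * A ^\<^sub>m k = A ^\<^sub>m k * A" for A :: "'a::comm_ring_1 mat"
proof (induction k)
  case (Suc k)
  have "A * (A ^\<^sub>m k * A) = A * A ^\<^sub>m k * A"
    by (rule assoc_mult_mat[symmetric]) (use Suc.prems in auto)
  then show ?case using Suc by simp
qed simp

lemma mpoly_index:
  fixes A :: "'a::comm_ring_1 mat"
  assumes A: "A \<in> carrier_mat n n" and ij: "i < n" "j < n" and m: "degree f < m"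
  shows "mpoly n A f $$ (i, j) = (\<Sum>k<m. coeff f k * (A ^\<^sub>m k) $$ (i, j))"
  using ij m
proof (induction f arbitrary: m i j)
  case 0 then show ?case by simp
next
  case (pCons a f)
  then obtain m' where m: "m = Suc m'" by (cases m) auto
  have IH: "mpoly n A f $$ (l, j) = (\<Sum>k<m'. coeff f k * (A ^\<^sub>m k) $$ (l, j))" if "l < n" for l
  proof (cases "f = 0")
    case True then show ?thesis using that pCons.prems by simp
  next
    case False
    then show ?thesis using pCons.IH[OF that pCons.prems(2), of m'] pCons.prems(3) m by simp
  qed
  have G: "mpoly n A f \<in> carrier_mat n n" using A by simp
  have "(A * mpoly n A f) $$ (i, j) = (\<Sum>l<n. A $$ (i, l) * mpoly n A f $$ (l, j))"
    using A pCons.prems(1,2) by (auto simp: scalar_prod_def atLeast0LessThan carrier_matD[OF G] intro!: sum.cong)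
  also have "\<dots> = (\<Sum>l<n. \<Sum>k<m'. coeff f k * (A $$ (i, l) * (A ^\<^sub>m k) $$ (l, j)))"
    by (intro sum.cong) (simp_all add: IH sum_distrib_left mult.left_commute)
  also have "\<dots> = (\<Sum>k<m'. coeff f k * (\<Sum>l<n. A $$ (i, l) * (A ^\<^sub>m k) $$ (l, j)))"
    by (subst sum.swap) (simp add: sum_distrib_left)
  also have "\<dots> = (\<Sum>k<m'. coeff f k * (A ^\<^sub>m Suc k) $$ (i, j))"
  proof (intro sum.cong refl)
    fix k
    have "(A * A ^\<^sub>m k) $$ (i, j) = (\<Sum>l<n. A $$ (i, l) * (A ^\<^sub>m k) $$ (l, j))"
      using A pCons.prems(1,2) by (auto simp: scalar_prod_def atLeast0LessThan intro!: sum.cong)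
    then show "coeff f k * (\<Sum>l<n. A $$ (i, l) * (A ^\<^sub>m k) $$ (l, j)) = coeff f k * (A ^\<^sub>m Suc k) $$ (i, j)"
      using pow_mat_commute[OF A, of k] by simp
  qed
  finally have AG: "(A * mpoly n A f) $$ (i, j) = (\<Sum>k<m'. coeff f k * (A ^\<^sub>m Suc k) $$ (i, j))" .
  have "mpoly n A (pCons a f) $$ (i, j) = a * (1\<^sub>m n) $$ (i, j) + (A * mpoly n A f) $$ (i, j)"
    using A pCons.prems(1,2) by (simp add: mpoly_pCons carrier_matD[OF G])
  also have "\<dots> = (\<Sum>k<m. coeff (pCons a f) k * (A ^\<^sub>m k) $$ (i, j))"
    unfolding AG m sum.lessThan_Suc_shift using A by simp
  finally show ?case .
qed

lemma mat_module_simps: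
  "carrier (mat_module n A) = carrier_vec n"
  "\<zero>\<^bsub>mat_module n A\<^esub> = 0\<^sub>v n"
  "v \<oplus>\<^bsub>mat_module n A\<^esub> w = v + w"
  by (simp_all add: mat_module_def)

text \<open>This replaces the defining sum over the powers of \<open>A\<close> by Horner's scheme.\<close>

lemma mat_module_smult:
  fixes A :: "'k::field mat"
  assumes A: "A \<in> carrier_mat n n" and v: "v \<in> carrier_vec n"
  shows "f \<odot>\<^bsub>mat_module n A\<^esub> v = mpoly n A f *\<^sub>v v"
proof (rule eq_vecI)
  have G: "mpoly n A f \<in> carrier_mat n n" using A by simp
  let ?F = "\<lambda>k. coeff f k \<cdot>\<^sub>v ((A ^\<^sub>m k) *\<^sub>v v)"
  have F: "?F \<in> {..degree f} \<rightarrow> carrier_vec n" using A v by (auto intro!: mult_mat_vec_carrier[of _ n n])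
  have s: "f \<odot>\<^bsub>mat_module n A\<^esub> v = finsum_vec TYPE('k) n ?F {..degree f}" by (simp add: mat_module_def)
  have "finsum_vec TYPE('k) n ?F {..degree f} \<in> carrier_vec n" by (rule finsum_vec_closed[OF F])
  then show "dim_vec (f \<odot>\<^bsub>mat_module n A\<^esub> v) = dim_vec (mpoly n A f *\<^sub>v v)" using G s by simp
  fix i assume "i < dim_vec (mpoly n A f *\<^sub>v v)"
  then have i: "i < n" using G by simp
  have "(f \<odot>\<^bsub>mat_module n A\<^esub> v) $ i = (\<Sum>k\<le>degree f. ?F k $ i)"
    unfolding s by (rule index_finsum_vec) (use i F in auto)
  also have "\<dots> = (\<Sum>k<Suc (degree f). \<Sum>j<n. coeff f k * (A ^\<^sub>m k) $$ (i, j) * v $ j)"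
    unfolding lessThan_Suc_atMost using A v i
    by (intro sum.cong) (auto simp: scalar_prod_def atLeast0LessThan sum_distrib_left mult.assoc)
  also have "\<dots> = (\<Sum>j<n. mpoly n A f $$ (i, j) * v $ j)"
  proof (subst sum.swap, rule sum.cong)
    fix j assume "j \<in> {..<n}"
    then have j: "j < n" by simp
    show "(\<Sum>k<Suc (degree f). coeff f k * (A ^\<^sub>m k) $$ (i, j) * v $ j) = mpoly n A f $$ (i, j) * v $ j"
      unfolding mpoly_index[OF A i j lessI] sum_distrib_right ..
  qed simp
  also have "\<dots> = (mpoly n A f *\<^sub>v v) $ i"
    using G v i by (simp add: scalar_prod_def atLeast0LessThan)
  finally show "(f \<odot>\<^bsub>mat_module n A\<^esub> v) $ i = (mpoly n A f *\<^sub>v v) $ i" .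
qed

lemma fv_smult_module:
  fixes A :: "'k::field mat"
  assumes A: "A \<in> carrier_mat n n" and v: "v \<in> carrier_vec n"
  shows "fv n (f \<odot>\<^bsub>mat_module n A\<^esub> v) = act (mop n A) f (fv n v)"
  using A v by (simp add: mat_module_smult fv_mult mop_mpoly fv_Vn)

lemma mat_module_smult_carrier:
  fixes A :: "'k::field mat"
  assumes A: "A \<in> carrier_mat n n" and v: "v \<in> carrier_vec n"
  shows "f \<odot>\<^bsub>mat_module n A\<^esub> v \<in> carrier_vec n"
  unfolding mat_module_smult[OF assms] using A v by (intro mult_mat_vec_carrier) auto

theorem mat_module_module:
  fixes A :: "'k::field mat"
  assumes A: "A \<in> carrier_mat n n"
  shows "Module.module class_ring (mat_module n A)"
proof (rule moduleI)
  show "cring (class_ring :: 'k poly ring)" by (rule class_cring.cring_axioms)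
  show "abelian_group (mat_module n A)"
  proof (rule abelian_groupI)
    fix x assume "x \<in> carrier (mat_module n A)"
    then show "\<exists>y\<in>carrier (mat_module n A). y \<oplus>\<^bsub>mat_module n A\<^esub> x = \<zero>\<^bsub>mat_module n A\<^esub>"
      by (intro bexI[of _ "- x"]) (auto simp: mat_module_simps)
  qed (auto simp: mat_module_simps comm_add_vec)
next
  note sc = mat_module_smult_carrier[OF A]
  note fs = fv_smult_module[OF A]
  note lin = mop_linop[of n A]
  fix a b :: "'k poly" and x y assume xy: "x \<in> carrier (mat_module n A)"
  then have x: "x \<in> carrier_vec n" by (simp add: mat_module_simps)
  show "a \<odot>\<^bsub>mat_module n A\<^esub> x \<in> carrier (mat_module n A)" using sc[OF x] by (simp add: mat_module_simps)
  have "(a + b) \<odot>\<^bsub>mat_module n A\<^esub> x = a \<odot>\<^bsub>mat_module n A\<^esub> x + b \<odot>\<^bsub>mat_module n A\<^esub> x"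
    by (rule fv_inj[of _ n]) (use x sc in \<open>simp_all add: fs fv_add act_add[OF lin]\<close>)
  then show "(a \<oplus>\<^bsub>class_ring\<^esub> b) \<odot>\<^bsub>mat_module n A\<^esub> x = a \<odot>\<^bsub>mat_module n A\<^esub> x \<oplus>\<^bsub>mat_module n A\<^esub> b \<odot>\<^bsub>mat_module n A\<^esub> x"
    by (simp add: mat_module_simps)
  have "(a * b) \<odot>\<^bsub>mat_module n A\<^esub> x = a \<odot>\<^bsub>mat_module n A\<^esub> (b \<odot>\<^bsub>mat_module n A\<^esub> x)"
    by (rule fv_inj[of _ n]) (use x sc in \<open>simp_all add: fs act_mult[OF lin]\<close>)
  then show "(a \<otimes>\<^bsub>class_ring\<^esub> b) \<odot>\<^bsub>mat_module n A\<^esub> x = a \<odot>\<^bsub>mat_module n A\<^esub> (b \<odot>\<^bsub>mat_module n A\<^esub> x)"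
    by simp
  have "1 \<odot>\<^bsub>mat_module n A\<^esub> x = x"
    by (rule fv_inj[of _ n]) (use x sc in \<open>simp_all add: fs act_1[OF lin]\<close>)
  then show "\<one>\<^bsub>class_ring\<^esub> \<odot>\<^bsub>mat_module n A\<^esub> x = x" by simp
  assume "y \<in> carrier (mat_module n A)"
  then have y: "y \<in> carrier_vec n" by (simp add: mat_module_simps)
  have "a \<odot>\<^bsub>mat_module n A\<^esub> (x + y) = a \<odot>\<^bsub>mat_module n A\<^esub> x + a \<odot>\<^bsub>mat_module n A\<^esub> y"
    by (rule fv_inj[of _ n]) (use x y sc in \<open>simp_all add: fs fv_add act_vec_add[OF lin]\<close>)
  then show "a \<odot>\<^bsub>mat_module n A\<^esub> (x \<oplus>\<^bsub>mat_module n A\<^esub> y) =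
      a \<odot>\<^bsub>mat_module n A\<^esub> x \<oplus>\<^bsub>mat_module n A\<^esub> a \<odot>\<^bsub>mat_module n A\<^esub> y"
    by (simp add: mat_module_simps)
qed

section \<open>Direct sums of cyclic modules\<close>

text \<open>The coset of \<open>a\<close> in \<open>k[t]/(e)\<close>.\<close>

definition qcos :: "'k::field poly \<Rightarrow> 'k poly \<Rightarrow> 'k poly set" where
  "qcos e a = (PIdl\<^bsub>class_ring\<^esub> e) +>\<^bsub>class_ring\<^esub> a"

lemma PIdl_ideal: "ideal (PIdl\<^bsub>class_ring\<^esub> e) (class_ring :: 'k::field poly ring)"
  by (rule cring.cgenideal_ideal[OF class_cring.cring_axioms]) simp

lemma qcos_eq_set: "qcos e a = {y. e dvd y - a}"
proof -
  have "y \<in> qcos e a \<longleftrightarrow> (\<exists>x. y = x * e + a)" for y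
    by (auto simp: qcos_def a_r_coset_def' cgenideal_def)
  moreover have "(\<exists>x. y = x * e + a) \<longleftrightarrow> e dvd y - a" for y
    by (auto simp: dvd_def algebra_simps diff_eq_eq)
  ultimately show ?thesis by auto
qed

lemma qcos_eq_iff: "qcos e a = qcos e b \<longleftrightarrow> e dvd a - b"
proof
  assume "qcos e a = qcos e b"
  moreover have "a \<in> qcos e a" by (simp add: qcos_eq_set)
  ultimately have "a \<in> qcos e b" by simp
  then show "e dvd a - b" by (simp add: qcos_eq_set)
next
  assume "e dvd a - b"
  then have "e dvd y - a \<longleftrightarrow> e dvd y - b" for y
    using dvd_add[of e "y - a" "a - b"] dvd_diff[of e "y - b" "a - b"] by auto
  then show "qcos e a = qcos e b" unfolding qcos_eq_set by blast
qed

lemma cyclic_ring_carrier: "carrier (cyclic_ring e) = range (qcos e)"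
  by (auto simp: cyclic_ring_def FactRing_def A_RCOSETS_def' qcos_def)

lemma qcos_add: "qcos e a \<oplus>\<^bsub>cyclic_ring e\<^esub> qcos e b = qcos e (a + b)"
  using ring_hom_add[OF ideal.rcos_ring_hom[OF PIdl_ideal], of a b e] by (simp add: cyclic_ring_def qcos_def)

lemma qcos_mult: "qcos e a \<otimes>\<^bsub>cyclic_ring e\<^esub> qcos e b = qcos e (a * b)"
  using ring_hom_mult[OF ideal.rcos_ring_hom[OF PIdl_ideal], of a b e] by (simp add: cyclic_ring_def qcos_def)

text \<open>The element of \<open>class_module c\<close> with the cosets of the \<open>f j\<close> as components.\<close>

definition fam :: "('k::field poly \<Rightarrow> nat list) \<Rightarrow> ('k poly \<times> nat \<Rightarrow> 'k poly) \<Rightarrow> 'k poly \<times> nat \<Rightarrow> 'k poly set" where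
  "fam c f = (\<lambda>j\<in>Jc c. qcos (ec c j) (f j))"

lemma class_module_alt:
  "class_module c = \<lparr>carrier = (\<Pi>\<^sub>E j\<in>Jc c. carrier (cyclic_ring (ec c j))), monoid.mult = undefined, one = undefined,
         zero = (\<lambda>j\<in>Jc c. \<zero>\<^bsub>cyclic_ring (ec c j)\<^esub>),
         add = (\<lambda>x y. \<lambda>j\<in>Jc c. x j \<oplus>\<^bsub>cyclic_ring (ec c j)\<^esub> y j),
         module.smult = (\<lambda>f x. \<lambda>j\<in>Jc c. qcos (ec c j) f \<otimes>\<^bsub>cyclic_ring (ec c j)\<^esub> x j)\<rparr>"
  unfolding class_module_def Let_def Jc_def ec_def qcos_def ..

lemma fam_carrier: "carrier (class_module c) = range (fam c)"
proof (intro subset_antisym subsetI)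
  fix x assume "x \<in> carrier (class_module c)"
  then have x: "x \<in> (\<Pi>\<^sub>E j\<in>Jc c. range (qcos (ec c j)))" by (simp add: class_module_alt cyclic_ring_carrier)
  then have "\<forall>j\<in>Jc c. \<exists>a. x j = qcos (ec c j) a" by blast
  then obtain f where f: "\<And>j. j \<in> Jc c \<Longrightarrow> x j = qcos (ec c j) (f j)" by metis
  have "x = fam c f"
    unfolding fam_def by (rule extensionalityI[of _ "Jc c"]) (use x f in \<open>auto simp: PiE_def\<close>)
  then show "x \<in> range (fam c)" by blast
qed (auto simp: fam_def class_module_alt cyclic_ring_carrier)

lemma fam_add: "fam c f \<oplus>\<^bsub>class_module c\<^esub> fam c g = fam c (\<lambda>j. f j + g j)"
  by (simp add: fam_def class_module_alt qcos_add cong: restrict_cong)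

lemma fam_smult: "p \<odot>\<^bsub>class_module c\<^esub> fam c f = fam c (\<lambda>j. p * f j)"
  by (simp add: fam_def class_module_alt qcos_mult cong: restrict_cong)

lemma fam_eq: "fam c f = fam c g \<longleftrightarrow> (\<forall>j\<in>Jc c. ec c j dvd f j - g j)"
  unfolding fam_def fun_eq_iff restrict_def qcos_eq_iff[symmetric] by auto

text \<open>An isomorphism corresponds to the images in \<open>k\<^sup>n\<close> of the standard generators of the direct sum.\<close>

theorem module_iso_iff_gens:
  fixes A :: "'k::field mat"
  assumes A: "A \<in> carrier_mat n n" and c: "c \<in> class_functions n"
  shows "module_iso class_ring (mat_module n A) (class_module c) \<longleftrightarrow> (\<exists>v. gens n A (Jc c) (ec c) v)"
proof
  assume "\<exists>v. gens n A (Jc c) (ec c) v"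
  then obtain v where g: "gens n A (Jc c) (ec c) v" ..
  let ?comb = "comb n A (Jc c) v"
  define h where "h w = fam c (SOME f. fv n w = ?comb f)" for w
  have h: "h w = fam c f" if "fv n w = ?comb f" for w f
  proof -
    have "fv n w = ?comb (SOME f. fv n w = ?comb f)" by (rule someI[of "\<lambda>f. fv n w = ?comb f", OF that])
    then have "?comb (SOME f. fv n w = ?comb f) = ?comb f" using that by (simp only:)
    then show ?thesis unfolding h_def fam_eq gens_eq_iff[OF g] .
  qed
  have ob: "\<exists>f. fv n w = ?comb f" for w using gens_obtain[OF g fv_Vn[of n w]] by metis
  have "h \<in> LinearCombinations.module_hom class_ring (mat_module n A) (class_module c)"
    unfolding LinearCombinations.module_hom_def
  proof (intro CollectI conjI allI impI funcsetI)
    fix w show "h w \<in> carrier (class_module c)" by (simp add: h_def fam_carrier)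
  next
    fix w w' assume "w \<in> carrier (mat_module n A) \<and> w' \<in> carrier (mat_module n A)"
    then have w: "w \<in> carrier_vec n" "w' \<in> carrier_vec n" by (auto simp: mat_module_simps)
    obtain f f' where f: "fv n w = ?comb f" "fv n w' = ?comb f'" using ob by metis
    have "fv n (w + w') = ?comb (\<lambda>j. f j + f' j)" using w f by (simp add: fv_add comb_add)
    then show "h (w \<oplus>\<^bsub>mat_module n A\<^esub> w') = h w \<oplus>\<^bsub>class_module c\<^esub> h w'"
      using h f by (simp add: fam_add mat_module_simps)
  next
    fix r :: "'k poly" and w assume "r \<in> carrier class_ring \<and> w \<in> carrier (mat_module n A)"
    then have w: "w \<in> carrier_vec n" by (auto simp: mat_module_simps)
    obtain f where f: "fv n w = ?comb f" using ob by metis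
    have "fv n (r \<odot>\<^bsub>mat_module n A\<^esub> w) = ?comb (\<lambda>j. r * f j)" unfolding comb_act fv_smult_module[OF A w] f ..
    then show "h (r \<odot>\<^bsub>mat_module n A\<^esub> w) = r \<odot>\<^bsub>class_module c\<^esub> h w"
      using h f by (simp add: fam_smult)
  qed
  moreover have "bij_betw h (carrier (mat_module n A)) (carrier (class_module c))"
    unfolding bij_betw_def
  proof (intro conjI inj_onI subset_antisym subsetI)
    fix w w' assume w: "w \<in> carrier (mat_module n A)" "w' \<in> carrier (mat_module n A)" "h w = h w'"
    obtain f f' where f: "fv n w = ?comb f" "fv n w' = ?comb f'" using ob by metis
    then have "?comb f = ?comb f'" using w(3) h unfolding gens_eq_iff[OF g] by (simp add: fam_eq)
    then show "w = w'" using w f fv_inj by (metis mat_module_simps(1))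
  next
    fix x assume "x \<in> carrier (class_module c)"
    then obtain f where x: "x = fam c f" by (auto simp: fam_carrier)
    have "?comb f \<in> Vn n" using g by (auto simp: gens_def cyclic_sum_def)
    then have "fv n (vec n (?comb f)) = ?comb f" by (rule fv_vec)
    then have "x = h (vec n (?comb f))" using h x by simp
    then show "x \<in> h ` carrier (mat_module n A)" by (auto simp: mat_module_simps)
  qed (auto simp: h_def fam_carrier)
  ultimately show "module_iso class_ring (mat_module n A) (class_module c)" unfolding module_iso_def by blast
next
  assume "module_iso class_ring (mat_module n A) (class_module c)"
  then obtain h where hom: "h \<in> LinearCombinations.module_hom class_ring (mat_module n A) (class_module c)"
    and bij: "bij_betw h (carrier_vec n) (carrier (class_module c))" by (auto simp: module_iso_def mat_module_simps)
  have h_add: "h (w + w') = h w \<oplus>\<^bsub>class_module c\<^esub> h w'" if "w \<in> carrier_vec n" "w' \<in> carrier_vec n" for w w'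
    using hom that by (auto simp: LinearCombinations.module_hom_def mat_module_simps)
  have h_smult: "h (r \<odot>\<^bsub>mat_module n A\<^esub> w) = r \<odot>\<^bsub>class_module c\<^esub> h w" if "w \<in> carrier_vec n" for r w
    using hom that by (auto simp: LinearCombinations.module_hom_def mat_module_simps)
  define k where "k = the_inv_into (carrier_vec n) h"
  have k: "k x \<in> carrier_vec n" "h (k x) = x" if "x \<in> range (fam c)" for x
    using that bij f_the_inv_into_f_bij_betw[OF bij, of x] the_inv_into_into[of h "carrier_vec n" x "carrier_vec n"]
    by (auto simp: k_def fam_carrier bij_betw_def)
  have kI: "k x = w" if "w \<in> carrier_vec n" "h w = x" for x w
    using that bij by (auto simp: k_def bij_betw_def the_inv_into_f_f)
  define G where "G f = fv n (k (fam c f))" for f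
  have G_add: "G (\<lambda>j. f j + f' j) = G f + G f'" for f f'
    unfolding G_def fv_add[OF k(1)[OF rangeI] k(1)[OF rangeI], symmetric]
    by (rule arg_cong[of _ _ "fv n"], rule kI) (simp_all add: k h_add fam_add)
  have G_act: "G (\<lambda>j. r * f j) = act (mop n A) r (G f)" for r f
    unfolding G_def fv_smult_module[OF A k(1)[OF rangeI], symmetric]
    by (rule arg_cong[of _ _ "fv n"], rule kI) (simp_all add: k h_smult fam_smult mat_module_smult_carrier[OF A])
  have G_cong: "G f = G f' \<longleftrightarrow> (\<forall>j\<in>Jc c. ec c j dvd f j - f' j)" for f f'
    unfolding G_def fam_eq[symmetric]
    using fv_inj[of _ n] k by (metis rangeI)
  have G_0: "G (\<lambda>j. 0) = 0" using G_add[of "\<lambda>j. 0" "\<lambda>j. 0"] by simp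
  define v where "v j = G (\<lambda>l. if l = j then 1 else 0)" for j
  have fin: "finite (Jc c)" by (rule Jc_finite[OF c])
  have part: "G (\<lambda>j. if j \<in> K then f j else 0) = comb n A K v f" if "finite K" for K f
    using that
  proof (induction K)
    case empty then show ?case by (simp add: G_0)
  next
    case (insert x K)
    have e: "(\<lambda>j. if j \<in> insert x K then f j else 0) = (\<lambda>j. f x * (if j = x then 1 else 0) + (if j \<in> K then f j else 0))"
      using insert(2) by (auto simp: fun_eq_iff)
    show ?case unfolding e G_add G_act insert(3) sum.insert[OF insert(1,2)] v_def ..
  qed
  have comb: "comb n A (Jc c) v f = G f" for f
    unfolding part[OF fin, symmetric] G_cong by simp
  have "gens n A (Jc c) (ec c) v"
    unfolding gens_def cyclic_sum_def comb
  proof (intro conjI allI subset_antisym subsetI)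
    fix f show "G f = 0 \<longleftrightarrow> (\<forall>j\<in>Jc c. ec c j dvd f j)" using G_cong[of f "\<lambda>j. 0"] by (simp add: G_0)
  next
    fix u :: "nat \<Rightarrow> 'k" assume u: "u \<in> Vn n"
    have "h (vec n u) \<in> carrier (class_module c)" using bij by (auto simp: bij_betw_def)
    then obtain f where f: "h (vec n u) = fam c f" by (auto simp: fam_carrier)
    then have "k (fam c f) = vec n u" by (intro kI) auto
    then have "u = G f" by (simp add: G_def fv_vec u)
    then show "u \<in> range G" by blast
  qed (auto simp: fin G_def fv_Vn)
  then show "\<exists>v. gens n A (Jc c) (ec c) v" by blast
qed

section \<open>Extensions as block matrices\<close>

lemma mpoly_const: "A \<in> carrier_mat n n \<Longrightarrow> mpoly n A [:a:] = a \<cdot>\<^sub>m 1\<^sub>m n"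
  by (auto simp: mpoly_pCons intro!: eq_matI)

lemma mpoly_X: "A \<in> carrier_mat n n \<Longrightarrow> mpoly n A [:0, 1:] = A"
proof -
  assume A: "A \<in> carrier_mat n n"
  have "mpoly n A [:1:] = 1 \<cdot>\<^sub>m 1\<^sub>m n" by (rule mpoly_const[OF A])
  also have "\<dots> = 1\<^sub>m n" by (intro eq_matI) auto
  finally show ?thesis using A by (subst mpoly_pCons[OF A]) (auto intro!: eq_matI)
qed

lemma mat_module_const:
  fixes A :: "'k::field mat"
  assumes "A \<in> carrier_mat n n" "v \<in> carrier_vec n"
  shows "[:a:] \<odot>\<^bsub>mat_module n A\<^esub> v = a \<cdot>\<^sub>v v"
  by (rule fv_inj[of _ n]) (use assms in \<open>simp_all add: mat_module_smult_carrier fv_smult_module act_const[OF mop_linop] fv_smult\<close>)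

lemma mat_module_X:
  fixes A :: "'k::field mat"
  assumes "A \<in> carrier_mat n n" "v \<in> carrier_vec n"
  shows "[:0, 1:] \<odot>\<^bsub>mat_module n A\<^esub> v = A *\<^sub>v v"
  using assms by (simp add: mat_module_smult mpoly_X)

text \<open>Linearity over \<open>k[t]\<close> need only be checked for constants and for \<open>t\<close>.\<close>

lemma module_hom_poly:
  fixes E :: "('k::field poly, 'a) module" and E' :: "('k poly, 'b) module"
  assumes "Module.module class_ring E" "Module.module class_ring E'"
    and maps: "\<And>x. x \<in> carrier E \<Longrightarrow> \<phi> x \<in> carrier E'"
    and add: "\<And>x y. x \<in> carrier E \<Longrightarrow> y \<in> carrier E \<Longrightarrow> \<phi> (x \<oplus>\<^bsub>E\<^esub> y) = \<phi> x \<oplus>\<^bsub>E'\<^esub> \<phi> y"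
    and const: "\<And>a x. x \<in> carrier E \<Longrightarrow> \<phi> ([:a:] \<odot>\<^bsub>E\<^esub> x) = [:a:] \<odot>\<^bsub>E'\<^esub> \<phi> x"
    and X: "\<And>x. x \<in> carrier E \<Longrightarrow> \<phi> ([:0, 1:] \<odot>\<^bsub>E\<^esub> x) = [:0, 1:] \<odot>\<^bsub>E'\<^esub> \<phi> x"
  shows "\<phi> \<in> LinearCombinations.module_hom class_ring E E'"
proof -
  interpret E: Module.module class_ring E by fact
  interpret E': Module.module class_ring E' by fact
  have "\<phi> (f \<odot>\<^bsub>E\<^esub> x) = f \<odot>\<^bsub>E'\<^esub> \<phi> x" if x: "x \<in> carrier E" for f x
  proof (induction f)
    case 0
    then show ?case using const[OF x, of 0] by simp
  next
    case (pCons a f)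
    have e: "pCons a f = [:a:] + [:0, 1:] * f" by simp
    have fx: "f \<odot>\<^bsub>E\<^esub> x \<in> carrier E" using E.smult_closed[of f x] x by simp
    have l: "pCons a f \<odot>\<^bsub>E\<^esub> x = [:a:] \<odot>\<^bsub>E\<^esub> x \<oplus>\<^bsub>E\<^esub> [:0, 1:] \<odot>\<^bsub>E\<^esub> (f \<odot>\<^bsub>E\<^esub> x)"
      unfolding e using E.smult_l_distr[of "[:a:]" "[:0, 1:] * f" x] E.smult_assoc1[of "[:0, 1:]" f x] x by simp
    have r: "pCons a f \<odot>\<^bsub>E'\<^esub> \<phi> x = [:a:] \<odot>\<^bsub>E'\<^esub> \<phi> x \<oplus>\<^bsub>E'\<^esub> [:0, 1:] \<odot>\<^bsub>E'\<^esub> (f \<odot>\<^bsub>E'\<^esub> \<phi> x)"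
      unfolding e using E'.smult_l_distr[of "[:a:]" "[:0, 1:] * f" "\<phi> x"] E'.smult_assoc1[of "[:0, 1:]" f "\<phi> x"] maps[OF x] by simp
    have c: "[:a:] \<odot>\<^bsub>E\<^esub> x \<in> carrier E" "[:0, 1:] \<odot>\<^bsub>E\<^esub> (f \<odot>\<^bsub>E\<^esub> x) \<in> carrier E"
      using E.smult_closed[of "[:a:]" x] E.smult_closed[of "[:0, 1:]" "f \<odot>\<^bsub>E\<^esub> x"] x fx by simp_all
    show ?case unfolding l r add[OF c] const[OF x] X[OF fx] pCons.IH ..
  qed
  then show ?thesis using maps add by (auto simp: LinearCombinations.module_hom_def)
qed

lemma smult_zero_vec': "a \<cdot>\<^sub>v 0\<^sub>v n = (0\<^sub>v n :: 'a::comm_ring_1 vec)"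
  by (intro eq_vecI) auto

lemma module_homD:
  assumes "h \<in> LinearCombinations.module_hom (class_ring :: 'r::comm_ring_1 ring) M N"
  shows "\<And>x. x \<in> carrier M \<Longrightarrow> h x \<in> carrier N"
    "\<And>x y. x \<in> carrier M \<Longrightarrow> y \<in> carrier M \<Longrightarrow> h (x \<oplus>\<^bsub>M\<^esub> y) = h x \<oplus>\<^bsub>N\<^esub> h y"
    "\<And>r x. x \<in> carrier M \<Longrightarrow> h (r \<odot>\<^bsub>M\<^esub> x) = r \<odot>\<^bsub>N\<^esub> h x"
  using assms by (auto simp: LinearCombinations.module_hom_def)

text \<open>\<open>\<tau>\<close> identifies the middle term with \<open>k\<^sup>n \<oplus> k\<^sup>n\<close> such that the maps of the extension become the inclusion of the second
  summand and the projection to the first, and \<open>t\<close> acts by the block matrix with rows \<open>(A, 0)\<close> and \<open>(D, A)\<close>.\<close>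

definition block_iso :: "nat \<Rightarrow> 'k::field mat \<Rightarrow> 'k mat \<Rightarrow> ('k poly, 'k vec, 'k vec) extension \<Rightarrow>
    ('k vec \<times> 'k vec \<Rightarrow> 'k vec \<times> 'k vec) \<Rightarrow> bool" where
  "block_iso n A D x \<tau> = (case x of (E, i, s) \<Rightarrow>
     bij_betw \<tau> (carrier_vec n \<times> carrier_vec n) (carrier E) \<and>
     (\<forall>v\<in>carrier_vec n. \<forall>w\<in>carrier_vec n. \<forall>v'\<in>carrier_vec n. \<forall>w'\<in>carrier_vec n.
        \<tau> (v + v', w + w') = \<tau> (v, w) \<oplus>\<^bsub>E\<^esub> \<tau> (v', w')) \<and>
     (\<forall>a. \<forall>v\<in>carrier_vec n. \<forall>w\<in>carrier_vec n. [:a:] \<odot>\<^bsub>E\<^esub> \<tau> (v, w) = \<tau> (a \<cdot>\<^sub>v v, a \<cdot>\<^sub>v w)) \<and>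
     (\<forall>v\<in>carrier_vec n. \<forall>w\<in>carrier_vec n. [:0, 1:] \<odot>\<^bsub>E\<^esub> \<tau> (v, w) = \<tau> (A *\<^sub>v v, D *\<^sub>v v + A *\<^sub>v w)) \<and>
     (\<forall>w\<in>carrier_vec n. i w = \<tau> (0\<^sub>v n, w)) \<and>
     (\<forall>v\<in>carrier_vec n. \<forall>w\<in>carrier_vec n. s (\<tau> (v, w)) = v))"

definition ext_rep :: "nat \<Rightarrow> 'k::field mat \<Rightarrow> ('k poly, 'k vec, 'k vec) extension \<Rightarrow> 'k mat \<Rightarrow> bool" where
  "ext_rep n A x D \<longleftrightarrow> D \<in> carrier_mat n n \<and> (\<exists>\<tau>. block_iso n A D x \<tau>)"

abbreviation exts :: "nat \<Rightarrow> 'k::field mat \<Rightarrow> ('k poly, 'k vec, 'k vec) extension set" where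
  "exts n A \<equiv> extensions class_ring (mat_module n A) (mat_module n A)"

lemma extensionsD:
  assumes "(E, i, s) \<in> exts n A"
  shows "Module.module class_ring E"
    "\<And>w. w \<in> carrier_vec n \<Longrightarrow> i w \<in> carrier E"
    "\<And>w w'. w \<in> carrier_vec n \<Longrightarrow> w' \<in> carrier_vec n \<Longrightarrow> i (w + w') = i w \<oplus>\<^bsub>E\<^esub> i w'"
    "\<And>f w. w \<in> carrier_vec n \<Longrightarrow> i (f \<odot>\<^bsub>mat_module n A\<^esub> w) = f \<odot>\<^bsub>E\<^esub> i w"
    "\<And>x. x \<in> carrier E \<Longrightarrow> s x \<in> carrier_vec n"
    "\<And>x y. x \<in> carrier E \<Longrightarrow> y \<in> carrier E \<Longrightarrow> s (x \<oplus>\<^bsub>E\<^esub> y) = s x + s y"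
    "\<And>f x. x \<in> carrier E \<Longrightarrow> s (f \<odot>\<^bsub>E\<^esub> x) = f \<odot>\<^bsub>mat_module n A\<^esub> s x"
    "inj_on i (carrier_vec n)" "i ` carrier_vec n = {e \<in> carrier E. s e = 0\<^sub>v n}"
    "s ` carrier E = carrier_vec n"
  using assms by (auto simp: extensions_def LinearCombinations.module_hom_def mat_module_simps)

lemma (in abelian_group) add_swap_middle:
  assumes "a \<in> carrier G" "b \<in> carrier G" "c \<in> carrier G" "d \<in> carrier G"
  shows "(a \<oplus> b) \<oplus> (c \<oplus> d) = (a \<oplus> c) \<oplus> (b \<oplus> d)"
  using assms by (simp add: a_ac)

text \<open>The section is determined by preimages of the unit vectors; the induction adds one coordinate at a time.\<close>

lemma linear_section:
  fixes A :: "'k::field mat"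
  assumes A: "A \<in> carrier_mat n n" and x: "(E, i, s) \<in> exts n A"
  obtains \<sigma> where "\<And>v. v \<in> carrier_vec n \<Longrightarrow> \<sigma> v \<in> carrier E" "\<And>v. v \<in> carrier_vec n \<Longrightarrow> s (\<sigma> v) = v"
    "\<And>v w. v \<in> carrier_vec n \<Longrightarrow> w \<in> carrier_vec n \<Longrightarrow> \<sigma> (v + w) = \<sigma> v \<oplus>\<^bsub>E\<^esub> \<sigma> w"
    "\<And>a v. v \<in> carrier_vec n \<Longrightarrow> \<sigma> (a \<cdot>\<^sub>v v) = [:a:] \<odot>\<^bsub>E\<^esub> \<sigma> v"
proof -
  note x = extensionsD[OF x]
  interpret E: Module.module class_ring E by (rule x(1))
  have sm: "f \<odot>\<^bsub>E\<^esub> e \<in> carrier E" if "e \<in> carrier E" for f e using E.smult_closed[of f e] that by simp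
  have "\<exists>b. b \<in> carrier E \<and> s b = unit_vec n j" for j
  proof -
    have "unit_vec n j \<in> s ` carrier E" unfolding x(10) by simp
    then show ?thesis by (metis imageE)
  qed
  then obtain b where b: "\<And>j. b j \<in> carrier E" "\<And>j. s (b j) = unit_vec n j" by metis
  have "\<exists>\<sigma>. (\<forall>v\<in>carrier_vec n. \<sigma> v \<in> carrier E \<and> s (\<sigma> v) = vec n (\<lambda>i. if i < m then v $ i else 0)) \<and>
      (\<forall>v\<in>carrier_vec n. \<forall>w\<in>carrier_vec n. \<sigma> (v + w) = \<sigma> v \<oplus>\<^bsub>E\<^esub> \<sigma> w) \<and>
      (\<forall>a. \<forall>v\<in>carrier_vec n. \<sigma> (a \<cdot>\<^sub>v v) = [:a:] \<odot>\<^bsub>E\<^esub> \<sigma> v)" if "m \<le> n" for m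
    using that
  proof (induction m)
    case 0
    have z: "\<zero>\<^bsub>E\<^esub> \<in> carrier E" by simp
    have "s \<zero>\<^bsub>E\<^esub> = s ([:0:] \<odot>\<^bsub>E\<^esub> \<zero>\<^bsub>E\<^esub>)" using E.smult_r_null[of "[:0:]"] by simp
    also have "\<dots> = [:0:] \<odot>\<^bsub>mat_module n A\<^esub> s \<zero>\<^bsub>E\<^esub>" by (rule x(7)[OF z])
    also have "\<dots> = 0 \<cdot>\<^sub>v s \<zero>\<^bsub>E\<^esub>" by (rule mat_module_const[OF A x(5)[OF z]])
    also have "\<dots> = 0\<^sub>v n" using x(5)[OF z] by (intro eq_vecI) auto
    finally have s0: "s \<zero>\<^bsub>E\<^esub> = 0\<^sub>v n" .
    have "vec n (\<lambda>i. if i < 0 then v $ i else 0) = 0\<^sub>v n" for v :: "'k vec" by (intro eq_vecI) auto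
    moreover have "[:a:] \<odot>\<^bsub>E\<^esub> \<zero>\<^bsub>E\<^esub> = \<zero>\<^bsub>E\<^esub>" for a using E.smult_r_null[of "[:a:]"] by simp
    ultimately show ?case using s0 by (intro exI[of _ "\<lambda>v. \<zero>\<^bsub>E\<^esub>"]) auto
  next
    case (Suc m)
    then obtain \<sigma> where \<sigma>0: "(\<forall>v\<in>carrier_vec n. \<sigma> v \<in> carrier E \<and> s (\<sigma> v) = vec n (\<lambda>i. if i < m then v $ i else 0)) \<and>
      (\<forall>v\<in>carrier_vec n. \<forall>w\<in>carrier_vec n. \<sigma> (v + w) = \<sigma> v \<oplus>\<^bsub>E\<^esub> \<sigma> w) \<and>
      (\<forall>a. \<forall>v\<in>carrier_vec n. \<sigma> (a \<cdot>\<^sub>v v) = [:a:] \<odot>\<^bsub>E\<^esub> \<sigma> v)" using Suc_leD by blast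
    then have \<sigma>: "\<And>v. v \<in> carrier_vec n \<Longrightarrow> \<sigma> v \<in> carrier E"
      "\<And>v. v \<in> carrier_vec n \<Longrightarrow> s (\<sigma> v) = vec n (\<lambda>i. if i < m then v $ i else 0)"
      "\<And>v w. v \<in> carrier_vec n \<Longrightarrow> w \<in> carrier_vec n \<Longrightarrow> \<sigma> (v + w) = \<sigma> v \<oplus>\<^bsub>E\<^esub> \<sigma> w"
      "\<And>a v. v \<in> carrier_vec n \<Longrightarrow> \<sigma> (a \<cdot>\<^sub>v v) = [:a:] \<odot>\<^bsub>E\<^esub> \<sigma> v" by auto
    define \<sigma>' where "\<sigma>' v = \<sigma> v \<oplus>\<^bsub>E\<^esub> [:v $ m:] \<odot>\<^bsub>E\<^esub> b m" for v
    have m: "m < n" using Suc.prems by simp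
    have 1: "\<sigma>' v \<in> carrier E \<and> s (\<sigma>' v) = vec n (\<lambda>i. if i < Suc m then v $ i else 0)" if v: "v \<in> carrier_vec n" for v
    proof
      show "\<sigma>' v \<in> carrier E" using \<sigma>(1)[OF v] sm[OF b(1)] by (simp add: \<sigma>'_def)
      have "s (\<sigma>' v) = vec n (\<lambda>i. if i < m then v $ i else 0) + v $ m \<cdot>\<^sub>v unit_vec n m"
        unfolding \<sigma>'_def x(6)[OF \<sigma>(1)[OF v] sm[OF b(1)]] \<sigma>(2)[OF v] x(7)[OF b(1)] b(2)
        by (simp add: mat_module_const[OF A])
      also have "\<dots> = vec n (\<lambda>i. if i < Suc m then v $ i else 0)"
        by (intro eq_vecI) (auto simp: unit_vec_def less_Suc_eq)
      finally show "s (\<sigma>' v) = vec n (\<lambda>i. if i < Suc m then v $ i else 0)" .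
    qed
    have 2: "\<sigma>' (v + w) = \<sigma>' v \<oplus>\<^bsub>E\<^esub> \<sigma>' w" if v: "v \<in> carrier_vec n" and w: "w \<in> carrier_vec n" for v w
    proof -
      have "[:(v + w) $ m:] \<odot>\<^bsub>E\<^esub> b m = [:v $ m:] \<odot>\<^bsub>E\<^esub> b m \<oplus>\<^bsub>E\<^esub> [:w $ m:] \<odot>\<^bsub>E\<^esub> b m"
        using E.smult_l_distr[of "[:v $ m:]" "[:w $ m:]" "b m"] b(1) m w by simp
      then show ?thesis unfolding \<sigma>'_def \<sigma>(3)[OF v w]
        using E.M.add_swap_middle[OF \<sigma>(1)[OF v] \<sigma>(1)[OF w] sm[OF b(1)] sm[OF b(1)]] by simp
    qed
    have 3: "\<sigma>' (a \<cdot>\<^sub>v v) = [:a:] \<odot>\<^bsub>E\<^esub> \<sigma>' v" if v: "v \<in> carrier_vec n" for a v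
    proof -
      have "[:(a \<cdot>\<^sub>v v) $ m:] \<odot>\<^bsub>E\<^esub> b m = [:a:] \<odot>\<^bsub>E\<^esub> ([:v $ m:] \<odot>\<^bsub>E\<^esub> b m)"
        using E.smult_assoc1[of "[:a:]" "[:v $ m:]" "b m"] b(1) m v by (simp add: mult.commute)
      then show ?thesis unfolding \<sigma>'_def \<sigma>(4)[OF v]
        using E.smult_r_distr[of "[:a:]" "\<sigma> v" "[:v $ m:] \<odot>\<^bsub>E\<^esub> b m"] \<sigma>(1)[OF v] sm[OF b(1)] by simp
    qed
    show ?case using 1 2 3 by blast
  qed
  from this[of n] obtain \<sigma> where \<sigma>0: "(\<forall>v\<in>carrier_vec n. \<sigma> v \<in> carrier E \<and> s (\<sigma> v) = vec n (\<lambda>i. if i < n then v $ i else 0)) \<and>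
      (\<forall>v\<in>carrier_vec n. \<forall>w\<in>carrier_vec n. \<sigma> (v + w) = \<sigma> v \<oplus>\<^bsub>E\<^esub> \<sigma> w) \<and>
      (\<forall>a. \<forall>v\<in>carrier_vec n. \<sigma> (a \<cdot>\<^sub>v v) = [:a:] \<odot>\<^bsub>E\<^esub> \<sigma> v)" by blast
  then have \<sigma>: "\<And>v. v \<in> carrier_vec n \<Longrightarrow> \<sigma> v \<in> carrier E"
      "\<And>v. v \<in> carrier_vec n \<Longrightarrow> s (\<sigma> v) = vec n (\<lambda>i. if i < n then v $ i else 0)"
      "\<And>v w. v \<in> carrier_vec n \<Longrightarrow> w \<in> carrier_vec n \<Longrightarrow> \<sigma> (v + w) = \<sigma> v \<oplus>\<^bsub>E\<^esub> \<sigma> w"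
      "\<And>a v. v \<in> carrier_vec n \<Longrightarrow> \<sigma> (a \<cdot>\<^sub>v v) = [:a:] \<odot>\<^bsub>E\<^esub> \<sigma> v" by auto
  have "vec n (\<lambda>i. if i < n then v $ i else 0) = v" if "v \<in> carrier_vec n" for v :: "'k vec"
    using that by (intro eq_vecI) auto
  then show ?thesis using that[of \<sigma>] \<sigma> by simp
qed

text \<open>For a \<open>k\<close>-linear section \<open>\<sigma>\<close>, the elements \<open>t \<sigma>(v) - \<sigma>(A v)\<close> lie in the kernel of the projection, hence
  are images of vectors that depend linearly on \<open>v\<close>.\<close>

theorem ext_rep_exists:
  fixes A :: "'k::field mat"
  assumes A: "A \<in> carrier_mat n n" and ex: "x \<in> exts n A"
  obtains D where "ext_rep n A x D"
proof -
  obtain E i s where xE: "x = (E, i, s)" by (cases x)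
  note x = extensionsD[OF ex[unfolded xE]]
  interpret E: Module.module class_ring E by (rule x(1))
  have sm: "f \<odot>\<^bsub>E\<^esub> e \<in> carrier E" if "e \<in> carrier E" for f e using E.smult_closed[of f e] that by simp
  obtain \<sigma> where \<sigma>: "\<And>v. v \<in> carrier_vec n \<Longrightarrow> \<sigma> v \<in> carrier E" "\<And>v. v \<in> carrier_vec n \<Longrightarrow> s (\<sigma> v) = v"
    "\<And>v w. v \<in> carrier_vec n \<Longrightarrow> w \<in> carrier_vec n \<Longrightarrow> \<sigma> (v + w) = \<sigma> v \<oplus>\<^bsub>E\<^esub> \<sigma> w"
    "\<And>a v. v \<in> carrier_vec n \<Longrightarrow> \<sigma> (a \<cdot>\<^sub>v v) = [:a:] \<odot>\<^bsub>E\<^esub> \<sigma> v"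
    by (rule linear_section[OF A ex[unfolded xE]]) (rule that)
  have Av: "A *\<^sub>v v \<in> carrier_vec n" if "v \<in> carrier_vec n" for v using A that by (rule mult_mat_vec_carrier)
  have i_X: "[:0, 1:] \<odot>\<^bsub>E\<^esub> i w = i (A *\<^sub>v w)" if "w \<in> carrier_vec n" for w
    using x(4)[OF that, of "[:0, 1:]"] mat_module_X[OF A that] by simp
  have i_const: "[:a:] \<odot>\<^bsub>E\<^esub> i w = i (a \<cdot>\<^sub>v w)" if "w \<in> carrier_vec n" for w a
    using x(4)[OF that, of "[:a:]"] mat_module_const[OF A that] by simp
  have s_i: "s (i w) = 0\<^sub>v n" if "w \<in> carrier_vec n" for w using x(9) that by blast
  have ker: "\<exists>w\<in>carrier_vec n. e = e' \<oplus>\<^bsub>E\<^esub> i w" if e: "e \<in> carrier E" "e' \<in> carrier E" "s e = s e'" for e e'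
  proof -
    define u where "u = e \<oplus>\<^bsub>E\<^esub> [:-1:] \<odot>\<^bsub>E\<^esub> e'"
    have u: "u \<in> carrier E" using e sm by (simp add: u_def)
    have "s u = s e + (-1) \<cdot>\<^sub>v s e'"
      unfolding u_def x(6)[OF e(1) sm[OF e(2)]] x(7)[OF e(2)] mat_module_const[OF A x(5)[OF e(2)]] ..
    also have "\<dots> = 0\<^sub>v n" using e(3) x(5)[OF e(2)] by (intro eq_vecI) auto
    finally obtain w where w: "w \<in> carrier_vec n" "u = i w" using u x(9) by blast
    have "[:-1:] \<odot>\<^bsub>E\<^esub> e' \<oplus>\<^bsub>E\<^esub> [:1:] \<odot>\<^bsub>E\<^esub> e' = \<zero>\<^bsub>E\<^esub>"
      using E.smult_l_distr[of "[:-1:]" "[:1:]" e'] E.smult_l_null[of e'] e by simp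
    moreover have "[:1:] \<odot>\<^bsub>E\<^esub> e' = e'" using E.smult_one[of e'] e by (simp add: one_pCons)
    ultimately have n: "[:-1:] \<odot>\<^bsub>E\<^esub> e' \<oplus>\<^bsub>E\<^esub> e' = \<zero>\<^bsub>E\<^esub>" by simp
    have "e' \<oplus>\<^bsub>E\<^esub> u = e \<oplus>\<^bsub>E\<^esub> ([:-1:] \<odot>\<^bsub>E\<^esub> e' \<oplus>\<^bsub>E\<^esub> e')"
      using e sm[OF e(2)] by (simp add: u_def E.M.a_ac)
    then have "e' \<oplus>\<^bsub>E\<^esub> u = e" using e by (simp add: n)
    then show ?thesis using w by auto
  qed
  have "\<exists>w\<in>carrier_vec n. [:0, 1:] \<odot>\<^bsub>E\<^esub> \<sigma> v = \<sigma> (A *\<^sub>v v) \<oplus>\<^bsub>E\<^esub> i w" if v: "v \<in> carrier_vec n" for v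
    using \<sigma>(1,2)[OF v] \<sigma>(1,2)[OF Av[OF v]] x(7)[OF \<sigma>(1)[OF v], of "[:0, 1:]"] mat_module_X[OF A v]
    by (intro ker sm) simp_all
  then obtain d where d: "\<And>v. v \<in> carrier_vec n \<Longrightarrow> d v \<in> carrier_vec n"
    "\<And>v. v \<in> carrier_vec n \<Longrightarrow> [:0, 1:] \<odot>\<^bsub>E\<^esub> \<sigma> v = \<sigma> (A *\<^sub>v v) \<oplus>\<^bsub>E\<^esub> i (d v)" by metis
  have i_inj: "w = w'" if "w \<in> carrier_vec n" "w' \<in> carrier_vec n" "e \<in> carrier E" "e \<oplus>\<^bsub>E\<^esub> i w = e \<oplus>\<^bsub>E\<^esub> i w'" for e w w'
    using that x(2,8) by (simp add: inj_on_eq_iff)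
  have d_add: "d (v + w) = d v + d w" if v: "v \<in> carrier_vec n" and w: "w \<in> carrier_vec n" for v w
  proof (rule i_inj)
    have "\<sigma> (A *\<^sub>v (v + w)) \<oplus>\<^bsub>E\<^esub> i (d (v + w)) = [:0, 1:] \<odot>\<^bsub>E\<^esub> \<sigma> (v + w)" using d(2)[of "v + w"] v w by simp
    also have "\<dots> = [:0, 1:] \<odot>\<^bsub>E\<^esub> \<sigma> v \<oplus>\<^bsub>E\<^esub> [:0, 1:] \<odot>\<^bsub>E\<^esub> \<sigma> w"
      unfolding \<sigma>(3)[OF v w] using E.smult_r_distr[of "[:0, 1:]" "\<sigma> v" "\<sigma> w"] \<sigma>(1) v w by simp
    also have "\<dots> = (\<sigma> (A *\<^sub>v v) \<oplus>\<^bsub>E\<^esub> \<sigma> (A *\<^sub>v w)) \<oplus>\<^bsub>E\<^esub> (i (d v) \<oplus>\<^bsub>E\<^esub> i (d w))"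
      unfolding d(2)[OF v] d(2)[OF w] by (rule E.M.add_swap_middle) (use \<sigma>(1) x(2) d(1) Av v w in auto)
    also have "\<dots> = \<sigma> (A *\<^sub>v (v + w)) \<oplus>\<^bsub>E\<^esub> i (d v + d w)"
      using \<sigma>(3)[OF Av[OF v] Av[OF w]] x(3)[OF d(1)[OF v] d(1)[OF w]] mult_add_distrib_mat_vec[OF A v w] by simp
    finally show "\<sigma> (A *\<^sub>v (v + w)) \<oplus>\<^bsub>E\<^esub> i (d (v + w)) = \<sigma> (A *\<^sub>v (v + w)) \<oplus>\<^bsub>E\<^esub> i (d v + d w)" .
  qed (use d(1) \<sigma>(1) Av v w in auto)
  have d_scale: "d (a \<cdot>\<^sub>v v) = a \<cdot>\<^sub>v d v" if v: "v \<in> carrier_vec n" for a v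
  proof (rule i_inj)
    have "\<sigma> (A *\<^sub>v (a \<cdot>\<^sub>v v)) \<oplus>\<^bsub>E\<^esub> i (d (a \<cdot>\<^sub>v v)) = [:0, 1:] \<odot>\<^bsub>E\<^esub> \<sigma> (a \<cdot>\<^sub>v v)" using d(2)[of "a \<cdot>\<^sub>v v"] v by simp
    also have "\<dots> = [:a:] \<odot>\<^bsub>E\<^esub> ([:0, 1:] \<odot>\<^bsub>E\<^esub> \<sigma> v)"
      unfolding \<sigma>(4)[OF v] using E.smult_assoc1[of "[:0, 1:]" "[:a:]" "\<sigma> v"] E.smult_assoc1[of "[:a:]" "[:0, 1:]" "\<sigma> v"] \<sigma>(1)[OF v]
      by (simp add: mult.commute)
    also have "\<dots> = [:a:] \<odot>\<^bsub>E\<^esub> \<sigma> (A *\<^sub>v v) \<oplus>\<^bsub>E\<^esub> [:a:] \<odot>\<^bsub>E\<^esub> i (d v)"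
      unfolding d(2)[OF v] using E.smult_r_distr[of "[:a:]" "\<sigma> (A *\<^sub>v v)" "i (d v)"] \<sigma>(1)[OF Av[OF v]] x(2)[OF d(1)[OF v]] by simp
    also have "\<dots> = \<sigma> (A *\<^sub>v (a \<cdot>\<^sub>v v)) \<oplus>\<^bsub>E\<^esub> i (a \<cdot>\<^sub>v d v)"
      using \<sigma>(4)[OF Av[OF v]] i_const[OF d(1)[OF v]] mult_mat_vec[OF A v] by simp
    finally show "\<sigma> (A *\<^sub>v (a \<cdot>\<^sub>v v)) \<oplus>\<^bsub>E\<^esub> i (d (a \<cdot>\<^sub>v v)) = \<sigma> (A *\<^sub>v (a \<cdot>\<^sub>v v)) \<oplus>\<^bsub>E\<^esub> i (a \<cdot>\<^sub>v d v)" .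
  qed (use d(1) \<sigma>(1) Av v in auto)
  obtain D where D: "D \<in> carrier_mat n n" "\<And>v. v \<in> carrier_vec n \<Longrightarrow> D *\<^sub>v v = d v"
    using linear_vec_mat[of n d, OF d(1) d_add d_scale] by blast
  define \<tau> where "\<tau> = (\<lambda>(v, w). \<sigma> v \<oplus>\<^bsub>E\<^esub> i w)"
  have s\<tau>: "s (\<tau> (v, w)) = v" if "v \<in> carrier_vec n" "w \<in> carrier_vec n" for v w
    using that \<sigma> x(2,6) s_i by (simp add: \<tau>_def)
  have bij: "bij_betw \<tau> (carrier_vec n \<times> carrier_vec n) (carrier E)"
    unfolding bij_betw_def
  proof (intro conjI inj_onI subset_antisym subsetI)
    fix p p' assume p: "p \<in> carrier_vec n \<times> carrier_vec n" "p' \<in> carrier_vec n \<times> carrier_vec n" "\<tau> p = \<tau> p'"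
    obtain v w v' w' where pp: "p = (v, w)" "p' = (v', w')" by (cases p, cases p')
    have vw: "v \<in> carrier_vec n" "w \<in> carrier_vec n" "v' \<in> carrier_vec n" "w' \<in> carrier_vec n" using p pp by auto
    have "v = v'" using s\<tau>[OF vw(1,2)] s\<tau>[OF vw(3,4)] p(3) pp by simp
    moreover have "w = w'"
      by (rule i_inj[OF vw(2,4) \<sigma>(1)[OF vw(1)]]) (use p(3) pp \<open>v = v'\<close> in \<open>simp add: \<tau>_def\<close>)
    ultimately show "p = p'" using pp by simp
  next
    fix e assume e: "e \<in> carrier E"
    obtain w where "w \<in> carrier_vec n" "e = \<sigma> (s e) \<oplus>\<^bsub>E\<^esub> i w"
      using ker[OF e \<sigma>(1)[OF x(5)[OF e]]] \<sigma>(2)[OF x(5)[OF e]] by auto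
    then have "e = \<tau> (s e, w)" "(s e, w) \<in> carrier_vec n \<times> carrier_vec n" using x(5)[OF e] by (auto simp: \<tau>_def)
    then show "e \<in> \<tau> ` (carrier_vec n \<times> carrier_vec n)" by (rule image_eqI)
  qed (use \<sigma>(1) x(2) in \<open>auto simp: \<tau>_def\<close>)
  have "block_iso n A D x \<tau>"
    unfolding block_iso_def xE prod.case
  proof (intro conjI ballI allI)
    show "bij_betw \<tau> (carrier_vec n \<times> carrier_vec n) (carrier E)" by (rule bij)
    fix v w :: "'k vec" assume v: "v \<in> carrier_vec n" and w: "w \<in> carrier_vec n"
    show "s (\<tau> (v, w)) = v" by (rule s\<tau>[OF v w])
    show "[:a:] \<odot>\<^bsub>E\<^esub> \<tau> (v, w) = \<tau> (a \<cdot>\<^sub>v v, a \<cdot>\<^sub>v w)" for a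
      using E.smult_r_distr[of "[:a:]" "\<sigma> v" "i w"] \<sigma>(1)[OF v] x(2)[OF w] \<sigma>(4)[OF v] i_const[OF w] by (simp add: \<tau>_def)
    have "[:0, 1:] \<odot>\<^bsub>E\<^esub> \<tau> (v, w) = (\<sigma> (A *\<^sub>v v) \<oplus>\<^bsub>E\<^esub> i (d v)) \<oplus>\<^bsub>E\<^esub> i (A *\<^sub>v w)"
      using E.smult_r_distr[of "[:0, 1:]" "\<sigma> v" "i w"] \<sigma>(1)[OF v] x(2)[OF w] d(2)[OF v] i_X[OF w] by (simp add: \<tau>_def)
    also have "\<dots> = \<sigma> (A *\<^sub>v v) \<oplus>\<^bsub>E\<^esub> i (d v + A *\<^sub>v w)"
      using x(3)[OF d(1)[OF v] Av[OF w]] \<sigma>(1)[OF Av[OF v]] x(2)[OF d(1)[OF v]] x(2)[OF Av[OF w]] by (simp add: E.M.a_assoc)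
    finally show "[:0, 1:] \<odot>\<^bsub>E\<^esub> \<tau> (v, w) = \<tau> (A *\<^sub>v v, D *\<^sub>v v + A *\<^sub>v w)" by (simp add: \<tau>_def D(2)[OF v])
    fix v' w' :: "'k vec" assume v': "v' \<in> carrier_vec n" and w': "w' \<in> carrier_vec n"
    show "\<tau> (v + v', w + w') = \<tau> (v, w) \<oplus>\<^bsub>E\<^esub> \<tau> (v', w')"
      using E.M.add_swap_middle[OF \<sigma>(1)[OF v] \<sigma>(1)[OF v'] x(2)[OF w] x(2)[OF w']] \<sigma>(3)[OF v v'] x(3)[OF w w']
      by (simp add: \<tau>_def)
  next
    fix w :: "'k vec" assume w: "w \<in> carrier_vec n"
    have "\<sigma> (0\<^sub>v n) = \<sigma> (0 \<cdot>\<^sub>v 0\<^sub>v n)" by (simp add: smult_zero_vec')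
    also have "\<dots> = \<zero>\<^bsub>E\<^esub>" using \<sigma>(4)[of "0\<^sub>v n" 0] E.smult_l_null[of "\<sigma> (0\<^sub>v n)"] \<sigma>(1)[of "0\<^sub>v n"] by simp
    finally show "i w = \<tau> (0\<^sub>v n, w)" using x(2)[OF w] by (simp add: \<tau>_def)
  qed
  then show ?thesis using D(1) that by (auto simp: ext_rep_def)
qed

lemma transport_module:
  fixes M :: "('a, 'm) module" and R :: "'a ring"
  assumes M: "Module.module R M" and bij: "bij_betw \<psi> S (carrier M)"
  defines "\<theta> \<equiv> the_inv_into S \<psi>"
  defines "N \<equiv> \<lparr>carrier = S, monoid.mult = undefined, one = undefined, zero = \<theta> \<zero>\<^bsub>M\<^esub>,
    add = (\<lambda>x y. \<theta> (\<psi> x \<oplus>\<^bsub>M\<^esub> \<psi> y)), module.smult = (\<lambda>a x. \<theta> (a \<odot>\<^bsub>M\<^esub> \<psi> x))\<rparr>"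
  shows "Module.module R N"
proof -
  interpret M: Module.module R M by fact
  have \<psi>: "\<psi> x \<in> carrier M" if "x \<in> S" for x using bij that by (auto simp: bij_betw_def)
  have \<theta>: "\<theta> y \<in> S" "\<psi> (\<theta> y) = y" if "y \<in> carrier M" for y
    using that bij f_the_inv_into_f_bij_betw[OF bij, of y] the_inv_into_into[of \<psi> S y S] by (auto simp: \<theta>_def bij_betw_def)
  have \<theta>\<psi>: "\<theta> (\<psi> x) = x" if "x \<in> S" for x using that bij by (auto simp: \<theta>_def bij_betw_def the_inv_into_f_f)
  show ?thesis
  proof (rule moduleI)
    show "cring R" by (rule M.R.is_cring)
    show "abelian_group N"
    proof (rule abelian_groupI)
      fix x assume "x \<in> carrier N"
      then have x: "x \<in> S" by (simp add: N_def)
      then have "\<theta> (\<ominus>\<^bsub>M\<^esub> \<psi> x) \<oplus>\<^bsub>N\<^esub> x = \<zero>\<^bsub>N\<^esub>" using \<psi> \<theta> by (simp add: N_def M.M.l_neg)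
      then show "\<exists>y\<in>carrier N. y \<oplus>\<^bsub>N\<^esub> x = \<zero>\<^bsub>N\<^esub>" using \<theta> \<psi> x by (intro bexI[of _ "\<theta> (\<ominus>\<^bsub>M\<^esub> \<psi> x)"]) (auto simp: N_def)
    qed (auto simp: N_def \<psi> \<theta> \<theta>\<psi> M.M.a_ac)
  qed (auto simp: N_def \<psi> \<theta> \<theta>\<psi> M.smult_l_distr M.smult_r_distr M.smult_assoc1)
qed

text \<open>The middle term is the module of the block matrix, transported to pairs of vectors.\<close>

theorem ext_exists_rep:
  fixes A D :: "'k::field mat"
  assumes A: "A \<in> carrier_mat n n" and D: "D \<in> carrier_mat n n"
  obtains x where "x \<in> exts n A" "ext_rep n A x D"
proof -
  define B where "B = four_block_mat A (0\<^sub>m n n) D A"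
  have B: "B \<in> carrier_mat (n + n) (n + n)" using A D by (simp add: B_def)
  have B_mult: "B *\<^sub>v (v @\<^sub>v w) = (A *\<^sub>v v) @\<^sub>v (D *\<^sub>v v + A *\<^sub>v w)" if v: "v \<in> carrier_vec n" and w: "w \<in> carrier_vec n" for v w
  proof -
    have "A *\<^sub>v v + 0\<^sub>m n n *\<^sub>v w = A *\<^sub>v v" using A v w by (intro eq_vecI) auto
    then show ?thesis unfolding B_def using four_block_mat_mult_vec[OF A zero_carrier_mat D A v w] by simp
  qed
  define M where "M = mat_module (n + n) B"
  have M: "Module.module class_ring M" unfolding M_def by (rule mat_module_module[OF B])
  let ?S = "carrier_vec n \<times> carrier_vec n :: ('k vec \<times> 'k vec) set"
  define \<psi> :: "'k vec \<times> 'k vec \<Rightarrow> 'k vec" where "\<psi> = (\<lambda>(v, w). v @\<^sub>v w)"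
  have bij: "bij_betw \<psi> ?S (carrier M)"
    by (rule bij_betwI[where g = "\<lambda>u. (vec_first u n, vec_last u n)"])
      (auto simp: \<psi>_def M_def mat_module_simps vec_first_def vec_last_def intro!: eq_vecI)
  define \<theta> where "\<theta> = the_inv_into ?S \<psi>"
  define E :: "('k poly, 'k vec \<times> 'k vec) module" where
    "E = \<lparr>carrier = ?S, monoid.mult = undefined, one = undefined, zero = \<theta> \<zero>\<^bsub>M\<^esub>,
      add = (\<lambda>x y. \<theta> (\<psi> x \<oplus>\<^bsub>M\<^esub> \<psi> y)), module.smult = (\<lambda>a x. \<theta> (a \<odot>\<^bsub>M\<^esub> \<psi> x))\<rparr>"
  have E: "Module.module class_ring E" unfolding E_def \<theta>_def by (rule transport_module[OF M bij])
  have \<theta>: "\<theta> (v @\<^sub>v w) = (v, w)" if "v \<in> carrier_vec n" "w \<in> carrier_vec n" for v w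
    unfolding \<theta>_def by (rule the_inv_into_f_eq) (use that bij in \<open>auto simp: \<psi>_def bij_betw_def\<close>)
  have car: "carrier E = ?S" by (simp add: E_def)
  have add: "(v, w) \<oplus>\<^bsub>E\<^esub> (v', w') = (v + v', w + w')"
    if "v \<in> carrier_vec n" "w \<in> carrier_vec n" "v' \<in> carrier_vec n" "w' \<in> carrier_vec n" for v w v' w'
  proof -
    have "(v @\<^sub>v w) + (v' @\<^sub>v w') = (v + v') @\<^sub>v (w + w')" using that by (intro eq_vecI) auto
    then show ?thesis using that \<theta>[of "v + v'" "w + w'"] by (simp add: E_def \<psi>_def M_def mat_module_simps)
  qed
  have const: "[:a:] \<odot>\<^bsub>E\<^esub> (v, w) = (a \<cdot>\<^sub>v v, a \<cdot>\<^sub>v w)"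
    if "v \<in> carrier_vec n" "w \<in> carrier_vec n" for a v w
  proof -
    have "a \<cdot>\<^sub>v (v @\<^sub>v w) = (a \<cdot>\<^sub>v v) @\<^sub>v (a \<cdot>\<^sub>v w)" using that by (intro eq_vecI) auto
    then show ?thesis using that \<theta>[of "a \<cdot>\<^sub>v v" "a \<cdot>\<^sub>v w"] mat_module_const[OF B, of "v @\<^sub>v w" a]
      by (simp add: E_def \<psi>_def M_def)
  qed
  have X: "[:0, 1:] \<odot>\<^bsub>E\<^esub> (v, w) = (A *\<^sub>v v, D *\<^sub>v v + A *\<^sub>v w)"
    if v: "v \<in> carrier_vec n" and w: "w \<in> carrier_vec n" for v w
  proof -
    have "A *\<^sub>v v \<in> carrier_vec n" "D *\<^sub>v v + A *\<^sub>v w \<in> carrier_vec n" using A D v w by auto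
    then show ?thesis using mat_module_X[OF B, of "v @\<^sub>v w"] v w \<theta>[of "A *\<^sub>v v" "D *\<^sub>v v + A *\<^sub>v w"]
      by (simp add: E_def \<psi>_def M_def B_mult)
  qed
  define i :: "'k vec \<Rightarrow> 'k vec \<times> 'k vec" where "i w = (0\<^sub>v n, w)" for w
  define s :: "'k vec \<times> 'k vec \<Rightarrow> 'k vec" where "s = fst"
  note MA = mat_module_module[OF A]
  have z: "A *\<^sub>v 0\<^sub>v n = 0\<^sub>v n" "D *\<^sub>v 0\<^sub>v n = 0\<^sub>v n" using A D by (auto intro!: eq_vecI)
  have Aw: "A *\<^sub>v w \<in> carrier_vec n" if "w \<in> carrier_vec n" for w using A that by (rule mult_mat_vec_carrier)
  have "i \<in> LinearCombinations.module_hom class_ring (mat_module n A) E"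
    by (rule module_hom_poly[OF MA E])
      (auto simp: i_def mat_module_simps car add const X mat_module_const[OF A] mat_module_X[OF A] z Aw)
  moreover have "s \<in> LinearCombinations.module_hom class_ring E (mat_module n A)"
    by (rule module_hom_poly[OF E MA])
      (auto simp: s_def mat_module_simps car add const X mat_module_const[OF A] mat_module_X[OF A])
  ultimately have "(E, i, s) \<in> exts n A"
    using E by (auto simp: extensions_def i_def s_def car mat_module_simps inj_on_def image_iff intro: zero_carrier_vec)
  moreover have "block_iso n A D (E, i, s) (\<lambda>p. p)"
    by (auto simp: block_iso_def car add const X i_def s_def bij_betw_def)
  ultimately show ?thesis using D by (intro that[of "(E, i, s)"]) (auto simp: ext_rep_def)
qed

lemma mat_eq_iff_index:
  assumes "X \<in> carrier_mat n m" "Y \<in> carrier_mat n m"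
  shows "X = Y \<longleftrightarrow> (\<forall>i<n. \<forall>j<m. X $$ (i, j) = Y $$ (i, j))"
  using assms by (auto intro!: eq_matI)

lemma sum_eq_iff_diff_eq:
  fixes a b c d :: "'a::comm_ring_1 mat"
  assumes "a \<in> carrier_mat n n" "b \<in> carrier_mat n n" "c \<in> carrier_mat n n" "d \<in> carrier_mat n n"
  shows "a + b = c + d \<longleftrightarrow> a - c = d - b"
proof -
  have "a + b = c + d \<longleftrightarrow> (\<forall>i<n. \<forall>j<n. a $$ (i,j) + b $$ (i,j) = c $$ (i,j) + d $$ (i,j))"
    using assms mat_eq_iff_index[of "a + b" n n "c + d"] by simp
  also have "\<dots> \<longleftrightarrow> (\<forall>i<n. \<forall>j<n. a $$ (i,j) - c $$ (i,j) = d $$ (i,j) - b $$ (i,j))"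
    by (simp add: algebra_simps diff_eq_eq eq_diff_eq)
  also have "\<dots> \<longleftrightarrow> a - c = d - b"
    using assms mat_eq_iff_index[OF minus_carrier_mat[OF assms(3), of a] minus_carrier_mat[OF assms(2), of d]] by simp
  finally show ?thesis .
qed

lemma block_isoD:
  assumes "block_iso n A D (E, i, s) \<tau>"
  shows "bij_betw \<tau> (carrier_vec n \<times> carrier_vec n) (carrier E)"
    and "\<And>v w v' w'. v \<in> carrier_vec n \<Longrightarrow> w \<in> carrier_vec n \<Longrightarrow> v' \<in> carrier_vec n \<Longrightarrow> w' \<in> carrier_vec n \<Longrightarrow>
      \<tau> (v + v', w + w') = \<tau> (v, w) \<oplus>\<^bsub>E\<^esub> \<tau> (v', w')"
    and "\<And>a v w. v \<in> carrier_vec n \<Longrightarrow> w \<in> carrier_vec n \<Longrightarrow> [:a:] \<odot>\<^bsub>E\<^esub> \<tau> (v, w) = \<tau> (a \<cdot>\<^sub>v v, a \<cdot>\<^sub>v w)"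
    and "\<And>v w. v \<in> carrier_vec n \<Longrightarrow> w \<in> carrier_vec n \<Longrightarrow> [:0, 1:] \<odot>\<^bsub>E\<^esub> \<tau> (v, w) = \<tau> (A *\<^sub>v v, D *\<^sub>v v + A *\<^sub>v w)"
    and "\<And>w. w \<in> carrier_vec n \<Longrightarrow> i w = \<tau> (0\<^sub>v n, w)"
    and "\<And>v w. v \<in> carrier_vec n \<Longrightarrow> w \<in> carrier_vec n \<Longrightarrow> s (\<tau> (v, w)) = v"
  using assms by (auto simp: block_iso_def)

lemma block_iso_carrier:
  assumes "block_iso n A D (E, i, s) \<tau>"
  shows "\<And>v w. v \<in> carrier_vec n \<Longrightarrow> w \<in> carrier_vec n \<Longrightarrow> \<tau> (v, w) \<in> carrier E"
    and "\<And>e. e \<in> carrier E \<Longrightarrow> \<exists>v\<in>carrier_vec n. \<exists>w\<in>carrier_vec n. e = \<tau> (v, w)"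
    and "\<And>v w v' w'. \<tau> (v, w) = \<tau> (v', w') \<Longrightarrow> v \<in> carrier_vec n \<Longrightarrow> w \<in> carrier_vec n \<Longrightarrow>
      v' \<in> carrier_vec n \<Longrightarrow> w' \<in> carrier_vec n \<Longrightarrow> v = v' \<and> w = w'"
proof -
  note b = block_isoD(1)[OF assms]
  show "\<tau> (v, w) \<in> carrier E" if "v \<in> carrier_vec n" "w \<in> carrier_vec n" for v w using that b by (auto simp: bij_betw_def)
  show "\<exists>v\<in>carrier_vec n. \<exists>w\<in>carrier_vec n. e = \<tau> (v, w)" if "e \<in> carrier E" for e
    using that b by (fastforce simp: bij_betw_def)
  show "v = v' \<and> w = w'" if "\<tau> (v, w) = \<tau> (v', w')" "v \<in> carrier_vec n" "w \<in> carrier_vec n" "v' \<in> carrier_vec n" "w' \<in> carrier_vec n" for v w v' w'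
    using that b by (auto simp: bij_betw_def dest!: inj_onD)
qed

text \<open>In block coordinates, a linear map that is compatible with the outer components \<open>g\<close> has the form
  \<open>(v, w) \<mapsto> (g v, Y v + g w)\<close>. It commutes with \<open>t\<close> if and only if \<open>Y A + g D = D' g + A Y\<close>.\<close>

theorem extension_morphism_iff:
  fixes A D D' g :: "'k::field mat"
  assumes A: "A \<in> carrier_mat n n" and x: "x \<in> exts n A" and y: "y \<in> exts n A"
    and rx: "ext_rep n A x D" and ry: "ext_rep n A y D'"
    and g: "g \<in> carrier_mat n n" "g * A = A * g"
    and f: "\<And>v. v \<in> carrier_vec n \<Longrightarrow> f v = g *\<^sub>v v"
  shows "extension_morphism class_ring (mat_module n A) f f x y \<longleftrightarrow> g * D - D' * g \<in> adrange n A"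
proof -
  obtain E i s where xE: "x = (E, i, s)" by (cases x)
  obtain E' i' s' where yE: "y = (E', i', s')" by (cases y)
  note x = extensionsD[OF x[unfolded xE]]
  note y = extensionsD[OF y[unfolded yE]]
  interpret E: Module.module class_ring E by (rule x(1))
  interpret E': Module.module class_ring E' by (rule y(1))
  obtain \<tau> where D: "D \<in> carrier_mat n n" and iso: "block_iso n A D (E, i, s) \<tau>" using rx by (auto simp: ext_rep_def xE)
  note bij = block_isoD(1)[OF iso] and \<tau>_add = block_isoD(2)[OF iso] and \<tau>_const = block_isoD(3)[OF iso]
    and \<tau>_X = block_isoD(4)[OF iso] and \<tau>_i = block_isoD(5)[OF iso] and \<tau>_s = block_isoD(6)[OF iso]
    and \<tau>_car = block_iso_carrier(1)[OF iso] and \<tau>_sur = block_iso_carrier(2)[OF iso]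
  obtain \<tau>' where D': "D' \<in> carrier_mat n n" and iso': "block_iso n A D' (E', i', s') \<tau>'" using ry by (auto simp: ext_rep_def yE)
  note \<tau>'_add = block_isoD(2)[OF iso'] and \<tau>'_const = block_isoD(3)[OF iso']
    and \<tau>'_X = block_isoD(4)[OF iso'] and \<tau>'_i = block_isoD(5)[OF iso'] and \<tau>'_s = block_isoD(6)[OF iso']
    and \<tau>'_car = block_iso_carrier(1)[OF iso'] and \<tau>'_sur = block_iso_carrier(2)[OF iso'] and \<tau>'_inj = block_iso_carrier(3)[OF iso']
  have mv: "Z *\<^sub>v v \<in> carrier_vec n" if "Z \<in> carrier_mat n n" "v \<in> carrier_vec n" for Z :: "'k mat" and v
    using that by (rule mult_mat_vec_carrier)
  have key: "g * D - D' * g = A * Y - Y * A \<longleftrightarrow>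
      (\<forall>v\<in>carrier_vec n. Y *\<^sub>v (A *\<^sub>v v) + g *\<^sub>v (D *\<^sub>v v) = D' *\<^sub>v (g *\<^sub>v v) + A *\<^sub>v (Y *\<^sub>v v))"
    if Y: "Y \<in> carrier_mat n n" for Y
  proof -
    have m: "g * D \<in> carrier_mat n n" "D' * g \<in> carrier_mat n n" "A * Y \<in> carrier_mat n n" "Y * A \<in> carrier_mat n n"
      using A D D' g(1) Y by auto
    have "g * D - D' * g = A * Y - Y * A \<longleftrightarrow> Y * A + g * D = D' * g + A * Y"
      unfolding sum_eq_iff_diff_eq[OF m(1,4,2,3), symmetric] comm_add_mat[OF m(4,1)] ..
    also have "\<dots> \<longleftrightarrow> (\<forall>v\<in>carrier_vec n. (Y * A + g * D) *\<^sub>v v = (D' * g + A * Y) *\<^sub>v v)"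
      using mat_vec_eqI[of "Y * A + g * D" n "D' * g + A * Y"] A D D' g(1) Y by (auto intro: mult_carrier_mat[of _ n n])
    also have "\<dots> \<longleftrightarrow> (\<forall>v\<in>carrier_vec n. Y *\<^sub>v (A *\<^sub>v v) + g *\<^sub>v (D *\<^sub>v v) = D' *\<^sub>v (g *\<^sub>v v) + A *\<^sub>v (Y *\<^sub>v v))"
    proof (rule ball_cong)
      fix v :: "'k vec" assume v: "v \<in> carrier_vec n"
      have "(Y * A + g * D) *\<^sub>v v = Y *\<^sub>v (A *\<^sub>v v) + g *\<^sub>v (D *\<^sub>v v)"
        unfolding add_mult_distrib_mat_vec[OF mult_carrier_mat[OF Y A] mult_carrier_mat[OF g(1) D] v]
          assoc_mult_mat_vec[OF Y A v] assoc_mult_mat_vec[OF g(1) D v] ..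
      moreover have "(D' * g + A * Y) *\<^sub>v v = D' *\<^sub>v (g *\<^sub>v v) + A *\<^sub>v (Y *\<^sub>v v)"
        unfolding add_mult_distrib_mat_vec[OF mult_carrier_mat[OF D' g(1)] mult_carrier_mat[OF A Y] v]
          assoc_mult_mat_vec[OF D' g(1) v] assoc_mult_mat_vec[OF A Y v] ..
      ultimately show "(Y * A + g * D) *\<^sub>v v = (D' * g + A * Y) *\<^sub>v v \<longleftrightarrow>
        Y *\<^sub>v (A *\<^sub>v v) + g *\<^sub>v (D *\<^sub>v v) = D' *\<^sub>v (g *\<^sub>v v) + A *\<^sub>v (Y *\<^sub>v v)" by simp
    qed simp
    finally show ?thesis .
  qed
  have gA: "g *\<^sub>v (A *\<^sub>v v) = A *\<^sub>v (g *\<^sub>v v)" if "v \<in> carrier_vec n" for v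
    using assoc_mult_mat_vec[OF g(1) A that] assoc_mult_mat_vec[OF A g(1) that] g(2) by simp
  show ?thesis
  proof
    assume "extension_morphism class_ring (mat_module n A) f f x y"
    then obtain \<phi> where hom: "\<phi> \<in> LinearCombinations.module_hom class_ring E E'"
      and \<phi>i: "\<And>w. w \<in> carrier_vec n \<Longrightarrow> \<phi> (i w) = i' (f w)" and \<phi>s: "\<And>e. e \<in> carrier E \<Longrightarrow> s' (\<phi> e) = f (s e)"
      by (auto simp: xE yE mat_module_simps)
    have \<phi>_car: "\<phi> e \<in> carrier E'" if "e \<in> carrier E" for e by (rule module_homD(1)[OF hom that])
    have \<phi>_add: "\<phi> (e \<oplus>\<^bsub>E\<^esub> e') = \<phi> e \<oplus>\<^bsub>E'\<^esub> \<phi> e'" if "e \<in> carrier E" "e' \<in> carrier E" for e e'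
      by (rule module_homD(2)[OF hom that])
    have \<phi>_smult: "\<phi> (r \<odot>\<^bsub>E\<^esub> e) = r \<odot>\<^bsub>E'\<^esub> \<phi> e" if "e \<in> carrier E" for r e
      by (rule module_homD(3)[OF hom that])
    have "\<exists>u\<in>carrier_vec n. \<phi> (\<tau> (v, 0\<^sub>v n)) = \<tau>' (g *\<^sub>v v, u)" if v: "v \<in> carrier_vec n" for v
    proof -
      have t: "\<tau> (v, 0\<^sub>v n) \<in> carrier E" using \<tau>_car[OF v] by simp
      obtain v' u where u: "v' \<in> carrier_vec n" "u \<in> carrier_vec n" "\<phi> (\<tau> (v, 0\<^sub>v n)) = \<tau>' (v', u)"
        using \<tau>'_sur[OF \<phi>_car[OF t]] by blast
      have "v' = g *\<^sub>v v" using \<phi>s[OF t] u \<tau>'_s[OF u(1,2)] \<tau>_s[OF v zero_carrier_vec] f[OF v] by simp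
      then show ?thesis using u by blast
    qed
    then obtain d where d: "\<And>v. v \<in> carrier_vec n \<Longrightarrow> d v \<in> carrier_vec n"
      "\<And>v. v \<in> carrier_vec n \<Longrightarrow> \<phi> (\<tau> (v, 0\<^sub>v n)) = \<tau>' (g *\<^sub>v v, d v)" by metis
    have d_add: "d (v + w) = d v + d w" if v: "v \<in> carrier_vec n" and w: "w \<in> carrier_vec n" for v w
    proof -
      have "\<tau>' (g *\<^sub>v (v + w), d (v + w)) = \<phi> (\<tau> (v + w, 0\<^sub>v n + 0\<^sub>v n))" using d(2)[of "v + w"] v w by simp
      also have "\<dots> = \<tau>' (g *\<^sub>v v, d v) \<oplus>\<^bsub>E'\<^esub> \<tau>' (g *\<^sub>v w, d w)"
        unfolding \<tau>_add[OF v zero_carrier_vec w zero_carrier_vec]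
        using \<phi>_add[OF \<tau>_car[OF v zero_carrier_vec] \<tau>_car[OF w zero_carrier_vec]] d(2)[OF v] d(2)[OF w] by simp
      also have "\<dots> = \<tau>' (g *\<^sub>v v + g *\<^sub>v w, d v + d w)"
        by (rule \<tau>'_add[symmetric]) (use mv[OF g(1)] d(1) v w in auto)
      finally show ?thesis by (rule conjunct2[OF \<tau>'_inj]) (use mv[OF g(1)] d(1) v w in auto)
    qed
    have d_scale: "d (a \<cdot>\<^sub>v v) = a \<cdot>\<^sub>v d v" if v: "v \<in> carrier_vec n" for a v
    proof -
      have "\<tau>' (g *\<^sub>v (a \<cdot>\<^sub>v v), d (a \<cdot>\<^sub>v v)) = \<phi> (\<tau> (a \<cdot>\<^sub>v v, a \<cdot>\<^sub>v 0\<^sub>v n))" using d(2)[of "a \<cdot>\<^sub>v v"] v by (simp add: smult_zero_vec')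
      also have "\<dots> = [:a:] \<odot>\<^bsub>E'\<^esub> \<tau>' (g *\<^sub>v v, d v)"
        unfolding \<tau>_const[OF v zero_carrier_vec, symmetric]
        using \<phi>_smult[OF \<tau>_car[OF v zero_carrier_vec]] d(2)[OF v] by simp
      also have "\<dots> = \<tau>' (a \<cdot>\<^sub>v (g *\<^sub>v v), a \<cdot>\<^sub>v d v)"
        by (rule \<tau>'_const) (use mv[OF g(1)] d(1) v in auto)
      finally show ?thesis by (rule conjunct2[OF \<tau>'_inj]) (use mv[OF g(1)] d(1) v in auto)
    qed
    obtain Y where Y: "Y \<in> carrier_mat n n" "\<And>v. v \<in> carrier_vec n \<Longrightarrow> Y *\<^sub>v v = d v"
      using linear_vec_mat[of n d, OF d(1) d_add d_scale] by blast
    have "Y *\<^sub>v (A *\<^sub>v v) + g *\<^sub>v (D *\<^sub>v v) = D' *\<^sub>v (g *\<^sub>v v) + A *\<^sub>v (Y *\<^sub>v v)" if v: "v \<in> carrier_vec n" for v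
    proof -
      note Av = mv[OF A v] and Dv = mv[OF D v] and gv = mv[OF g(1) v]
      have "\<tau>' (A *\<^sub>v (g *\<^sub>v v), D' *\<^sub>v (g *\<^sub>v v) + A *\<^sub>v d v) = \<phi> ([:0, 1:] \<odot>\<^bsub>E\<^esub> \<tau> (v, 0\<^sub>v n))"
        using \<phi>_smult[OF \<tau>_car[OF v zero_carrier_vec]] d(2)[OF v] \<tau>'_X[OF gv d(1)[OF v]] by simp
      also have "[:0, 1:] \<odot>\<^bsub>E\<^esub> \<tau> (v, 0\<^sub>v n) = \<tau> (A *\<^sub>v v + 0\<^sub>v n, 0\<^sub>v n + D *\<^sub>v v)"
      proof -
        have "A *\<^sub>v 0\<^sub>v n = 0\<^sub>v n" using A by (auto intro!: eq_vecI)
        then show ?thesis using \<tau>_X[OF v zero_carrier_vec] Av Dv by simp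
      qed
      also have "\<phi> \<dots> = \<tau>' (g *\<^sub>v (A *\<^sub>v v), d (A *\<^sub>v v)) \<oplus>\<^bsub>E'\<^esub> \<tau>' (0\<^sub>v n, g *\<^sub>v (D *\<^sub>v v))"
        unfolding \<tau>_add[OF Av zero_carrier_vec zero_carrier_vec Dv]
        using \<phi>_add[OF \<tau>_car[OF Av zero_carrier_vec] \<tau>_car[OF zero_carrier_vec Dv]] d(2)[OF Av]
          \<phi>i[OF Dv] \<tau>_i[OF Dv] \<tau>'_i[OF mv[OF g(1) Dv]] f[OF Dv] by simp
      also have "\<dots> = \<tau>' (g *\<^sub>v (A *\<^sub>v v) + 0\<^sub>v n, d (A *\<^sub>v v) + g *\<^sub>v (D *\<^sub>v v))"
        by (rule \<tau>'_add[symmetric]) (use mv[OF g(1)] d(1) Av Dv in auto)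
      finally have "D' *\<^sub>v (g *\<^sub>v v) + A *\<^sub>v d v = d (A *\<^sub>v v) + g *\<^sub>v (D *\<^sub>v v)"
        by (rule conjunct2[OF \<tau>'_inj]) (use mv[OF g(1)] mv[OF A] mv[OF D'] d(1) Av Dv gv v in auto)
      then show ?thesis using Y(2)[OF Av] Y(2)[OF v] by simp
    qed
    then have "g * D - D' * g = A * Y - Y * A" using key[OF Y(1)] by blast
    then show "g * D - D' * g \<in> adrange n A" using Y(1) by (auto simp: adrange_def)
  next
    assume "g * D - D' * g \<in> adrange n A"
    then obtain Y where Y: "Y \<in> carrier_mat n n" "g * D - D' * g = A * Y - Y * A" by (auto simp: adrange_def)
    then have rel: "Y *\<^sub>v (A *\<^sub>v v) + g *\<^sub>v (D *\<^sub>v v) = D' *\<^sub>v (g *\<^sub>v v) + A *\<^sub>v (Y *\<^sub>v v)" if "v \<in> carrier_vec n" for v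
      using key[OF Y(1)] that by blast
    define \<phi> where "\<phi> e = (case the_inv_into (carrier_vec n \<times> carrier_vec n) \<tau> e of
      (v, w) \<Rightarrow> \<tau>' (g *\<^sub>v v, Y *\<^sub>v v + g *\<^sub>v w))" for e
    have \<phi>: "\<phi> (\<tau> (v, w)) = \<tau>' (g *\<^sub>v v, Y *\<^sub>v v + g *\<^sub>v w)" if "v \<in> carrier_vec n" "w \<in> carrier_vec n" for v w
      using the_inv_into_f_f[of \<tau> "carrier_vec n \<times> carrier_vec n" "(v, w)"] bij that by (simp add: \<phi>_def bij_betw_def)
    note c = mv[OF g(1)] mv[OF Y(1)] mv[OF A] mv[OF D] mv[OF D']
    have "\<phi> \<in> LinearCombinations.module_hom class_ring E E'"
    proof (rule module_hom_poly[OF x(1) y(1)])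
      fix e assume "e \<in> carrier E"
      then obtain v w where v: "v \<in> carrier_vec n" and w: "w \<in> carrier_vec n" and e: "e = \<tau> (v, w)" using \<tau>_sur by blast
      show "\<phi> e \<in> carrier E'" unfolding e \<phi>[OF v w] by (rule \<tau>'_car[OF c(1)[OF v] add_carrier_vec[OF c(2)[OF v] c(1)[OF w]]])
      show "\<phi> ([:a:] \<odot>\<^bsub>E\<^esub> e) = [:a:] \<odot>\<^bsub>E'\<^esub> \<phi> e" for a
      proof -
        have "Y *\<^sub>v (a \<cdot>\<^sub>v v) + g *\<^sub>v (a \<cdot>\<^sub>v w) = a \<cdot>\<^sub>v (Y *\<^sub>v v + g *\<^sub>v w)"
          using mult_mat_vec[OF Y(1) v] mult_mat_vec[OF g(1) w] smult_add_distrib_vec[OF c(2)[OF v] c(1)[OF w]] by simp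
        moreover have "\<phi> (\<tau> (a \<cdot>\<^sub>v v, a \<cdot>\<^sub>v w)) = \<tau>' (g *\<^sub>v (a \<cdot>\<^sub>v v), Y *\<^sub>v (a \<cdot>\<^sub>v v) + g *\<^sub>v (a \<cdot>\<^sub>v w))"
          by (rule \<phi>) (use v w in auto)
        moreover have "[:a:] \<odot>\<^bsub>E'\<^esub> \<tau>' (g *\<^sub>v v, Y *\<^sub>v v + g *\<^sub>v w) = \<tau>' (a \<cdot>\<^sub>v (g *\<^sub>v v), a \<cdot>\<^sub>v (Y *\<^sub>v v + g *\<^sub>v w))"
          by (rule \<tau>'_const[OF c(1)[OF v] add_carrier_vec[OF c(2)[OF v] c(1)[OF w]]])
        ultimately show ?thesis unfolding e \<tau>_const[OF v w] \<phi>[OF v w] by (simp only: mult_mat_vec[OF g(1) v])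
      qed
      show "\<phi> ([:0, 1:] \<odot>\<^bsub>E\<^esub> e) = [:0, 1:] \<odot>\<^bsub>E'\<^esub> \<phi> e"
      proof -
        note Av = c(3)[OF v] and Dv = c(4)[OF v] and Aw = c(3)[OF w] and gv = c(1)[OF v] and gw = c(1)[OF w] and Yv = c(2)[OF v]
        have "Y *\<^sub>v (A *\<^sub>v v) + g *\<^sub>v (D *\<^sub>v v + A *\<^sub>v w) = (Y *\<^sub>v (A *\<^sub>v v) + g *\<^sub>v (D *\<^sub>v v)) + g *\<^sub>v (A *\<^sub>v w)"
          unfolding mult_add_distrib_mat_vec[OF g(1) Dv Aw]
          by (rule assoc_add_vec[OF c(2)[OF Av] c(1)[OF Dv] c(1)[OF Aw], symmetric])
        also have "\<dots> = (D' *\<^sub>v (g *\<^sub>v v) + A *\<^sub>v (Y *\<^sub>v v)) + A *\<^sub>v (g *\<^sub>v w)" unfolding rel[OF v] gA[OF w] ..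
        also have "\<dots> = D' *\<^sub>v (g *\<^sub>v v) + A *\<^sub>v (Y *\<^sub>v v + g *\<^sub>v w)"
          unfolding mult_add_distrib_mat_vec[OF A Yv gw]
          by (rule assoc_add_vec[OF c(5)[OF gv] c(3)[OF Yv] c(3)[OF gw]])
        finally have eq: "Y *\<^sub>v (A *\<^sub>v v) + g *\<^sub>v (D *\<^sub>v v + A *\<^sub>v w) = D' *\<^sub>v (g *\<^sub>v v) + A *\<^sub>v (Y *\<^sub>v v + g *\<^sub>v w)" .
        have "\<phi> ([:0, 1:] \<odot>\<^bsub>E\<^esub> e) = \<tau>' (g *\<^sub>v (A *\<^sub>v v), Y *\<^sub>v (A *\<^sub>v v) + g *\<^sub>v (D *\<^sub>v v + A *\<^sub>v w))"
          unfolding e \<tau>_X[OF v w] by (rule \<phi>) (use Av Dv Aw in auto)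
        also have "\<dots> = [:0, 1:] \<odot>\<^bsub>E'\<^esub> \<phi> e"
          unfolding e \<phi>[OF v w] eq gA[OF v] by (rule \<tau>'_X[symmetric]) (use gv Yv gw in auto)
        finally show ?thesis .
      qed
      fix e' assume "e' \<in> carrier E"
      then obtain v' w' where v': "v' \<in> carrier_vec n" and w': "w' \<in> carrier_vec n" and e': "e' = \<tau> (v', w')" using \<tau>_sur by blast
      show "\<phi> (e \<oplus>\<^bsub>E\<^esub> e') = \<phi> e \<oplus>\<^bsub>E'\<^esub> \<phi> e'"
      proof -
        have "Y *\<^sub>v (v + v') + g *\<^sub>v (w + w') = (Y *\<^sub>v v + g *\<^sub>v w) + (Y *\<^sub>v v' + g *\<^sub>v w')"
          unfolding mult_add_distrib_mat_vec[OF Y(1) v v'] mult_add_distrib_mat_vec[OF g(1) w w']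
          using c(1)[OF w] c(1)[OF w'] c(2)[OF v] c(2)[OF v'] by (intro eq_vecI) auto
        then have "\<phi> (\<tau> (v + v', w + w')) = \<tau>' (g *\<^sub>v v + g *\<^sub>v v', (Y *\<^sub>v v + g *\<^sub>v w) + (Y *\<^sub>v v' + g *\<^sub>v w'))"
          using \<phi>[OF add_carrier_vec[OF v v'] add_carrier_vec[OF w w']] by (simp only: mult_add_distrib_mat_vec[OF g(1) v v'])
        also have "\<dots> = \<tau>' (g *\<^sub>v v, Y *\<^sub>v v + g *\<^sub>v w) \<oplus>\<^bsub>E'\<^esub> \<tau>' (g *\<^sub>v v', Y *\<^sub>v v' + g *\<^sub>v w')"
          by (rule \<tau>'_add[OF c(1)[OF v] add_carrier_vec[OF c(2)[OF v] c(1)[OF w]] c(1)[OF v'] add_carrier_vec[OF c(2)[OF v'] c(1)[OF w']]])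
        finally show ?thesis unfolding e e' \<tau>_add[OF v w v' w', symmetric] \<phi>[OF v w] \<phi>[OF v' w'] .
      qed
    qed
    moreover have "\<phi> (i w) = i' (f w)" if w: "w \<in> carrier_vec n" for w
    proof -
      have "g *\<^sub>v 0\<^sub>v n = 0\<^sub>v n" "Y *\<^sub>v 0\<^sub>v n + g *\<^sub>v w = g *\<^sub>v w" using g(1) Y(1) w c(1)[OF w] by (auto intro!: eq_vecI)
      then show ?thesis using \<tau>_i[OF w] \<phi>[OF zero_carrier_vec w] \<tau>'_i[OF c(1)[OF w]] f[OF w] by simp
    qed
    moreover have "s' (\<phi> e) = f (s e)" if e0: "e \<in> carrier E" for e
    proof -
      obtain v w where v: "v \<in> carrier_vec n" and w: "w \<in> carrier_vec n" and e: "e = \<tau> (v, w)" using \<tau>_sur[OF e0] by blast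
      show ?thesis unfolding e \<phi>[OF v w] \<tau>_s[OF v w] f[OF v] by (rule \<tau>'_s[OF c(1)[OF v] add_carrier_vec[OF c(2)[OF v] c(1)[OF w]]])
    qed
    ultimately show "extension_morphism class_ring (mat_module n A) f f x y"
      by (auto simp: xE yE mat_module_simps intro!: bexI[of _ \<phi>])
  qed
qed

section \<open>Invertible matrices and commutators\<close>

definition general_linear :: "nat \<Rightarrow> 'a::comm_ring_1 mat set" where
  "general_linear n = {g \<in> carrier_mat n n. \<exists>h\<in>carrier_mat n n. g * h = 1\<^sub>m n \<and> h * g = 1\<^sub>m n}"

lemma GL_mat_carrier: "carrier (GL_mat TYPE('a::comm_ring_1) n) = (general_linear n :: 'a mat set)"
  by (auto simp: GL_mat_def units_of_carrier Units_def ring_mat_simps general_linear_def)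

lemma centralizer_mat_alt: "centralizer_mat n A = general_linear n \<inter> {g. g * A = A * g}" for A :: "'a::comm_ring_1 mat"
  by (auto simp: centralizer_mat_def GL_mat_carrier)

lemma centralizer_matE:
  fixes A :: "'a::comm_ring_1 mat"
  assumes g: "g \<in> centralizer_mat n A" and A: "A \<in> carrier_mat n n"
  obtains h where "g \<in> carrier_mat n n" "h \<in> carrier_mat n n" "g * h = 1\<^sub>m n" "h * g = 1\<^sub>m n" "g * A = A * g"
    "h * A = A * h" "h \<in> centralizer_mat n A" "g \<in> cent n A" "h \<in> cent n A"
proof -
  obtain h where h: "g \<in> carrier_mat n n" "h \<in> carrier_mat n n" "g * h = 1\<^sub>m n" "h * g = 1\<^sub>m n" "g * A = A * g"
    using g by (auto simp: centralizer_mat_alt general_linear_def)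
  have "h * A = h * (A * (g * h))" using h A by simp
  also have "\<dots> = h * ((A * g) * h)" unfolding assoc_mult_mat[OF A h(1,2)] ..
  also have "\<dots> = h * (g * (A * h))" unfolding h(5)[symmetric] assoc_mult_mat[OF h(1) A h(2)] ..
  also have "\<dots> = (h * g) * (A * h)"
    by (rule assoc_mult_mat[symmetric, OF h(2) h(1) mult_carrier_mat[OF A h(2)]])
  also have "\<dots> = A * h" using h A by simp
  finally have c: "h * A = A * h" .
  have "h \<in> centralizer_mat n A" using h c by (auto simp: centralizer_mat_alt general_linear_def)
  then show ?thesis using that h c by (simp add: cent_def)
qed

lemma centralizer_mat_one: "A \<in> carrier_mat n n \<Longrightarrow> 1\<^sub>m n \<in> centralizer_mat n A" for A :: "'a::comm_ring_1 mat"
  by (auto simp: centralizer_mat_alt general_linear_def intro!: bexI[of _ "1\<^sub>m n"])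

lemma general_linear_mult:
  fixes g h :: "'a::comm_ring_1 mat"
  assumes "g \<in> general_linear n" "h \<in> general_linear n"
  shows "g * h \<in> general_linear n"
proof -
  obtain g' h' where *: "g' \<in> carrier_mat n n" "g * g' = 1\<^sub>m n" "g' * g = 1\<^sub>m n" "h' \<in> carrier_mat n n" "h * h' = 1\<^sub>m n" "h' * h = 1\<^sub>m n"
    and c: "g \<in> carrier_mat n n" "h \<in> carrier_mat n n"
    using assms by (auto simp: general_linear_def)
  have "(g * h) * (h' * g') = g * ((h * h') * g')"
    unfolding assoc_mult_mat[OF c mult_carrier_mat[OF *(4,1)]] assoc_mult_mat[OF c(2) *(4) *(1)] ..
  moreover have "(h' * g') * (g * h) = h' * ((g' * g) * h)"
    unfolding assoc_mult_mat[OF *(4,1) mult_carrier_mat[OF c]] assoc_mult_mat[OF *(1) c] ..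
  ultimately have "(g * h) * (h' * g') = 1\<^sub>m n \<and> (h' * g') * (g * h) = 1\<^sub>m n" using * c by simp
  then show ?thesis
    using mult_carrier_mat[OF c] mult_carrier_mat[OF *(4,1)] unfolding general_linear_def by blast
qed

lemma centralizer_mat_mult:
  fixes A :: "'a::comm_ring_1 mat"
  assumes A: "A \<in> carrier_mat n n" and g: "g \<in> centralizer_mat n A" and h: "h \<in> centralizer_mat n A"
  shows "g * h \<in> centralizer_mat n A"
proof -
  have c: "g \<in> carrier_mat n n" "h \<in> carrier_mat n n" "g * A = A * g" "h * A = A * h"
    using g h by (auto simp: centralizer_mat_alt general_linear_def)
  have "(g * h) * A = g * (A * h)" unfolding assoc_mult_mat[OF c(1,2) A] c(4) ..
  also have "\<dots> = A * (g * h)"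
    unfolding assoc_mult_mat[OF c(1) A c(2), symmetric] c(3) by (rule assoc_mult_mat[OF A c(1,2)])
  finally show ?thesis using general_linear_mult[of g n h] g h by (simp add: centralizer_mat_alt)
qed

lemma adrange_iff: "y \<in> adrange n A \<longleftrightarrow> (\<exists>Y\<in>carrier_mat n n. y = A * Y - Y * A)"
  by (auto simp: adrange_def)

lemma adrange_carrier: "A \<in> carrier_mat n n \<Longrightarrow> y \<in> adrange n A \<Longrightarrow> y \<in> carrier_mat n n"
  by (auto simp: adrange_def intro!: minus_carrier_mat mult_carrier_mat[of _ n n])

lemma adrange_zero: "A \<in> carrier_mat n n \<Longrightarrow> 0\<^sub>m n n \<in> adrange n A" for A :: "'a::comm_ring_1 mat"
  unfolding adrange_iff by (intro bexI[of _ "0\<^sub>m n n"]) (auto intro!: eq_matI)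

lemma adrange_add:
  fixes A :: "'a::comm_ring_1 mat"
  assumes A: "A \<in> carrier_mat n n" and "x \<in> adrange n A" "y \<in> adrange n A"
  shows "x + y \<in> adrange n A"
proof -
  obtain X Y where X: "X \<in> carrier_mat n n" "x = A * X - X * A" and Y: "Y \<in> carrier_mat n n" "y = A * Y - Y * A"
    using assms by (auto simp: adrange_iff)
  have "x + y = A * (X + Y) - (X + Y) * A"
    unfolding X(2) Y(2) mult_add_distrib_mat[OF A X(1) Y(1)] add_mult_distrib_mat[OF X(1) Y(1) A]
    using A X(1) Y(1) by (intro eq_matI) auto
  then show ?thesis using X(1) Y(1) by (auto simp: adrange_iff intro!: bexI[of _ "X + Y"])
qed

lemma adrange_left:
  fixes A :: "'a::comm_ring_1 mat"
  assumes A: "A \<in> carrier_mat n n" and g: "g \<in> cent n A" and "y \<in> adrange n A"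
  shows "g * y \<in> adrange n A"
proof -
  obtain Y where Y: "Y \<in> carrier_mat n n" "y = A * Y - Y * A" using assms by (auto simp: adrange_iff)
  have G: "g \<in> carrier_mat n n" "g * A = A * g" using g by (auto simp: cent_def)
  have "g * y = g * (A * Y) - g * (Y * A)"
    unfolding Y(2) by (rule mult_minus_distrib_mat[OF G(1) mult_carrier_mat[OF A Y(1)] mult_carrier_mat[OF Y(1) A]])
  also have "\<dots> = A * (g * Y) - (g * Y) * A"
    unfolding assoc_mult_mat[OF G(1) A Y(1), symmetric] assoc_mult_mat[OF G(1) Y(1) A, symmetric] G(2)
      assoc_mult_mat[OF A G(1) Y(1)] ..
  finally show ?thesis using G(1) Y(1) by (auto simp: adrange_iff intro!: bexI[of _ "g * Y"] mult_carrier_mat[of _ n n])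
qed

lemma adrange_right:
  fixes A :: "'a::comm_ring_1 mat"
  assumes A: "A \<in> carrier_mat n n" and g: "g \<in> cent n A" and "y \<in> adrange n A"
  shows "y * g \<in> adrange n A"
proof -
  obtain Y where Y: "Y \<in> carrier_mat n n" "y = A * Y - Y * A" using assms by (auto simp: adrange_iff)
  have G: "g \<in> carrier_mat n n" "g * A = A * g" using g by (auto simp: cent_def)
  have "y * g = (A * Y) * g - (Y * A) * g"
    unfolding Y(2) by (rule minus_mult_distrib_mat[OF mult_carrier_mat[OF A Y(1)] mult_carrier_mat[OF Y(1) A] G(1)])
  also have "\<dots> = A * (Y * g) - (Y * g) * A"
    unfolding assoc_mult_mat[OF A Y(1) G(1)] assoc_mult_mat[OF Y(1) A G(1)] G(2)[symmetric]
      assoc_mult_mat[OF Y(1) G(1) A] ..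
  finally show ?thesis using G(1) Y(1) by (auto simp: adrange_iff intro!: bexI[of _ "Y * g"] mult_carrier_mat[of _ n n])
qed

lemma uminus_diff_mat:
  fixes X Y :: "'a::comm_ring_1 mat"
  shows "X \<in> carrier_mat n m \<Longrightarrow> Y \<in> carrier_mat n m \<Longrightarrow> - (X - Y) = Y - X"
  by (intro eq_matI) auto

lemma adrange_uminus:
  fixes A :: "'a::comm_ring_1 mat"
  assumes A: "A \<in> carrier_mat n n" and y: "y \<in> adrange n A"
  shows "- y \<in> adrange n A"
proof -
  have "- 1\<^sub>m n \<in> cent n A" using A by (auto simp: cent_def)
  moreover have "- 1\<^sub>m n * y = - y"
    using uminus_mult_left_mat[of "1\<^sub>m n" y] adrange_carrier[OF A y] by simp
  ultimately show ?thesis using adrange_left[OF A _ y] by metis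
qed

text \<open>The orbit relation of the centralizer of \<open>A\<close>, acting by conjugation on matrices modulo commutators
  with \<open>A\<close>.\<close>

definition conj_rel :: "nat \<Rightarrow> 'a::comm_ring_1 mat \<Rightarrow> 'a mat \<Rightarrow> 'a mat \<Rightarrow> bool" where
  "conj_rel n A D D' \<longleftrightarrow> (\<exists>g\<in>centralizer_mat n A. g * D - D' * g \<in> adrange n A)"

definition conj_stab :: "nat \<Rightarrow> 'a::comm_ring_1 mat \<Rightarrow> 'a mat \<Rightarrow> 'a mat set" where
  "conj_stab n A D = {g \<in> centralizer_mat n A. g * D - D * g \<in> adrange n A}"

lemma conj_rel_refl:
  fixes A :: "'a::comm_ring_1 mat"
  assumes "A \<in> carrier_mat n n" "D \<in> carrier_mat n n" shows "conj_rel n A D D"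
proof -
  have "1\<^sub>m n * D - D * 1\<^sub>m n = 0\<^sub>m n n" using assms(2) by simp
  then show ?thesis unfolding conj_rel_def
    using adrange_zero[OF assms(1)] centralizer_mat_one[OF assms(1)] by (intro bexI[of _ "1\<^sub>m n"]) simp_all
qed

lemma conj_rel_sym:
  fixes A :: "'a::comm_ring_1 mat"
  assumes A: "A \<in> carrier_mat n n" and D: "D \<in> carrier_mat n n" "E \<in> carrier_mat n n" and r: "conj_rel n A D E"
  shows "conj_rel n A E D"
proof -
  obtain g where gc: "g \<in> centralizer_mat n A" and y: "g * D - E * g \<in> adrange n A" using r by (auto simp: conj_rel_def)
  obtain h where h: "g \<in> carrier_mat n n" "h \<in> carrier_mat n n" "g * h = 1\<^sub>m n" "h * g = 1\<^sub>m n" "h \<in> centralizer_mat n A" "h \<in> cent n A"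
    using centralizer_matE[OF gc A] by metis
  have gD: "g * D \<in> carrier_mat n n" and Eg: "E * g \<in> carrier_mat n n" and hE: "h * E \<in> carrier_mat n n" and Dh: "D * h \<in> carrier_mat n n"
    using h D by auto
  have "h * (g * D - E * g) = (h * g) * D - h * (E * g)"
    unfolding mult_minus_distrib_mat[OF h(2) gD Eg] assoc_mult_mat[OF h(2,1) D(1)] ..
  also have "\<dots> = D - (h * E) * g" unfolding h(4) left_mult_one_mat[OF D(1)] assoc_mult_mat[OF h(2) D(2) h(1)] ..
  finally have "(h * (g * D - E * g)) * h = D * h - ((h * E) * g) * h"
    using minus_mult_distrib_mat[OF D(1) mult_carrier_mat[OF hE h(1)] h(2)] by simp
  also have "\<dots> = D * h - h * E"
    unfolding assoc_mult_mat[OF hE h(1,2)] h(3) right_mult_one_mat[OF hE] ..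
  finally have "D * h - h * E \<in> adrange n A" using adrange_right[OF A h(6) adrange_left[OF A h(6) y]] by simp
  then have "- (D * h - h * E) \<in> adrange n A" by (rule adrange_uminus[OF A])
  moreover have "- (D * h - h * E) = h * E - D * h" by (rule uminus_diff_mat[OF Dh hE])
  ultimately show ?thesis using h(5) unfolding conj_rel_def by (intro bexI[of _ h]) simp_all
qed

lemma conj_rel_trans:
  fixes A :: "'a::comm_ring_1 mat"
  assumes A: "A \<in> carrier_mat n n" and D: "D \<in> carrier_mat n n" and E: "E \<in> carrier_mat n n" and F: "F \<in> carrier_mat n n"
    and r: "conj_rel n A D E" "conj_rel n A E F"
  shows "conj_rel n A D F"
proof -
  obtain g h where g: "g \<in> centralizer_mat n A" "g * D - E * g \<in> adrange n A"
    and h: "h \<in> centralizer_mat n A" "h * E - F * h \<in> adrange n A" using r by (auto simp: conj_rel_def)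
  have c: "g \<in> carrier_mat n n" "g \<in> cent n A" "h \<in> carrier_mat n n" "h \<in> cent n A"
    using g(1) h(1) by (auto simp: centralizer_mat_alt general_linear_def cent_def)
  have m: "g * D \<in> carrier_mat n n" "E * g \<in> carrier_mat n n" "h * E \<in> carrier_mat n n" "F * h \<in> carrier_mat n n"
    "h * g \<in> carrier_mat n n" using c D E F by auto
  have "h * (g * D - E * g) + (h * E - F * h) * g = (h * g) * D - F * (h * g)"
    unfolding mult_minus_distrib_mat[OF c(3) m(1,2)] minus_mult_distrib_mat[OF m(3,4) c(1)]
      assoc_mult_mat[OF c(3,1) D] assoc_mult_mat[OF F c(3,1)] assoc_mult_mat[OF c(3) E c(1)]
    using c D E F m by (intro eq_matI) (auto simp del: index_mult_mat(1))
  then have "(h * g) * D - F * (h * g) \<in> adrange n A"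
    using adrange_add[OF A adrange_left[OF A c(4) g(2)] adrange_right[OF A c(2) h(2)]] by simp
  then show ?thesis unfolding conj_rel_def using centralizer_mat_mult[OF A h(1) g(1)] by blast
qed

lemma conj_rel_adrange:
  fixes A :: "'a::comm_ring_1 mat"
  assumes A: "A \<in> carrier_mat n n" and D: "D \<in> carrier_mat n n" "E \<in> carrier_mat n n" and ad: "D - E \<in> adrange n A"
  shows "conj_rel n A D E"
proof -
  have "1\<^sub>m n * D - E * 1\<^sub>m n = D - E" using D by simp
  then show ?thesis using ad centralizer_mat_one[OF A] unfolding conj_rel_def by (intro bexI[of _ "1\<^sub>m n"]) simp_all
qed

section \<open>Orbits on the extension group\<close>

text \<open>The class in \<open>Ext\<^sup>1\<close> of the extensions with block \<open>D\<close>.\<close>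

definition ext_class :: "nat \<Rightarrow> 'k::field mat \<Rightarrow> 'k mat \<Rightarrow> ('k poly, 'k vec, 'k vec) extension set" where
  "ext_class n A D = {y \<in> exts n A. \<exists>D'. ext_rep n A y D' \<and> D - D' \<in> adrange n A}"

lemma ext_class_iff: "y \<in> ext_class n A D \<longleftrightarrow> y \<in> exts n A \<and> (\<exists>D'. ext_rep n A y D' \<and> D - D' \<in> adrange n A)"
  unfolding ext_class_def by (rule mem_Collect_eq)

lemma ext_rep_carrier: "ext_rep n A x D \<Longrightarrow> D \<in> carrier_mat n n" by (simp add: ext_rep_def)

lemma identity_morphism_iff:
  fixes A :: "'k::field mat"
  assumes A: "A \<in> carrier_mat n n" and x: "x \<in> exts n A" "y \<in> exts n A" and r: "ext_rep n A x D" "ext_rep n A y D'"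
  shows "extension_morphism class_ring (mat_module n A) (\<lambda>a. a) (\<lambda>a. a) x y \<longleftrightarrow> D - D' \<in> adrange n A"
proof -
  have "extension_morphism class_ring (mat_module n A) (\<lambda>a. a) (\<lambda>a. a) x y \<longleftrightarrow> 1\<^sub>m n * D - D' * 1\<^sub>m n \<in> adrange n A"
    by (rule extension_morphism_iff[OF A x r]) (use A in auto)
  then show ?thesis using ext_rep_carrier[OF r(1)] ext_rep_carrier[OF r(2)] by simp
qed

lemma ext_class_self:
  fixes A :: "'k::field mat"
  assumes A: "A \<in> carrier_mat n n" and x: "x \<in> exts n A" and r: "ext_rep n A x D"
  shows "x \<in> ext_class n A D"
proof -
  have "D - D \<in> adrange n A" using adrange_zero[OF A] minus_r_inv_mat[OF ext_rep_carrier[OF r]] by simp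
  then show ?thesis unfolding ext_class_iff using x r by blast
qed

lemma adrange_diff_trans:
  fixes A :: "'a::comm_ring_1 mat"
  assumes A: "A \<in> carrier_mat n n" and c: "D \<in> carrier_mat n n" "E \<in> carrier_mat n n" "F \<in> carrier_mat n n"
    and ad: "D - E \<in> adrange n A" "E - F \<in> adrange n A"
  shows "D - F \<in> adrange n A"
proof -
  have "(D - E) + (E - F) = D - F" using c by (intro eq_matI) auto
  then show ?thesis using adrange_add[OF A ad] by simp
qed

lemma adrange_diff_sym:
  fixes A :: "'a::comm_ring_1 mat"
  assumes A: "A \<in> carrier_mat n n" and c: "D \<in> carrier_mat n n" "E \<in> carrier_mat n n" and ad: "D - E \<in> adrange n A"
  shows "E - D \<in> adrange n A"
  using adrange_uminus[OF A ad] uminus_diff_mat[OF c] by simp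

lemma ext_class_eq_iff:
  fixes A :: "'k::field mat"
  assumes A: "A \<in> carrier_mat n n" and c: "D \<in> carrier_mat n n" "E \<in> carrier_mat n n"
  shows "ext_class n A D = ext_class n A E \<longleftrightarrow> D - E \<in> adrange n A"
proof
  assume eq: "ext_class n A D = ext_class n A E"
  obtain x where x: "x \<in> exts n A" "ext_rep n A x D" by (rule ext_exists_rep[OF A c(1)])
  have "x \<in> ext_class n A E" using ext_class_self[OF A x] eq by blast
  then obtain F where F: "ext_rep n A x F" "E - F \<in> adrange n A" unfolding ext_class_iff by blast
  have Fc: "F \<in> carrier_mat n n" by (rule ext_rep_carrier[OF F(1)])
  have "D - D \<in> adrange n A" using adrange_zero[OF A] minus_r_inv_mat[OF c(1)] by simp
  then have "D - F \<in> adrange n A"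
    unfolding identity_morphism_iff[OF A x(1) x(1) x(2) x(2), symmetric] identity_morphism_iff[OF A x(1) x(1) x(2) F(1)] .
  then show "D - E \<in> adrange n A"
    by (rule adrange_diff_trans[OF A c(1) Fc c(2) _ adrange_diff_sym[OF A c(2) Fc F(2)]])
next
  assume DE: "D - E \<in> adrange n A"
  have ED: "E - D \<in> adrange n A" by (rule adrange_diff_sym[OF A c DE])
  have "y \<in> ext_class n A D \<longleftrightarrow> y \<in> ext_class n A E" for y
    unfolding ext_class_iff
    using adrange_diff_trans[OF A c(1,2) ext_rep_carrier DE] adrange_diff_trans[OF A c(2,1) ext_rep_carrier ED] by blast
  then show "ext_class n A D = ext_class n A E" by blast
qed

lemma extension_equiv_class:
  fixes A :: "'k::field mat"
  assumes A: "A \<in> carrier_mat n n" and x: "x \<in> exts n A" and r: "ext_rep n A x D"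
  shows "extension_equiv class_ring (mat_module n A) (mat_module n A) `` {x} = ext_class n A D"
proof -
  have "y \<in> extension_equiv class_ring (mat_module n A) (mat_module n A) `` {x} \<longleftrightarrow> y \<in> ext_class n A D" for y
  proof -
    have "y \<in> extension_equiv class_ring (mat_module n A) (mat_module n A) `` {x} \<longleftrightarrow>
        y \<in> exts n A \<and> extension_morphism class_ring (mat_module n A) (\<lambda>a. a) (\<lambda>a. a) x y"
      unfolding extension_equiv_def Image_singleton mem_Collect_eq case_prod_conv using x by blast
    also have "\<dots> \<longleftrightarrow> y \<in> ext_class n A D"
      unfolding ext_class_iff using ext_rep_exists[OF A, of y] identity_morphism_iff[OF A x _ r, of y] by metis
    finally show ?thesis .
  qed
  then show ?thesis by blast
qed

lemma mat_Ext1_eq: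
  fixes A :: "'k::field mat"
  assumes A: "A \<in> carrier_mat n n"
  shows "mat_Ext1 n A = ext_class n A ` carrier_mat n n"
proof (intro subset_antisym subsetI)
  fix \<xi> assume "\<xi> \<in> mat_Ext1 n A"
  then obtain x where x: "x \<in> exts n A" and \<xi>: "\<xi> = extension_equiv class_ring (mat_module n A) (mat_module n A) `` {x}"
    unfolding mat_Ext1_def Ext1_def by (rule quotientE)
  obtain D where D: "ext_rep n A x D" by (rule ext_rep_exists[OF A x])
  show "\<xi> \<in> ext_class n A ` carrier_mat n n"
    unfolding \<xi> extension_equiv_class[OF A x D] by (rule imageI) (rule ext_rep_carrier[OF D])
next
  fix \<xi> assume "\<xi> \<in> ext_class n A ` carrier_mat n n"
  then obtain D where D: "D \<in> carrier_mat n n" and \<xi>: "\<xi> = ext_class n A D" by blast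
  obtain x where x: "x \<in> exts n A" "ext_rep n A x D" by (rule ext_exists_rep[OF A D])
  show "\<xi> \<in> mat_Ext1 n A"
    unfolding \<xi> extension_equiv_class[OF A x, symmetric] mat_Ext1_def Ext1_def by (rule quotientI[OF x(1)])
qed

text \<open>The commutator space is stable under multiplication by matrices that commute with \<open>A\<close>, so one may multiply
  by \<open>g\<close> and by its inverse \<open>h\<close>.\<close>

lemma conjugate_diff_adrange:
  fixes A :: "'a::comm_ring_1 mat"
  assumes A: "A \<in> carrier_mat n n" and D: "D \<in> carrier_mat n n" and E: "E \<in> carrier_mat n n"
    and g: "g \<in> cent n A" and h: "h \<in> cent n A" and gh: "g * h = 1\<^sub>m n" "h * g = 1\<^sub>m n"
  shows "g * D * h - E \<in> adrange n A \<longleftrightarrow> g * D - E * g \<in> adrange n A"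
proof -
  have c: "g \<in> carrier_mat n n" "h \<in> carrier_mat n n" using g h by (auto simp: cent_def)
  have m: "g * D \<in> carrier_mat n n" "E * g \<in> carrier_mat n n" "g * D * h \<in> carrier_mat n n"
    using c D E by (auto intro: mult_carrier_mat[of _ n n])
  have "(g * D * h - E) * g = g * D - E * g"
    unfolding minus_mult_distrib_mat[OF m(3) E c(1)] assoc_mult_mat[OF m(1) c(2,1)] gh right_mult_one_mat[OF m(1)] ..
  moreover have "(g * D - E * g) * h = g * D * h - E"
    unfolding minus_mult_distrib_mat[OF m(1,2) c(2)] assoc_mult_mat[OF E c] gh right_mult_one_mat[OF E] ..
  ultimately show ?thesis using adrange_right[OF A g] adrange_right[OF A h] by metis
qed

text \<open>On the blocks, the diagonal action is conjugation.\<close>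

lemma Ext1_act_class:
  fixes A :: "'k::field mat"
  assumes A: "A \<in> carrier_mat n n" and D: "D \<in> carrier_mat n n"
    and g: "g \<in> cent n A" and h: "h \<in> cent n A" and gh: "g * h = 1\<^sub>m n" "h * g = 1\<^sub>m n"
  shows "mat_Ext1_act n A g (ext_class n A D) = ext_class n A (g * D * h)"
proof -
  have gc: "g \<in> carrier_mat n n" "g * A = A * g" "h \<in> carrier_mat n n" using g h by (auto simp: cent_def)
  note mor = extension_morphism_iff[OF A _ _ _ _ gc(1,2) refl]
  have "y \<in> mat_Ext1_act n A g (ext_class n A D) \<longleftrightarrow> y \<in> ext_class n A (g * D * h)" for y
  proof -
    have "ext_class n A D \<in> Ext1 class_ring (mat_module n A) (mat_module n A)"
      using mat_Ext1_eq[OF A] D by (simp add: mat_Ext1_def)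
    then have "y \<in> mat_Ext1_act n A g (ext_class n A D) \<longleftrightarrow>
        y \<in> exts n A \<and> (\<exists>x\<in>ext_class n A D. extension_morphism class_ring (mat_module n A) (\<lambda>v. g *\<^sub>v v) (\<lambda>v. g *\<^sub>v v) x y)"
      unfolding mat_Ext1_act_def Ext1_act_def restrict_apply if_P mem_Collect_eq by (simp only: if_True mem_Collect_eq)
    also have "\<dots> \<longleftrightarrow> y \<in> ext_class n A (g * D * h)"
    proof
      assume "y \<in> exts n A \<and> (\<exists>x\<in>ext_class n A D. extension_morphism class_ring (mat_module n A) (\<lambda>v. g *\<^sub>v v) (\<lambda>v. g *\<^sub>v v) x y)"
      then obtain x where y: "y \<in> exts n A" and "x \<in> ext_class n A D"
        and m: "extension_morphism class_ring (mat_module n A) (\<lambda>v. g *\<^sub>v v) (\<lambda>v. g *\<^sub>v v) x y" by blast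
      then obtain D' where x: "x \<in> exts n A" and D': "ext_rep n A x D'" "D - D' \<in> adrange n A" unfolding ext_class_iff by blast
      obtain E where E: "ext_rep n A y E" by (rule ext_rep_exists[OF A y])
      have D'c: "D' \<in> carrier_mat n n" and Ec: "E \<in> carrier_mat n n" using D' E by (auto intro: ext_rep_carrier)
      have "g * D' - E * g \<in> adrange n A" using m mor[OF x y D'(1) E] by simp
      moreover have "g * D - g * D' \<in> adrange n A"
        using adrange_left[OF A g D'(2)] mult_minus_distrib_mat[OF gc(1) D D'c] by simp
      ultimately have "g * D - E * g \<in> adrange n A"
        using adrange_diff_trans[OF A mult_carrier_mat[OF gc(1) D] mult_carrier_mat[OF gc(1) D'c] mult_carrier_mat[OF Ec gc(1)]] by blast
      then have "g * D * h - E \<in> adrange n A" using conjugate_diff_adrange[OF A D Ec g h gh] by simp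
      then show "y \<in> ext_class n A (g * D * h)" unfolding ext_class_iff using y E by blast
    next
      assume "y \<in> ext_class n A (g * D * h)"
      then obtain E where y: "y \<in> exts n A" and E: "ext_rep n A y E" "g * D * h - E \<in> adrange n A" unfolding ext_class_iff by blast
      have "g * D - E * g \<in> adrange n A" using E(2) conjugate_diff_adrange[OF A D ext_rep_carrier[OF E(1)] g h gh] by simp
      moreover obtain x where x: "x \<in> exts n A" "ext_rep n A x D" by (rule ext_exists_rep[OF A D])
      ultimately have "extension_morphism class_ring (mat_module n A) (\<lambda>v. g *\<^sub>v v) (\<lambda>v. g *\<^sub>v v) x y"
        using mor[OF x(1) y x(2) E(1)] by simp
      then show "y \<in> exts n A \<and> (\<exists>x\<in>ext_class n A D. extension_morphism class_ring (mat_module n A) (\<lambda>v. g *\<^sub>v v) (\<lambda>v. g *\<^sub>v v) x y)"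
        using y ext_class_self[OF A x] by blast
    qed
    finally show ?thesis .
  qed
  then show ?thesis by blast
qed

lemma Ext1_act_eq_class:
  fixes A :: "'k::field mat"
  assumes A: "A \<in> carrier_mat n n" and D: "D \<in> carrier_mat n n" and E: "E \<in> carrier_mat n n" and g: "g \<in> centralizer_mat n A"
  shows "mat_Ext1_act n A g (ext_class n A D) = ext_class n A E \<longleftrightarrow> g * D - E * g \<in> adrange n A"
proof -
  obtain h where h: "g \<in> carrier_mat n n" "h \<in> carrier_mat n n" "g * h = 1\<^sub>m n" "h * g = 1\<^sub>m n" "g \<in> cent n A" "h \<in> cent n A"
    using centralizer_matE[OF g A] by metis
  have "g * D * h \<in> carrier_mat n n" using h D by (auto intro: mult_carrier_mat[of _ n n])
  then show ?thesis
    unfolding Ext1_act_class[OF A D h(5,6,3,4)] by (simp add: ext_class_eq_iff[OF A _ E] conjugate_diff_adrange[OF A D E h(5,6,3,4)])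
qed

lemma ext_class_stabilizer:
  fixes A :: "'k::field mat"
  assumes A: "A \<in> carrier_mat n n" and D: "D \<in> carrier_mat n n"
  shows "stabilizer (centralizer_group n A) (mat_Ext1_act n A) (ext_class n A D) = conj_stab n A D"
  using Ext1_act_eq_class[OF A D D] unfolding stabilizer_def conj_stab_def centralizer_group_def by auto

lemma ext_class_orbit:
  fixes A :: "'k::field mat"
  assumes A: "A \<in> carrier_mat n n" and D: "D \<in> carrier_mat n n"
  shows "orbit (centralizer_group n A) (mat_Ext1_act n A) (ext_class n A D) =
    ext_class n A ` {E \<in> carrier_mat n n. conj_rel n A D E}"
proof (intro subset_antisym subsetI)
  fix \<xi> assume "\<xi> \<in> orbit (centralizer_group n A) (mat_Ext1_act n A) (ext_class n A D)"
  then obtain g where g: "g \<in> centralizer_mat n A" and \<xi>: "\<xi> = mat_Ext1_act n A g (ext_class n A D)"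
    unfolding orbit_def centralizer_group_def by auto
  obtain h where h: "g \<in> carrier_mat n n" "h \<in> carrier_mat n n" "g * h = 1\<^sub>m n" "h * g = 1\<^sub>m n" "g \<in> cent n A" "h \<in> cent n A"
    using centralizer_matE[OF g A] by metis
  have c: "g * D * h \<in> carrier_mat n n" using h D by (auto intro: mult_carrier_mat[of _ n n])
  have eq: "\<xi> = ext_class n A (g * D * h)" unfolding \<xi> by (rule Ext1_act_class[OF A D h(5,6,3,4)])
  then have "g * D - (g * D * h) * g \<in> adrange n A" using Ext1_act_eq_class[OF A D c g] \<xi> by simp
  then show "\<xi> \<in> ext_class n A ` {E \<in> carrier_mat n n. conj_rel n A D E}"
    using eq c g unfolding conj_rel_def by blast
next
  fix \<xi> assume "\<xi> \<in> ext_class n A ` {E \<in> carrier_mat n n. conj_rel n A D E}"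
  then obtain E g where E: "E \<in> carrier_mat n n" "g \<in> centralizer_mat n A" "g * D - E * g \<in> adrange n A" and \<xi>: "\<xi> = ext_class n A E"
    unfolding conj_rel_def by blast
  then have "\<xi> = mat_Ext1_act n A g (ext_class n A D)" using Ext1_act_eq_class[OF A D E(1,2)] by simp
  then show "\<xi> \<in> orbit (centralizer_group n A) (mat_Ext1_act n A) (ext_class n A D)"
    using E(2) unfolding orbit_def centralizer_group_def by auto
qed

lemma ext_class_orbit_eq_iff:
  fixes A :: "'k::field mat"
  assumes A: "A \<in> carrier_mat n n" and D: "D \<in> carrier_mat n n" and E: "E \<in> carrier_mat n n"
  shows "orbit (centralizer_group n A) (mat_Ext1_act n A) (ext_class n A D) =
    orbit (centralizer_group n A) (mat_Ext1_act n A) (ext_class n A E) \<longleftrightarrow> conj_rel n A D E"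
proof
  assume eq: "orbit (centralizer_group n A) (mat_Ext1_act n A) (ext_class n A D) =
    orbit (centralizer_group n A) (mat_Ext1_act n A) (ext_class n A E)"
  have "ext_class n A E \<in> ext_class n A ` {F \<in> carrier_mat n n. conj_rel n A D F}"
    using eq conj_rel_refl[OF A E] E unfolding ext_class_orbit[OF A D] ext_class_orbit[OF A E] by blast
  then obtain F where F: "F \<in> carrier_mat n n" "conj_rel n A D F" "ext_class n A F = ext_class n A E" by auto
  have "conj_rel n A F E" by (rule conj_rel_adrange[OF A F(1) E]) (use F E ext_class_eq_iff[OF A F(1) E] in simp)
  then show "conj_rel n A D E" by (rule conj_rel_trans[OF A D F(1) E F(2)])
next
  assume r: "conj_rel n A D E"
  have "{F \<in> carrier_mat n n. conj_rel n A D F} = {F \<in> carrier_mat n n. conj_rel n A E F}"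
    using conj_rel_trans[OF A D E _ r] conj_rel_trans[OF A E D _ conj_rel_sym[OF A D E r]] by blast
  then show "orbit (centralizer_group n A) (mat_Ext1_act n A) (ext_class n A D) =
    orbit (centralizer_group n A) (mat_Ext1_act n A) (ext_class n A E)"
    unfolding ext_class_orbit[OF A D] ext_class_orbit[OF A E] by simp
qed

text \<open>Orbits whose stabilizers have a prescribed order, as the image of a set of matrices. Together with
  \<open>ext_class_orbit_eq_iff\<close> this reduces counting them to counting the classes of \<open>conj_rel\<close>.\<close>

lemma orbits_with_stabilizer:
  fixes A :: "'k::field mat"
  assumes A: "A \<in> carrier_mat n n"
  shows "{X \<in> orbits (centralizer_group n A) (mat_Ext1 n A) (mat_Ext1_act n A).
      \<exists>\<xi>\<in>X. P (card (stabilizer (centralizer_group n A) (mat_Ext1_act n A) \<xi>))} =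
    (\<lambda>D. orbit (centralizer_group n A) (mat_Ext1_act n A) (ext_class n A D)) `
      {D \<in> carrier_mat n n. P (card (conj_stab n A D))}" (is "?L = ?o ` ?S")
proof (intro subset_antisym subsetI)
  fix X assume "X \<in> ?L"
  then obtain D0 where D0: "D0 \<in> carrier_mat n n" "X = ?o D0"
    and "\<exists>\<xi>\<in>X. P (card (stabilizer (centralizer_group n A) (mat_Ext1_act n A) \<xi>))"
    unfolding orbits_def mat_Ext1_eq[OF A] by blast
  then obtain E where E: "E \<in> carrier_mat n n" "conj_rel n A D0 E"
    "P (card (stabilizer (centralizer_group n A) (mat_Ext1_act n A) (ext_class n A E)))"
    unfolding ext_class_orbit[OF A D0(1)] by blast
  have "X = ?o E" using D0(2) E(2) ext_class_orbit_eq_iff[OF A D0(1) E(1)] by simp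
  then show "X \<in> ?o ` ?S" using E(1,3) unfolding ext_class_stabilizer[OF A E(1)] by blast
next
  fix X assume "X \<in> ?o ` ?S"
  then obtain D where D: "D \<in> carrier_mat n n" "P (card (conj_stab n A D))" "X = ?o D" by blast
  have "ext_class n A D \<in> X"
    unfolding D(3) ext_class_orbit[OF A D(1)] using D(1) conj_rel_refl[OF A D(1)] by blast
  moreover have "X \<in> orbits (centralizer_group n A) (mat_Ext1 n A) (mat_Ext1_act n A)"
    unfolding orbits_def mat_Ext1_eq[OF A] using D by blast
  moreover have "P (card (stabilizer (centralizer_group n A) (mat_Ext1_act n A) (ext_class n A D)))"
    unfolding ext_class_stabilizer[OF A D(1)] by (rule D(2))
  ultimately show "X \<in> ?L" by blast
qed

section \<open>Similarity of lifts\<close>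

lemma centralizer_mat_cent: "centralizer_mat n A = general_linear n \<inter> cent n A" for A :: "'a::comm_ring_1 mat"
  by (auto simp: centralizer_mat_alt cent_def general_linear_def)

lemma general_linear_carrier: "g \<in> general_linear n \<Longrightarrow> g \<in> carrier_mat n n"
  by (simp add: general_linear_def)

lemma similar_mat_iff:
  fixes B C :: "'a::comm_ring_1 mat"
  assumes B: "B \<in> carrier_mat n n" and C: "C \<in> carrier_mat n n"
  shows "similar_mat B C \<longleftrightarrow> (\<exists>P\<in>general_linear n. P * C = B * P)"
proof
  assume "similar_mat B C"
  then obtain m P Q where "{B, C, P, Q} \<subseteq> carrier_mat m m" and w: "P * Q = 1\<^sub>m m" "Q * P = 1\<^sub>m m" "B = P * C * Q"
    using similar_matD by blast
  moreover from this have "m = n" using B by auto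
  ultimately have PQ: "P \<in> carrier_mat n n" "Q \<in> carrier_mat n n" "P * Q = 1\<^sub>m n" "Q * P = 1\<^sub>m n" by auto
  have "B * P = P * C"
    unfolding w(3) assoc_mult_mat[OF mult_carrier_mat[OF PQ(1) C] PQ(2,1)] PQ(4)
    by (rule right_mult_one_mat[OF mult_carrier_mat[OF PQ(1) C]])
  moreover have "P \<in> general_linear n" using PQ unfolding general_linear_def by blast
  ultimately show "\<exists>P\<in>general_linear n. P * C = B * P" by metis
next
  assume "\<exists>P\<in>general_linear n. P * C = B * P"
  then obtain P Q where P: "P \<in> carrier_mat n n" "Q \<in> carrier_mat n n" "P * Q = 1\<^sub>m n" "Q * P = 1\<^sub>m n" and e: "P * C = B * P"
    by (auto simp: general_linear_def)
  have "P * C * Q = B" unfolding e assoc_mult_mat[OF B P(1,2)] P(3) by (rule right_mult_one_mat[OF B])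
  then show "similar_mat B C" using P B C by (intro similar_matI[of B C P Q n]) auto
qed

lemma similar_mat_carrier:
  fixes B C :: "'a::comm_ring_1 mat"
  shows "similar_mat B C \<Longrightarrow> B \<in> carrier_mat n n \<longleftrightarrow> C \<in> carrier_mat n n"
  by (auto dest!: similar_matD)

lemma general_linear_similar:
  fixes A B :: "'a::comm_ring_1 mat"
  assumes A: "A \<in> general_linear n" and s: "similar_mat B A"
  shows "B \<in> general_linear n"
proof -
  have Ac: "A \<in> carrier_mat n n" by (rule general_linear_carrier[OF A])
  have Bc: "B \<in> carrier_mat n n" using similar_mat_carrier[OF s] Ac by blast
  obtain P Q where P: "P \<in> carrier_mat n n" "Q \<in> carrier_mat n n" "P * Q = 1\<^sub>m n" "Q * P = 1\<^sub>m n" "P * A = B * P"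
    using s unfolding similar_mat_iff[OF Bc Ac] by (auto simp: general_linear_def)
  have "P \<in> general_linear n" "Q \<in> general_linear n" using P unfolding general_linear_def by blast+
  then have "P * A * Q \<in> general_linear n" using A by (intro general_linear_mult)
  moreover have "P * A * Q = B" unfolding P(5) assoc_mult_mat[OF Bc P(1,2)] P(3) using Bc by simp
  ultimately show ?thesis by simp
qed

definition sim_class :: "'a::comm_ring_1 mat \<Rightarrow> 'a mat set" where
  "sim_class B = {C. similar_mat B C}"

lemma similarity_classes_eq: "similarity_classes TYPE('a::comm_ring_1) n = sim_class ` (carrier_mat n n :: 'a mat set)"
  by (auto simp: similarity_classes_def quotient_def sim_class_def)

lemma sim_class_self: "B \<in> carrier_mat n n \<Longrightarrow> B \<in> sim_class B"
  by (simp add: sim_class_def similar_mat_refl)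

lemma sim_class_eq_iff:
  fixes B C :: "'a::comm_ring_1 mat"
  assumes "C \<in> carrier_mat n n"
  shows "sim_class B = sim_class C \<longleftrightarrow> similar_mat B C"
proof
  assume "sim_class B = sim_class C"
  then show "similar_mat B C" using sim_class_self[OF assms] by (auto simp: sim_class_def)
next
  assume "similar_mat B C"
  then show "sim_class B = sim_class C"
    unfolding sim_class_def using similar_mat_trans similar_mat_sym by blast
qed

lemma similarity_class_carrier:
  fixes C :: "'a::comm_ring_1 mat set"
  assumes "C \<in> similarity_classes TYPE('a) n" "B \<in> C"
  shows "B \<in> carrier_mat n n"
  using assms similar_mat_carrier[of _ B n] by (auto simp: similarity_classes_eq sim_class_def)

lemma similarity_class_eq:
  fixes C :: "'a::comm_ring_1 mat set"
  assumes "C \<in> similarity_classes TYPE('a) n" "B \<in> C"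
  shows "C = sim_class B"
proof -
  obtain B0 where "C = sim_class B0" using assms(1) by (auto simp: similarity_classes_eq)
  then show ?thesis using assms(2) sim_class_eq_iff[OF similarity_class_carrier[OF assms]] by (simp add: sim_class_def)
qed

lemma conjugate_centralizer:
  fixes B C P Q :: "'a::comm_ring_1 mat"
  assumes B: "B \<in> carrier_mat n n" and C: "C \<in> carrier_mat n n"
    and P: "P \<in> carrier_mat n n" "Q \<in> carrier_mat n n" "P * Q = 1\<^sub>m n" "Q * P = 1\<^sub>m n" and e: "P * C = B * P"
    and g: "g \<in> centralizer_mat n C"
  shows "P * g * Q \<in> centralizer_mat n B"
proof -
  have g': "g \<in> general_linear n" "g * C = C * g" "g \<in> carrier_mat n n"
    using g by (auto simp: centralizer_mat_alt general_linear_def)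
  have PGL: "P \<in> general_linear n" "Q \<in> general_linear n" using P by (auto simp: general_linear_def)
  have gl: "P * g * Q \<in> general_linear n" by (intro general_linear_mult PGL g')
  have "Q * B = Q * (B * (P * Q))" using P(3) B by simp
  also have "\<dots> = Q * ((P * C) * Q)" unfolding e assoc_mult_mat[OF B P(1,2)] ..
  also have "\<dots> = (Q * P) * (C * Q)"
    unfolding assoc_mult_mat[OF P(1) C P(2)] by (rule assoc_mult_mat[OF P(2,1) mult_carrier_mat[OF C P(2)], symmetric])
  also have "\<dots> = C * Q" using P C by simp
  finally have QB: "Q * B = C * Q" .
  have Pg: "P * g \<in> carrier_mat n n" using P(1) g'(3) by (rule mult_carrier_mat)
  have "(P * g * Q) * B = (P * g) * (C * Q)" unfolding assoc_mult_mat[OF Pg P(2) B] QB ..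
  also have "\<dots> = (P * (g * C)) * Q"
    unfolding assoc_mult_mat[OF Pg C P(2), symmetric] assoc_mult_mat[OF P(1) g'(3) C] ..
  also have "\<dots> = ((B * P) * g) * Q"
    unfolding g'(2) assoc_mult_mat[OF P(1) C g'(3), symmetric] e ..
  also have "\<dots> = B * (P * g * Q)" unfolding assoc_mult_mat[OF B P(1) g'(3)] by (rule assoc_mult_mat[OF B Pg P(2)])
  finally show ?thesis using gl by (simp add: centralizer_mat_alt)
qed

lemma centralizer_mat_finite: "finite (centralizer_mat n (B :: 'a::{finite,comm_ring_1} mat))"
  by (rule finite_subset[OF _ finite_carrier_mat[of n]]) (auto simp: centralizer_mat_alt general_linear_def)

lemma similar_centralizer_card:
  fixes B C :: "'a::{finite,comm_ring_1} mat"
  assumes "B \<in> carrier_mat n n" "similar_mat B C"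
  shows "card (centralizer_mat n B) = card (centralizer_mat n C)"
proof -
  have le: "card (centralizer_mat n C) \<le> card (centralizer_mat n B)"
    if B: "B \<in> carrier_mat n n" and s: "similar_mat B C" for B C :: "'a mat"
  proof -
    have C: "C \<in> carrier_mat n n" using similar_mat_carrier[OF s] B by blast
    obtain P Q where P: "P \<in> carrier_mat n n" "Q \<in> carrier_mat n n" "P * Q = 1\<^sub>m n" "Q * P = 1\<^sub>m n" "P * C = B * P"
      using s unfolding similar_mat_iff[OF B C] by (auto simp: general_linear_def)
    have inv: "Q * (P * g * Q) * P = g" if "g \<in> carrier_mat n n" for g
    proof -
      have Pg: "P * g \<in> carrier_mat n n" using P(1) that by (rule mult_carrier_mat)
      have "Q * (P * g * Q) * P = (Q * (P * g)) * (Q * P)"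
        unfolding assoc_mult_mat[OF P(2) Pg P(2), symmetric] by (rule assoc_mult_mat[OF mult_carrier_mat[OF P(2) Pg] P(2,1)])
      also have "\<dots> = g" using P that unfolding assoc_mult_mat[OF P(2,1) that, symmetric] by simp
      finally show ?thesis .
    qed
    show ?thesis
    proof (rule card_inj_on_le[where f = "\<lambda>g. P * g * Q"])
      show "inj_on (\<lambda>g. P * g * Q) (centralizer_mat n C)"
        by (rule inj_on_inverseI[where g = "\<lambda>y. Q * y * P"]) (rule inv, simp add: centralizer_mat_alt general_linear_def)
      show "(\<lambda>g. P * g * Q) ` centralizer_mat n C \<subseteq> centralizer_mat n B"
        using conjugate_centralizer[OF B C P] by blast
    qed (rule centralizer_mat_finite)
  qed
  show ?thesis
    using le[OF assms] le[OF _ similar_mat_sym[OF assms(2)]] similar_mat_carrier[OF assms(2)] assms(1) by (metis antisym)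
qed

context square_zero
begin

lemma general_linear_red_iff:
  assumes P: "P \<in> carrier_mat n n"
  shows "P \<in> general_linear n \<longleftrightarrow> redm P \<in> general_linear n"
proof
  assume "P \<in> general_linear n"
  then obtain Q where Q: "Q \<in> carrier_mat n n" "P * Q = 1\<^sub>m n" "Q * P = 1\<^sub>m n" by (auto simp: general_linear_def)
  have "redm P * redm Q = 1\<^sub>m n" "redm Q * redm P = 1\<^sub>m n"
    using redm_mult[OF P Q(1)] redm_mult[OF Q(1) P] Q redm_one by simp_all
  then show "redm P \<in> general_linear n" using P Q by (auto simp: general_linear_def intro!: bexI[of _ "redm Q"])
next
  assume "redm P \<in> general_linear n"
  then obtain q where q: "q \<in> carrier_mat n n" "redm P * q = 1\<^sub>m n" "q * redm P = 1\<^sub>m n" by (auto simp: general_linear_def)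
  obtain Q where "Q \<in> carrier_mat n n" "P * Q = 1\<^sub>m n" "Q * P = 1\<^sub>m n" using inverse_lift[OF P q] by metis
  then show "P \<in> general_linear n" using P by (auto simp: general_linear_def)
qed

definition commuting_lift :: "nat \<Rightarrow> 'k mat \<Rightarrow> 'r mat \<Rightarrow> bool" where
  "commuting_lift n A At \<longleftrightarrow> At \<in> carrier_mat n n \<and> redm At = A \<and>
     (\<forall>X\<in>cent n A. \<exists>Xt\<in>carrier_mat n n. redm Xt = X \<and> At * Xt = Xt * At)"

lemma commuting_lift_exists:
  assumes "A \<in> carrier_mat n n"
  obtains At where "commuting_lift n A At"
proof -
  obtain At where "At \<in> carrier_mat n n" "redm At = A"
    "\<And>X. X \<in> carrier_mat n n \<Longrightarrow> A * X = X * A \<Longrightarrow> \<exists>Xt. Xt \<in> carrier_mat n n \<and> redm Xt = X \<and> At * Xt = Xt * At"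
    by (rule centralizer_lifts[OF assms]) (rule that)
  then have "commuting_lift n A At" unfolding commuting_lift_def cent_def by blast
  then show ?thesis by (rule that)
qed

lemma redm_add_thmat: "B \<in> carrier_mat n n \<Longrightarrow> X \<in> carrier_mat n n \<Longrightarrow> redm (B + thmat X) = redm B"
  by (simp add: redm_add redm_thmat right_add_zero_mat)

lemma add_thmat_cancel:
  assumes B: "B \<in> carrier_mat n n" and X: "X \<in> carrier_mat n n" "Y \<in> carrier_mat n n"
  shows "B + thmat X = B + thmat Y \<longleftrightarrow> X = Y"
proof
  assume e: "B + thmat X = B + thmat Y"
  have c: "thmat X \<in> carrier_mat n n" "thmat Y \<in> carrier_mat n n" using X by auto
  have "\<forall>i<n. \<forall>j<n. (B + thmat X) $$ (i, j) = (B + thmat Y) $$ (i, j)" unfolding e by blast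
  then have "\<forall>i<n. \<forall>j<n. thmat X $$ (i, j) = thmat Y $$ (i, j)" using B c by simp
  then have "thmat X = thmat Y" unfolding mat_eq_iff_index[OF c] .
  then show "X = Y" by (rule thmat_inj[OF X])
qed simp

text \<open>Both products are expanded. The leading terms agree because \<open>P\<close> commutes with \<open>At\<close>, the terms with two factors
  from the kernel vanish, and \<open>\<theta>\<close> is injective on the rest.\<close>

lemma first_order_intertwiner_iff:
  assumes At: "At \<in> carrier_mat n n" and P: "P \<in> carrier_mat n n" "At * P = P * At"
    and W: "W \<in> carrier_mat n n" and X: "X \<in> carrier_mat n n" and X': "X' \<in> carrier_mat n n"
  shows "(P + thmat W) * (At + thmat X) = (At + thmat X') * (P + thmat W) \<longleftrightarrow>
    redm At * W - W * redm At = redm P * X - X' * redm P"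
proof -
  let ?p = "redm P" and ?A = "redm At"
  have c: "?p \<in> carrier_mat n n" "?A \<in> carrier_mat n n" using P At by auto
  have m: "?p * X \<in> carrier_mat n n" "W * ?A \<in> carrier_mat n n" "X' * ?p \<in> carrier_mat n n" "?A * W \<in> carrier_mat n n"
    using c W X X' by auto
  have expand: "(B + thmat Y) * (C + thmat Z) = B * C + thmat (redm B * Z + Y * redm C)"
    if "B \<in> carrier_mat n n" "C \<in> carrier_mat n n" "Y \<in> carrier_mat n n" "Z \<in> carrier_mat n n" for B C Y Z
  proof -
    have t: "thmat Y \<in> carrier_mat n n" "thmat Z \<in> carrier_mat n n" using that by auto
    have s: "B * C \<in> carrier_mat n n" "redm B * Z \<in> carrier_mat n n" "Y * redm C \<in> carrier_mat n n"
      using that by (auto intro: mult_carrier_mat[of _ n n])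
    have "(B + thmat Y) * (C + thmat Z) = (B * C + B * thmat Z) + (thmat Y * C + thmat Y * thmat Z)"
      unfolding add_mult_distrib_mat[OF that(1) t(1) add_carrier_mat[OF t(2)]]
        mult_add_distrib_mat[OF that(1) that(2) t(2)] mult_add_distrib_mat[OF t(1) that(2) t(2)] ..
    also have "\<dots> = (B * C + thmat (redm B * Z)) + (thmat (Y * redm C) + 0\<^sub>m n n)"
      unfolding thmat_mult_left[OF that(1,4)] thmat_mult_right[OF that(2,3)] thmat_mult_thmat[OF that(3,4)] ..
    also have "\<dots> = B * C + thmat (redm B * Z + Y * redm C)"
    proof -
      have u: "thmat (redm B * Z) \<in> carrier_mat n n" "thmat (Y * redm C) \<in> carrier_mat n n" using s(2,3) by auto
      show ?thesis unfolding thmat_add[OF s(2,3)] right_add_zero_mat[OF u(2)] by (rule assoc_add_mat[OF s(1) u])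
    qed
    finally show ?thesis .
  qed
  have "(P + thmat W) * (At + thmat X) = (At + thmat X') * (P + thmat W) \<longleftrightarrow>
      P * At + thmat (?p * X + W * ?A) = P * At + thmat (?A * W + X' * ?p)"
    unfolding expand[OF P(1) At W X] expand[OF At P(1) X' W] P(2) ..
  also have "\<dots> \<longleftrightarrow> ?p * X + W * ?A = ?A * W + X' * ?p"
    by (rule add_thmat_cancel[OF mult_carrier_mat[OF P(1) At]]) (use m in auto)
  also have "\<dots> \<longleftrightarrow> ?A * W + X' * ?p = ?p * X + W * ?A" by (rule eq_commute)
  also have "\<dots> \<longleftrightarrow> ?A * W + X' * ?p = W * ?A + ?p * X" unfolding comm_add_mat[OF m(1,2)] ..
  also have "\<dots> \<longleftrightarrow> ?A * W - W * ?A = ?p * X - X' * ?p"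
    by (rule sum_eq_iff_diff_eq[OF m(4,3,2,1)])
  finally show ?thesis .
qed

lemma intertwiner_split:
  assumes A: "A \<in> carrier_mat n n" and L: "commuting_lift n A At"
    and X: "X \<in> carrier_mat n n" and X': "X' \<in> carrier_mat n n"
    and P: "P \<in> general_linear n" "P * (At + thmat X) = (At + thmat X') * P"
    and P0: "P0 \<in> carrier_mat n n" "At * P0 = P0 * At" "redm P0 = redm P"
  obtains W where "W \<in> carrier_mat n n" "P = P0 + thmat W" "A * W - W * A = redm P * X - X' * redm P"
proof -
  have At: "At \<in> carrier_mat n n" "redm At = A" using L by (auto simp: commuting_lift_def)
  have Pc: "P \<in> carrier_mat n n" using P(1) by (rule general_linear_carrier)
  obtain W where W: "W \<in> carrier_mat n n" "P = P0 + thmat W" by (rule redm_eqE[OF Pc P0(1) P0(3)[symmetric]])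
  have "A * W - W * A = redm P * X - X' * redm P"
    using first_order_intertwiner_iff[OF At(1) P0(1,2) W(1) X X'] P(2) unfolding W(2)[symmetric] At(2) P0(3) by blast
  then show ?thesis by (rule that[OF W])
qed

lemma intertwiner_reduces:
  assumes A: "A \<in> carrier_mat n n" and L: "commuting_lift n A At"
    and X: "X \<in> carrier_mat n n" and X': "X' \<in> carrier_mat n n"
    and P: "P \<in> general_linear n" "P * (At + thmat X) = (At + thmat X') * P"
  shows "redm P \<in> centralizer_mat n A"
proof -
  have At: "At \<in> carrier_mat n n" "redm At = A" using L by (auto simp: commuting_lift_def)
  have Pc: "P \<in> carrier_mat n n" using P(1) by (rule general_linear_carrier)
  have t: "At + thmat X \<in> carrier_mat n n" "At + thmat X' \<in> carrier_mat n n" using X X' by auto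
  have "redm P * A = A * redm P"
    using arg_cong[OF P(2), of redm] unfolding redm_mult[OF Pc t(1)] redm_mult[OF t(2) Pc] redm_add_thmat[OF At(1) X] redm_add_thmat[OF At(1) X'] At(2) .
  then show ?thesis using P(1) general_linear_red_iff[OF Pc] by (simp add: centralizer_mat_alt)
qed

text \<open>Every intertwiner reduces to some \<open>g\<close> in \<open>G_A\<close>, and differs from a lift of \<open>g\<close> that commutes with \<open>At\<close> by some
  \<open>\<theta>(W)\<close>.\<close>

lemma lifted_similar_iff:
  assumes A: "A \<in> carrier_mat n n" and L: "commuting_lift n A At"
    and X: "X \<in> carrier_mat n n" and X': "X' \<in> carrier_mat n n"
  shows "similar_mat (At + thmat X') (At + thmat X) \<longleftrightarrow> conj_rel n A X X'"
proof -
  have At: "At \<in> carrier_mat n n" "redm At = A" using L by (auto simp: commuting_lift_def)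
  have t: "At + thmat X' \<in> carrier_mat n n" "At + thmat X \<in> carrier_mat n n" using X X' by auto
  show ?thesis
    unfolding similar_mat_iff[OF t] conj_rel_def
  proof
    assume "\<exists>P\<in>general_linear n. P * (At + thmat X) = (At + thmat X') * P"
    then obtain P where P: "P \<in> general_linear n" "P * (At + thmat X) = (At + thmat X') * P" by blast
    have p: "redm P \<in> centralizer_mat n A" by (rule intertwiner_reduces[OF A L X X' P])
    then obtain P0 where P0: "P0 \<in> carrier_mat n n" "redm P0 = redm P" "At * P0 = P0 * At"
      using L by (auto simp: centralizer_mat_cent commuting_lift_def)
    obtain W where "W \<in> carrier_mat n n" "P = P0 + thmat W" "A * W - W * A = redm P * X - X' * redm P"
      by (rule intertwiner_split[OF A L X X' P P0(1,3,2)])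
    then show "\<exists>g\<in>centralizer_mat n A. g * X - X' * g \<in> adrange n A"
      using p unfolding adrange_iff by (intro bexI[of _ "redm P"] bexI[of _ W]) auto
  next
    assume "\<exists>g\<in>centralizer_mat n A. g * X - X' * g \<in> adrange n A"
    then obtain g W where g: "g \<in> centralizer_mat n A" and W: "W \<in> carrier_mat n n" "g * X - X' * g = A * W - W * A"
      unfolding adrange_iff by blast
    obtain P0 where P0: "P0 \<in> carrier_mat n n" "redm P0 = g" "At * P0 = P0 * At"
      using L g by (auto simp: centralizer_mat_cent commuting_lift_def)
    have "P0 + thmat W \<in> general_linear n"
      using g general_linear_red_iff[of "P0 + thmat W" n] W(1) P0 by (simp add: redm_add_thmat centralizer_mat_cent)
    moreover have "(P0 + thmat W) * (At + thmat X) = (At + thmat X') * (P0 + thmat W)"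
      unfolding first_order_intertwiner_iff[OF At(1) P0(1,3) W(1) X X'] At(2) P0(2) by (rule W(2)[symmetric])
    ultimately show "\<exists>P\<in>general_linear n. P * (At + thmat X) = (At + thmat X') * P" by blast
  qed
qed

text \<open>Reduction maps the centralizer onto the stabilizer of \<open>X\<close>. The fibre over \<open>g\<close> consists of the solutions \<open>W\<close> of
  \<open>A W - W A = g X - X g\<close>, of which there are as many as elements of \<open>cent n A\<close>.\<close>

lemma lifted_centralizer_card:
  assumes A: "A \<in> carrier_mat n n" and L: "commuting_lift n A At" and X: "X \<in> carrier_mat n n"
  shows "card (centralizer_mat n (At + thmat X)) = card (cent n A) * card (conj_stab n A X)"
proof -
  have At: "At \<in> carrier_mat n n" "redm At = A" using L by (auto simp: commuting_lift_def)
  have "\<forall>g\<in>cent n A. \<exists>P0. P0 \<in> carrier_mat n n \<and> redm P0 = g \<and> At * P0 = P0 * At"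
    using L by (auto simp: commuting_lift_def)
  then obtain l where l: "\<And>g. g \<in> cent n A \<Longrightarrow> l g \<in> carrier_mat n n" "\<And>g. g \<in> cent n A \<Longrightarrow> redm (l g) = g"
    "\<And>g. g \<in> cent n A \<Longrightarrow> At * l g = l g * At" by metis
  define W where "W g = {Y \<in> carrier_mat n n. A * Y - Y * A = g * X - X * g}" for g
  have stab: "g \<in> cent n A" "g \<in> centralizer_mat n A" "g \<in> general_linear n" "g * X - X * g \<in> adrange n A" if "g \<in> conj_stab n A X" for g
    using that by (auto simp: conj_stab_def centralizer_mat_cent)
  have "bij_betw (\<lambda>(g, Y). l g + thmat Y) (SIGMA g:conj_stab n A X. W g) (centralizer_mat n (At + thmat X))"
    unfolding bij_betw_def
  proof (intro conjI inj_onI subset_antisym subsetI)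
    fix u v assume u: "u \<in> (SIGMA g:conj_stab n A X. W g)" "v \<in> (SIGMA g:conj_stab n A X. W g)"
      and eq: "(case u of (g, Y) \<Rightarrow> l g + thmat Y) = (case v of (g, Y) \<Rightarrow> l g + thmat Y)"
    obtain g Y g' Y' where uv: "u = (g, Y)" "v = (g', Y')" by (cases u, cases v)
    have Y: "g \<in> conj_stab n A X" "Y \<in> carrier_mat n n" "g' \<in> conj_stab n A X" "Y' \<in> carrier_mat n n"
      using u uv by (auto simp: W_def)
    have e: "l g + thmat Y = l g' + thmat Y'" using eq uv by simp
    have "redm (l g + thmat Y) = g" using l(1,2)[OF stab(1)[OF Y(1)]] Y(2) by (simp add: redm_add_thmat)
    moreover have "redm (l g' + thmat Y') = g'" using l(1,2)[OF stab(1)[OF Y(3)]] Y(4) by (simp add: redm_add_thmat)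
    ultimately have "g = g'" using e by simp
    then show "u = v" using e add_thmat_cancel[OF l(1)[OF stab(1)[OF Y(1)]] Y(2,4)] uv by simp
  next
    fix P assume "P \<in> (\<lambda>(g, Y). l g + thmat Y) ` (SIGMA g:conj_stab n A X. W g)"
    then obtain g Y where P: "P = l g + thmat Y" and g: "g \<in> conj_stab n A X" and Y: "Y \<in> carrier_mat n n" "A * Y - Y * A = g * X - X * g"
      by (auto simp: W_def)
    note lg = l[OF stab(1)[OF g]]
    have "P \<in> general_linear n"
      using general_linear_red_iff[of P n] lg(1) Y(1) stab(3)[OF g] lg(2) by (simp add: P redm_add_thmat)
    moreover have "P * (At + thmat X) = (At + thmat X) * P"
      unfolding P first_order_intertwiner_iff[OF At(1) lg(1,3) Y(1) X X] At(2) lg(2) by (rule Y(2))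
    ultimately show "P \<in> centralizer_mat n (At + thmat X)" by (simp add: centralizer_mat_alt)
  next
    fix P assume "P \<in> centralizer_mat n (At + thmat X)"
    then have P: "P \<in> general_linear n" "P * (At + thmat X) = (At + thmat X) * P" by (auto simp: centralizer_mat_alt)
    have p: "redm P \<in> centralizer_mat n A" by (rule intertwiner_reduces[OF A L X X P])
    then have pc: "redm P \<in> cent n A" by (simp add: centralizer_mat_cent)
    obtain Y where Y: "Y \<in> carrier_mat n n" "P = l (redm P) + thmat Y" "A * Y - Y * A = redm P * X - X * redm P"
      by (rule intertwiner_split[OF A L X X P l(1,3,2)[OF pc]])
    have "redm P \<in> conj_stab n A X" using p Y(1) Y(3)[symmetric] by (auto simp: conj_stab_def adrange_iff)
    then have "(redm P, Y) \<in> (SIGMA g:conj_stab n A X. W g)" using Y by (simp add: W_def)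
    then show "P \<in> (\<lambda>(g, Y). l g + thmat Y) ` (SIGMA g:conj_stab n A X. W g)"
      by (rule rev_image_eqI) (simp add: Y(2)[symmetric])
  qed
  then have "card (centralizer_mat n (At + thmat X)) = card (SIGMA g:conj_stab n A X. W g)" by (rule bij_betw_same_card[symmetric])
  also have "\<dots> = (\<Sum>g\<in>conj_stab n A X. card (W g))"
  proof (rule card_SigmaI)
    show "finite (conj_stab n A X)" by (rule finite_subset[OF _ centralizer_mat_finite[of n A]]) (auto simp: conj_stab_def)
    show "\<forall>g\<in>conj_stab n A X. finite (W g)" by (auto simp: W_def finite_carrier_mat)
  qed
  also have "\<dots> = (\<Sum>g\<in>conj_stab n A X. card (cent n A))"
    unfolding W_def by (intro sum.cong refl ad_fibre[OF A] stab(4))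
  finally show ?thesis by simp
qed

end

section \<open>Similarity classes above a type\<close>

lemma has_sim_type_iff:
  fixes B :: "'k::field mat"
  assumes "\<tau> \<in> sim_types n"
  shows "has_sim_type n B \<tau> \<longleftrightarrow> B \<in> carrier_mat n n \<and> (\<exists>c\<in>\<tau>. \<exists>v. gens n B (Jc c) (ec c) v)"
  unfolding has_sim_type_def using module_iso_iff_gens sim_types_class(1)[OF assms] by blast

lemma has_sim_type_exists:
  fixes B :: "'k::{finite,field} mat"
  assumes B: "B \<in> carrier_mat n n"
  obtains \<tau> where "\<tau> \<in> sim_types n" "has_sim_type n B \<tau>"
proof -
  obtain c v where c: "c \<in> class_functions n" "gens n B (Jc c) (ec c) v" by (rule class_function_exists)
  let ?t = "same_type n `` {c}"
  have t: "?t \<in> sim_types n" unfolding sim_types_def by (rule quotientI[OF c(1)])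
  moreover have "c \<in> ?t" by (rule equiv_class_self[OF same_type_equiv c(1)])
  ultimately have "has_sim_type n B ?t" unfolding has_sim_type_iff[OF t] using B c(2) by blast
  then show ?thesis using t that by blast
qed

lemma has_sim_type_unique:
  fixes B :: "'k::{finite,field} mat"
  assumes t: "\<tau> \<in> sim_types n" "\<tau>' \<in> sim_types n" and h: "has_sim_type n B \<tau>" "has_sim_type n B' \<tau>'" and s: "similar_mat B' B"
  shows "\<tau> = \<tau>'"
proof -
  obtain c v where c: "c \<in> \<tau>" "gens n B (Jc c) (ec c) v" and B: "B \<in> carrier_mat n n"
    using h(1) has_sim_type_iff[OF t(1)] by blast
  obtain c' v' where c': "c' \<in> \<tau>'" "gens n B' (Jc c') (ec c') v'" and B': "B' \<in> carrier_mat n n"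
    using h(2) has_sim_type_iff[OF t(2)] by blast
  obtain P Q where P: "P \<in> carrier_mat n n" "Q \<in> carrier_mat n n" "P * Q = 1\<^sub>m n" "Q * P = 1\<^sub>m n" "P * B = B' * P"
    using s unfolding similar_mat_iff[OF B' B] by (auto simp: general_linear_def)
  have "c = c'"
    by (rule class_function_unique[OF sim_types_class(1)[OF t(1) c(1)] gens_transport[OF B B' P(1-4) P(5)[symmetric] c(2)]
          sim_types_class(1)[OF t(2) c'(1)] c'(2)])
  then show ?thesis
    using c(1) c'(1) t quotient_disj[OF same_type_equiv, of \<tau> n \<tau>'] unfolding sim_types_def by blast
qed

lemma centralizer_type_z:
  fixes B :: "'k::{finite,field} mat"
  assumes t: "\<tau> \<in> sim_types n" and h: "has_sim_type n B \<tau>"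
  shows "card (cent n B) = card (UNIV :: 'k set) ^ type_z \<tau>"
proof -
  obtain c v where c: "c \<in> \<tau>" "gens n B (Jc c) (ec c) v" and B: "B \<in> carrier_mat n n"
    using h has_sim_type_iff[OF t] by blast
  show ?thesis unfolding cent_def type_z[OF t c(1)] by (rule centralizer_dim[OF B sim_types_class(1)[OF t c(1)] c(2)])
qed

text \<open>Similar matrices have conjugate centralizers and commutator spaces; a suitable conjugate of \<open>B\<close> has the same ones as \<open>A\<close>.\<close>

lemma same_type_representative:
  fixes A B :: "'k::{finite,field} mat"
  assumes t: "\<tau> \<in> sim_types n" and h: "has_sim_type n A \<tau>" "has_sim_type n B \<tau>"
  obtains B' where "B' \<in> carrier_mat n n" "similar_mat B B'" "cent n B' = cent n A" "adrange n B' = adrange n A"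
proof -
  obtain c v where c: "c \<in> \<tau>" "gens n A (Jc c) (ec c) v" and A: "A \<in> carrier_mat n n"
    using h(1) has_sim_type_iff[OF t] by blast
  obtain c' v' where c': "c' \<in> \<tau>" "gens n B (Jc c') (ec c') v'" and B: "B \<in> carrier_mat n n"
    using h(2) has_sim_type_iff[OF t] by blast
  have "(c, c') \<in> same_type n" using sim_types_class(2)[OF t c(1)] c'(1) by blast
  then obtain B' w where B': "B' \<in> carrier_mat n n" "gens n B' (Jc c') (ec c') w" "cent n B' = cent n A" "adrange n B' = adrange n A"
    by (rule type_transport[OF A _ c(2)])
  show ?thesis by (rule that[OF B'(1) gens_similar[OF B B'(1) c'(2) B'(2)] B'(3,4)])
qed

lemma card_image_same_kernel:
  assumes "\<And>x y. x \<in> S \<Longrightarrow> y \<in> S \<Longrightarrow> f x = f y \<longleftrightarrow> g x = g y"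
  shows "card (f ` S) = card (g ` S)"
proof -
  define h where "h z = g (inv_into S f z)" for z
  have h: "h (f x) = g x" if "x \<in> S" for x
    unfolding h_def using assms[of "inv_into S f (f x)" x] that by (simp add: inv_into_into f_inv_into_f)
  have "inj_on h (f ` S)"
  proof (rule inj_onI)
    fix u v assume "u \<in> f ` S" "v \<in> f ` S" and e: "h u = h v"
    then obtain x y where "x \<in> S" "u = f x" "y \<in> S" "v = f y" by blast
    then show "u = v" using assms[of x y] h[of x] h[of y] e by simp
  qed
  moreover have "h ` f ` S = g ` S" using h by (auto simp: image_iff)
  ultimately show ?thesis by (metis card_image)
qed

lemma finite_similarity_classes: "finite (similarity_classes TYPE('a::{finite,comm_ring_1}) n)"
  unfolding similarity_classes_eq by (rule finite_imageI) (rule finite_carrier_mat)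

lemma finite_sim_types:
  fixes A :: "('k::{finite,field} poly \<Rightarrow> nat list) set \<Rightarrow> 'k mat"
  assumes A: "\<And>\<tau>. \<tau> \<in> sim_types n \<Longrightarrow> has_sim_type n (A \<tau>) \<tau>"
  shows "finite (sim_types n :: ('k poly \<Rightarrow> nat list) set set)"
proof (rule inj_on_finite[where f = A])
  have c: "A \<tau> \<in> carrier_mat n n" if "\<tau> \<in> sim_types n" for \<tau> using A[OF that] by (simp add: has_sim_type_def)
  show "inj_on A (sim_types n)"
  proof (rule inj_onI)
    fix \<tau> \<tau>' :: "('k poly \<Rightarrow> nat list) set" assume t: "\<tau> \<in> sim_types n" "\<tau>' \<in> sim_types n" and e: "A \<tau> = A \<tau>'"
    show "\<tau> = \<tau>'" by (rule has_sim_type_unique[OF t A[OF t(1)] A[OF t(2)]]) (use e c[OF t(1)] in \<open>simp add: similar_mat_refl\<close>)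
  qed
  show "A ` sim_types n \<subseteq> carrier_mat n n" using c by blast
qed (rule finite_carrier_mat)

lemma conj_rel_cong:
  fixes A B :: "'a::comm_ring_1 mat"
  assumes "cent n B = cent n A" "adrange n B = adrange n A"
  shows "conj_rel n B = conj_rel n A" "conj_stab n B = conj_stab n A"
  using assms by (simp_all add: fun_eq_iff conj_rel_def conj_stab_def centralizer_mat_cent)

context square_zero
begin

lemma red_similar:
  assumes B: "B \<in> carrier_mat n n" "similar_mat B C"
  shows "similar_mat (redm B) (redm C)"
proof -
  have C: "C \<in> carrier_mat n n" using similar_mat_carrier[OF B(2)] B(1) by blast
  then obtain P where P: "P \<in> general_linear n" "P * C = B * P" using B(2) similar_mat_iff[OF B(1) C] by blast
  have Pc: "P \<in> carrier_mat n n" by (rule general_linear_carrier[OF P(1)])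
  have "redm P * redm C = redm B * redm P"
    using arg_cong[OF P(2), of redm] unfolding redm_mult[OF Pc C] redm_mult[OF B(1) Pc] .
  moreover have "redm P \<in> general_linear n" using P(1) general_linear_red_iff[OF Pc] by blast
  ultimately show ?thesis
    using similar_mat_iff[of "redm B" n "redm C"] B(1) C by auto
qed

lemma similar_to_lift:
  assumes B: "B \<in> carrier_mat n n" and A: "A \<in> carrier_mat n n" and s: "similar_mat A (redm B)"
  obtains B' where "B' \<in> carrier_mat n n" "similar_mat B' B" "redm B' = A"
proof -
  have rB: "redm B \<in> carrier_mat n n" using B by simp
  obtain p q where p: "p \<in> carrier_mat n n" "q \<in> carrier_mat n n" "p * q = 1\<^sub>m n" "q * p = 1\<^sub>m n" "p * redm B = A * p"
    using s unfolding similar_mat_iff[OF A rB] by (auto simp: general_linear_def)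
  obtain P where P: "P \<in> carrier_mat n n" "redm P = p" using redm_surj[OF p(1)] by blast
  obtain Q where Q: "Q \<in> carrier_mat n n" "P * Q = 1\<^sub>m n" "Q * P = 1\<^sub>m n" "redm Q = q"
    using inverse_lift[OF P(1) p(2)] p(3,4) P(2) by metis
  have PB: "P * B \<in> carrier_mat n n" using P(1) B by (rule mult_carrier_mat)
  have c: "P * B * Q \<in> carrier_mat n n" using PB Q(1) by (rule mult_carrier_mat)
  show ?thesis
  proof (rule that[OF c])
    show "similar_mat (P * B * Q) B" using c P Q B by (intro similar_matI[of _ _ P Q n]) auto
    have "redm (P * B * Q) = (A * p) * q" unfolding redm_mult[OF PB Q(1)] redm_mult[OF P(1) B] P(2) Q(4) p(5) ..
    then show "redm (P * B * Q) = A" unfolding assoc_mult_mat[OF A p(1,2)] p(3) using A by simp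
  qed
qed

text \<open>Every class above the class of \<open>A\<close> has members that reduce to \<open>A\<close> itself.\<close>

lemma classes_above:
  assumes A: "A \<in> carrier_mat n n" and L: "commuting_lift n A At"
  shows "{C \<in> similarity_classes TYPE('r) n. (\<exists>B\<in>C. redm B \<in> sim_class A) \<and> (\<exists>B\<in>C. card (centralizer_mat n B) = N)} =
    (\<lambda>X. sim_class (At + thmat X)) ` {X \<in> carrier_mat n n. card (cent n A) * card (conj_stab n A X) = N}" (is "?L = ?f ` ?S")
proof (intro subset_antisym subsetI)
  have At: "At \<in> carrier_mat n n" "redm At = A" using L by (auto simp: commuting_lift_def)
  {
    fix C assume "C \<in> ?L"
    then obtain B B1 where C: "C \<in> similarity_classes TYPE('r) n" and B: "B \<in> C" "similar_mat A (redm B)" and B1: "B1 \<in> C" "card (centralizer_mat n B1) = N"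
      unfolding sim_class_def by blast
    have Bc: "B \<in> carrier_mat n n" by (rule similarity_class_carrier[OF C B(1)])
    obtain B2 where B2: "B2 \<in> carrier_mat n n" "similar_mat B2 B" "redm B2 = A" by (rule similar_to_lift[OF Bc A B(2)])
    have "redm B2 = redm At" unfolding B2(3) At(2) ..
    then obtain X where X: "X \<in> carrier_mat n n" "B2 = At + thmat X" by (rule redm_eqE[OF B2(1) At(1)])
    have CB: "C = sim_class B2" using similarity_class_eq[OF C B(1)] sim_class_eq_iff[OF Bc, of B2] B2(2) by simp
    have "card (centralizer_mat n B2) = N"
      using B1 similar_centralizer_card[OF B2(1)] unfolding CB sim_class_def by blast
    then have "X \<in> ?S" using X lifted_centralizer_card[OF A L X(1)] by simp
    then show "C \<in> ?f ` ?S" unfolding CB X(2) by (rule imageI)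
  next
    fix C assume "C \<in> ?f ` ?S"
    then obtain X where X: "X \<in> carrier_mat n n" "card (cent n A) * card (conj_stab n A X) = N" and C: "C = sim_class (At + thmat X)" by blast
    have c: "At + thmat X \<in> carrier_mat n n" using X(1) by simp
    have m: "At + thmat X \<in> C" unfolding C by (rule sim_class_self[OF c])
    moreover have "C \<in> similarity_classes TYPE('r) n" unfolding similarity_classes_eq C using c by (rule imageI)
    moreover have "redm (At + thmat X) \<in> sim_class A"
      unfolding redm_add_thmat[OF At(1) X(1)] At(2) by (rule sim_class_self[OF A])
    moreover have "card (centralizer_mat n (At + thmat X)) = N" using lifted_centralizer_card[OF A L X(1)] X(2) by simp
    ultimately show "C \<in> ?L" by blast
  }
qed

text \<open>Over \<open>R\<close> and on \<open>Ext\<^sup>1\<close>, the classes are images of the same set of matrices \<open>X\<close> under maps that identify the same matrices. The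
  right-hand side refers to \<open>A\<close> in place of \<open>B\<close>, which is possible since both sides depend only on the centralizer
  and the commutators.\<close>

lemma card_classes_above:
  assumes A: "A \<in> carrier_mat n n" and B: "B \<in> carrier_mat n n" and eq: "cent n B = cent n A" "adrange n B = adrange n A"
  shows "card {C \<in> similarity_classes TYPE('r) n. (\<exists>B'\<in>C. redm B' \<in> sim_class B) \<and> (\<exists>B'\<in>C. card (centralizer_mat n B') = N)} =
    card {X \<in> orbits (centralizer_group n A) (mat_Ext1 n A) (mat_Ext1_act n A).
           \<exists>\<xi>\<in>X. card (cent n A) * card (stabilizer (centralizer_group n A) (mat_Ext1_act n A) \<xi>) = N}"
proof -
  obtain Bt where L: "commuting_lift n B Bt" by (rule commuting_lift_exists[OF B])
  have Bt: "Bt \<in> carrier_mat n n" using L by (simp add: commuting_lift_def)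
  show ?thesis
    unfolding classes_above[OF B L] orbits_with_stabilizer[OF A, of "\<lambda>m. card (cent n A) * m = N"] eq(1) conj_rel_cong[OF eq]
  proof (rule card_image_same_kernel)
    fix X Y assume "X \<in> {X \<in> carrier_mat n n. card (cent n A) * card (conj_stab n A X) = N}"
      "Y \<in> {X \<in> carrier_mat n n. card (cent n A) * card (conj_stab n A X) = N}"
    then have XY: "X \<in> carrier_mat n n" "Y \<in> carrier_mat n n" by blast+
    have "sim_class (Bt + thmat X) = sim_class (Bt + thmat Y) \<longleftrightarrow> similar_mat (Bt + thmat X) (Bt + thmat Y)"
      by (rule sim_class_eq_iff[of _ n]) (use XY in simp)
    also have "\<dots> \<longleftrightarrow> conj_rel n A Y X" unfolding lifted_similar_iff[OF B L XY(2,1)] conj_rel_cong(1)[OF eq] ..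
    also have "\<dots> \<longleftrightarrow> conj_rel n A X Y" using conj_rel_sym[OF A] XY by blast
    finally show "sim_class (Bt + thmat X) = sim_class (Bt + thmat Y) \<longleftrightarrow>
      orbit (centralizer_group n A) (mat_Ext1_act n A) (ext_class n A X) = orbit (centralizer_group n A) (mat_Ext1_act n A) (ext_class n A Y)"
      unfolding ext_class_orbit_eq_iff[OF A XY] .
  qed
qed

text \<open>The classes over \<open>R\<close> are partitioned by the class of their reductions, and these by their types. By
  \<open>same_type_representative\<close> the number of classes above a class is the same for all classes of one type. The set \<open>K\<close> is left arbitrary in order to cover both all classes and the
  invertible ones.\<close>

theorem count_classes:
  fixes A :: "('k poly \<Rightarrow> nat list) set \<Rightarrow> 'k mat"
  assumes A: "\<And>\<tau>. \<tau> \<in> sim_types n \<Longrightarrow> has_sim_type n (A \<tau>) \<tau>" and K: "K \<subseteq> similarity_classes TYPE('k) n"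
  shows "card {C \<in> similarity_classes TYPE('r) n. (\<exists>D\<in>K. \<exists>B\<in>C. redm B \<in> D) \<and> (\<exists>B\<in>C. card (centralizer_mat n B) = N)} =
    (\<Sum>\<tau>\<in>sim_types n. card (K \<inter> classes_of_type n \<tau>) *
       card {X \<in> orbits (centralizer_group n (A \<tau>)) (mat_Ext1 n (A \<tau>)) (mat_Ext1_act n (A \<tau>)).
           \<exists>\<xi>\<in>X. card (UNIV :: 'k set) ^ type_z \<tau> *
             card (stabilizer (centralizer_group n (A \<tau>)) (mat_Ext1_act n (A \<tau>)) \<xi>) = N})"
    (is "card ?L = (\<Sum>\<tau>\<in>sim_types n. card (K \<inter> classes_of_type n \<tau>) * ?F \<tau>)")
proof -
  define S where "S D = {C \<in> similarity_classes TYPE('r) n. (\<exists>B\<in>C. redm B \<in> D) \<and> (\<exists>B\<in>C. card (centralizer_mat n B) = N)}" for D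
  have finR: "finite (\<Union>(similarity_classes TYPE('r) n))"
    by (rule finite_subset[OF _ finite_carrier_mat[of n]]) (auto dest: similarity_class_carrier)
  have finS: "finite (S D)" for D
  proof (rule finite_subset)
    show "S D \<subseteq> Pow (\<Union>(similarity_classes TYPE('r) n))" by (auto simp: S_def)
    show "finite (Pow (\<Union>(similarity_classes TYPE('r) n)))" using finR by simp
  qed
  have finK: "finite K" by (rule finite_subset[OF K finite_similarity_classes])
  have disjS: "S D \<inter> S D' = {}" if D: "D \<in> K" "D' \<in> K" "D \<noteq> D'" for D D'
  proof (rule ccontr)
    assume "S D \<inter> S D' \<noteq> {}"
    then obtain C B B' where C: "C \<in> similarity_classes TYPE('r) n" and B: "B \<in> C" "redm B \<in> D" and B': "B' \<in> C" "redm B' \<in> D'"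
      unfolding S_def by blast
    have DK: "D \<in> similarity_classes TYPE('k) n" "D' \<in> similarity_classes TYPE('k) n" using D K by blast+
    have "similar_mat B B'" using B'(1) similarity_class_eq[OF C B(1)] by (simp add: sim_class_def)
    then have "similar_mat (redm B) (redm B')" by (rule red_similar[OF similarity_class_carrier[OF C B(1)]])
    then have "sim_class (redm B) = sim_class (redm B')" using sim_class_eq_iff[OF similarity_class_carrier[OF DK(2) B'(2)]] by simp
    then show False using D(3) similarity_class_eq[OF DK(1) B(2)] similarity_class_eq[OF DK(2) B'(2)] by simp
  qed
  have "?L = (\<Union>D\<in>K. S D)" unfolding S_def by blast
  then have "card ?L = (\<Sum>D\<in>K. card (S D))"
    using card_UN_disjoint[OF finK, of S] finS disjS by simp
  also have "K = (\<Union>\<tau>\<in>sim_types n. K \<inter> classes_of_type n \<tau>)"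
  proof (intro subset_antisym subsetI)
    fix D assume D: "D \<in> K"
    then have DK: "D \<in> similarity_classes TYPE('k) n" using K by blast
    then obtain B where B: "B \<in> carrier_mat n n" "B \<in> D" unfolding similarity_classes_eq using sim_class_self by blast
    obtain \<tau> where "\<tau> \<in> sim_types n" "has_sim_type n B \<tau>" by (rule has_sim_type_exists[OF B(1)])
    then show "D \<in> (\<Union>\<tau>\<in>sim_types n. K \<inter> classes_of_type n \<tau>)" using D DK B by (auto simp: classes_of_type_def)
  qed blast
  then have "(\<Sum>D\<in>K. card (S D)) = (\<Sum>D\<in>(\<Union>\<tau>\<in>sim_types n. K \<inter> classes_of_type n \<tau>). card (S D))" by simp
  also have "\<dots> = (\<Sum>\<tau>\<in>sim_types n. \<Sum>D\<in>K \<inter> classes_of_type n \<tau>. card (S D))"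
  proof (rule sum.UNION_disjoint)
    show "finite (sim_types n :: ('k poly \<Rightarrow> nat list) set set)" by (rule finite_sim_types[of n A]) (rule A)
    show "\<forall>\<tau>\<in>sim_types n. finite (K \<inter> classes_of_type n \<tau>)" using finK by blast
    show "\<forall>\<tau>\<in>sim_types n. \<forall>\<tau>'\<in>sim_types n. \<tau> \<noteq> \<tau>' \<longrightarrow> (K \<inter> classes_of_type n \<tau>) \<inter> (K \<inter> classes_of_type n \<tau>') = {}"
    proof (intro ballI impI equals0I)
      fix \<tau> \<tau>' D assume t: "\<tau> \<in> sim_types n" "\<tau>' \<in> sim_types n" and ne: "\<tau> \<noteq> \<tau>'"
        and "D \<in> (K \<inter> classes_of_type n \<tau>) \<inter> (K \<inter> classes_of_type n \<tau>')"
      then obtain B B' where D: "D \<in> similarity_classes TYPE('k) n" and B: "B \<in> D" "has_sim_type n B \<tau>" and B': "B' \<in> D" "has_sim_type n B' \<tau>'"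
        by (auto simp: classes_of_type_def)
      have "similar_mat B' B" using B(1) similarity_class_eq[OF D B'(1)] by (simp add: sim_class_def)
      then show False using has_sim_type_unique[OF t B(2) B'(2)] ne by blast
    qed
  qed
  also have "\<dots> = (\<Sum>\<tau>\<in>sim_types n. card (K \<inter> classes_of_type n \<tau>) * ?F \<tau>)"
  proof (rule sum.cong[OF refl])
    fix \<tau> :: "('k poly \<Rightarrow> nat list) set" assume t: "\<tau> \<in> sim_types n"
    have Ac: "A \<tau> \<in> carrier_mat n n" using A[OF t] by (simp add: has_sim_type_def)
    have "card (S D) = ?F \<tau>" if "D \<in> K \<inter> classes_of_type n \<tau>" for D
    proof -
      obtain B where D: "D \<in> similarity_classes TYPE('k) n" and B: "B \<in> D" "has_sim_type n B \<tau>" using \<open>D \<in> _\<close> by (auto simp: classes_of_type_def)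
      obtain B' where B': "B' \<in> carrier_mat n n" "similar_mat B B'" "cent n B' = cent n (A \<tau>)" "adrange n B' = adrange n (A \<tau>)"
        by (rule same_type_representative[OF t A[OF t] B(2)])
      have "D = sim_class B'" using similarity_class_eq[OF D B(1)] sim_class_eq_iff[OF B'(1)] B'(2) by simp
      then show ?thesis
        unfolding S_def using card_classes_above[OF Ac B'(1,3,4), of N] centralizer_type_z[OF t A[OF t]] by simp
    qed
    then show "(\<Sum>D\<in>K \<inter> classes_of_type n \<tau>. card (S D)) = card (K \<inter> classes_of_type n \<tau>) * ?F \<tau>" by simp
  qed
  finally show ?thesis .
qed

end

section \<open>Conjugacy classes of the general linear group\<close>

lemma GL_mat_group: "group (GL_mat TYPE('a::comm_ring_1) n)"
proof -
  interpret r: ring "ring_mat TYPE('a) n ()" by (rule ring_mat)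
  show ?thesis unfolding GL_mat_def by (rule r.units_group)
qed

lemma GL_mat_mult: "g \<otimes>\<^bsub>GL_mat TYPE('a::comm_ring_1) n\<^esub> h = g * h"
  by (simp add: GL_mat_def units_of_def ring_mat_def)

lemma GL_mat_one: "\<one>\<^bsub>GL_mat TYPE('a::comm_ring_1) n\<^esub> = 1\<^sub>m n"
  by (simp add: GL_mat_def units_of_def ring_mat_def)

lemma GL_mat_inv:
  fixes g h :: "'a::comm_ring_1 mat"
  assumes "g \<in> carrier_mat n n" "h \<in> carrier_mat n n" "g * h = 1\<^sub>m n" "h * g = 1\<^sub>m n"
  shows "inv\<^bsub>GL_mat TYPE('a) n\<^esub> g = h"
proof -
  have "g \<in> general_linear n" "h \<in> general_linear n" using assms unfolding general_linear_def by blast+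
  then show ?thesis
    by (intro group.inv_equality[OF GL_mat_group]) (simp_all add: GL_mat_carrier GL_mat_mult GL_mat_one assms)
qed

lemma conjugation_orbit:
  fixes B :: "'a::comm_ring_1 mat"
  assumes B: "B \<in> general_linear n"
  shows "orbit (GL_mat TYPE('a) n) (\<lambda>g. \<lambda>h\<in>carrier (GL_mat TYPE('a) n). g \<otimes>\<^bsub>GL_mat TYPE('a) n\<^esub> h \<otimes>\<^bsub>GL_mat TYPE('a) n\<^esub>
    inv\<^bsub>GL_mat TYPE('a) n\<^esub> g) B = sim_class B"
proof -
  have "orbit (GL_mat TYPE('a) n) (\<lambda>g. \<lambda>h\<in>carrier (GL_mat TYPE('a) n). g \<otimes>\<^bsub>GL_mat TYPE('a) n\<^esub> h \<otimes>\<^bsub>GL_mat TYPE('a) n\<^esub>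
    inv\<^bsub>GL_mat TYPE('a) n\<^esub> g) B = {g * B * inv\<^bsub>GL_mat TYPE('a) n\<^esub> g | g. g \<in> general_linear n}"
    using B by (simp add: orbit_def GL_mat_carrier GL_mat_mult)
  also have "\<dots> = sim_class B"
  proof (intro subset_antisym subsetI)
    fix C assume "C \<in> {g * B * inv\<^bsub>GL_mat TYPE('a) n\<^esub> g | g. g \<in> general_linear n}"
    then obtain g where g: "g \<in> general_linear n" and C: "C = g * B * inv\<^bsub>GL_mat TYPE('a) n\<^esub> g" by blast
    obtain h where h: "g \<in> carrier_mat n n" "h \<in> carrier_mat n n" "g * h = 1\<^sub>m n" "h * g = 1\<^sub>m n"
      using g by (auto simp: general_linear_def)
    have Bc: "B \<in> carrier_mat n n" by (rule general_linear_carrier[OF B])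
    have "similar_mat C B"
      by (rule similar_matI[of _ _ g h n]) (use h Bc in \<open>auto simp: C GL_mat_inv[OF h]\<close>)
    then show "C \<in> sim_class B" by (simp add: sim_class_def similar_mat_sym)
  next
    fix C assume "C \<in> sim_class B"
    then have "similar_mat C B" by (simp add: sim_class_def similar_mat_sym)
    then obtain m P Q where "{C, B, P, Q} \<subseteq> carrier_mat m m" "P * Q = 1\<^sub>m m" "Q * P = 1\<^sub>m m" and C: "C = P * B * Q"
      using similar_matD by blast
    moreover from this have "m = n" using general_linear_carrier[OF B] by auto
    ultimately have P: "P \<in> carrier_mat n n" "Q \<in> carrier_mat n n" "P * Q = 1\<^sub>m n" "Q * P = 1\<^sub>m n" by auto
    then have "P \<in> general_linear n" unfolding general_linear_def by blast
    then show "C \<in> {g * B * inv\<^bsub>GL_mat TYPE('a) n\<^esub> g | g. g \<in> general_linear n}"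
      unfolding C using GL_mat_inv[OF P] by blast
  qed
  finally show ?thesis .
qed

lemma conjugacy_classes_GL_mat:
  "conjugacy_classes (GL_mat TYPE('a::comm_ring_1) n) =
    {C \<in> similarity_classes TYPE('a) n. \<exists>B\<in>C. B \<in> general_linear n}"
proof -
  have "conjugacy_classes (GL_mat TYPE('a) n) = sim_class ` general_linear n"
    unfolding conjugacy_classes_def orbits_def GL_mat_carrier[symmetric]
    using conjugation_orbit[of _ n] by (auto simp: GL_mat_carrier)
  also have "\<dots> = {C \<in> similarity_classes TYPE('a) n. \<exists>B\<in>C. B \<in> general_linear n}"
  proof (intro subset_antisym subsetI)
    fix C :: "'a mat set" assume "C \<in> sim_class ` general_linear n"
    then obtain B where B: "B \<in> general_linear n" "C = sim_class B" by blast
    have c: "B \<in> carrier_mat n n" by (rule general_linear_carrier[OF B(1)])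
    show "C \<in> {C \<in> similarity_classes TYPE('a) n. \<exists>B\<in>C. B \<in> general_linear n}"
      unfolding similarity_classes_eq B(2) using B(1) c sim_class_self[OF c] by blast
  next
    fix C :: "'a mat set" assume "C \<in> {C \<in> similarity_classes TYPE('a) n. \<exists>B\<in>C. B \<in> general_linear n}"
    then obtain B where "C \<in> similarity_classes TYPE('a) n" "B \<in> C" "B \<in> general_linear n" by blast
    then show "C \<in> sim_class ` general_linear n" using similarity_class_eq by blast
  qed
  finally show ?thesis .
qed

lemma invertible_mat_iff:
  fixes A :: "'a::comm_ring_1 mat"
  assumes A: "A \<in> carrier_mat n n"
  shows "invertible_mat A \<longleftrightarrow> A \<in> general_linear n"
proof
  assume "invertible_mat A"
  then obtain B where B: "A * B = 1\<^sub>m n" "B * A = 1\<^sub>m (dim_row B)"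
    using A by (auto simp: invertible_mat_def inverts_mat_def)
  have "dim_col B = n" "dim_row B = n"
    using arg_cong[OF B(1), of dim_col] arg_cong[OF B(2), of dim_col] A by auto
  then have "B \<in> carrier_mat n n" by auto
  moreover have "B * A = 1\<^sub>m n" using B(2) \<open>dim_row B = n\<close> by simp
  ultimately show "A \<in> general_linear n" using A B(1) by (auto simp: general_linear_def)
next
  assume "A \<in> general_linear n"
  then obtain h where h: "h \<in> carrier_mat n n" "A * h = 1\<^sub>m n" "h * A = 1\<^sub>m n" by (auto simp: general_linear_def)
  then show "invertible_mat A" using A unfolding invertible_mat_def inverts_mat_def by (intro conjI exI[of _ h]) auto
qed

section \<open>Local rings of length two\<close>

lemma class_ring_idealI:
  fixes I :: "'a::comm_ring_1 set"
  assumes "0 \<in> I" "\<And>x y. x \<in> I \<Longrightarrow> y \<in> I \<Longrightarrow> x + y \<in> I" "\<And>x y. x \<in> I \<Longrightarrow> y * x \<in> I"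
  shows "ideal I (class_ring :: 'a ring)"
proof (rule idealI)
  show R: "ring (class_ring :: 'a ring)" by (rule cring.axioms(1)[OF class_cring.cring_axioms])
  have G: "group (add_monoid (class_ring :: 'a ring))" by (rule abelian_group.a_group[OF ring.is_abelian_group[OF R]])
  show "subgroup I (add_monoid (class_ring :: 'a ring))"
  proof (rule group.subgroupI[OF G])
    fix a assume a: "a \<in> I"
    have "inv\<^bsub>add_monoid (class_ring :: 'a ring)\<^esub> a = - 1 * a" by (rule group.inv_equality[OF G]) simp_all
    then show "inv\<^bsub>add_monoid (class_ring :: 'a ring)\<^esub> a \<in> I" using assms(3)[OF a, of "- 1"] by simp
  qed (use assms in auto)
qed (use assms(3) in \<open>auto simp: mult.commute\<close>)

lemma class_ring_idealD:
  fixes I :: "'a::comm_ring_1 set"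
  assumes "ideal I (class_ring :: 'a ring)"
  shows "0 \<in> I" "x \<in> I \<Longrightarrow> y \<in> I \<Longrightarrow> x + y \<in> I" "x \<in> I \<Longrightarrow> y * x \<in> I"
  using additive_subgroup.zero_closed[OF ideal.axioms(1)[OF assms]]
    additive_subgroup.a_closed[OF ideal.axioms(1)[OF assms], of x y] ideal.I_l_closed[OF assms, of x y] by simp_all

text \<open>In a chain \<open>0 \<subset> I \<subset> R\<close> without refinements \<open>I\<close> is maximal, hence equal to \<open>\<mm>\<close>, and it is minimal among the nonzero
  ideals. Every \<open>\<pi> \<noteq> 0\<close> in \<open>\<mm>\<close> is therefore a generator. The annihilator of \<open>\<pi>\<close> is a maximal ideal as well: if an
  ideal \<open>J\<close> is strictly larger, then \<open>J \<pi>\<close> is a nonzero ideal in \<open>\<mm>\<close>, so \<open>J \<pi> = R \<pi>\<close> and \<open>J = R\<close>. As \<open>R\<close> is local, the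
  annihilator is \<open>\<mm>\<close>.\<close>

lemma length_two_generator:
  fixes \<mm> :: "'a::comm_ring_1 set"
  assumes loc: "local_ring (class_ring :: 'a ring)" and len: "ring_has_length (class_ring :: 'a ring) 2"
    and mx: "maximalideal \<mm> (class_ring :: 'a ring)"
  obtains \<pi> where "\<mm> = range (\<lambda>r. r * \<pi>)" "\<And>r. r * \<pi> = 0 \<longleftrightarrow> r \<in> \<mm>"
proof -
  let ?R = "class_ring :: 'a ring"
  have uniq: "I = \<mm>" if "maximalideal I ?R" for I using loc mx that unfolding local_ring_def by blast
  obtain I :: "nat \<Rightarrow> 'a set" where I: "\<forall>i\<le>2. ideal (I i) ?R" "I 0 = {\<zero>\<^bsub>?R\<^esub>}" "I 2 = carrier ?R"
    "\<forall>i<2. I i \<subset> I (Suc i) \<and> \<not> (\<exists>J. ideal J ?R \<and> I i \<subset> J \<and> J \<subset> I (Suc i))"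
    using len unfolding ring_has_length_def by blast
  have I1: "ideal (I 1) ?R" using I(1) by simp
  have chain0: "{0} \<subset> I 1" "\<not> (\<exists>J. ideal J ?R \<and> {0} \<subset> J \<and> J \<subset> I 1)" using I(2) I(4)[rule_format, of 0] by auto
  have chain1: "I 1 \<subset> UNIV" "\<not> (\<exists>J. ideal J ?R \<and> I 1 \<subset> J \<and> J \<subset> UNIV)" using I(3) I(4)[rule_format, of 1] by (auto simp: numeral_2_eq_2)
  have "maximalideal (I 1) ?R"
    by (rule maximalidealI[OF I1]) (use chain1 in auto)
  then have I1m: "I 1 = \<mm>" by (rule uniq)
  note mI = class_ring_idealD[OF I1[unfolded I1m]]
  obtain \<pi> where \<pi>: "\<pi> \<in> \<mm>" "\<pi> \<noteq> 0" using chain0(1) unfolding I1m by blast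
  have mul: "ideal ((\<lambda>r. r * \<pi>) ` J) ?R" if "ideal J ?R" for J
  proof (rule class_ring_idealI)
    show "0 \<in> (\<lambda>r. r * \<pi>) ` J" using class_ring_idealD(1)[OF that] by (rule rev_image_eqI) simp
    fix x assume "x \<in> (\<lambda>r. r * \<pi>) ` J"
    then obtain a where a: "a \<in> J" "x = a * \<pi>" by blast
    show "y * x \<in> (\<lambda>r. r * \<pi>) ` J" for y
      using class_ring_idealD(3)[OF that a(1), of y] by (rule rev_image_eqI) (simp add: a(2) mult.assoc)
    fix y assume "y \<in> (\<lambda>r. r * \<pi>) ` J"
    then obtain b where b: "b \<in> J" "y = b * \<pi>" by blast
    show "x + y \<in> (\<lambda>r. r * \<pi>) ` J"
      using class_ring_idealD(2)[OF that a(1) b(1)] by (rule rev_image_eqI) (simp add: a(2) b(2) distrib_right)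
  qed
  have sub: "(\<lambda>r. r * \<pi>) ` J \<subseteq> \<mm>" for J using mI(3)[OF \<pi>(1)] by blast
  have alt: "(\<lambda>r. r * \<pi>) ` J = \<mm>" if J: "ideal J ?R" and ne: "a \<in> J" "a * \<pi> \<noteq> 0" for J a
  proof -
    have "0 \<in> (\<lambda>r. r * \<pi>) ` J" by (rule class_ring_idealD(1)[OF mul[OF J]])
    moreover have "a * \<pi> \<in> (\<lambda>r. r * \<pi>) ` J" using ne(1) by blast
    ultimately have "{0} \<subset> (\<lambda>r. r * \<pi>) ` J" using ne(2) by blast
    then show ?thesis using chain0(2) mul[OF J] sub[of J] unfolding I1m by blast
  qed
  have U: "ideal (UNIV :: 'a set) ?R" by (rule class_ring_idealI) auto
  have gen: "\<mm> = range (\<lambda>r. r * \<pi>)" using alt[OF U, of 1] \<pi>(2) by simp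
  define Z where "Z = {r. r * \<pi> = 0}"
  have Z: "ideal Z ?R" by (rule class_ring_idealI) (auto simp: Z_def distrib_right mult.assoc)
  have "maximalideal Z ?R"
  proof (rule maximalidealI[OF Z])
    have "1 \<notin> Z" using \<pi>(2) by (simp add: Z_def)
    then show "carrier ?R \<noteq> Z" by auto
    fix J assume J: "ideal J ?R" "Z \<subseteq> J"
    show "J = Z \<or> J = carrier ?R"
    proof (rule disjCI)
      assume "J \<noteq> carrier ?R"
      show "J = Z"
      proof (rule ccontr)
        assume "J \<noteq> Z"
        then obtain a where "a \<in> J" "a * \<pi> \<noteq> 0" using J(2) unfolding Z_def by blast
        then have eq: "(\<lambda>r. r * \<pi>) ` J = range (\<lambda>r. r * \<pi>)" using alt[OF J(1)] gen by simp
        have "r \<in> J" for r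
        proof -
          obtain j where j: "j \<in> J" "r * \<pi> = j * \<pi>" using eq by (metis imageE rangeI)
          then have "r - j \<in> J" using J(2) by (auto simp: Z_def left_diff_distrib)
          from class_ring_idealD(2)[OF J(1) this j(1)] show ?thesis by simp
        qed
        then show False using \<open>J \<noteq> carrier ?R\<close> by auto
      qed
    qed
  qed
  then have "Z = \<mm>" by (rule uniq)
  then show ?thesis using that[OF gen] unfolding Z_def by blast
qed

text \<open>The residue map composed with the given isomorphism to \<open>k\<close>.\<close>

lemma residue_map_exists:
  fixes \<mm> :: "'a::comm_ring_1 set"
  assumes I: "ideal \<mm> (class_ring :: 'a ring)" and iso: "(class_ring :: 'a ring) Quot \<mm> \<simeq> (class_ring :: 'k::field ring)"
  obtains red :: "'a \<Rightarrow> 'k::field" where "comm_ring_hom red" "surj red" "\<And>r. red r = 0 \<longleftrightarrow> r \<in> \<mm>"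
proof -
  let ?R = "class_ring :: 'a ring" and ?K = "class_ring :: 'k ring"
  obtain h where h: "h \<in> Ring.ring_hom (?R Quot \<mm>) ?K" "bij_betw h (carrier (?R Quot \<mm>)) UNIV"
    using iso by (auto simp: is_ring_iso_def ring_iso_def)
  define red where "red r = h (\<mm> +>\<^bsub>?R\<^esub> r)" for r
  have red: "red \<in> Ring.ring_hom ?R ?K"
    using ring_hom_trans[OF ideal.rcos_ring_hom[OF I] h(1)] by (simp add: red_def[abs_def] comp_def)
  have cc: "comm_ring_hom red"
  proof unfold_locales
    show add: "red (x + y) = red x + red y" for x y using ring_hom_add[OF red, of x y] by simp
    have "red 0 + red 0 = red 0 + 0" using add[of 0 0] by simp
    then show "red 0 = 0" by (rule add_left_imp_eq)
  qed (use ring_hom_mult[OF red] ring_hom_one[OF red] in simp_all)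
  interpret comm_ring_hom red by (rule cc)
  have cos: "\<mm> +>\<^bsub>?R\<^esub> r \<in> carrier (?R Quot \<mm>)" for r
    by (auto simp: FactRing_def A_RCOSETS_def')
  have "red r = 0 \<longleftrightarrow> r \<in> \<mm>" for r
  proof
    assume "red r = 0"
    then have "h (\<mm> +>\<^bsub>?R\<^esub> r) = h (\<mm> +>\<^bsub>?R\<^esub> 0)" using hom_zero by (simp add: red_def)
    then have "\<mm> +>\<^bsub>?R\<^esub> r = \<mm> +>\<^bsub>?R\<^esub> 0" using h(2) cos by (auto simp: bij_betw_def dest: inj_onD)
    moreover have "r \<in> \<mm> +>\<^bsub>?R\<^esub> r" using class_ring_idealD(1)[OF I] by (auto simp: a_r_coset_def')
    ultimately show "r \<in> \<mm>" by (auto simp: a_r_coset_def')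
  next
    assume r: "r \<in> \<mm>"
    have "- r \<in> \<mm>" using class_ring_idealD(3)[OF I r, of "- 1"] by simp
    have "\<mm> +>\<^bsub>?R\<^esub> r = \<mm> +>\<^bsub>?R\<^esub> 0"
    proof (intro subset_antisym subsetI)
      fix x assume "x \<in> \<mm> +>\<^bsub>?R\<^esub> r"
      then show "x \<in> \<mm> +>\<^bsub>?R\<^esub> 0" using class_ring_idealD(2)[OF I _ r] by (auto simp: a_r_coset_def')
    next
      fix x assume "x \<in> \<mm> +>\<^bsub>?R\<^esub> 0"
      then have "x \<in> \<mm>" by (auto simp: a_r_coset_def')
      from class_ring_idealD(2)[OF I this \<open>- r \<in> \<mm>\<close>] show "x \<in> \<mm> +>\<^bsub>?R\<^esub> r"
        by (auto simp: a_r_coset_def' intro!: bexI[of _ "x - r"])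
    qed
    then have "red r = red 0" by (simp add: red_def)
    then show "red r = 0" by simp
  qed
  moreover have "surj red"
  proof (rule surjI)
    fix y :: 'k
    have "y \<in> h ` carrier (?R Quot \<mm>)" using h(2) by (simp add: bij_betw_def)
    then have "\<exists>r. red r = y" by (auto simp: FactRing_def A_RCOSETS_def' red_def)
    then show "red (SOME r. red r = y) = y" by (rule someI_ex)
  qed
  ultimately show ?thesis using cc that by blast
qed

text \<open>\<open>\<theta>(x)\<close> is \<open>\<pi>\<close> times any element with residue \<open>x\<close>. The choice of this element does not matter because \<open>\<pi>\<close> is killed
  exactly by \<open>\<mm>\<close>.\<close>

lemma square_zero_exists:
  fixes \<mm> :: "'r::{finite,comm_ring_1} set"
  assumes loc: "local_ring (class_ring :: 'r ring)" and len: "ring_has_length (class_ring :: 'r ring) 2"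
    and mx: "maximalideal \<mm> (class_ring :: 'r ring)"
    and iso: "(class_ring :: 'r ring) Quot \<mm> \<simeq> (class_ring :: 'k::{finite,field} ring)"
  obtains red :: "'r \<Rightarrow> 'k::{finite,field}" and th where "square_zero red th"
proof -
  obtain \<pi> where \<pi>: "\<mm> = range (\<lambda>r. r * \<pi>)" "\<And>r. r * \<pi> = 0 \<longleftrightarrow> r \<in> \<mm>"
    by (rule length_two_generator[OF loc len mx]) (rule that)
  obtain red :: "'r \<Rightarrow> 'k" where red: "comm_ring_hom red" "surj red" "\<And>r. red r = 0 \<longleftrightarrow> r \<in> \<mm>"
    by (rule residue_map_exists[OF maximalideal.axioms(1)[OF mx] iso]) (rule that)
  interpret comm_ring_hom red by (rule red(1))
  obtain l where l: "\<And>x. red (l x) = x" using red(2) by (metis surjD)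
  have ker: "red a = red b \<longleftrightarrow> a * \<pi> = b * \<pi>" for a b
    using \<pi>(2)[of "a - b"] red(3)[of "a - b"] by (simp add: left_diff_distrib hom_minus)
  show ?thesis
  proof (rule that[of red "\<lambda>x. l x * \<pi>"], unfold_locales)
    fix x y r
    show "l (x + y) * \<pi> = l x * \<pi> + l y * \<pi>"
      using ker[of "l (x + y)" "l x + l y"] by (simp add: l hom_add distrib_right)
    show "r * (l x * \<pi>) = l (red r * x) * \<pi>"
      using ker[of "r * l x" "l (red r * x)"] by (simp add: l hom_mult mult.assoc)
  next
    show "inj (\<lambda>x. l x * \<pi>)"
    proof (rule injI)
      fix x y assume "l x * \<pi> = l y * \<pi>"
      then show "x = y" using ker[of "l x" "l y"] by (simp add: l)
    qed
    have "r * \<pi> = l (red r) * \<pi>" for r using ker[of r "l (red r)"] by (simp add: l)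
    then have "range (\<lambda>x. l x * \<pi>) = \<mm>" unfolding \<pi>(1) by auto
    then show "range (\<lambda>x. l x * \<pi>) = {r. red r = 0}" using red(3) by auto
  qed (rule red(2))
qed

section \<open>The class counts\<close>

theorem theorem9p8:
  fixes \<mm> :: "'r::{finite, comm_ring_1} set"
    and A :: "('k::{finite, field} poly \<Rightarrow> nat list) set \<Rightarrow> 'k mat"
    and n N q :: nat
  assumes "local_ring (class_ring :: 'r ring)"
    and "principal_ideal_ring (class_ring :: 'r ring)"
    and "ring_has_length (class_ring :: 'r ring) 2"
    and "maximalideal \<mm> (class_ring :: 'r ring)"
    and "(class_ring :: 'r ring) Quot \<mm> \<simeq> (class_ring :: 'k ring)"
    and "q = card (UNIV :: 'k set)"
    and "N > 0"
    and "\<And>\<tau>. \<tau> \<in> sim_types n \<Longrightarrow> has_sim_type n (A \<tau>) \<tau>"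
  shows "card {C \<in> similarity_classes TYPE('r) n. \<exists>B\<in>C. card (centralizer_mat n B) = N} =
      (\<Sum>\<tau>\<in>sim_types n. card (classes_of_type n \<tau>) *
         card {X \<in> orbits (centralizer_group n (A \<tau>)) (mat_Ext1 n (A \<tau>)) (mat_Ext1_act n (A \<tau>)).
           \<exists>\<xi>\<in>X. q ^ type_z \<tau> *
             card (stabilizer (centralizer_group n (A \<tau>)) (mat_Ext1_act n (A \<tau>)) \<xi>) = N})
    \<and> card {C \<in> conjugacy_classes (GL_mat TYPE('r) n). \<exists>B\<in>C. card (centralizer_mat n B) = N} =
      (\<Sum>\<tau>\<in>sim_types n. card (invertible_classes_of_type n \<tau>) *
         card {X \<in> orbits (centralizer_group n (A \<tau>)) (mat_Ext1 n (A \<tau>)) (mat_Ext1_act n (A \<tau>)).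
           \<exists>\<xi>\<in>X. q ^ type_z \<tau> *
             card (stabilizer (centralizer_group n (A \<tau>)) (mat_Ext1_act n (A \<tau>)) \<xi>) = N})"
proof -
  obtain red :: "'r \<Rightarrow> 'k" and th where "square_zero red th"
    by (rule square_zero_exists[OF assms(1,3,4,5)])
  then interpret square_zero red th .
  let ?K = "similarity_classes TYPE('k) n"
  let ?I = "{D \<in> ?K. \<forall>A\<in>D. invertible_mat A}"
  have above: "\<exists>D\<in>?K. \<exists>B\<in>C. redm B \<in> D" if C: "C \<in> similarity_classes TYPE('r) n" for C
  proof -
    obtain B where B: "B \<in> carrier_mat n n" "B \<in> C" using C unfolding similarity_classes_eq using sim_class_self by blast
    have "redm B \<in> carrier_mat n n" using B(1) by simp
    then have "sim_class (redm B) \<in> ?K" "redm B \<in> sim_class (redm B)"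
      unfolding similarity_classes_eq by (blast, rule sim_class_self)
    then show ?thesis using B(2) by blast
  qed
  have invertible: "D \<in> ?I \<longleftrightarrow> A \<in> general_linear n" if D: "D \<in> ?K" "A \<in> D" for D A
  proof -
    have "B \<in> general_linear n" if B: "B \<in> D" and gl: "A \<in> general_linear n" for B
      by (rule general_linear_similar[OF gl]) (use B similarity_class_eq[OF D] in \<open>simp add: sim_class_def similar_mat_sym\<close>)
    then show ?thesis using D invertible_mat_iff similarity_class_carrier[OF D(1)] by blast
  qed
  have set1: "{C \<in> similarity_classes TYPE('r) n. \<exists>B\<in>C. card (centralizer_mat n B) = N} =
    {C \<in> similarity_classes TYPE('r) n. (\<exists>D\<in>?K. \<exists>B\<in>C. redm B \<in> D) \<and> (\<exists>B\<in>C. card (centralizer_mat n B) = N)}"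
    using above by blast
  have red_gl: "redm B \<in> general_linear n \<longleftrightarrow> B \<in> general_linear n" if "C \<in> similarity_classes TYPE('r) n" "B \<in> C" for B C
    using general_linear_red_iff[OF similarity_class_carrier[OF that]] by blast
  have "(\<exists>B\<in>C. B \<in> general_linear n) \<longleftrightarrow> (\<exists>D\<in>?I. \<exists>B\<in>C. redm B \<in> D)" if C: "C \<in> similarity_classes TYPE('r) n" for C
  proof
    assume "\<exists>B\<in>C. B \<in> general_linear n"
    then obtain B where B: "B \<in> C" "B \<in> general_linear n" by blast
    have g: "redm B \<in> general_linear n" using red_gl[OF C B(1)] B(2) by blast
    have c: "redm B \<in> carrier_mat n n" by (rule general_linear_carrier[OF g])
    have D: "sim_class (redm B) \<in> ?K" unfolding similarity_classes_eq by (rule imageI[OF c])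
    then show "\<exists>D\<in>?I. \<exists>B\<in>C. redm B \<in> D" using invertible[OF D sim_class_self[OF c]] g sim_class_self[OF c] B(1) by blast
  next
    assume "\<exists>D\<in>?I. \<exists>B\<in>C. redm B \<in> D"
    then obtain D B where D: "D \<in> ?I" "B \<in> C" "redm B \<in> D" by blast
    then have "redm B \<in> general_linear n" using invertible[of D "redm B"] by blast
    then show "\<exists>B\<in>C. B \<in> general_linear n" using red_gl[OF C D(2)] D(2) by blast
  qed
  then have set2: "{C \<in> conjugacy_classes (GL_mat TYPE('r) n). \<exists>B\<in>C. card (centralizer_mat n B) = N} =
    {C \<in> similarity_classes TYPE('r) n. (\<exists>D\<in>?I. \<exists>B\<in>C. redm B \<in> D) \<and> (\<exists>B\<in>C. card (centralizer_mat n B) = N)}"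
    unfolding conjugacy_classes_GL_mat by blast
  have t1: "?K \<inter> classes_of_type n \<tau> = classes_of_type n \<tau>" for \<tau> by (auto simp: classes_of_type_def)
  have t2: "?I \<inter> classes_of_type n \<tau> = invertible_classes_of_type n \<tau>" for \<tau>
    by (auto simp: classes_of_type_def invertible_classes_of_type_def)
  show ?thesis
    unfolding set1 set2 assms(6)
    using count_classes[of n A ?K N, OF assms(8)] count_classes[of n A ?I N, OF assms(8)] unfolding t1 t2 by auto
qed

end
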